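(* Let $k\ge 2$. For every pair of pure $k$-partite states $\varphi,\psi$ (state vectors in finite-dimensional $k$-partite Hilbert spaces, possibly different ones), \[ R_{\mathrm{LOCCq}}(|\varphi\rangle\langle\varphi|,|\psi\rangle\langle\psi|)=\inf_{\substack{E\\ E(\psi)\neq 0}}\frac{E(\varphi)}{E(\psi)}, \] where the infimum ranges over all functions $E$ from $k$-partite pure states (of arbitrary finite local dimensions) to $\mathbb{R}$ that satisfy all of the following: (i) $E(\mathrm{GHZ})=1$; (ii) full additivity: $E(\varphi\otimes\psi)=E(\varphi)+E(\psi)$ for all pure $k$-partite states $\varphi,\psi$; (iii) monotonicity on average under LOCC; (iv) asymptotic continuity (on pure states).
   Context: All logarithms are base 2. A $k$-partite state is a density operator on $\mathcal{H}=\mathcal{H}_1\otimes\cdots\otimes\mathcal{H}_k$ with each $\mathcal{H}_j$ finite-dimensional; for $\rho$ on $\mathcal{H}$ and $\sigma$ on $\mathcal{K}$, $\rho\otimes\sigma$ is regarded as the $k$-partite state on $(\mathcal{H}_1\otimes\mathcal{K}_1)\otimes\cdots\otimes(\mathcal{H}_k\otimes\mathcal{K}_k)$. For a unit vector $\varphi$ we write $E(\varphi)$ for $E(|\varphi\rangle\langle\varphi|)$. $\mathrm{GHZ}_r$ is the state with vector $r^{-1/2}(|11\ldots1\rangle+\cdots+|rr\ldots r\rangle)$ on $(\mathbb{C}^r)^{\otimes k}$, and $\mathrm{GHZ}=\mathrm{GHZ}_2$. The fidelity is $F(\rho,\sigma)=\operatorname{Tr}\sqrt{\sigma^{1/2}\rho\sigma^{1/2}}$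 and the purified distance is $D(\rho,\sigma)=\sqrt{1-F(\rho,\sigma)^2}$. We write $\rho\to_\epsilon\sigma$ if there is an LOCC channel $\Lambda$ (local operations and classical communication among the $k$ parties) with $D(\Lambda(\rho),\sigma)\le\epsilon$. A number $r\ge 0$ is an achievable rate from $\rho$ to $\sigma$ if for every $\delta>0$, $\limsup_{n\to\infty}\inf\{\epsilon\ge 0:\rho^{\otimes n}\otimes\mathrm{GHZ}^{\otimes\lfloor\delta n\rfloor}\to_\epsilon\sigma^{\otimes\lceil rn\rceil}\}=0$; $R_{\mathrm{LOCCq}}(\rho,\sigma)$ is the supremum of achievable rates. A function $E$ on pure states is monotone on average under LOCC if whenever an LOCC channel maps $|\varphi\rangle\langle\varphi|$ to $\sum_{x\in\mathcal{X}}P(x)|x\rangle\langle x|\otimes|\varphi_x\rangle\langle\varphi_x|$ (finite $\mathcal{X}$, $P$ a probability distribution, $|x\rangle$ an orthonormal classical flag available to all parties), then $E(\varphi)\ge\sum_x P(x)E(\varphi_x)$. Asymptotic continuity on pure states: regard the disjoint union of the pure state sets on all $\mathbb{C}^{d_1}\otimes\cdots\otimes\mathbb{C}^{d_k}$ as a metric space, where two states on the same space have distance equal to their purified distance and states on different spaces have distance $1$; let $\dim\mathcal{H}=d_1\cdots d_k$ on the corresponding piece. $E$ is asymptotically continuous if $E/(1+\log\dim\mathcal{H})$ is uniformly continuous on this metric space. The infimum over an empty set is $+\infty$. *)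

theory Defs
  imports "HOL-Analysis.Analysis" "HOL-Library.Extended_Real" "HOL-Library.Liminf_Limsup"
    "Jordan_Normal_Form.Matrix"
begin

text \<open>A k-partite operator is represented as a pair (d, M): d is the list of local
dimensions [d_1,...,d_k], M a matrix on C^(d_1 * ... * d_k) with computational basis
ordered lexicographically (mixed radix, first factor most significant).\<close>

type_synonym kop = "nat list \<times> complex mat"

definition adj :: "complex mat \<Rightarrow> complex mat" where
  "adj A = mat (dim_col A) (dim_row A) (\<lambda>(i,j). cnj (A $$ (j,i)))"

definition mtrace :: "complex mat \<Rightarrow> complex" where
  "mtrace A = (\<Sum>i<dim_row A. A $$ (i,i))"

definition msum :: "nat \<Rightarrow> nat \<Rightarrow> complex mat list \<Rightarrow> complex mat" where
  "msum n m As = foldr (+) As (0\<^sub>m n m)"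

definition qform :: "complex mat \<Rightarrow> complex vec \<Rightarrow> complex" where
  "qform A v = (\<Sum>i<dim_vec v. cnj (v $ i) * (A *\<^sub>v v) $ i)"

definition psd :: "complex mat \<Rightarrow> bool" where
  "psd A \<longleftrightarrow> dim_row A = dim_col A \<and>
     (\<forall>v. dim_vec v = dim_row A \<longrightarrow> Im (qform A v) = 0 \<and> Re (qform A v) \<ge> 0)"

text \<open>Positive semidefinite square root (unique for psd matrices).\<close>
definition msqrt :: "complex mat \<Rightarrow> complex mat" where
  "msqrt A = (THE S. S \<in> carrier_mat (dim_row A) (dim_row A) \<and> psd S \<and> S * S = A)"

definition fidelity :: "complex mat \<Rightarrow> complex mat \<Rightarrow> real" where
  "fidelity \<rho> \<sigma> = Re (mtrace (msqrt (msqrt \<sigma> * \<rho> * msqrt \<sigma>)))"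

definition purified_dist :: "complex mat \<Rightarrow> complex mat \<Rightarrow> real" where
  "purified_dist \<rho> \<sigma> = sqrt (1 - (fidelity \<rho> \<sigma>)\<^sup>2)"

definition proj :: "complex vec \<Rightarrow> complex mat" where
  "proj v = mat (dim_vec v) (dim_vec v) (\<lambda>(i,j). v $ i * cnj (v $ j))"

definition unit_norm :: "complex vec \<Rightarrow> bool" where
  "unit_norm v \<longleftrightarrow> (\<Sum>i<dim_vec v. (cmod (v $ i))\<^sup>2) = 1"

fun digits :: "nat list \<Rightarrow> nat \<Rightarrow> nat list" where
  "digits [] i = []"
| "digits (a # ds) i = (i div prod_list ds) # digits ds (i mod prod_list ds)"

fun enc :: "nat list \<Rightarrow> nat list \<Rightarrow> nat" where
  "enc (a # ds) (x # xs) = x * prod_list ds + enc ds xs"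
| "enc _ _ = 0"

definition valid_dims :: "nat \<Rightarrow> nat list \<Rightarrow> bool" where
  "valid_dims k d \<longleftrightarrow> length d = k \<and> (\<forall>x\<in>set d. 0 < x)"

definition kstate :: "nat \<Rightarrow> kop \<Rightarrow> bool" where
  "kstate k s \<longleftrightarrow> valid_dims k (fst s) \<and>
     snd s \<in> carrier_mat (prod_list (fst s)) (prod_list (fst s)) \<and> psd (snd s) \<and> mtrace (snd s) = 1"

definition kpure :: "nat \<Rightarrow> kop \<Rightarrow> bool" where
  "kpure k s \<longleftrightarrow> valid_dims k (fst s) \<and>
     (\<exists>v. dim_vec v = prod_list (fst s) \<and> unit_norm v \<and> snd s = proj v)"

text \<open>k-partite tensor product: (H_1 x K_1) x ... x (H_k x K_k).\<close>
definition ktensor :: "kop \<Rightarrow> kop \<Rightarrow> kop" where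
  "ktensor s t = (let d = fst s; e = fst t; de = map2 (*) d e; n = prod_list de in
     (de, mat n n (\<lambda>(r,c). let rd = digits de r; cd = digits de c in
        snd s $$ (enc d (map2 (div) rd e), enc d (map2 (div) cd e)) *
        snd t $$ (enc e (map2 (mod) rd e), enc e (map2 (mod) cd e)))))"

definition trivial_kop :: "nat \<Rightarrow> kop" where
  "trivial_kop k = (replicate k 1, 1\<^sub>m 1)"

fun kpow :: "nat \<Rightarrow> kop \<Rightarrow> nat \<Rightarrow> kop" where
  "kpow k s 0 = trivial_kop k"
| "kpow k s (Suc n) = ktensor (kpow k s n) s"

definition ghz_vec :: "nat \<Rightarrow> nat \<Rightarrow> complex vec" where
  "ghz_vec k r = vec (r ^ k) (\<lambda>i. if (\<forall>x\<in>set (digits (replicate k r) i). x = hd (digits (replicate k r) i))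
                                   then complex_of_real (1 / sqrt (real r)) else 0)"

definition GHZ :: "nat \<Rightarrow> nat \<Rightarrow> kop" where
  "GHZ k r = (replicate k r, proj (ghz_vec k r))"

definition local_op :: "nat list \<Rightarrow> nat \<Rightarrow> nat \<Rightarrow> complex mat \<Rightarrow> complex mat" where
  "local_op d j e L = (let d' = d[j := e] in
     mat (prod_list d') (prod_list d) (\<lambda>(r,c). let rd = digits d' r; cd = digits d c in
       if (\<forall>i<length d. i \<noteq> j \<longrightarrow> rd ! i = cd ! i) then L $$ (rd ! j, cd ! j) else 0))"

text \<open>locc d d' Ks: Ks is the list of (fine-grained) Kraus operators, one per classical
  branch (complete record of all broadcast outcomes), of a finite-round LOCC protocol
  from the k-partite system with local dims d to the one with local dims d'.
  In each round some party j performs a local instrument (Kraus operators L_x,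
  possibly changing its local dimension to e_x), broadcasts x, and the
  remaining protocol may depend on x.\<close>
inductive locc :: "nat list \<Rightarrow> nat list \<Rightarrow> complex mat list \<Rightarrow> bool" where
  stop: "(\<forall>x\<in>set d. 0 < x) \<Longrightarrow> locc d d [1\<^sub>m (prod_list d)]"
| round: "\<lbrakk> j < length d; (\<forall>x\<in>set d. 0 < x);
           \<forall>(e, L)\<in>set Ls. 0 < e \<and> L \<in> carrier_mat e (d ! j);
           msum (d ! j) (d ! j) (map (\<lambda>(e, L). adj L * L) Ls) = 1\<^sub>m (d ! j);
           length Ps = length Ls;
           \<forall>i<length Ls. locc (d[j := fst (Ls ! i)]) d' (Ps ! i) \<rbrakk>
         \<Longrightarrow> locc d d' (concat (map2 (\<lambda>(e, L) P. map (\<lambda>K. K * local_op d j e L) P) Ls Ps))"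

definition apply_kraus :: "nat \<Rightarrow> complex mat list \<Rightarrow> complex mat \<Rightarrow> complex mat" where
  "apply_kraus n Ks \<rho> = msum n n (map (\<lambda>K. K * \<rho> * adj K) Ks)"

definition locc_trans :: "kop \<Rightarrow> real \<Rightarrow> kop \<Rightarrow> bool" where
  "locc_trans \<rho> \<epsilon> \<sigma> \<longleftrightarrow> (\<exists>Ks. locc (fst \<rho>) (fst \<sigma>) Ks \<and>
      purified_dist (apply_kraus (prod_list (fst \<sigma>)) Ks (snd \<rho>)) (snd \<sigma>) \<le> \<epsilon>)"

definition achievable :: "nat \<Rightarrow> kop \<Rightarrow> kop \<Rightarrow> real \<Rightarrow> bool" where
  "achievable k \<rho> \<sigma> r \<longleftrightarrow> r \<ge> 0 \<and> (\<forall>\<delta>>0.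
     limsup (\<lambda>n. Inf (ereal ` {\<epsilon>. \<epsilon> \<ge> 0 \<and>
        locc_trans (ktensor (kpow k \<rho> n) (kpow k (GHZ k 2) (nat \<lfloor>\<delta> * real n\<rfloor>)))
                   \<epsilon> (kpow k \<sigma> (nat \<lceil>r * real n\<rceil>))})) = 0)"

definition R_LOCCq :: "nat \<Rightarrow> kop \<Rightarrow> kop \<Rightarrow> ereal" where
  "R_LOCCq k \<rho> \<sigma> = Sup (ereal ` {r. achievable k \<rho> \<sigma> r})"

definition fully_additive :: "nat \<Rightarrow> (kop \<Rightarrow> real) \<Rightarrow> bool" where
  "fully_additive k E \<longleftrightarrow> (\<forall>s t. kpure k s \<and> kpure k t \<longrightarrow> E (ktensor s t) = E s + E t)"

definition monotone_on_average :: "nat \<Rightarrow> (kop \<Rightarrow> real) \<Rightarrow> bool" where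
  "monotone_on_average k E \<longleftrightarrow>
    (\<forall>d \<phi> d' Ks (m::nat) f P \<phi>s.
       kpure k (d, proj \<phi>) \<and> dim_vec \<phi> = prod_list d \<and> locc d d' Ks \<and>
       (\<forall>b<length Ks. f b < m) \<and> (\<forall>x<m. P x \<ge> 0) \<and> (\<Sum>x<m. P x) = 1 \<and>
       (\<forall>x<m. kpure k (d', proj (\<phi>s x)) \<and> dim_vec (\<phi>s x) = prod_list d' \<and>
          msum (prod_list d') (prod_list d')
             (map (\<lambda>b. Ks ! b * proj \<phi> * adj (Ks ! b)) (filter (\<lambda>b. f b = x) [0..<length Ks]))
          = complex_of_real (P x) \<cdot>\<^sub>m proj (\<phi>s x))
       \<longrightarrow> E (d, proj \<phi>) \<ge> (\<Sum>x<m. P x * E (d', proj (\<phi>s x))))"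

definition kdist :: "kop \<Rightarrow> kop \<Rightarrow> real" where
  "kdist s t = (if fst s = fst t then purified_dist (snd s) (snd t) else 1)"

definition asymptotically_continuous :: "nat \<Rightarrow> (kop \<Rightarrow> real) \<Rightarrow> bool" where
  "asymptotically_continuous k E \<longleftrightarrow>
    (\<forall>\<epsilon>>0. \<exists>\<delta>>0. \<forall>s t. kpure k s \<and> kpure k t \<and> kdist s t < \<delta> \<longrightarrow>
        \<bar>E s / (1 + log 2 (real (prod_list (fst s)))) - E t / (1 + log 2 (real (prod_list (fst t))))\<bar> < \<epsilon>)"

definition admissible :: "nat \<Rightarrow> (kop \<Rightarrow> real) \<Rightarrow> bool" where
  "admissible k E \<longleftrightarrow> E (GHZ k 2) = 1 \<and> fully_additive k E \<and>
     monotone_on_average k E \<and> asymptotically_continuous k E"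

end

theory Submission
  imports Defs "HOL-Library.Multiset" "HOL-Real_Asymp.Real_Asymp"
begin

text \<open>Multisets of pure states are ordered by \<open>M \<ge> N\<close> if \<open>n\<close> copies of \<open>M\<close> and \<open>o(n)\<close> GHZ states
  are asymptotically convertible to \<open>n\<close> copies of \<open>N\<close>. This preorder is additive, satisfies cancellation
  and is closed under limits, and every state is bounded by a multiple of GHZ, which is itself not
  degenerate because of the Schmidt rank. If \<open>A \<ge> B\<close> fails, then Zorn's lemma gives a total additive
  preorder that extends \<open>\<ge>\<close> and puts \<open>A\<close> strictly below \<open>B\<close>; comparing with multiples of GHZ it becomes an additive monotone
  \<open>E\<close> with \<open>E A < E B\<close>. Hence the rate is the infimum of \<open>E \<phi> / E \<psi>\<close> over all additive monotones of \<open>\<ge>\<close>.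

  Such an \<open>E\<close> is monotone on average: by the weak law of large numbers, many copies of an ensemble contain every member with its
  expected frequency. It is asymptotically continuous: measuring the flag of
  \<open>a |0\<dots>0\<rangle> \<phi> + b |1\<dots>1\<rangle> \<chi>\<close> in the Fourier basis shows that the flagged superposition is worth at least
  the average of \<open>E (a \<phi> + b \<chi>)\<close> and \<open>E (a \<phi> - b \<chi>)\<close>, while typical sequences of flags show that for small
  \<open>b\<close> it is worth hardly more than \<open>\<phi>\<close>; this approximate midpoint concavity along great circles, together with
  \<open>0 \<le> E \<le> log dim\<close>, forces continuity. Conversely, the conditions (i)-(iv) bound the rate by the usual
  averaging argument over the branches of a protocol.\<close>

section \<open>Separating functionals of resource theories\<close>

text \<open>Multisets are used because tensor factors commute only up to a local relabelling,
  whereas the order theory needs a commutative monoid. The vanishing supply of GHZ states makes the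
  order well behaved: any fixed multiset can be bought from finitely many GHZ states, so catalysts
  and incomplete blocks have cost rate zero. Cancellation and closure under limits both rest on
  this. Protocols are measured by sums of squared overlaps with a pure target. Such a sum is a
  squared fidelity, it is additive over branches, and it spares any work with mixed states before
  the final translation to Kraus lists. Continuity is the delicate condition, since a functional
  obtained from Zorn's lemma carries no information about neighbouring vectors. The flagged
  superposition supplies it because it can be evaluated in two ways. Its error per copy vanishes
  with the weight of the second state and grows at most linearly in the logarithm of the dimension,
  which is what the normalisation by \<open>1 + log dim\<close> tolerates.\<close>

lemma replicate_mset_plus: "replicate_mset (m + n) x = replicate_mset m x + replicate_mset n x"
  by (auto intro: multiset_eqI)

lemma repeat_replicate_mset [simp]: "repeat_mset n (replicate_mset m x) = replicate_mset (n * m) x"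
  by (auto intro: multiset_eqI)

lemma repeat_mset_subset: "m \<le> n \<Longrightarrow> repeat_mset m M \<subseteq># repeat_mset n M"
  by (simp add: subseteq_mset_def)

lemma replicate_mset_subset: "m \<le> n \<Longrightarrow> replicate_mset m x \<subseteq># replicate_mset n x"
  by (simp add: subseteq_mset_def)

lemma nat_floor_le_iff: "0 \<le> (x::real) \<Longrightarrow> m \<le> nat \<lfloor>x\<rfloor> \<longleftrightarrow> real m \<le> x"
  by (simp add: le_nat_iff le_floor_iff)

lemma nat_floor_half:
  assumes d: "0 \<le> (\<delta>::real)"
  shows "nat \<lfloor>\<delta> / 2 * real n\<rfloor> + nat \<lfloor>\<delta> / 2 * real n\<rfloor> \<le> nat \<lfloor>\<delta> * real n\<rfloor>"
proof -
  have "real (nat \<lfloor>\<delta> / 2 * real n\<rfloor>) \<le> \<delta> / 2 * real n" using d by (intro of_nat_floor) simp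
  then show ?thesis using d by (subst nat_floor_le_iff) auto
qed

text \<open>\<open>p\<close> is a guaranteed squared fidelity and may be negative. The loss in
  \<open>cv_comp\<close> arises because the second protocol receives a state with a component of
  weight up to \<open>1 - p\<close> outside \<open>N\<close>; \<eta> balances the two error terms.
  \<open>cv_nondeg\<close> is the Schmidt rank bound: rank \<open>2 ^ i\<close> reaches the GHZ
  state of rank \<open>2 ^ j\<close> with squared fidelity at most
  \<open>2 ^ i / 2 ^ j\<close>.\<close>

locale resource_theory =
  fixes S :: "'a set" and cv :: "'a multiset \<Rightarrow> 'a multiset \<Rightarrow> real \<Rightarrow> bool" and g :: 'a
  assumes g_in: "g \<in> S"
    and cv_antimono: "cv M N p \<Longrightarrow> q \<le> p \<Longrightarrow> cv M N q"
    and cv_comp: "\<lbrakk>set_mset M \<subseteq> S; set_mset N \<subseteq> S; set_mset K \<subseteq> S; cv M N p; cv N K p'; 0 \<le> p'; 0 < \<eta>; \<eta> < 1\<rbrakk>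
      \<Longrightarrow> cv M K ((1 - \<eta>) * p * p' - (1 - p) / \<eta>)"
    and cv_add: "\<lbrakk>set_mset M \<subseteq> S; set_mset N \<subseteq> S; set_mset K \<subseteq> S; cv M N p\<rbrakk> \<Longrightarrow> cv (M + K) (N + K) p"
    and cv_discard: "\<lbrakk>set_mset M \<subseteq> S; set_mset N \<subseteq> S\<rbrakk> \<Longrightarrow> cv (M + N) M 1"
    and cv_from_g: "s \<in> S \<Longrightarrow> \<exists>n. cv (replicate_mset n g) {#s#} 1"
    and cv_nondeg: "cv (replicate_mset i g) (replicate_mset j g) p \<Longrightarrow> p * 2 ^ j \<le> 2 ^ i"
begin

section \<open>Asymptotic conversion with fidelity tending to 1\<close>

definition Cr :: "'a multiset set" where "Cr = {M. set_mset M \<subseteq> S}"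

lemma Cr_iff: "M \<in> Cr \<longleftrightarrow> set_mset M \<subseteq> S" by (simp add: Cr_def)

lemma Cr_add [simp]: "M + N \<in> Cr \<longleftrightarrow> M \<in> Cr \<and> N \<in> Cr" by (auto simp: Cr_def)

lemma Cr_add_mset [simp]: "add_mset x M \<in> Cr \<longleftrightarrow> x \<in> S \<and> M \<in> Cr" by (auto simp: Cr_def)

lemma Cr_empty [simp]: "{#} \<in> Cr" by (simp add: Cr_def)

lemma Cr_repeat [simp]: "M \<in> Cr \<Longrightarrow> repeat_mset n M \<in> Cr"
  by (induction n) auto

lemma Cr_g [simp]: "replicate_mset n g \<in> Cr" using g_in by (auto simp: Cr_def)

lemma Cr_subset: "M \<in> Cr \<Longrightarrow> N \<subseteq># M \<Longrightarrow> N \<in> Cr"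
  using set_mset_mono by (auto simp: Cr_def)

lemma cv_subset: "M \<in> Cr \<Longrightarrow> N \<subseteq># M \<Longrightarrow> cv M N 1"
  using cv_discard[of N "M - N"] Cr_subset[of M N] Cr_subset[of M "M - N"]
  by (auto simp: Cr_iff)

definition tends :: "(nat \<Rightarrow> 'a multiset) \<Rightarrow> (nat \<Rightarrow> 'a multiset) \<Rightarrow> bool" where
  "tends A B \<longleftrightarrow> (\<forall>n. A n \<in> Cr \<and> B n \<in> Cr) \<and> (\<forall>\<epsilon>>0. \<forall>\<^sub>F n in sequentially. cv (A n) (B n) (1 - \<epsilon>))"

lemma tends_trans [trans]:
  assumes "tends A B" "tends B C"
  shows "tends A C"
  unfolding tends_def
proof (intro conjI allI impI)
  fix n show "A n \<in> Cr" "C n \<in> Cr" using assms by (auto simp: tends_def)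
next
  fix \<epsilon> :: real assume e: "\<epsilon> > 0"
  \<comment> \<open>The quadratic choice of \<theta> keeps the term \<open>\<theta> / \<eta>\<close>
    small; the total loss is at most \<open>\<eta> + 2 * \<theta> + \<eta> / 3\<close>, which is
    below \<open>2 * \<eta>\<close>.\<close>
  define \<eta> where "\<eta> = min (\<epsilon> / 3) (1/3)"
  define \<theta> where "\<theta> = \<eta>\<^sup>2 / 3"
  have h: "0 < \<eta>" "\<eta> \<le> 1/3" "2 * \<eta> \<le> \<epsilon>" using e by (auto simp: \<eta>_def)
  have th: "0 < \<theta>" "\<theta> \<le> \<eta> / 9"
    using h by (auto simp: \<theta>_def power2_eq_square)
  have "\<theta> / \<eta> = \<eta> / 3" using h by (simp add: \<theta>_def power2_eq_square)
  moreover have "(1 - \<eta>) * (1 - \<theta>) * (1 - \<theta>) \<ge> 1 - \<eta> - 2 * \<theta>"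
  proof -
    have "(1 - \<theta>) * (1 - \<theta>) \<ge> 1 - 2 * \<theta>" by (simp add: algebra_simps)
    then have "(1 - \<eta>) * ((1 - \<theta>) * (1 - \<theta>)) \<ge> (1 - \<eta>) * (1 - 2 * \<theta>)"
      using h by (intro mult_left_mono) auto
    moreover have "(1 - \<eta>) * (1 - 2 * \<theta>) = 1 - \<eta> - 2 * \<theta> + 2 * (\<eta> * \<theta>)" by (simp add: algebra_simps)
    moreover have "\<eta> * \<theta> \<ge> 0" using h th by simp
    ultimately show ?thesis by (simp add: mult.assoc)
  qed
  ultimately have ineq: "(1 - \<eta>) * (1 - \<theta>) * (1 - \<theta>) - (1 - (1 - \<theta>)) / \<eta> \<ge> 1 - \<epsilon>"
    using h th by simp
  have "\<forall>\<^sub>F n in sequentially. cv (A n) (B n) (1 - \<theta>)" "\<forall>\<^sub>F n in sequentially. cv (B n) (C n) (1 - \<theta>)"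
    using assms th by (auto simp: tends_def)
  then show "\<forall>\<^sub>F n in sequentially. cv (A n) (C n) (1 - \<epsilon>)"
  proof eventually_elim
    case (elim n)
    have "cv (A n) (C n) ((1 - \<eta>) * (1 - \<theta>) * (1 - \<theta>) - (1 - (1 - \<theta>)) / \<eta>)"
      using assms h th elim by (intro cv_comp[where N = "B n"]) (auto simp: tends_def Cr_iff)
    then show ?case using ineq cv_antimono by blast
  qed
qed

lemma tends_add_right:
  assumes "tends A B" "\<And>n. K n \<in> Cr"
  shows "tends (\<lambda>n. A n + K n) (\<lambda>n. B n + K n)"
  unfolding tends_def
proof (intro conjI allI impI)
  fix n show "A n + K n \<in> Cr" "B n + K n \<in> Cr" using assms by (auto simp: tends_def)
next
  fix \<epsilon> :: real assume "\<epsilon> > 0"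
  then have "\<forall>\<^sub>F n in sequentially. cv (A n) (B n) (1 - \<epsilon>)" using assms by (auto simp: tends_def)
  then show "\<forall>\<^sub>F n in sequentially. cv (A n + K n) (B n + K n) (1 - \<epsilon>)"
    by eventually_elim (rule cv_add; use assms in \<open>auto simp: tends_def Cr_iff\<close>)
qed

lemma tends_add:
  assumes "tends A B" "tends A' B'"
  shows "tends (\<lambda>n. A n + A' n) (\<lambda>n. B n + B' n)"
proof -
  have "tends (\<lambda>n. A n + A' n) (\<lambda>n. B n + A' n)"
    using assms by (intro tends_add_right) (auto simp: tends_def)
  also have "tends (\<lambda>n. B n + A' n) (\<lambda>n. B n + B' n)"
    using tends_add_right[OF assms(2), of B] assms by (simp add: add.commute tends_def)
  finally show ?thesis .
qed

lemma tends_subset: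
  assumes "\<And>n. A n \<in> Cr" "\<And>n. B n \<in> Cr" "\<forall>\<^sub>F n in sequentially. B n \<subseteq># A n"
  shows "tends A B"
  unfolding tends_def
proof (intro conjI allI impI)
  fix \<epsilon> :: real assume e: "\<epsilon> > 0"
  show "\<forall>\<^sub>F n in sequentially. cv (A n) (B n) (1 - \<epsilon>)"
    using assms(3)
  proof eventually_elim
    case (elim n)
    show ?case by (rule cv_antimono[OF cv_subset[OF assms(1) elim]]) (use e in auto)
  qed
qed (use assms in auto)

lemma tends_const:
  assumes "M \<in> Cr" "N \<in> Cr" "\<And>q. q < 1 \<Longrightarrow> cv M N q"
  shows "tends (\<lambda>_. M) (\<lambda>_. N)"
  using assms by (auto simp: tends_def)

lemma tends_subseq:
  assumes "tends A B" "filterlim f at_top sequentially"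
  shows "tends (\<lambda>n. A (f n)) (\<lambda>n. B (f n))"
  using assms eventually_compose_filterlim[OF _ assms(2)] by (auto simp: tends_def)

text \<open>Since every squared fidelity below 1 is attained on one copy, the error per copy can be
  made as small as the number of copies demands.\<close>

lemma cv_multiple:
  assumes MN: "M \<in> Cr" "N \<in> Cr" and ex: "\<And>q. q < 1 \<Longrightarrow> cv M N q" and q: "q < 1"
  shows "cv (repeat_mset n M) (repeat_mset n N) q"
proof -
  have "tends (\<lambda>_. repeat_mset n M) (\<lambda>_. repeat_mset n N)"
  proof (induction n)
    case 0 show ?case by (intro tends_subset) auto
  next
    case (Suc n)
    show ?case using tends_add[OF tends_const[OF MN ex] Suc] by simp
  qed
  then have "\<forall>\<^sub>F m in sequentially. cv (repeat_mset n M) (repeat_mset n N) (1 - (1 - q))"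
    using q unfolding tends_def by (metis diff_gt_0_iff_gt)
  then show ?thesis by simp
qed

lemma multiset_from_g:
  assumes "M \<in> Cr"
  shows "\<exists>b. tends (\<lambda>_. replicate_mset b g) (\<lambda>_. M)"
  using assms
proof (induction M)
  case empty
  show ?case by (rule exI[of _ 0]) (auto intro!: tends_subset)
next
  case (add x M)
  then have M: "M \<in> Cr" and x: "x \<in> S" by (auto simp: Cr_def)
  obtain b where b: "tends (\<lambda>_. replicate_mset b g) (\<lambda>_. M)" using add M by blast
  obtain c where c: "cv (replicate_mset c g) {#x#} 1" using cv_from_g x by blast
  have "tends (\<lambda>_. replicate_mset c g) (\<lambda>_. {#x#})"
    using c x cv_antimono by (intro tends_const) (auto simp: Cr_def g_in)
  from tends_add[OF this b] show ?case
    by (intro exI[of _ "c + b"]) (simp add: replicate_mset_plus)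
qed

section \<open>The preorder with a vanishing rate of GHZ states\<close>

definition ge :: "'a multiset \<Rightarrow> 'a multiset \<Rightarrow> bool" where
  "ge M N \<longleftrightarrow> M \<in> Cr \<and> N \<in> Cr \<and> (\<forall>\<delta>>0. tends (\<lambda>n. repeat_mset n M + replicate_mset (nat \<lfloor>\<delta> * real n\<rfloor>) g)
     (\<lambda>n. repeat_mset n N))"

lemma geD:
  "ge M N \<Longrightarrow> \<delta> > 0 \<Longrightarrow> tends (\<lambda>n. repeat_mset n M + replicate_mset (nat \<lfloor>\<delta> * real n\<rfloor>) g) (\<lambda>n. repeat_mset n N)"
  by (simp add: ge_def)

lemma geI:
  assumes "M \<in> Cr" "N \<in> Cr" "tends (\<lambda>n. repeat_mset n M) (\<lambda>n. repeat_mset n N)"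
  shows "ge M N"
  unfolding ge_def
proof (intro conjI allI impI assms(1,2))
  fix \<delta> :: real
  have "tends (\<lambda>n. repeat_mset n M + replicate_mset (nat \<lfloor>\<delta> * real n\<rfloor>) g) (\<lambda>n. repeat_mset n M)"
    using assms by (intro tends_subset) auto
  also note assms(3)
  finally show "tends (\<lambda>n. repeat_mset n M + replicate_mset (nat \<lfloor>\<delta> * real n\<rfloor>) g) (\<lambda>n. repeat_mset n N)" .
qed

lemma ge_subset: "M \<in> Cr \<Longrightarrow> N \<subseteq># M \<Longrightarrow> ge M N"
  by (intro geI tends_subset Cr_repeat) (auto intro: Cr_subset simp: subseteq_mset_def)

lemma ge_of_cv:
  assumes "M \<in> Cr" "N \<in> Cr" "\<And>q. q < 1 \<Longrightarrow> cv M N q"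
  shows "ge M N"
  using assms by (intro geI) (auto simp: tends_def intro!: always_eventually cv_multiple)

lemma ge_trans: "ge M N \<Longrightarrow> ge N K \<Longrightarrow> ge M K"
  unfolding ge_def
proof (intro conjI allI impI; elim conjE)
  fix \<delta> :: real assume d: "\<delta> > 0" and C: "M \<in> Cr" "N \<in> Cr" "K \<in> Cr"
  \<comment> \<open>Each of the two conversions receives half of the GHZ budget.\<close>
  let ?h = "\<lambda>n. replicate_mset (nat \<lfloor>\<delta> / 2 * real n\<rfloor>) g"
  assume 1: "\<forall>\<delta>>0. tends (\<lambda>n. repeat_mset n M + replicate_mset (nat \<lfloor>\<delta> * real n\<rfloor>) g) (\<lambda>n. repeat_mset n N)"
     and 2: "\<forall>\<delta>>0. tends (\<lambda>n. repeat_mset n N + replicate_mset (nat \<lfloor>\<delta> * real n\<rfloor>) g) (\<lambda>n. repeat_mset n K)"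
  have "tends (\<lambda>n. repeat_mset n M + replicate_mset (nat \<lfloor>\<delta> * real n\<rfloor>) g)
      (\<lambda>n. (repeat_mset n M + ?h n) + ?h n)"
    using C d nat_floor_half[of \<delta>]
    by (intro tends_subset) (auto simp: add.assoc simp flip: replicate_mset_plus intro!: always_eventually replicate_mset_subset)
  also have "tends \<dots> (\<lambda>n. repeat_mset n N + ?h n)"
    using 1[rule_format, of "\<delta> / 2"] d by (intro tends_add_right) auto
  also have "tends \<dots> (\<lambda>n. repeat_mset n K)" using 2[rule_format, of "\<delta> / 2"] d by auto
  finally show "tends (\<lambda>n. repeat_mset n M + replicate_mset (nat \<lfloor>\<delta> * real n\<rfloor>) g) (\<lambda>n. repeat_mset n K)" .
qed auto

lemma ge_add:
  assumes "ge M N" "ge M' N'"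
  shows "ge (M + M') (N + N')"
proof -
  have *: "ge (M + K) (N + K)" if "ge M N" "K \<in> Cr" for M N K
    unfolding ge_def
  proof (intro conjI allI impI)
    fix \<delta> :: real assume "\<delta> > 0"
    then have "tends (\<lambda>n. repeat_mset n M + replicate_mset (nat \<lfloor>\<delta> * real n\<rfloor>) g) (\<lambda>n. repeat_mset n N)"
      using that by (auto simp: ge_def)
    from tends_add_right[OF this, of "\<lambda>n. repeat_mset n K"] that
    show "tends (\<lambda>n. repeat_mset n (M + K) + replicate_mset (nat \<lfloor>\<delta> * real n\<rfloor>) g) (\<lambda>n. repeat_mset n (N + K))"
      by (simp add: ac_simps)
  qed (use that in \<open>auto simp: ge_def\<close>)
  have "ge (M + M') (N + M')" using * assms by (auto simp: ge_def)
  moreover have "ge (N + M') (N + N')" using *[OF assms(2), of N] assms by (simp add: ge_def add.commute)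
  ultimately show ?thesis by (rule ge_trans)
qed

lemma ge_refl: "M \<in> Cr \<Longrightarrow> ge M M" by (simp add: ge_subset)

lemma ge_multiple: "ge M N \<Longrightarrow> ge (repeat_mset n M) (repeat_mset n N)"
  by (induction n) (auto intro: ge_add ge_refl)

lemma ge_from_g: "M \<in> Cr \<Longrightarrow> \<exists>b. ge (replicate_mset b g) M"
proof -
  assume M: "M \<in> Cr"
  obtain b where b: "tends (\<lambda>_. replicate_mset b g) (\<lambda>_. M)" using multiset_from_g[OF M] by blast
  have "ge (replicate_mset b g) M"
  proof (rule ge_of_cv)
    fix q :: real assume "q < 1"
    then have "\<forall>\<^sub>F n in sequentially. cv (replicate_mset b g) M (1 - (1 - q))"
      using b unfolding tends_def by (metis diff_gt_0_iff_gt)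
    then show "cv (replicate_mset b g) M q" by simp
  qed (use M in auto)
  then show ?thesis by blast
qed

text \<open>Converting in blocks of \<open>c\<close> copies spends \<open>b\<close> GHZ states per
  block, that is at rate \<open>b / c\<close>, which falls below every \<delta> for large
  \<open>c\<close>. The incomplete last block is bought from a constant number of GHZ
  states.\<close>

lemma ge_limit:
  assumes MN: "M \<in> Cr" "N \<in> Cr"
    and lim: "\<And>c0::nat. \<exists>c\<ge>c0. ge (repeat_mset c M + replicate_mset b g) (repeat_mset c N)"
  shows "ge M N"
  unfolding ge_def
proof (intro conjI allI impI MN)
  fix \<delta> :: real assume d: "\<delta> > 0"
  \<comment> \<open>Each block is charged \<open>b + 1\<close> GHZ states: \<open>b\<close> from the
    hypothesis and 1 for its own vanishing supply, which is used below at rate 1 per block. The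
    other half of \<delta> is left for the constant \<open>b'\<close>.\<close>
  obtain c0 :: nat where c0: "real c0 \<ge> 2 * (real b + 1) / \<delta> + 1" using real_arch_simple by blast
  obtain c where c: "c \<ge> c0" "ge (repeat_mset c M + replicate_mset b g) (repeat_mset c N)" using lim by blast
  have "real c \<ge> 2 * (real b + 1) / \<delta> + 1" using c c0 by linarith
  then have cpos: "real c > 0" and cd: "(real b + 1) / real c \<le> \<delta> / 2"
  proof -
    assume a: "real c \<ge> 2 * (real b + 1) / \<delta> + 1"
    have "2 * (real b + 1) / \<delta> > 0" using d by simp
    then show c0: "real c > 0" using a by linarith
    have "2 * (real b + 1) / \<delta> \<le> real c" using a by linarith
    then show "(real b + 1) / real c \<le> \<delta> / 2" using c0 d by (simp add: field_simps)
  qed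
  obtain b' where b': "tends (\<lambda>_. replicate_mset b' g) (\<lambda>_. repeat_mset c N)"
    using multiset_from_g[of "repeat_mset c N"] MN by auto
  have lim: "filterlim (\<lambda>n. n div c) at_top sequentially"
    unfolding filterlim_at_top
  proof
    fix Z
    show "\<forall>\<^sub>F x in sequentially. Z \<le> x div c"
      using cpos by (intro eventually_sequentiallyI[of "Z * c"]) (simp add: less_eq_div_iff_mult_less_eq)
  qed
  let ?l = "\<lambda>n. n div c"
  have "tends (\<lambda>n. repeat_mset n (repeat_mset c M + replicate_mset b g) + replicate_mset (nat \<lfloor>1 * real n\<rfloor>) g)
      (\<lambda>n. repeat_mset n (repeat_mset c N))"
    by (rule geD[OF c(2)]) simp
  from tends_subseq[OF this lim]
  have t: "tends (\<lambda>n. repeat_mset (?l n * c) M + replicate_mset (?l n * b + ?l n) g) (\<lambda>n. repeat_mset (?l n * c) N)"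
    by (simp add: ac_simps replicate_mset_plus)
  have "\<forall>\<^sub>F n in sequentially. ?l n * b + ?l n + b' \<le> nat \<lfloor>\<delta> * real n\<rfloor>"
  proof -
    obtain n0 :: nat where n0: "real n0 \<ge> 2 * real b' / \<delta>" using real_arch_simple by blast
    have "?l n * b + ?l n + b' \<le> nat \<lfloor>\<delta> * real n\<rfloor>" if "n \<ge> n0" for n
    proof -
      have "real (?l n) \<le> real n / real c" by (simp add: of_nat_div_le_of_nat)
      then have "real (?l n) * (real b + 1) \<le> real n / real c * (real b + 1)" by (intro mult_right_mono) auto
      also have "\<dots> = real n * ((real b + 1) / real c)" by simp
      also have "\<dots> \<le> real n * (\<delta> / 2)" using cd by (intro mult_left_mono) auto
      finally have 1: "real (?l n) * (real b + 1) \<le> real n * (\<delta> / 2)" .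
      have "real n \<ge> 2 * real b' / \<delta>" using n0 that by linarith
      then have "real b' \<le> real n * (\<delta> / 2)" using d by (simp add: field_simps)
      with 1 have "real (?l n * b + ?l n + b') \<le> \<delta> * real n" by (simp add: algebra_simps)
      then show ?thesis using d by (subst nat_floor_le_iff) auto
    qed
    then show ?thesis by (rule eventually_sequentiallyI)
  qed
  then have "tends (\<lambda>n. repeat_mset n M + replicate_mset (nat \<lfloor>\<delta> * real n\<rfloor>) g)
     (\<lambda>n. (repeat_mset (?l n * c) M + replicate_mset (?l n * b + ?l n) g) + replicate_mset b' g)"
  proof (intro tends_subset, goal_cases)
    case 3
    then show ?case
      by eventually_elim (auto simp: add.assoc simp flip: replicate_mset_plus
          intro!: subset_mset.add_mono replicate_mset_subset repeat_mset_subset)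
  qed (use MN in auto)
  also have "tends \<dots> (\<lambda>n. repeat_mset (?l n * c) N + repeat_mset c N)"
    by (rule tends_add[OF t b'])
  also have "tends \<dots> (\<lambda>n. repeat_mset n N)"
  proof (intro tends_subset always_eventually allI)
    fix n
    have "n \<le> ?l n * c + c"
      using div_mult_mod_eq[of n c] mod_less_divisor[of c n] cpos by linarith
    then show "repeat_mset n N \<subseteq># repeat_mset (n div c * c) N + repeat_mset c N"
      unfolding repeat_mset_distrib[symmetric] by (rule repeat_mset_subset)
  qed (use MN in auto)
  finally show "tends (\<lambda>n. repeat_mset n M + replicate_mset (nat \<lfloor>\<delta> * real n\<rfloor>) g) (\<lambda>n. repeat_mset n N)" .
qed

text \<open>\<open>X\<close> is a catalyst: it is returned after every copy, so one \<open>X\<close>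
  serves all \<open>n\<close> copies. The relation is a parameter because the argument is needed for
  \<open>ge\<close> and again for its extensions.\<close>

lemma iterate_cancel:
  assumes tr: "\<And>a b c. R a b \<Longrightarrow> R b c \<Longrightarrow> R a c"
    and ad: "\<And>a b c. R a b \<Longrightarrow> c \<in> Cr \<Longrightarrow> R (a + c) (b + c)"
    and rf: "\<And>a. a \<in> Cr \<Longrightarrow> R a a"
    and C: "M \<in> Cr" "N \<in> Cr" "X \<in> Cr" and R: "R (M + X) (N + X)"
  shows "R (repeat_mset n M + X) (repeat_mset n N + X)"
proof (induction n)
  case 0 show ?case using rf C by simp
next
  case (Suc n)
  have "R (repeat_mset n M + X + M) (repeat_mset n N + X + M)" using Suc ad C by blast
  moreover have "R (M + X + repeat_mset n N) (N + X + repeat_mset n N)" using R ad C by simp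
  ultimately show ?case using tr by (simp add: ac_simps)
qed

text \<open>The catalyst is bought once from \<open>b\<close> GHZ states, used for \<open>c\<close>
  copies and discarded; as \<open>b\<close> does not depend on \<open>c\<close>,
  \<open>ge_limit\<close> removes the cost.\<close>

lemma ge_cancel:
  assumes "M \<in> Cr" "N \<in> Cr" "X \<in> Cr" "ge (M + X) (N + X)"
  shows "ge M N"
proof -
  obtain b where b: "ge (replicate_mset b g) X" using ge_from_g assms by blast
  have "ge (repeat_mset c M + replicate_mset b g) (repeat_mset c N)" for c
  proof -
    have "ge (repeat_mset c M + replicate_mset b g) (repeat_mset c M + X)"
      using b assms by (intro ge_add ge_refl) auto
    moreover have "ge (repeat_mset c M + X) (repeat_mset c N + X)"
    proof (rule iterate_cancel[where R = ge])
      show "ge a d" if "ge a b" "ge b d" for a b d using that by (rule ge_trans)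
      show "ge (a + d) (b + d)" if "ge a b" "d \<in> Cr" for a b d using that by (intro ge_add ge_refl)
    qed (use assms in \<open>auto intro: ge_refl\<close>)
    moreover have "ge (repeat_mset c N + X) (repeat_mset c N)"
      using assms by (intro ge_subset) auto
    ultimately show ?thesis using ge_trans by blast
  qed
  then show ?thesis using assms by (intro ge_limit[where b = b]) auto
qed

lemma ge_root:
  assumes "M \<in> Cr" "N \<in> Cr" "n > 0" "ge (repeat_mset n M) (repeat_mset n N)"
  shows "ge M N"
proof (rule ge_limit[where b = 0])
  fix c0 :: nat
  have "ge (repeat_mset (c0 * n) M + replicate_mset 0 g) (repeat_mset (c0 * n) N)"
    using ge_multiple[OF assms(4), of c0] by simp
  moreover have "c0 * n \<ge> c0" using assms by simp
  ultimately show "\<exists>c\<ge>c0. ge (repeat_mset c M + replicate_mset 0 g) (repeat_mset c N)" by blast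
qed (use assms in auto)

lemma ge_nondeg:
  assumes "ge (replicate_mset i g) (replicate_mset j g)"
  shows "j \<le> i"
proof (rule ccontr)
  assume "\<not> j \<le> i"
  then have ij: "i < j" by simp
  \<comment> \<open>Half a GHZ state per copy cannot make up for a deficit of one per copy: at least
    one GHZ state is still missing, so the squared fidelity is at most 1/2, against the 3/4 claimed
    next.\<close>
  have "tends (\<lambda>n. repeat_mset n (replicate_mset i g) + replicate_mset (nat \<lfloor>1/2 * real n\<rfloor>) g)
     (\<lambda>n. repeat_mset n (replicate_mset j g))"
    by (rule geD[OF assms]) simp
  then have "\<forall>\<^sub>F n in sequentially. cv (repeat_mset n (replicate_mset i g) + replicate_mset (nat \<lfloor>1/2 * real n\<rfloor>) g)
     (repeat_mset n (replicate_mset j g)) (1 - 1/4)"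
    unfolding tends_def by (elim conjE allE[of _ "1/4"]) simp
  then obtain n0 where n0: "\<And>n. n \<ge> n0 \<Longrightarrow> cv (repeat_mset n (replicate_mset i g) + replicate_mset (nat \<lfloor>1/2 * real n\<rfloor>) g)
     (repeat_mset n (replicate_mset j g)) (1 - 1/4)"
    unfolding eventually_sequentially by blast
  define n where "n = max 2 n0"
  let ?h = "nat \<lfloor>1/2 * real n\<rfloor>"
  have hn: "?h + 1 \<le> n"
  proof -
    have "real ?h \<le> 1/2 * real n" by (intro of_nat_floor) simp
    moreover have "n \<ge> 2" by (simp add: n_def)
    ultimately show ?thesis by linarith
  qed
  have "cv (replicate_mset (n * i + ?h) g) (replicate_mset (n * j) g) (1 - 1/4)"
    using n0[of n] by (simp add: n_def replicate_mset_plus)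
  then have "(1 - 1/4) * 2 ^ (n * j) \<le> (2::real) ^ (n * i + ?h)" by (rule cv_nondeg)
  moreover have "(1 - 1/4) * (2::real) ^ (n * i + ?h + 1) \<le> (1 - 1/4) * 2 ^ (n * j)"
  proof (rule mult_left_mono)
  show "(2::real) ^ (n * i + ?h + 1) \<le> 2 ^ (n * j)"
  proof (rule power_increasing)
    have "n * (i + 1) \<le> n * j" using ij by (intro mult_left_mono) auto
    then show "n * i + ?h + 1 \<le> n * j" using hn by simp
  qed simp
  qed simp
  ultimately have "(1 - 1/4) * (2::real) ^ (n * i + ?h + 1) \<le> 2 ^ (n * i + ?h)"
    by (rule order_trans[rotated])
  then have "(1 - 1/4) * 2 * (2::real) ^ (n * i + ?h) \<le> 1 * 2 ^ (n * i + ?h)"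
    by simp
  then have "(1 - 1/4) * (2::real) \<le> 1" by (rule mult_right_le_imp_le) simp
  then show False by simp
qed

section \<open>Extension to a total additive preorder\<close>

definition good :: "('a multiset \<times> 'a multiset) set \<Rightarrow> bool" where
  "good R \<longleftrightarrow> R \<subseteq> Cr \<times> Cr \<and> (\<forall>M N. ge M N \<longrightarrow> (M, N) \<in> R) \<and> trans R \<and>
     (\<forall>M N K. (M, N) \<in> R \<and> K \<in> Cr \<longrightarrow> (M + K, N + K) \<in> R) \<and>
     (\<forall>i j. (replicate_mset i g, replicate_mset j g) \<in> R \<longrightarrow> j \<le> i)"

text \<open>In the group of differences, \<open>a - b\<close> lies above a multiple of
  \<open>s - t\<close>; distributing the multiple over both sides avoids subtraction.\<close>

definition extend :: "('a multiset \<times> 'a multiset) set \<Rightarrow> 'a multiset \<Rightarrow> 'a multiset \<Rightarrow> ('a multiset \<times> 'a multiset) set" where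
  "extend R s t = {(a, b). a \<in> Cr \<and> b \<in> Cr \<and> (\<exists>n. (a + repeat_mset n t, b + repeat_mset n s) \<in> R)}"

lemma good_add:
  assumes "good R" "(a, b) \<in> R" "(a', b') \<in> R"
  shows "(a + a', b + b') \<in> R"
proof -
  have "(a + a', b + a') \<in> R" using assms by (auto simp: good_def)
  moreover have "(a' + b, b' + b) \<in> R" using assms by (auto simp: good_def)
  ultimately show ?thesis using assms(1) by (auto simp: good_def add.commute dest: transD)
qed

lemma good_multiple: "good R \<Longrightarrow> (a, b) \<in> R \<Longrightarrow> (repeat_mset n a, repeat_mset n b) \<in> R"
  by (induction n) (auto intro: good_add simp: good_def ge_refl)

lemma good_trans: "good R \<Longrightarrow> (a, b) \<in> R \<Longrightarrow> (b, c) \<in> R \<Longrightarrow> (a, c) \<in> R"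
  by (auto simp: good_def dest: transD)

text \<open>The hypothesis \<open>nd\<close> is nondegeneracy of the extension, the one clause of
  \<open>good\<close> that may fail.\<close>

lemma good_extend:
  assumes R: "good R" and st: "s \<in> Cr" "t \<in> Cr"
    and nd: "\<And>n i j. (replicate_mset i g + repeat_mset n t, replicate_mset j g + repeat_mset n s) \<in> R \<Longrightarrow> j \<le> i"
  shows "good (extend R s t)" "R \<subseteq> extend R s t" "(s, t) \<in> extend R s t"
proof -
  show sub: "R \<subseteq> extend R s t"
  proof
    fix x assume "x \<in> R"
    then show "x \<in> extend R s t"
      using R by (cases x) (auto simp: extend_def good_def intro!: exI[of _ 0])
  qed
  have "(s + repeat_mset 1 t, t + repeat_mset 1 s) \<in> R"
    using R st ge_refl[of "s + t"] by (auto simp: good_def add.commute)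
  then show "(s, t) \<in> extend R s t" using st by (auto simp: extend_def simp del: repeat_mset_Suc)
  show "good (extend R s t)"
    unfolding good_def
  proof (intro conjI allI impI; (elim conjE)?)
    show "extend R s t \<subseteq> Cr \<times> Cr" by (auto simp: extend_def)
  next
    fix M N assume "ge M N" then show "(M, N) \<in> extend R s t" using sub R by (auto simp: good_def)
  next
    show "trans (extend R s t)"
    proof (rule transI)
      fix a b c assume ab: "(a, b) \<in> extend R s t" and bc: "(b, c) \<in> extend R s t"
      then obtain n m where n: "(a + repeat_mset n t, b + repeat_mset n s) \<in> R"
        and m: "(b + repeat_mset m t, c + repeat_mset m s) \<in> R" by (auto simp: extend_def)
      have "(a + repeat_mset n t + repeat_mset m t, b + repeat_mset n s + repeat_mset m t) \<in> R"
        using n R st by (auto simp: good_def)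
      moreover have "(b + repeat_mset m t + repeat_mset n s, c + repeat_mset m s + repeat_mset n s) \<in> R"
        using m R st by (auto simp: good_def)
      ultimately have "(a + repeat_mset (n + m) t, c + repeat_mset (n + m) s) \<in> R"
        using good_trans[OF R] by (simp add: repeat_mset_distrib ac_simps)
      then show "(a, c) \<in> extend R s t" using ab bc by (auto simp: extend_def)
    qed
  next
    fix M N K assume "(M, N) \<in> extend R s t" "K \<in> Cr"
    then obtain n where "(M + repeat_mset n t, N + repeat_mset n s) \<in> R" "M \<in> Cr" "N \<in> Cr"
      by (auto simp: extend_def)
    moreover from this have "(M + repeat_mset n t + K, N + repeat_mset n s + K) \<in> R"
      using R \<open>K \<in> Cr\<close> by (auto simp: good_def)
    ultimately show "(M + K, N + K) \<in> extend R s t" using \<open>K \<in> Cr\<close>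
      by (auto simp: extend_def ac_simps intro!: exI[of _ n])
  next
    fix i j assume "(replicate_mset i g, replicate_mset j g) \<in> extend R s t"
    then show "j \<le> i" using nd by (auto simp: extend_def)
  qed
qed

lemma good_maximal:
  assumes R0: "good R0"
  shows "\<exists>R. good R \<and> R0 \<subseteq> R \<and> (\<forall>R'. good R' \<and> R \<subseteq> R' \<longrightarrow> R' = R)"
proof -
  let ?A = "{R. good R \<and> R0 \<subseteq> R}"
  have "\<exists>M\<in>?A. \<forall>X\<in>?A. M \<subseteq> X \<longrightarrow> X = M"
  proof (rule subset_Zorn_nonempty)
    show "?A \<noteq> {}" using R0 by auto
  next
    fix \<C> assume ne: "\<C> \<noteq> {}" and ch: "subset.chain ?A \<C>"
    have gd: "good R" "R0 \<subseteq> R" if "R \<in> \<C>" for R using ch that by (auto simp: subset.chain_def)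
    \<comment> \<open>Transitivity is the only clause that involves two pairs, and in a chain both
      lie in a common member.\<close>
    have two: "\<exists>R\<in>\<C>. x \<in> R \<and> y \<in> R" if "x \<in> \<Union>\<C>" "y \<in> \<Union>\<C>" for x y
    proof -
      obtain R1 R2 where "R1 \<in> \<C>" "x \<in> R1" "R2 \<in> \<C>" "y \<in> R2" using \<open>x \<in> \<Union>\<C>\<close> \<open>y \<in> \<Union>\<C>\<close> by blast
      moreover have "R1 \<subseteq> R2 \<or> R2 \<subseteq> R1" using ch \<open>R1 \<in> \<C>\<close> \<open>R2 \<in> \<C>\<close>
        unfolding subset_chain_def by blast
      ultimately show ?thesis by blast
    qed
    have "good (\<Union>\<C>)"
      unfolding good_def
    proof (intro conjI allI impI; (elim conjE)?)
      show "\<Union>\<C> \<subseteq> Cr \<times> Cr" using gd by (fastforce simp: good_def)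
      show "trans (\<Union>\<C>)"
      proof (rule transI)
        fix a b c assume "(a, b) \<in> \<Union>\<C>" "(b, c) \<in> \<Union>\<C>"
        then obtain R where "R \<in> \<C>" "(a, b) \<in> R" "(b, c) \<in> R" using two by blast
        then show "(a, c) \<in> \<Union>\<C>" using gd good_trans by blast
      qed
    next
      fix M N assume "ge M N" then show "(M, N) \<in> \<Union>\<C>" using gd ne by (auto simp: good_def)
    next
      fix M N K assume "(M, N) \<in> \<Union>\<C>" "K \<in> Cr"
      then show "(M + K, N + K) \<in> \<Union>\<C>" using gd by (fastforce simp: good_def)
    next
      fix i j assume "(replicate_mset i g, replicate_mset j g) \<in> \<Union>\<C>"
      then show "j \<le> i" using gd by (auto simp: good_def)
    qed
    then show "\<Union>\<C> \<in> ?A" using gd ne by blast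
  qed
  then obtain R where R: "R \<in> ?A" and mx: "\<forall>X\<in>?A. R \<subseteq> X \<longrightarrow> X = R" by (rule bexE)
  have "R' = R" if "good R'" "R \<subseteq> R'" for R'
    using mx[rule_format, of R'] R that by (auto dest: order_trans)
  then show ?thesis using R by (intro exI[of _ R]) simp
qed

lemma good_from_g: "good R \<Longrightarrow> M \<in> Cr \<Longrightarrow> \<exists>b. (replicate_mset b g, M) \<in> R"
  using ge_from_g[of M] by (auto simp: good_def)

text \<open>By maximality an undecided pair can be added in neither direction without creating GHZ
  states. The two failures, taken with suitable multiplicities, contain the same copies of
  \<open>s\<close> and \<open>t\<close> on both sides; these form a catalyst \<open>X\<close> with
  which \<open>p\<close> GHZ states become \<open>q > p\<close>. Repetition pays for
  \<open>X\<close> and contradicts nondegeneracy.\<close>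

lemma maximal_total:
  assumes R: "good R" and mx: "\<And>R'. good R' \<Longrightarrow> R \<subseteq> R' \<Longrightarrow> R' = R"
    and st: "s \<in> Cr" "t \<in> Cr"
  shows "(s, t) \<in> R \<or> (t, s) \<in> R"
proof (rule ccontr)
  assume no: "\<not> ?thesis"
  have ex: "\<exists>n i j. n > 0 \<and> i < j \<and> (replicate_mset i g + repeat_mset n t, replicate_mset j g + repeat_mset n s) \<in> R"
    if "(s, t) \<notin> R" "s \<in> Cr" "t \<in> Cr" for s t
  proof (rule ccontr)
    assume a: "\<nexists>n i j. n > 0 \<and> i < j \<and> (replicate_mset i g + repeat_mset n t, replicate_mset j g + repeat_mset n s) \<in> R"
    have nd: "j \<le> i" if r: "(replicate_mset i g + repeat_mset n t, replicate_mset j g + repeat_mset n s) \<in> R" for n i j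
    proof (cases "n = 0")
      case True then show ?thesis using r R by (auto simp: good_def)
    next
      case False then show ?thesis using r a by (meson not_gr_zero not_le)
    qed
    have "good (extend R s t)" "R \<subseteq> extend R s t" "(s, t) \<in> extend R s t"
      by (rule good_extend[OF R that(2,3)]; erule nd)+
    then show False using mx that(1) by blast
  qed
  obtain n i j where 1: "n > 0" "i < j" "(replicate_mset i g + repeat_mset n t, replicate_mset j g + repeat_mset n s) \<in> R"
    using ex[of s t] no st by blast
  obtain n' i' j' where 2: "n' > 0" "i' < j'" "(replicate_mset i' g + repeat_mset n' s, replicate_mset j' g + repeat_mset n' t) \<in> R"
    using ex[of t s] no st by blast
  \<comment> \<open>Multiplying the first failure by \<open>n'\<close> and the second by
    \<open>n\<close> makes \<open>s\<close> and \<open>t\<close> both occur \<open>n * n'\<close>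
    times on each side.\<close>
  define X where "X = repeat_mset (n * n') (s + t)"
  define p where "p = n' * i + n * i'"
  define q where "q = n' * j + n * j'"
  have pq: "p < q" unfolding p_def q_def using 1 2 by (intro add_strict_mono) auto
  have X: "X \<in> Cr" using st by (simp add: X_def)
  have "(repeat_mset n' (replicate_mset i g + repeat_mset n t) + repeat_mset n (replicate_mset i' g + repeat_mset n' s),
        repeat_mset n' (replicate_mset j g + repeat_mset n s) + repeat_mset n (replicate_mset j' g + repeat_mset n' t)) \<in> R"
    by (intro good_add[OF R] good_multiple[OF R] 1(3) 2(3))
  then have pX: "(replicate_mset p g + X, replicate_mset q g + X) \<in> R"
    unfolding X_def p_def q_def
    by (simp add: ac_simps replicate_mset_plus)
  obtain b where b: "(replicate_mset b g, X) \<in> R" using good_from_g R X by blast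
  \<comment> \<open>Each round gains at least one GHZ state, so \<open>b + 1\<close> rounds exceed
    the price \<open>b\<close> of the catalyst.\<close>
  let ?m = "b + 1"
  have "(repeat_mset ?m (replicate_mset p g) + X, repeat_mset ?m (replicate_mset q g) + X) \<in> R"
  proof (rule iterate_cancel[where R = "\<lambda>a b. (a, b) \<in> R"])
    show "(a, d) \<in> R" if "(a, b) \<in> R" "(b, d) \<in> R" for a b d using R that by (rule good_trans)
    show "(a + d, b + d) \<in> R" if "(a, b) \<in> R" "d \<in> Cr" for a b d using R that by (simp add: good_def)
    show "(a, a) \<in> R" if "a \<in> Cr" for a using R that ge_refl by (simp add: good_def)
  qed (use pX X in auto)
  moreover have "(replicate_mset b g + repeat_mset ?m (replicate_mset p g), X + repeat_mset ?m (replicate_mset p g)) \<in> R"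
    using b R by (auto simp: good_def simp del: repeat_mset_Suc)
  moreover have "(repeat_mset ?m (replicate_mset q g) + X, repeat_mset ?m (replicate_mset q g)) \<in> R"
    using R X ge_subset[of "repeat_mset ?m (replicate_mset q g) + X" "repeat_mset ?m (replicate_mset q g)"]
    by (auto simp: good_def simp del: repeat_mset_Suc)
  ultimately have "(replicate_mset b g + repeat_mset ?m (replicate_mset p g), repeat_mset ?m (replicate_mset q g)) \<in> R"
    using good_trans[OF R] by (metis add.commute)
  then have "(replicate_mset (b + ?m * p) g, replicate_mset (?m * q) g) \<in> R"
    by (simp only: replicate_mset_plus repeat_replicate_mset)
  then have "?m * q \<le> b + ?m * p" using R by (auto simp: good_def)
  moreover have "?m * q \<ge> ?m * p + ?m" using mult_le_mono2[of "p + 1" q ?m] pq by simp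
  ultimately show False by linarith
qed

section \<open>The real-valued functional of a total preorder\<close>

definition val :: "('a multiset \<times> 'a multiset) set \<Rightarrow> 'a multiset \<Rightarrow> real" where
  "val R M = Sup {real u / real n | u n. n > 0 \<and> (repeat_mset n M, replicate_mset u g) \<in> R}"

text \<open>Superadditivity of the yield rate \<open>val R\<close> follows from additivity of
  \<open>R\<close> alone. Subadditivity needs totality: any number of copies of \<open>M\<close>
  lies between \<open>u\<close> and \<open>u + 1\<close> GHZ states for some \<open>u\<close>, so
  that yield and cost differ by at most one GHZ state in total.\<close>

lemma total_val:
  assumes R: "good R" and tot: "\<And>s t. s \<in> Cr \<Longrightarrow> t \<in> Cr \<Longrightarrow> (s, t) \<in> R \<or> (t, s) \<in> R"
  shows val_mono: "(M, N) \<in> R \<Longrightarrow> val R N \<le> val R M"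
    and val_add: "M \<in> Cr \<Longrightarrow> N \<in> Cr \<Longrightarrow> val R (M + N) = val R M + val R N"
    and val_g: "val R {#g#} = 1"
proof -
  let ?A = "\<lambda>M. {real u / real n | u n. n > 0 \<and> (repeat_mset n M, replicate_mset u g) \<in> R}"
  have nd: "j \<le> i" if "(replicate_mset i g, replicate_mset j g) \<in> R" for i j
    using R that by (auto simp: good_def)
  have bd: "bdd_above (?A M)" if M: "M \<in> Cr" for M
  proof -
    obtain b where b: "(replicate_mset b g, M) \<in> R" using good_from_g R M by blast
    have "x \<le> real b" if x: "x \<in> ?A M" for x
    proof -
      obtain u n where un: "x = real u / real n" "n > 0" "(repeat_mset n M, replicate_mset u g) \<in> R" using x by blast
      have "(replicate_mset (n * b) g, replicate_mset u g) \<in> R"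
        using good_trans[OF R good_multiple[OF R b, of n] un(3)]
        by simp
      then have "u \<le> n * b" by (rule nd)
      then have "real u \<le> real n * real b" by (metis of_nat_le_iff of_nat_mult)
      then show ?thesis using un by (simp add: divide_le_eq mult.commute)
    qed
    then show ?thesis by (auto simp: bdd_above_def)
  qed
  have ne: "?A M \<noteq> {}" if "M \<in> Cr" for M
  proof -
    have "(repeat_mset 1 M, replicate_mset 0 g) \<in> R" using R that ge_subset[of M "{#}"] by (auto simp: good_def)
    then have "real 0 / real 1 \<in> ?A M" using lessI[of 0] unfolding One_nat_def by blast
    then show ?thesis by blast
  qed
  have up: "real u / real n \<le> val R M" if "M \<in> Cr" "n > 0" "(repeat_mset n M, replicate_mset u g) \<in> R" for M n u
    unfolding val_def using that bd[OF that(1)] by (intro cSup_upper) auto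
  have approx: "\<exists>x\<in>?A M. val R M - e < x" if "M \<in> Cr" "e > 0" for M e
  proof -
    have "val R M - e < val R M" using that by simp
    then have "val R M - e < Sup (?A M)" unfolding val_def .
    then show ?thesis using less_cSup_iff[OF ne[OF that(1)] bd[OF that(1)]] by blast
  qed
  show mono: "val R N \<le> val R M" if MN: "(M, N) \<in> R" for M N
  proof -
    have C: "M \<in> Cr" "N \<in> Cr" using MN R by (auto simp: good_def)
    show ?thesis unfolding val_def[of R N]
    proof (rule cSup_least)
      show "?A N \<noteq> {}" using ne C by blast
      fix x assume "x \<in> ?A N"
      then obtain u n where un: "x = real u / real n" "n > 0" "(repeat_mset n N, replicate_mset u g) \<in> R" by blast
      have "(repeat_mset n M, replicate_mset u g) \<in> R" using good_trans[OF R good_multiple[OF R MN]] un by blast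
      then show "x \<le> val R M" using up C un by blast
    qed
  qed
  have near: "\<exists>u. (repeat_mset n M, replicate_mset u g) \<in> R \<and> (replicate_mset (u + 1) g, repeat_mset n M) \<in> R"
    if M: "M \<in> Cr" for M n
  proof -
    let ?P = "\<lambda>u. (repeat_mset n M, replicate_mset u g) \<in> R"
    have P0: "?P 0" using R M ge_subset[of "repeat_mset n M" "{#}"] by (auto simp: good_def)
    obtain b where b: "(replicate_mset b g, repeat_mset n M) \<in> R" using good_from_g R M by (metis Cr_repeat)
    have bnd: "u \<le> b" if "?P u" for u using nd good_trans[OF R b that] by blast
    define u where "u = (GREATEST u. ?P u)"
    have "?P u" unfolding u_def using GreatestI_nat[of ?P 0 b] P0 bnd by blast
    moreover have "\<not> ?P (u + 1)" using Greatest_le_nat[of ?P "u + 1" b] bnd unfolding u_def by auto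
    ultimately show ?thesis using tot[of "repeat_mset n M" "replicate_mset (u + 1) g"] M Cr_g Cr_repeat by blast
  qed
  show "val R (M + N) = val R M + val R N" if M: "M \<in> Cr" and N: "N \<in> Cr"
  proof (rule antisym)
    show "val R (M + N) \<le> val R M + val R N"
      unfolding val_def[of R "M + N"]
    proof (rule cSup_least)
      show "?A (M + N) \<noteq> {}" using ne[of "M + N"] M N Cr_add by blast
      fix x assume "x \<in> ?A (M + N)"
      then obtain u n where un: "x = real u / real n" "n > 0" "(repeat_mset n (M + N), replicate_mset u g) \<in> R" by blast
      show "x \<le> val R M + val R N"
      proof (rule field_le_epsilon)
        fix e :: real assume e: "e > 0"
        \<comment> \<open>The two roundings cost 2 GHZ states for \<open>K * n\<close> copies, which
          is at most \<open>2 / K\<close> after division by \<open>K * n\<close>.\<close>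
        obtain K :: nat where K: "real K \<ge> 2 / e + 1" using real_arch_simple by blast
        have Kpos: "real K > 0" using K e by (smt (verit) divide_pos_pos)
        have Ke: "2 / real K \<le> e"
        proof -
          have "2 / e \<le> real K" using K by linarith
          then show ?thesis using Kpos e by (simp add: field_simps)
        qed
        obtain a where a: "(repeat_mset (K * n) M, replicate_mset a g) \<in> R" "(replicate_mset (a + 1) g, repeat_mset (K * n) M) \<in> R"
          using near M by blast
        obtain b where b: "(repeat_mset (K * n) N, replicate_mset b g) \<in> R" "(replicate_mset (b + 1) g, repeat_mset (K * n) N) \<in> R"
          using near N by blast
        have "(replicate_mset (a + 1) g + replicate_mset (b + 1) g, repeat_mset (K * n) M + repeat_mset (K * n) N) \<in> R"
          by (rule good_add[OF R a(2) b(2)])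
        moreover have "(repeat_mset (K * n) M + repeat_mset (K * n) N, replicate_mset (K * u) g) \<in> R"
          using good_multiple[OF R un(3), of K] by simp
        ultimately have "(replicate_mset ((a + 1) + (b + 1)) g, replicate_mset (K * u) g) \<in> R"
          unfolding replicate_mset_plus[of "a + 1" "b + 1"] by (rule good_trans[OF R])
        then have "K * u \<le> (a + 1) + (b + 1)" by (rule nd)
        then have "real K * real u \<le> real a + real b + 2" using of_nat_mono[of "K * u" "(a + 1) + (b + 1)", where 'a = real] by simp
        then have "real u / real n \<le> (real a + real b + 2) / (real K * real n)"
          using Kpos un(2) by (simp add: field_simps)
        also have "\<dots> = real a / real (K * n) + real b / real (K * n) + 2 / (real K * real n)"
          by (simp add: add_divide_distrib)
        also have "\<dots> \<le> val R M + val R N + 2 / real K"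
        proof (intro add_mono)
          have "K * n > 0" using Kpos un(2) by simp
          then show "real a / real (K * n) \<le> val R M" "real b / real (K * n) \<le> val R N"
            using up M N a(1) b(1) by blast+
          have "real K * 1 \<le> real K * real n" using un(2) by (intro mult_left_mono) auto
          then show "2 / (real K * real n) \<le> 2 / real K" using Kpos by (intro divide_left_mono) auto
        qed
        finally show "x \<le> val R M + val R N + e" using un Ke by linarith
      qed
    qed
    show "val R M + val R N \<le> val R (M + N)"
    proof (rule field_le_epsilon)
      fix e :: real assume e: "e > 0"
      obtain x where x: "x \<in> ?A M" "x > val R M - e / 2"
        using approx[OF M, of "e / 2"] e by (meson half_gt_zero)
      obtain y where y: "y \<in> ?A N" "y > val R N - e / 2"
        using approx[OF N, of "e / 2"] e by (meson half_gt_zero)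
      obtain u n where un: "x = real u / real n" "n > 0" "(repeat_mset n M, replicate_mset u g) \<in> R" using x(1) by blast
      obtain v m where vm: "y = real v / real m" "m > 0" "(repeat_mset m N, replicate_mset v g) \<in> R" using y(1) by blast
      have "(repeat_mset m (repeat_mset n M) + repeat_mset n (repeat_mset m N),
          repeat_mset m (replicate_mset u g) + repeat_mset n (replicate_mset v g)) \<in> R"
        by (intro good_add[OF R] good_multiple[OF R] un vm)
      then have "(repeat_mset (m * n) (M + N), replicate_mset (m * u + n * v) g) \<in> R"
        by (simp add: mult.commute replicate_mset_plus)
      then have "real (m * u + n * v) / real (m * n) \<le> val R (M + N)"
        by (intro up) (use M N un(2) vm(2) in simp_all)
      moreover have "real (m * u + n * v) / real (m * n) = x + y"
        using un vm by (simp add: field_simps)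
      ultimately show "val R M + val R N \<le> val R (M + N) + e" using x y by linarith
    qed
  qed
  show "val R {#g#} = 1"
  proof (rule antisym)
    have gC: "{#g#} \<in> Cr" using Cr_g[of 1] by simp
    show "val R {#g#} \<le> 1"
      unfolding val_def
    proof (rule cSup_least)
      show "?A {#g#} \<noteq> {}" using ne gC by blast
      fix x assume "x \<in> ?A {#g#}"
      then obtain u n where un: "x = real u / real n" "n > 0" "(repeat_mset n {#g#}, replicate_mset u g) \<in> R" by blast
      then have "u \<le> n" using nd by simp
      then show "x \<le> 1" using un by simp
    qed
    have "(repeat_mset 1 {#g#}, replicate_mset 1 g) \<in> R" using R ge_refl[OF gC] by (simp add: good_def)
    then show "1 \<le> val R {#g#}" using up[OF gC, of 1 1] by simp
  qed
qed

theorem separating_functional: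
  assumes AB: "A \<in> Cr" "B \<in> Cr" and n: "\<not> ge A B"
  shows "\<exists>E. (\<forall>M\<in>Cr. \<forall>N\<in>Cr. E (M + N) = E M + E N) \<and> E {#g#} = (1::real) \<and>
    (\<forall>M N. ge M N \<longrightarrow> E N \<le> E M) \<and> E A < E B"
proof -
  \<comment> \<open>One GHZ state is kept in reserve: the extension will place \<open>c\<close>
    copies of \<open>B\<close> above \<open>c\<close> copies of \<open>A\<close> together with one
    GHZ state, and this extra state makes the final inequality strict.\<close>
  obtain c where c: "\<not> ge (repeat_mset c A + {#g#}) (repeat_mset c B)"
    using ge_limit[OF AB, of 1] n by auto
  define s where "s = repeat_mset c B"
  define t where "t = repeat_mset c A + {#g#}"
  have gC: "{#g#} \<in> Cr" using Cr_g[of 1] by simp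
  have st: "s \<in> Cr" "t \<in> Cr" using AB gC by (auto simp: s_def t_def g_in)
  let ?G = "{(M, N). ge M N}"
  have G: "good ?G"
    unfolding good_def
  proof (intro conjI allI impI; (elim conjE)?)
    show "?G \<subseteq> Cr \<times> Cr" by (auto simp: ge_def)
    show "trans ?G" by (auto intro!: transI dest: ge_trans)
  qed (auto intro: ge_nondeg ge_add ge_refl)
  \<comment> \<open>If the extension created GHZ states, then discarding the surplus, cancelling
    \<open>i\<close> GHZ states and taking an \<open>n\<close>-th root would give
    \<open>ge t s\<close>, against the choice of \<open>c\<close>.\<close>
  have nd: "j \<le> i" if r: "(replicate_mset i g + repeat_mset n t, replicate_mset j g + repeat_mset n s) \<in> ?G" for n i j
  proof (rule ccontr)
    assume "\<not> j \<le> i"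
    then have ij: "i < j" by simp
    have n0: "n > 0"
    proof (rule ccontr)
      assume "\<not> n > 0"
      then have "ge (replicate_mset i g) (replicate_mset j g)" using r by simp
      then show False using ge_nondeg ij by fastforce
    qed
    have "ge (replicate_mset i g + repeat_mset n t) (replicate_mset j g + repeat_mset n s)" using r by simp
    moreover have "ge (replicate_mset j g + repeat_mset n s) (replicate_mset i g + repeat_mset n s)"
      using ij st by (intro ge_subset) (auto intro: replicate_mset_subset)
    ultimately have "ge (repeat_mset n t + replicate_mset i g) (repeat_mset n s + replicate_mset i g)"
      using ge_trans by (metis add.commute)
    then have "ge (repeat_mset n t) (repeat_mset n s)" using ge_cancel[of "repeat_mset n t" "repeat_mset n s" "replicate_mset i g"] st by simp
    then have "ge t s" using ge_root st n0 by blast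
    then show False using c by (simp add: s_def t_def)
  qed
  obtain R where R: "good R" "extend ?G s t \<subseteq> R" "\<And>R'. good R' \<Longrightarrow> R \<subseteq> R' \<Longrightarrow> R' = R"
  proof -
    have "good (extend ?G s t)" by (rule good_extend(1)[OF G st], erule nd)
    from good_maximal[OF this] show ?thesis using that by (elim exE conjE) simp
  qed
  have tot: "(x, y) \<in> R \<or> (y, x) \<in> R" if "x \<in> Cr" "y \<in> Cr" for x y
    using maximal_total[OF R(1) R(3) that] by blast
  have add: "val R (M + N) = val R M + val R N" if "M \<in> Cr" "N \<in> Cr" for M N
    using val_add[OF R(1) tot that] by blast
  have v0: "val R {#} = 0" using add[of "{#}" "{#}"] by simp
  have mult: "val R (repeat_mset n M) = real n * val R M" if "M \<in> Cr" for n M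
    using that by (induction n) (auto simp: add v0 algebra_simps)
  have "(s, t) \<in> extend ?G s t" by (rule good_extend(3)[OF G st], erule nd)
  then have "(s, t) \<in> R" using R(2) by (rule rev_subsetD)
  then have "val R t \<le> val R s" using val_mono[OF R(1) tot] by blast
  then have "real c * val R A + 1 \<le> real c * val R B"
    unfolding s_def t_def using add[of "repeat_mset c A" "{#g#}"] mult AB gC val_g[OF R(1) tot] by simp
  then have "val R A < val R B" by (smt (verit) mult_left_mono of_nat_0_le_iff)
  moreover have "val R N \<le> val R M" if "ge M N" for M N
    using val_mono[OF R(1) tot] R(1) that by (auto simp: good_def)
  ultimately show ?thesis using add val_g[OF R(1) tot] by (intro exI[of _ "val R"]) simp
qed

end

section \<open>Payoffs of LOCC protocols\<close>

text \<open>Amplitudes are indexed by lists of local labels, so that a local operation is a list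
  update and products are formed party by party; the mixed-radix numbering of basis vectors is then
  largely avoided.\<close>

type_synonym amp = "nat list \<Rightarrow> complex"

definition ibox :: "nat list \<Rightarrow> nat list set" where
  "ibox d = {xs. length xs = length d \<and> (\<forall>i<length d. xs ! i < d ! i)}"

lemma box_Nil [simp]: "ibox [] = {[]}" by (auto simp: ibox_def)

lemma Cons_in_box [simp]: "x # xs \<in> ibox (a # d) \<longleftrightarrow> x < a \<and> xs \<in> ibox d"
  by (auto simp: ibox_def less_Suc_eq_0_disj)

lemma box_Cons: "ibox (a # d) = (\<lambda>(x, xs). x # xs) ` ({..<a} \<times> ibox d)"
proof (intro Set.set_eqI iffI)
  fix ys assume ys: "ys \<in> ibox (a # d)"
  then obtain x xs where "ys = x # xs" by (cases ys) (auto simp: ibox_def)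
  then show "ys \<in> (\<lambda>(x, xs). x # xs) ` ({..<a} \<times> ibox d)" using ys by auto
qed auto

lemma finite_box [simp]: "finite (ibox d)"
  by (induction d) (auto simp: box_Cons)

lemma length_box: "xs \<in> ibox d \<Longrightarrow> length xs = length d" by (simp add: ibox_def)

lemma nth_box: "xs \<in> ibox d \<Longrightarrow> i < length d \<Longrightarrow> xs ! i < d ! i" by (simp add: ibox_def)

lemma sum_box_Cons: "sum f (ibox (a # d)) = (\<Sum>x<a. \<Sum>xs\<in>ibox d. f (x # xs))"
  unfolding box_Cons
  by (subst sum.reindex) (auto simp: inj_on_def sum.cartesian_product case_prod_unfold)

lemma sum_box_split:
  "j < length d \<Longrightarrow> sum f (ibox d) = (\<Sum>xs\<in>ibox (d[j := 1]). \<Sum>z<d ! j. f (xs[j := z]))"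
proof (induction d arbitrary: j f)
  case (Cons a d)
  show ?case
  proof (cases j)
    case 0
    then show ?thesis by (simp add: sum_box_Cons sum.swap[of _ "{..<a}"])
  next
    case (Suc i)
    then show ?thesis using Cons by (simp add: sum_box_Cons)
  qed
qed simp

lemma box_update: "xs \<in> ibox (d[j := e']) \<Longrightarrow> z < e \<Longrightarrow> xs[j := z] \<in> ibox (d[j := e])"
proof -
  assume xs: "xs \<in> ibox (d[j := e'])" and z: "z < e"
  have "xs[j := z] ! i < d[j := e] ! i" if "i < length d" for i
    using xs z that by (cases "i = j") (auto simp: ibox_def dest!: spec[of _ i])
  then show ?thesis using xs by (simp add: ibox_def)
qed

lemma box_update': "xs \<in> ibox d \<Longrightarrow> z < e \<Longrightarrow> xs[j := z] \<in> ibox (d[j := e])"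
  using box_update[of xs d j "d ! j" z e] by simp

text \<open>With the values fixed to 0 outside the index box, equal vectors are equal
  functions.\<close>

definition supp :: "nat list \<Rightarrow> amp \<Rightarrow> bool" where
  "supp d a \<longleftrightarrow> (\<forall>xs. xs \<notin> ibox d \<longrightarrow> a xs = 0)"

lemma supp_ext: "supp d a \<Longrightarrow> supp d b \<Longrightarrow> (\<And>xs. xs \<in> ibox d \<Longrightarrow> a xs = b xs) \<Longrightarrow> a = b"
  unfolding supp_def by (intro ext) metis

definition ip :: "nat list \<Rightarrow> amp \<Rightarrow> amp \<Rightarrow> complex" where
  "ip d a b = (\<Sum>x\<in>ibox d. cnj (a x) * b x)"

definition nrm :: "nat list \<Rightarrow> amp \<Rightarrow> real" where
  "nrm d a = (\<Sum>x\<in>ibox d. (cmod (a x))\<^sup>2)"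

definition lact :: "nat list \<Rightarrow> nat \<Rightarrow> complex mat \<Rightarrow> amp \<Rightarrow> amp" where
  "lact d j L a = (\<lambda>zs. if zs \<in> ibox (d[j := dim_row L]) then \<Sum>y<d ! j. L $$ (zs ! j, y) * a (zs[j := y]) else 0)"

definition instrument :: "nat \<Rightarrow> nat \<Rightarrow> (nat \<Rightarrow> complex mat) \<Rightarrow> bool" where
  "instrument D m L \<longleftrightarrow> (\<forall>i<m. 0 < dim_row (L i) \<and> dim_col (L i) = D) \<and>
     (\<forall>y<D. \<forall>y'<D. (\<Sum>i<m. \<Sum>z<dim_row (L i). cnj (L i $$ (z, y)) * L i $$ (z, y')) = (if y = y' then 1 else 0))"

lemma supp_lact: "supp (d[j := dim_row L]) (lact d j L a)" by (simp add: supp_def lact_def)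

lemma nrm_nonneg: "0 \<le> nrm d a" by (simp add: nrm_def sum_nonneg)

text \<open>The columns of \<open>M\<close> are orthonormal, so \<open>M\<close> preserves norms.
  The row index set is arbitrary in order to stack all Kraus operators of an instrument into a
  single isometry.\<close>

lemma isometry_sum:
  fixes M :: "'i \<Rightarrow> nat \<Rightarrow> complex"
  assumes c: "\<And>y y'. y < D \<Longrightarrow> y' < D \<Longrightarrow> (\<Sum>i\<in>I. cnj (M i y) * M i y') = (if y = y' then 1 else 0)"
  shows "(\<Sum>i\<in>I. (cmod (\<Sum>y<D. M i y * \<alpha> y))\<^sup>2) = (\<Sum>y<D. (cmod (\<alpha> y))\<^sup>2)"
proof -
  have "complex_of_real (\<Sum>i\<in>I. (cmod (\<Sum>y<D. M i y * \<alpha> y))\<^sup>2)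
      = (\<Sum>i\<in>I. (\<Sum>y<D. cnj (M i y * \<alpha> y)) * (\<Sum>y<D. M i y * \<alpha> y))"
    unfolding of_real_sum complex_norm_square
    by (intro sum.cong refl) (simp add: mult.commute)
  also have "\<dots> = (\<Sum>i\<in>I. \<Sum>y<D. \<Sum>y'<D. cnj (\<alpha> y) * \<alpha> y' * (cnj (M i y) * M i y'))"
    unfolding sum_product by (intro sum.cong refl) simp
  also have "\<dots> = (\<Sum>y<D. \<Sum>i\<in>I. \<Sum>y'<D. cnj (\<alpha> y) * \<alpha> y' * (cnj (M i y) * M i y'))"
    by (rule sum.swap)
  also have "\<dots> = (\<Sum>y<D. \<Sum>y'<D. \<Sum>i\<in>I. cnj (\<alpha> y) * \<alpha> y' * (cnj (M i y) * M i y'))"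
    by (intro sum.cong refl sum.swap)
  also have "\<dots> = (\<Sum>y<D. \<Sum>y'<D. if y = y' then cnj (\<alpha> y) * \<alpha> y' else 0)"
    by (intro sum.cong refl) (simp add: sum_distrib_left[symmetric] c)
  also have "\<dots> = (\<Sum>y<D. cnj (\<alpha> y) * \<alpha> y)" by simp
  also have "\<dots> = complex_of_real (\<Sum>y<D. (cmod (\<alpha> y))\<^sup>2)"
    unfolding of_real_sum complex_norm_square by (simp add: mult.commute)
  finally show ?thesis using of_real_eq_iff by blast
qed

lemma nrm_lact_sum:
  assumes j: "j < length d" and L: "instrument (d ! j) m L"
  shows "(\<Sum>i<m. nrm (d[j := dim_row (L i)]) (lact d j (L i) a)) = nrm d a"
proof -
  have "nrm (d[j := dim_row (L i)]) (lact d j (L i) a) =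
      (\<Sum>xs\<in>ibox (d[j := 1]). \<Sum>z<dim_row (L i). (cmod (\<Sum>y<d ! j. L i $$ (z, y) * a (xs[j := y])))\<^sup>2)" for i
    unfolding nrm_def lact_def
    using j by (subst sum_box_split[of j]) (auto intro!: sum.cong simp: box_update length_box)
  then have "(\<Sum>i<m. nrm (d[j := dim_row (L i)]) (lact d j (L i) a)) =
     (\<Sum>xs\<in>ibox (d[j := 1]). \<Sum>i<m. \<Sum>z<dim_row (L i). (cmod (\<Sum>y<d ! j. L i $$ (z, y) * a (xs[j := y])))\<^sup>2)"
    by (simp add: sum.swap[of _ "{..<m}"])
  also have "\<dots> = (\<Sum>xs\<in>ibox (d[j := 1]). \<Sum>y<d ! j. (cmod (a (xs[j := y])))\<^sup>2)"
  proof (rule sum.cong[OF refl])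
    fix xs
    show "(\<Sum>i<m. \<Sum>z<dim_row (L i). (cmod (\<Sum>y<d ! j. L i $$ (z, y) * a (xs[j := y])))\<^sup>2)
       = (\<Sum>y<d ! j. (cmod (a (xs[j := y])))\<^sup>2)" (is "?lhs = ?rhs")
    proof -
      let ?I = "Sigma {..<m} (\<lambda>i. {..<dim_row (L i)})"
      have S: "(\<Sum>i<m. \<Sum>z<dim_row (L i). f i z) = (\<Sum>k\<in>?I. f (fst k) (snd k))" for f :: "nat \<Rightarrow> nat \<Rightarrow> 'b::comm_monoid_add"
        by (subst sum.Sigma) (auto simp: case_prod_unfold)
      show "?lhs = ?rhs"
        unfolding S
        by (rule isometry_sum) (use L in \<open>simp add: instrument_def S\<close>)
    qed
  qed
  also have "\<dots> = nrm d a" unfolding nrm_def using j by (rule sum_box_split[symmetric])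
  finally show ?thesis .
qed

text \<open>\<open>pay H d a p\<close>: starting from the vector \<open>a\<close>, some finite-round LOCC protocol ends, in each
  branch, at an unnormalised vector \<open>v\<close> with local dimensions \<open>d'\<close> and a payoff \<open>q\<close> such that
  \<open>H d' v q\<close>, and these payoffs sum up to at least \<open>p\<close>. Since the norm of \<open>v\<close> carries the
  probability of the branch, sums of payoffs are averages.\<close>

inductive pay :: "(nat list \<Rightarrow> amp \<Rightarrow> real \<Rightarrow> bool) \<Rightarrow> nat list \<Rightarrow> amp \<Rightarrow> real \<Rightarrow> bool" for H where
  leaf: "H d a p \<Longrightarrow> pay H d a p"
| round: "\<lbrakk>j < length d; instrument (d ! j) m L;
     \<forall>i<m. pay H (d[j := dim_row (L i)]) (lact d j (L i) a) (q i); p \<le> (\<Sum>i<m. q i)\<rbrakk> \<Longrightarrow> pay H d a p"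

text \<open>A further protocol is grafted onto every leaf.\<close>

lemma pay_bind:
  assumes "pay H d a p" "\<And>d' v q. H d' v q \<Longrightarrow> pay H' d' v q"
  shows "pay H' d a p"
  using assms by (induction rule: pay.induct) (auto intro: pay.intros)

lemma pay_antimono:
  assumes "pay H d a p" "q \<le> p" "\<And>d' v q q'. H d' v q \<Longrightarrow> q' \<le> q \<Longrightarrow> H d' v q'"
  shows "pay H d a q"
  using assms(1)
proof cases
  case leaf then show ?thesis using assms by (auto intro: pay.leaf)
next
  case (round j m L q')
  then show ?thesis using assms(2) by (intro pay.round[where q = q']) auto
qed

section \<open>Rounds of monomial measurements\<close>

definition pm :: "(nat \<Rightarrow> nat \<Rightarrow> nat) \<Rightarrow> nat list \<Rightarrow> nat list" where
  "pm \<pi> xs = map (\<lambda>j. \<pi> j (xs ! j)) [0..<length xs]"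

lemma length_pm [simp]: "length (pm \<pi> xs) = length xs" by (simp add: pm_def)

lemma nth_pm [simp]: "j < length xs \<Longrightarrow> pm \<pi> xs ! j = \<pi> j (xs ! j)" by (simp add: pm_def)

text \<open>The tensor product of the local maps that send \<open>|x>\<close> to
  \<open>c j x\<close> times \<open>|\<pi> j x>\<close>. The maps \<open>\<pi> j\<close> need not be
  injective, so amplitudes may add up.\<close>

definition mact :: "nat list \<Rightarrow> nat list \<Rightarrow> (nat \<Rightarrow> nat \<Rightarrow> nat) \<Rightarrow> (nat \<Rightarrow> nat \<Rightarrow> complex) \<Rightarrow> amp \<Rightarrow> amp" where
  "mact d e \<pi> c a = (\<lambda>zs. if zs \<in> ibox e then \<Sum>xs\<in>ibox d. if pm \<pi> xs = zs then (\<Prod>j<length d. c j (xs ! j)) * a xs else 0 else 0)"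

lemma supp_mact: "supp e (mact d e \<pi> c a)" by (simp add: supp_def mact_def)

lemma mact_id: "supp d a \<Longrightarrow> mact d d (\<lambda>j x. x) (\<lambda>j x. 1) a = a"
proof (rule supp_ext[of d])
  fix xs assume xs: "xs \<in> ibox d"
  have "pm (\<lambda>j x. x) ys = ys" for ys by (simp add: pm_def map_nth)
  then show "mact d d (\<lambda>j x. x) (\<lambda>j x. 1) a xs = a xs"
    using xs by (simp add: mact_def)
qed (auto simp: supp_mact)

text \<open>The induction step of \<open>pay_monomial\<close>: in stage \<open>i\<close> the parties
  below \<open>i\<close> have already acted, which is what \<open>D\<close>, \<open>P\<close> and
  \<open>c\<close> encode, and \<open>t\<close> is the outcome of party \<open>l\<close>.\<close>

lemma mact_step:
  fixes lam :: "nat \<Rightarrow> nat \<Rightarrow> nat \<Rightarrow> complex"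
  assumes l: "l < length d" and e: "length e = length d" and y: "length y = length d"
    and pi: "\<And>x. x < d ! l \<Longrightarrow> \<pi> l x < e ! l"
  defines "D \<equiv> \<lambda>i. take i e @ drop i d"
    and "P \<equiv> \<lambda>i j. if j < i then \<pi> j else (\<lambda>x. x)"
    and "c \<equiv> \<lambda>y i j. if j < i then lam j (y ! j) else (\<lambda>x. 1::complex)"
  shows "lact (D l) l (mat (e ! l) (d ! l) (\<lambda>(z, x). if z = \<pi> l x then lam l t x else 0)) (mact d (D l) (P l) (c y l) a)
    = mact d (D (Suc l)) (P (Suc l)) (c (y[l := t]) (Suc l)) a"
    (is "lact _ _ ?L ?a = ?b")
proof -
  have Dl: "(D l)[l := e ! l] = D (Suc l)"
    unfolding D_def using l e by (intro nth_equalityI) (auto simp: nth_append nth_list_update less_Suc_eq)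
  have Dnth: "D l ! l = d ! l" using l e by (simp add: D_def nth_append)
  have lenD: "length (D i) = length d" for i using e by (simp add: D_def)
  show ?thesis
  proof (rule supp_ext[of "D (Suc l)"])
    show "supp (D (Suc l)) (lact (D l) l ?L ?a)" using supp_lact[of "D l" l ?L] by (simp add: Dl)
    show "supp (D (Suc l)) ?b" by (rule supp_mact)
  next
    fix zs assume zs: "zs \<in> ibox (D (Suc l))"
    have lz: "length zs = length d" using zs by (simp add: length_box lenD)
    have zl: "zs ! l < e ! l" using nth_box[OF zs, of l] l e lenD by (simp add: D_def nth_append)
    have up: "zs[l := x] \<in> ibox (D l)" if "x < d ! l" for x
      using box_update'[OF zs that, of l] l e
      by (simp add: Dl[symmetric]) (metis Dnth list_update_id)
    have "lact (D l) l ?L ?a zs = (\<Sum>x<d ! l. ?L $$ (zs ! l, x) * ?a (zs[l := x]))"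
      using zs by (simp add: lact_def Dl Dnth)
    also have "\<dots> = (\<Sum>x<d ! l. \<Sum>xs\<in>ibox d. (if zs ! l = \<pi> l x then lam l t x else 0) *
         (if pm (P l) xs = zs[l := x] then (\<Prod>j<length d. c y l j (xs ! j)) * a xs else 0))"
      using zl up by (intro sum.cong refl) (simp add: mact_def sum_distrib_left)
    also have "\<dots> = (\<Sum>xs\<in>ibox d. \<Sum>x<d ! l. (if zs ! l = \<pi> l x then lam l t x else 0) *
         (if pm (P l) xs = zs[l := x] then (\<Prod>j<length d. c y l j (xs ! j)) * a xs else 0))"
      by (rule sum.swap)
    also have "\<dots> = (\<Sum>xs\<in>ibox d. if pm (P (Suc l)) xs = zs then (\<Prod>j<length d. c (y[l := t]) (Suc l) j (xs ! j)) * a xs else 0)"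
    proof (intro sum.cong refl)
      fix xs assume xs: "xs \<in> ibox d"
      have lx: "length xs = length d" "xs ! l < d ! l" using xs l by (auto simp: length_box nth_box)
      have eq: "pm (P l) xs = zs[l := x] \<and> zs ! l = \<pi> l x \<longleftrightarrow> x = xs ! l \<and> pm (P (Suc l)) xs = zs" for x
      proof
        assume h: "pm (P l) xs = zs[l := x] \<and> zs ! l = \<pi> l x"
        then have h1: "pm (P l) xs ! j = zs[l := x] ! j" for j by simp
        have x: "x = xs ! l" using h1[of l] l lx lz by (simp add: P_def)
        have "pm (P (Suc l)) xs ! j = zs ! j" if "j < length d" for j
          using h1[of j] h that l lx lz x by (cases "j = l") (auto simp: P_def nth_list_update split: if_splits)
        then have "pm (P (Suc l)) xs = zs" using lx lz by (intro nth_equalityI) auto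
        then show "x = xs ! l \<and> pm (P (Suc l)) xs = zs" using x by simp
      next
        assume h: "x = xs ! l \<and> pm (P (Suc l)) xs = zs"
        then have h1: "pm (P (Suc l)) xs ! j = zs ! j" for j by simp
        have "pm (P l) xs ! j = zs[l := x] ! j" if "j < length d" for j
          using h1[of j] h that l lx lz by (cases "j = l") (auto simp: P_def nth_list_update split: if_splits)
        then have "pm (P l) xs = zs[l := x]" using lx lz by (intro nth_equalityI) auto
        then show "pm (P l) xs = zs[l := x] \<and> zs ! l = \<pi> l x" using h1[of l] h l lx by (simp add: P_def)
      qed
      have "(\<Sum>x<d ! l. (if zs ! l = \<pi> l x then lam l t x else 0) *
         (if pm (P l) xs = zs[l := x] then (\<Prod>j<length d. c y l j (xs ! j)) * a xs else 0))
        = (\<Sum>x<d ! l. if x = xs ! l then (if pm (P (Suc l)) xs = zs then lam l t x * ((\<Prod>j<length d. c y l j (xs ! j)) * a xs) else 0) else 0)"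
      proof (intro sum.cong refl)
        fix x
        show "(if zs ! l = \<pi> l x then lam l t x else 0) *
         (if pm (P l) xs = zs[l := x] then (\<Prod>j<length d. c y l j (xs ! j)) * a xs else 0)
          = (if x = xs ! l then (if pm (P (Suc l)) xs = zs then lam l t x * ((\<Prod>j<length d. c y l j (xs ! j)) * a xs) else 0) else 0)"
        proof (cases "pm (P l) xs = zs[l := x] \<and> zs ! l = \<pi> l x")
          case True
          then have "x = xs ! l \<and> pm (P (Suc l)) xs = zs" using eq[of x] by blast
          then show ?thesis using True by (simp only: if_True simp_thms)
        next
          case False
          then have "\<not> (x = xs ! l \<and> pm (P (Suc l)) xs = zs)" using eq[of x] by blast
          then show ?thesis using False by (simp only: mult_zero_left mult_zero_right split: if_splits) blast
        qed
      qed
      also have "\<dots> = (if pm (P (Suc l)) xs = zs then lam l t (xs ! l) * ((\<Prod>j<length d. c y l j (xs ! j)) * a xs) else 0)"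
        using lx by simp
      also have "lam l t (xs ! l) * (\<Prod>j<length d. c y l j (xs ! j)) = (\<Prod>j<length d. c (y[l := t]) (Suc l) j (xs ! j))"
      proof -
        have "(\<Prod>j<length d. c (y[l := t]) (Suc l) j (xs ! j)) = (\<Prod>j<length d. (if j = l then lam l t (xs ! l) else 1) * c y l j (xs ! j))"
          using l y by (intro prod.cong refl) (auto simp: c_def nth_list_update less_Suc_eq)
        also have "\<dots> = lam l t (xs ! l) * (\<Prod>j<length d. c y l j (xs ! j))"
          using l by (simp add: prod.distrib)
        finally show ?thesis by simp
      qed
      then have "(if pm (P (Suc l)) xs = zs then lam l t (xs ! l) * ((\<Prod>j<length d. c y l j (xs ! j)) * a xs) else 0)
         = (if pm (P (Suc l)) xs = zs then (\<Prod>j<length d. c (y[l := t]) (Suc l) j (xs ! j)) * a xs else 0)"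
        by (simp add: mult.assoc[symmetric])
      finally show "(\<Sum>x<d ! l. (if zs ! l = \<pi> l x then lam l t x else 0) *
         (if pm (P l) xs = zs[l := x] then (\<Prod>j<length d. c y l j (xs ! j)) * a xs else 0))
        = (if pm (P (Suc l)) xs = zs then (\<Prod>j<length d. c (y[l := t]) (Suc l) j (xs ! j)) * a xs else 0)" .
    qed
    also have "\<dots> = ?b zs" using zs by (simp add: mact_def)
    finally show "lact (D l) l ?L ?a zs = ?b zs" .
  qed
qed

text \<open>All parties measure, party \<open>j\<close> with the monomial Kraus operators
  \<open>|x\<rangle> \<mapsto> \<lambda>\<^sub>j(y,x) |\<pi>\<^sub>j(x)\<rangle>\<close> for the outcomes \<open>y\<close>. Every protocol below is a composition of such rounds.\<close>

lemma pay_monomial: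
  assumes len: "length e = length d" "length m = length d" and a: "supp d a"
    and epos: "\<And>j. j < length d \<Longrightarrow> 0 < e ! j"
    and pi: "\<And>j x. j < length d \<Longrightarrow> x < d ! j \<Longrightarrow> \<pi> j x < e ! j"
    and compl: "\<And>j x x'. \<lbrakk>j < length d; x < d ! j; x' < d ! j; \<pi> j x = \<pi> j x'\<rbrakk>
        \<Longrightarrow> (\<Sum>t<m ! j. cnj (lam j t x) * lam j t x') = (if x = x' then 1 else 0)"
    and cont: "\<And>y. y \<in> ibox m \<Longrightarrow> pay H e (mact d e \<pi> (\<lambda>j. lam j (y ! j)) a) (q y)"
    and p: "p \<le> (\<Sum>y\<in>ibox m. q y)"
    and anti: "\<And>d' v q q'. H d' v q \<Longrightarrow> q' \<le> q \<Longrightarrow> H d' v q'"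
  shows "pay H d a p"
\<comment> \<open>An empty box of outcomes means \<open>m ! j = 0\<close> for some party;
  completeness then forces \<open>d ! j = 0\<close>, and there the instrument without outcomes is
  legitimate.\<close>
proof (cases "ibox m = {}")
  case True
  then obtain j where j: "j < length m" "m ! j = 0"
    using len by (auto simp: ibox_def) (metis length_replicate not_gr_zero nth_replicate)
  have "pay H d a (\<Sum>y\<in>ibox m. q y)" if "d ! j = 0"
  proof (rule pay.round[of j d 0])
    show "j < length d" using j len by simp
    show "instrument (d ! j) 0 undefined" using that by (simp add: instrument_def)
  qed (use True in auto)
  moreover have "d ! j = 0" using compl[of j 0 0] j len by (cases "d ! j") auto
  ultimately show ?thesis using p by (auto intro: pay_antimono anti)
next
  case False
  then obtain y0 where y0: "y0 \<in> ibox m" by blast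
  define n where "n = length d"
  define D where "D = (\<lambda>i. take i e @ drop i d)"
  define P where "P = (\<lambda>i j. if j < i then \<pi> j else (\<lambda>x. x))"
  define c where "c = (\<lambda>y i j. if j < i then lam j (y ! j) else (\<lambda>x. 1::complex))"
  have lenD: "length (D i) = length d" for i using len by (simp add: D_def)
  \<comment> \<open>Backward induction over the parties: when the first \<open>n - i\<close>
    outcomes are those of \<open>y\<close>, the payoffs of all their completions are still to be
    collected.\<close>
  have claim: "pay H (D (n - i)) (mact d (D (n - i)) (P (n - i)) (c y (n - i)) a)
      (\<Sum>y' | y' \<in> ibox m \<and> take (n - i) y' = take (n - i) y. q y')"
    if "i \<le> n" "y \<in> ibox m" for i y
    using that
  proof (induction i arbitrary: y)
    case 0
    have "{y'. y' \<in> ibox m \<and> take n y' = take n y} = {y}"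
      using 0 len by (auto simp: n_def length_box)
    moreover have "mact d e (P n) (c y n) a = mact d e \<pi> (\<lambda>j. lam j (y ! j)) a"
    proof -
      have "pm (P n) xs = pm \<pi> xs" if "xs \<in> ibox d" for xs
        using that by (intro nth_equalityI) (auto simp: P_def n_def length_box)
      then show ?thesis
        unfolding mact_def by (intro ext if_cong refl sum.cong) (auto simp: c_def n_def)
    qed
    moreover have "D n = e" using len by (simp add: D_def n_def)
    ultimately show ?case using cont[OF 0(2)] by simp
  next
    case (Suc i)
    define l where "l = n - Suc i"
    have l: "l < n" "n - i = Suc l" using Suc(2) by (auto simp: l_def)
    let ?L = "\<lambda>t. mat (e ! l) (d ! l) (\<lambda>(z, x). if z = \<pi> l x then lam l t x else 0)"
    have Dl: "(D l)[l := e ! l] = D (Suc l)"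
      unfolding D_def using l len by (intro nth_equalityI) (auto simp: nth_append nth_list_update less_Suc_eq n_def)
    have Dnth: "D l ! l = d ! l" using l len by (simp add: D_def nth_append n_def)
    have ylen: "length y = length d" using Suc(3) len by (simp add: length_box)
    show ?case
      unfolding l_def[symmetric]
    proof (rule pay.round[where j = l and m = "m ! l" and L = ?L])
      show "l < length (D l)" using l lenD by (simp add: n_def)
      show "instrument (D l ! l) (m ! l) ?L"
        unfolding instrument_def Dnth
      proof (intro conjI allI impI)
        fix x x' assume x: "x < d ! l" "x' < d ! l"
        have "(\<Sum>t<m ! l. \<Sum>z<dim_row (?L t). cnj (?L t $$ (z, x)) * ?L t $$ (z, x'))
            = (\<Sum>t<m ! l. \<Sum>z<e ! l. if z = \<pi> l x then if \<pi> l x = \<pi> l x' then cnj (lam l t x) * lam l t x' else 0 else 0)"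
          using x by (intro sum.cong) auto
        also have "\<dots> = (\<Sum>t<m ! l. if \<pi> l x = \<pi> l x' then cnj (lam l t x) * lam l t x' else 0)"
          using pi[of l x] x l by (simp add: n_def)
        also have "\<dots> = (if x = x' then 1 else 0)"
          using compl[of l x x'] l x by (cases "\<pi> l x = \<pi> l x'") (auto simp: n_def)
        finally show "(\<Sum>t<m ! l. \<Sum>z<dim_row (?L t). cnj (?L t $$ (z, x)) * ?L t $$ (z, x')) = (if x = x' then 1 else 0)" .
      qed (use epos l in \<open>auto simp: n_def\<close>)
      show "\<forall>t<m ! l. pay H ((D l)[l := dim_row (?L t)]) (lact (D l) l (?L t) (mact d (D l) (P l) (c y l) a))
        (\<Sum>y' | y' \<in> ibox m \<and> take (Suc l) y' = take (Suc l) (y[l := t]). q y')"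
      proof (intro allI impI)
        fix t assume t: "t < m ! l"
        have yt: "y[l := t] \<in> ibox m" using box_update'[OF Suc(3) t, of l] by simp
        have "lact (D l) l (?L t) (mact d (D l) (P l) (c y l) a) = mact d (D (Suc l)) (P (Suc l)) (c (y[l := t]) (Suc l)) a"
          unfolding D_def P_def c_def using l len ylen pi by (intro mact_step) (auto simp: n_def)
        then show "pay H ((D l)[l := dim_row (?L t)]) (lact (D l) l (?L t) (mact d (D l) (P l) (c y l) a))
           (\<Sum>y' | y' \<in> ibox m \<and> take (Suc l) y' = take (Suc l) (y[l := t]). q y')"
          using Suc.IH[OF _ yt] Suc(2) l Dl by simp
      qed
      have "{y'. y' \<in> ibox m \<and> take l y' = take l y}
        = (\<Union>t\<in>{..<m ! l}. {y'. y' \<in> ibox m \<and> take (Suc l) y' = take (Suc l) (y[l := t])})"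
      proof (intro Set.set_eqI iffI)
        fix y' assume "y' \<in> {y'. y' \<in> ibox m \<and> take l y' = take l y}"
        then have y': "y' \<in> ibox m" "take l y' = take l y" by auto
        then have "length y' = length d" "y' ! l < m ! l" using len l by (auto simp: length_box nth_box n_def)
        then have "take (Suc l) y' = take (Suc l) (y[l := y' ! l])"
          using y' ylen l by (simp add: take_Suc_conv_app_nth n_def)
        then show "y' \<in> (\<Union>t\<in>{..<m ! l}. {y'. y' \<in> ibox m \<and> take (Suc l) y' = take (Suc l) (y[l := t])})"
          using y' \<open>y' ! l < m ! l\<close> by auto
      next
        fix y' assume "y' \<in> (\<Union>t\<in>{..<m ! l}. {y'. y' \<in> ibox m \<and> take (Suc l) y' = take (Suc l) (y[l := t])})"
        then obtain t where y': "y' \<in> ibox m" "take (Suc l) y' = take (Suc l) (y[l := t])" by auto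
        from arg_cong[OF this(2), of "take l"] have "take l y' = take l y" by (simp add: min_def)
        then show "y' \<in> {y'. y' \<in> ibox m \<and> take l y' = take l y}" using y' by simp
      qed
      moreover have "(\<Sum>y'\<in>(\<Union>t\<in>{..<m ! l}. {y'. y' \<in> ibox m \<and> take (Suc l) y' = take (Suc l) (y[l := t])}). q y')
        = (\<Sum>t<m ! l. \<Sum>y' | y' \<in> ibox m \<and> take (Suc l) y' = take (Suc l) (y[l := t]). q y')"
      proof (rule sum.UNION_disjoint)
        show "\<forall>i\<in>{..<m ! l}. finite {y'. y' \<in> ibox m \<and> take (Suc l) y' = take (Suc l) (y[l := i])}"
          by (auto intro: finite_subset[OF _ finite_box[of m]])
        have "take (Suc l) (y[l := s]) \<noteq> take (Suc l) (y[l := t])" if "s \<noteq> t" for s t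
          using that l ylen by (simp add: take_Suc_conv_app_nth n_def)
        then show "\<forall>i\<in>{..<m ! l}. \<forall>j\<in>{..<m ! l}. i \<noteq> j \<longrightarrow>
           {y'. y' \<in> ibox m \<and> take (Suc l) y' = take (Suc l) (y[l := i])} \<inter>
           {y'. y' \<in> ibox m \<and> take (Suc l) y' = take (Suc l) (y[l := j])} = {}"
          by auto
      qed simp
      ultimately show "(\<Sum>y' | y' \<in> ibox m \<and> take l y' = take l y. q y')
        \<le> (\<Sum>t<m ! l. \<Sum>y' | y' \<in> ibox m \<and> take (Suc l) y' = take (Suc l) (y[l := t]). q y')"
        by simp
    qed
  qed
  have "pay H (D 0) (mact d (D 0) (P 0) (c y0 0) a) (\<Sum>y' | y' \<in> ibox m \<and> take 0 y' = take 0 y0. q y')"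
    using claim[of n y0] y0 by simp
  moreover have "D 0 = d" by (simp add: D_def)
  moreover have "mact d d (P 0) (c y0 0) a = a" using mact_id[OF a] by (simp add: P_def c_def)
  ultimately have "pay H d a (\<Sum>y\<in>ibox m. q y)" by simp
  then show ?thesis using p anti by (rule pay_antimono)
qed

section \<open>Tensor products and composition of conversions\<close>

definition dmul :: "nat list \<Rightarrow> nat list \<Rightarrow> nat list" where "dmul d f = map2 (*) d f"

text \<open>Each party packs its two labels into one, the second factor being the less significant,
  in agreement with \<open>ktensor\<close>.\<close>

definition join :: "nat list \<Rightarrow> nat list \<Rightarrow> nat list \<Rightarrow> nat list" where
  "join f xs ys = map (\<lambda>j. xs ! j * f ! j + ys ! j) [0..<length f]"

definition tn :: "nat list \<Rightarrow> amp \<Rightarrow> nat list \<Rightarrow> amp \<Rightarrow> amp" where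
  "tn d a f b = (\<lambda>zs. if zs \<in> ibox (dmul d f) then a (map2 (div) zs f) * b (map2 (mod) zs f) else 0)"

lemma length_dmul [simp]: "length (dmul d f) = min (length d) (length f)" by (simp add: dmul_def)

lemma nth_dmul [simp]: "j < length d \<Longrightarrow> j < length f \<Longrightarrow> dmul d f ! j = d ! j * f ! j" by (simp add: dmul_def)

lemma length_join [simp]: "length (join f xs ys) = length f" by (simp add: join_def)

lemma nth_join [simp]: "j < length f \<Longrightarrow> join f xs ys ! j = xs ! j * f ! j + ys ! j" by (simp add: join_def)

lemma mult_add_less: "x < a \<Longrightarrow> y < b \<Longrightarrow> x * b + y < a * (b::nat)"
proof -
  assume "x < a" "y < b"
  then have "x * b + y < x * b + b" by simp
  also have "\<dots> = Suc x * b" by simp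
  also have "\<dots> \<le> a * b" using \<open>x < a\<close> by (intro mult_le_mono1) simp
  finally show ?thesis .
qed

lemma join_in_box:
  "length d = length f \<Longrightarrow> xs \<in> ibox d \<Longrightarrow> ys \<in> ibox f \<Longrightarrow> join f xs ys \<in> ibox (dmul d f)"
  by (auto simp: ibox_def mult_add_less)

lemma div_join:
  "length d = length f \<Longrightarrow> xs \<in> ibox d \<Longrightarrow> ys \<in> ibox f \<Longrightarrow> map2 (div) (join f xs ys) f = xs"
  by (rule nth_equalityI) (auto simp: ibox_def)

lemma mod_join:
  "length d = length f \<Longrightarrow> xs \<in> ibox d \<Longrightarrow> ys \<in> ibox f \<Longrightarrow> map2 (mod) (join f xs ys) f = ys"
  by (rule nth_equalityI) (auto simp: ibox_def)

lemma div_in_box: "length d = length f \<Longrightarrow> zs \<in> ibox (dmul d f) \<Longrightarrow> map2 (div) zs f \<in> ibox d"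
  by (auto simp: ibox_def less_mult_imp_div_less)

lemma mod_in_box: "length d = length f \<Longrightarrow> zs \<in> ibox (dmul d f) \<Longrightarrow> map2 (mod) zs f \<in> ibox f"
proof -
  assume a: "length d = length f" "zs \<in> ibox (dmul d f)"
  then have "zs ! i < d ! i * f ! i" if "i < length f" for i using that nth_box[OF a(2), of i] by simp
  then have "f ! i > 0" if "i < length f" for i using that by (metis mult_0_right not_gr_zero not_less_zero)
  then show ?thesis using a by (auto simp: ibox_def)
qed

lemma join_div_mod: "length d = length f \<Longrightarrow> zs \<in> ibox (dmul d f) \<Longrightarrow> join f (map2 (div) zs f) (map2 (mod) zs f) = zs"
  by (rule nth_equalityI) (auto simp: ibox_def div_mult_mod_eq)

lemma sum_box_dmul:
  assumes "length d = length f"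
  shows "sum h (ibox (dmul d f)) = (\<Sum>xs\<in>ibox d. \<Sum>ys\<in>ibox f. h (join f xs ys))"
  unfolding sum.cartesian_product
  by (rule sum.reindex_bij_witness[of _ "\<lambda>(xs, ys). join f xs ys" "\<lambda>zs. (map2 (div) zs f, map2 (mod) zs f)"])
     (use assms in \<open>auto simp: join_in_box div_join mod_join div_in_box mod_in_box join_div_mod\<close>)

lemma tn_join: "length d = length f \<Longrightarrow> xs \<in> ibox d \<Longrightarrow> ys \<in> ibox f \<Longrightarrow> tn d a f b (join f xs ys) = a xs * b ys"
  by (simp add: tn_def join_in_box div_join mod_join)

lemma supp_tn: "supp (dmul d f) (tn d a f b)" by (simp add: supp_def tn_def)

lemma box_dmul_cases:
  assumes "length d = length f" "zs \<in> ibox (dmul d f)"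
  obtains xs ys where "xs \<in> ibox d" "ys \<in> ibox f" "zs = join f xs ys"
  using that[OF div_in_box[OF assms] mod_in_box[OF assms]] join_div_mod[OF assms] by simp

lemma tn_eqI:
  assumes "length d = length f" "supp (dmul d f) c" "\<And>xs ys. xs \<in> ibox d \<Longrightarrow> ys \<in> ibox f \<Longrightarrow> c (join f xs ys) = a xs * b ys"
  shows "c = tn d a f b"
proof (rule supp_ext[OF assms(2) supp_tn])
  fix zs assume "zs \<in> ibox (dmul d f)"
  then obtain xs ys where "xs \<in> ibox d" "ys \<in> ibox f" "zs = join f xs ys"
    using box_dmul_cases[OF assms(1)] by blast
  then show "c zs = tn d a f b zs" using assms(3) tn_join[OF assms(1)] by simp
qed

lemma ip_tn: "length d = length f \<Longrightarrow> ip (dmul d f) (tn d a f b) (tn d a' f b') = ip d a a' * ip f b b'"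
  unfolding ip_def sum_product by (simp add: sum_box_dmul tn_join ac_simps)

lemma nrm_tn: "length d = length f \<Longrightarrow> nrm (dmul d f) (tn d a f b) = nrm d a * nrm f b"
  unfolding nrm_def sum_product by (simp add: sum_box_dmul tn_join norm_mult power_mult_distrib)

lemma sum_nat_dmul:
  fixes h :: "nat \<Rightarrow> 'b::comm_monoid_add"
  shows "sum h {..<e * F} = (\<Sum>z<e. \<Sum>t<F. h (z * F + t))"
  unfolding sum.cartesian_product
proof (rule sum.reindex_bij_witness[of _ "\<lambda>(z, t). z * F + t" "\<lambda>x. (x div F, x mod F)"])
  fix x assume "x \<in> {..<e * F}"
  then have "x < e * F" by simp
  then have "F > 0" by (metis mult_0_right not_gr_zero not_less_zero)
  then show "(x div F, x mod F) \<in> {..<e} \<times> {..<F}" using \<open>x < e * F\<close> by (simp add: less_mult_imp_div_less)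
qed (auto simp: mult_add_less)

lemma pay_tensor:
  assumes "pay H d a p" "length d = length f" "\<forall>x\<in>set f. 0 < x"
  shows "pay (\<lambda>D w q. \<exists>d' v. length d' = length f \<and> D = dmul d' f \<and> w = tn d' v f b \<and> H d' v q) (dmul d f) (tn d a f b) p"
  using assms
proof (induction rule: pay.induct)
  case (leaf d a p)
  then show ?case by (intro pay.leaf) auto
next
  case (round j d m L a q p)
  let ?H = "\<lambda>D w q. \<exists>d' v. length d' = length f \<and> D = dmul d' f \<and> w = tn d' v f b \<and> H d' v q"
  define F where "F = f ! j"
  have F: "F > 0" using round by (auto simp: F_def)
  have j: "j < length d" "j < length f" using round by auto
  have Dj: "dmul d f ! j = d ! j * F" using j by (simp add: F_def)
  \<comment> \<open>The Kraus operator \<open>L i\<close> tensored with the identity on the second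
    factor of party \<open>j\<close>.\<close>
  define L' where "L' = (\<lambda>i. mat (dim_row (L i) * F) (d ! j * F)
      (\<lambda>(z, x). if z mod F = x mod F then L i $$ (z div F, x div F) else 0))"
  have ent: "L' i $$ (z * F + t, x * F + s) = (if t = s then L i $$ (z, x) else 0)"
    if "z < dim_row (L i)" "x < d ! j" "t < F" "s < F" for i z t x s
    using that by (simp add: L'_def mult_add_less)
  have dimL': "dim_row (L' i) = dim_row (L i) * F" for i by (simp add: L'_def)
  have inst: "instrument (dmul d f ! j) m L'"
    unfolding instrument_def Dj
  proof (intro conjI allI impI)
    fix y y' assume y: "y < d ! j * F" "y' < d ! j * F"
    have yd: "y div F < d ! j" "y' div F < d ! j" "y mod F < F" "y' mod F < F"
      using y F by (auto simp: less_mult_imp_div_less)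
    have e: "L' i $$ (z * F + t, y) = (if t = y mod F then L i $$ (z, y div F) else 0)"
      "L' i $$ (z * F + t, y') = (if t = y' mod F then L i $$ (z, y' div F) else 0)"
      if "z < dim_row (L i)" "t < F" for i z t
      using ent[of z i "y div F" t "y mod F"] ent[of z i "y' div F" t "y' mod F"] that yd by simp_all
    have "(\<Sum>i<m. \<Sum>z<dim_row (L' i). cnj (L' i $$ (z, y)) * L' i $$ (z, y'))
       = (\<Sum>i<m. \<Sum>z<dim_row (L i). \<Sum>t<F. if t = y mod F then (if y mod F = y' mod F then cnj (L i $$ (z, y div F)) * L i $$ (z, y' div F) else 0) else 0)"
      unfolding dimL' sum_nat_dmul by (intro sum.cong refl) (use e in auto)
    also have "\<dots> = (if y mod F = y' mod F then (\<Sum>i<m. \<Sum>z<dim_row (L i). cnj (L i $$ (z, y div F)) * L i $$ (z, y' div F)) else 0)"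
      using yd by simp
    also have "\<dots> = (if y mod F = y' mod F then (if y div F = y' div F then 1 else 0) else 0)"
      using round(2) yd by (simp add: instrument_def)
    also have "\<dots> = (if y = y' then 1 else 0)"
      by (metis div_mult_mod_eq)
    finally show "(\<Sum>i<m. \<Sum>z<dim_row (L' i). cnj (L' i $$ (z, y)) * L' i $$ (z, y')) = (if y = y' then 1 else 0)" .
  qed (use round(2) F in \<open>auto simp: instrument_def L'_def\<close>)
  show ?case
  proof (rule pay.round[where j = j and m = m and L = L' and q = q])
    show "j < length (dmul d f)" using j by simp
    show "instrument (dmul d f ! j) m L'" by (rule inst)
    show "p \<le> sum q {..<m}" by (rule round)
    show "\<forall>i<m. pay ?H ((dmul d f)[j := dim_row (L' i)]) (lact (dmul d f) j (L' i) (tn d a f b)) (q i)"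
    proof (intro allI impI)
      fix i assume i: "i < m"
      let ?e = "dim_row (L i)" and ?d = "d[j := dim_row (L i)]"
      have D': "(dmul d f)[j := dim_row (L' i)] = dmul ?d f"
        using j round by (intro nth_equalityI) (auto simp: nth_list_update L'_def F_def)
      have ld: "length ?d = length f" using round by simp
      have "lact (dmul d f) j (L' i) (tn d a f b) = tn ?d (lact d j (L i) a) f b"
      proof (rule tn_eqI[OF ld])
        show "supp (dmul ?d f) (lact (dmul d f) j (L' i) (tn d a f b))"
          using supp_lact[of "dmul d f" j "L' i"] by (simp add: D')
        fix xs ys assume xs: "xs \<in> ibox ?d" and ys: "ys \<in> ibox f"
        have lx: "length xs = length d" "length ys = length f" using xs ys round by (auto simp: length_box)
        have xj: "xs ! j < ?e" using nth_box[OF xs, of j] j by simp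
        have yj: "ys ! j < F" using nth_box[OF ys, of j] j by (simp add: F_def)
        have up: "(join f xs ys)[j := x * F + ys ! j] = join f (xs[j := x]) ys" for x
          using j lx round by (intro nth_equalityI) (auto simp: nth_list_update F_def)
        have xin: "xs[j := x] \<in> ibox d" if "x < d ! j" for x
          using box_update[OF xs that] j by simp
        have "lact (dmul d f) j (L' i) (tn d a f b) (join f xs ys)
          = (\<Sum>y<d ! j * F. L' i $$ (xs ! j * F + ys ! j, y) * tn d a f b ((join f xs ys)[j := y]))"
          using join_in_box[OF ld xs ys] j Dj by (simp add: lact_def D' F_def)
        also have "\<dots> = (\<Sum>x<d ! j. \<Sum>t<F. L' i $$ (xs ! j * F + ys ! j, x * F + t) * tn d a f b ((join f xs ys)[j := x * F + t]))"
          by (rule sum_nat_dmul)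
        also have "\<dots> = (\<Sum>x<d ! j. \<Sum>t<F. if t = ys ! j then L i $$ (xs ! j, x) * tn d a f b ((join f xs ys)[j := x * F + ys ! j]) else 0)"
          using ent xj yj by (intro sum.cong refl) auto
        also have "\<dots> = (\<Sum>x<d ! j. L i $$ (xs ! j, x) * (a (xs[j := x]) * b ys))"
          using yj xin ys round tn_join[of d f] by (simp add: up)
        also have "\<dots> = lact d j (L i) a xs * b ys"
          using xs by (simp add: lact_def sum_distrib_right mult.assoc)
        finally show "lact (dmul d f) j (L' i) (tn d a f b) (join f xs ys) = lact d j (L i) a xs * b ys" .
      qed
      then show "pay ?H ((dmul d f)[j := dim_row (L' i)]) (lact (dmul d f) j (L' i) (tn d a f b)) (q i)"
        using round i ld by (simp add: D')
    qed
  qed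
qed

section \<open>Pure states and conversion with a given fidelity\<close>

type_synonym pv = "nat list \<times> amp"

definition St :: "nat \<Rightarrow> pv set" where
  "St k = {s. valid_dims k (fst s) \<and> supp (fst s) (snd s) \<and> nrm (fst s) (snd s) = 1}"

definition tens :: "pv \<Rightarrow> pv \<Rightarrow> pv" where
  "tens s t = (dmul (fst s) (fst t), tn (fst s) (snd s) (fst t) (snd t))"

text \<open>Summed over the branches, these squared overlaps are the squared fidelity of the output
  mixture with the pure state \<open>t\<close>; hence \<open>conv s t p\<close> bounds that squared
  fidelity from below by \<open>p\<close>.\<close>

definition target :: "pv \<Rightarrow> nat list \<Rightarrow> amp \<Rightarrow> real \<Rightarrow> bool" where
  "target t d v q \<longleftrightarrow> d = fst t \<and> q \<le> (cmod (ip d (snd t) v))\<^sup>2"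

definition conv :: "pv \<Rightarrow> pv \<Rightarrow> real \<Rightarrow> bool" where
  "conv s t p \<longleftrightarrow> pay (target t) (fst s) (snd s) p"

lemma target_antimono: "target t d v q \<Longrightarrow> q' \<le> q \<Longrightarrow> target t d v q'" by (auto simp: target_def)

lemma conv_antimono: "conv s t p \<Longrightarrow> q \<le> p \<Longrightarrow> conv s t q"
  unfolding conv_def by (erule pay_antimono) (auto intro: target_antimono)

lemma ip_self: "ip d a a = complex_of_real (nrm d a)"
  unfolding ip_def nrm_def of_real_sum complex_norm_square by (simp add: mult.commute)

lemma St_length: "s \<in> St k \<Longrightarrow> length (fst s) = k" by (simp add: St_def valid_dims_def)

lemma St_pos: "s \<in> St k \<Longrightarrow> x \<in> set (fst s) \<Longrightarrow> 0 < x" by (simp add: St_def valid_dims_def)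

lemma St_pos': "s \<in> St k \<Longrightarrow> j < k \<Longrightarrow> 0 < fst s ! j" by (simp add: St_def valid_dims_def)

lemma dmul_valid: "valid_dims k d \<Longrightarrow> valid_dims k f \<Longrightarrow> valid_dims k (dmul d f)"
  unfolding valid_dims_def all_set_conv_all_nth by auto

lemma tens_St: "s \<in> St k \<Longrightarrow> t \<in> St k \<Longrightarrow> tens s t \<in> St k"
  using St_length[of s k] St_length[of t k] by (simp add: St_def tens_def supp_tn nrm_tn dmul_valid)

lemma conv_tens:
  assumes "conv s t p" "s \<in> St k" "t \<in> St k" "u \<in> St k"
  shows "conv (tens s u) (tens t u) p"
proof -
  have l: "length (fst s) = k" "length (fst t) = k" "length (fst u) = k" using assms St_length by auto
  have u: "ip (fst u) (snd u) (snd u) = 1" using assms(4) by (simp add: ip_self St_def)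
  have "pay (\<lambda>D w q. \<exists>d' v. length d' = length (fst u) \<and> D = dmul d' (fst u) \<and> w = tn d' v (fst u) (snd u) \<and> target t d' v q)
     (dmul (fst s) (fst u)) (tn (fst s) (snd s) (fst u) (snd u)) p"
    using assms(1) l St_pos[OF assms(4)] unfolding conv_def by (intro pay_tensor) auto
  then show ?thesis
    unfolding conv_def tens_def fst_conv snd_conv
  proof (rule pay_bind, elim exE conjE)
    fix d' v q D w
    assume "length d' = length (fst u)" "D = dmul d' (fst u)" "w = tn d' v (fst u) (snd u)" "target t d' v q"
    then show "pay (target (dmul (fst t) (fst u), tn (fst t) (snd t) (fst u) (snd u))) D w q"
      using u by (intro pay.leaf) (auto simp: target_def ip_tn)
  qed
qed

lemma Cauchy_Schwarz_ip: "(cmod (ip d a b))\<^sup>2 \<le> nrm d a * nrm d b"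
proof -
  have "cmod (ip d a b) \<le> (\<Sum>x\<in>ibox d. cmod (a x) * cmod (b x))"
    unfolding ip_def by (rule order_trans[OF norm_sum]) (simp add: norm_mult)
  then have "(cmod (ip d a b))\<^sup>2 \<le> (\<Sum>x\<in>ibox d. cmod (a x) * cmod (b x))\<^sup>2"
    by (intro power_mono) auto
  also have "\<dots> \<le> nrm d a * nrm d b" unfolding nrm_def by (rule Cauchy_Schwarz_ineq_sum)
  finally show ?thesis .
qed

text \<open>Young's inequality \<open>2 * |x| * |y| \<le> \<eta> * |x|\<^sup>2 + |y|\<^sup>2 /
  \<eta>\<close>; this is the source of the loss term in every composition of protocols.\<close>

lemma perturb_norm_sq:
  fixes x y :: complex
  assumes "0 < \<eta>" "\<eta> < 1"
  shows "(1 - \<eta>) * (cmod x)\<^sup>2 - (cmod y)\<^sup>2 / \<eta> \<le> (cmod (x + y))\<^sup>2"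
proof -
  have "cmod x \<le> cmod (x + y) + cmod y" by (metis add_diff_cancel_right' norm_triangle_ineq4)
  moreover have "cmod y \<le> cmod (x + y) + cmod x" by (metis add_diff_cancel_left' norm_triangle_ineq4)
  ultimately have "\<bar>cmod x - cmod y\<bar> \<le> cmod (x + y)" by linarith
  then have "(cmod x - cmod y)\<^sup>2 \<le> (cmod (x + y))\<^sup>2" by (metis abs_ge_zero power2_abs power_mono)
  moreover have "0 \<le> (sqrt \<eta> * cmod x - cmod y / sqrt \<eta>)\<^sup>2" by simp
  then have "2 * cmod x * cmod y \<le> \<eta> * (cmod x)\<^sup>2 + (cmod y)\<^sup>2 / \<eta>"
    using assms by (simp add: power2_diff power_mult_distrib power_divide)
  ultimately show ?thesis by (simp add: power2_diff algebra_simps) (smt (verit) zero_le_power2)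
qed

lemma ip_add: "ip d a (\<lambda>x. v x + w x) = ip d a v + ip d a w"
  by (simp add: ip_def distrib_left sum.distrib)

lemma ip_scale: "ip d a (\<lambda>x. c * v x) = c * ip d a v"
  by (simp add: ip_def sum_distrib_left ac_simps)

lemma nrm_scale: "nrm d (\<lambda>x. c * v x) = (cmod c)\<^sup>2 * nrm d v"
  by (simp add: nrm_def sum_distrib_left norm_mult power_mult_distrib)

lemma lact_add: "lact d j L (\<lambda>x. v x + w x) = (\<lambda>x. lact d j L v x + lact d j L w x)"
  by (auto simp: lact_def distrib_left sum.distrib)

lemma lact_scale: "lact d j L (\<lambda>x. c * v x) = (\<lambda>x. c * lact d j L v x)"
  by (auto simp: lact_def sum_distrib_left ac_simps intro!: ext sum.cong)

text \<open>The payoff of one fixed protocol as a function of its input: a sum of squared moduli of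
  linear functionals, of which only attainability, stability and homogeneity are recorded. A bare
  \<open>pay\<close> statement says nothing about the same protocol on a neighbouring
  vector.\<close>

definition gain :: "pv \<Rightarrow> nat list \<Rightarrow> (amp \<Rightarrow> real) \<Rightarrow> bool" where
  "gain t d G \<longleftrightarrow> (\<forall>v. pay (target t) d v (G v)) \<and>
     (\<forall>v w \<eta>. 0 < \<eta> \<longrightarrow> \<eta> < 1 \<longrightarrow> (1 - \<eta>) * G v - nrm d w / \<eta> \<le> G (\<lambda>x. v x + w x)) \<and>
     (\<forall>c v. G (\<lambda>x. c * v x) = (cmod c)\<^sup>2 * G v)"

lemma gain_pay: "gain t d G \<Longrightarrow> pay (target t) d v (G v)"
  and gain_perturb: "gain t d G \<Longrightarrow> 0 < \<eta> \<Longrightarrow> \<eta> < 1 \<Longrightarrow> (1 - \<eta>) * G v - nrm d w / \<eta> \<le> G (\<lambda>x. v x + w x)"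
  and gain_scale: "gain t d G \<Longrightarrow> G (\<lambda>x. c * v x) = (cmod c)\<^sup>2 * G v"
  by (simp_all add: gain_def)

text \<open>At a leaf, stability is Cauchy-Schwarz combined with \<open>perturb_norm_sq\<close>. It
  passes through a round because the squared norms of the branches of the perturbation add up to its
  squared norm before the round.\<close>

lemma protocol_gain:
  assumes "pay (target t) d a p" "nrm (fst t) (snd t) \<le> 1"
  shows "\<exists>G. p \<le> G a \<and> gain t d G"
  using assms
proof (induction rule: pay.induct)
  case (leaf d a p)
  have "gain t d (\<lambda>v. (cmod (ip d (snd t) v))\<^sup>2)"
    unfolding gain_def
  proof (intro conjI allI impI)
    fix v show "pay (target t) d v ((cmod (ip d (snd t) v))\<^sup>2)"
      using leaf by (intro pay.leaf) (auto simp: target_def)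
  next
    fix v w and \<eta> :: real assume h: "0 < \<eta>" "\<eta> < 1"
    have "(cmod (ip d (snd t) w))\<^sup>2 \<le> nrm d (snd t) * nrm d w" by (rule Cauchy_Schwarz_ip)
    also have "\<dots> \<le> 1 * nrm d w" using leaf by (intro mult_right_mono nrm_nonneg) (auto simp: target_def)
    finally have "(cmod (ip d (snd t) w))\<^sup>2 / \<eta> \<le> nrm d w / \<eta>" using h by (simp add: divide_right_mono)
    then show "(1 - \<eta>) * (cmod (ip d (snd t) v))\<^sup>2 - nrm d w / \<eta> \<le> (cmod (ip d (snd t) (\<lambda>x. v x + w x)))\<^sup>2"
      using perturb_norm_sq[of \<eta> "ip d (snd t) v" "ip d (snd t) w"] h unfolding ip_add by linarith
  next
    fix c v show "(cmod (ip d (snd t) (\<lambda>x. c * v x)))\<^sup>2 = (cmod c)\<^sup>2 * (cmod (ip d (snd t) v))\<^sup>2"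
      by (simp add: ip_scale norm_mult power_mult_distrib)
  qed
  then show ?case using leaf by (intro exI[of _ "\<lambda>v. (cmod (ip d (snd t) v))\<^sup>2"]) (auto simp: target_def)
next
  case (round j d m L a q p)
  let ?P = "\<lambda>i G. q i \<le> G (lact d j (L i) a) \<and> gain t (d[j := dim_row (L i)]) G"
  define G where "G = (\<lambda>i. SOME G. ?P i G)"
  have P: "?P i (G i)" if "i < m" for i
    unfolding G_def
    by (rule someI_ex[of "?P i", OF round(4)[THEN spec, THEN mp, OF that, THEN conjunct2, THEN mp, OF round(5)]])
  define K where "K = (\<lambda>v. \<Sum>i<m. G i (lact d j (L i) v))"
  have "gain t d K"
    unfolding gain_def
  proof (intro conjI allI impI)
    fix v show "pay (target t) d v (K v)"
      unfolding K_def using P gain_pay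
      by (intro pay.round[OF round(1,2), where q = "\<lambda>i. G i (lact d j (L i) v)"]) auto
  next
    fix v w and \<eta> :: real assume h: "0 < \<eta>" "\<eta> < 1"
    have "(1 - \<eta>) * K v - nrm d w / \<eta>
      = (\<Sum>i<m. (1 - \<eta>) * G i (lact d j (L i) v) - nrm (d[j := dim_row (L i)]) (lact d j (L i) w) / \<eta>)"
      using nrm_lact_sum[OF round(1,2), of w]
      by (simp add: K_def sum_subtractf sum_distrib_left sum_divide_distrib[symmetric])
    also have "\<dots> \<le> K (\<lambda>x. v x + w x)"
      unfolding K_def lact_add using P gain_perturb h by (intro sum_mono) blast
    finally show "(1 - \<eta>) * K v - nrm d w / \<eta> \<le> K (\<lambda>x. v x + w x)" .
  next
    fix c v show "K (\<lambda>x. c * v x) = (cmod c)\<^sup>2 * K v"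
      unfolding K_def lact_scale sum_distrib_left using P gain_scale by (intro sum.cong refl) blast
  qed
  moreover have "p \<le> K a"
  proof -
    have "(\<Sum>i<m. q i) \<le> K a" unfolding K_def using P by (intro sum_mono) auto
    then show ?thesis using round(3) by linarith
  qed
  ultimately show ?case by blast
qed

lemma pay_scale:
  assumes "pay (target t) d a p" "nrm (fst t) (snd t) \<le> 1"
  shows "pay (target t) d (\<lambda>x. c * a x) ((cmod c)\<^sup>2 * p)"
proof -
  obtain G where G: "p \<le> G a" "gain t d G" using protocol_gain[OF assms] by blast
  have "pay (target t) d (\<lambda>x. c * a x) ((cmod c)\<^sup>2 * G a)"
    using gain_pay[OF G(2), of "\<lambda>x. c * a x"] unfolding gain_scale[OF G(2)] .
  moreover have "(cmod c)\<^sup>2 * p \<le> (cmod c)\<^sup>2 * G a" using G(1) by (simp add: mult_left_mono)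
  ultimately show ?thesis by (rule pay_antimono) (rule target_antimono)
qed

text \<open>At each leaf of the first protocol the vector is a multiple \<alpha> of the intermediate
  target plus an orthogonal rest. The second protocol earns at least
  \<open>|\<alpha>|\<^sup>2 * p'\<close> on the first part, and the rests have total squared norm at
  most \<open>nrm d a - p\<close>.\<close>

lemma pay_compose:
  assumes "pay (target t) d a p"
    and t: "nrm (fst t) (snd t) = 1" and u: "nrm (fst u) (snd u) \<le> 1"
    and tu: "pay (target u) (fst t) (snd t) p'" and p': "0 \<le> p'" and h: "0 < \<eta>" "\<eta> < 1"
  shows "pay (target u) d a ((1 - \<eta>) * p * p' - (nrm d a - p) / \<eta>)"
proof -
  obtain G where G: "p' \<le> G (snd t)" "gain u (fst t) G" using protocol_gain[OF tu u] by blast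
  show ?thesis
    using assms(1)
  proof (induction rule: pay.induct)
    case (leaf d v q)
    have d: "d = fst t" and q: "q \<le> (cmod (ip d (snd t) v))\<^sup>2" using leaf by (auto simp: target_def)
    define \<alpha> where "\<alpha> = ip d (snd t) v"
    define w where "w = (\<lambda>x. v x - \<alpha> * snd t x)"
    have v: "v = (\<lambda>x. \<alpha> * snd t x + w x)" by (simp add: w_def)
    have "complex_of_real (nrm d w) = ip d w w" by (simp add: ip_self)
    also have "\<dots> = (\<Sum>x\<in>ibox d. cnj (v x) * v x - \<alpha> * cnj (v x) * snd t x - cnj \<alpha> * (cnj (snd t x) * v x) + cnj \<alpha> * \<alpha> * (cnj (snd t x) * snd t x))"
      unfolding ip_def w_def by (intro sum.cong refl) (simp add: algebra_simps)
    also have "\<dots> = ip d v v - \<alpha> * cnj \<alpha> - cnj \<alpha> * \<alpha> + cnj \<alpha> * \<alpha> * ip d (snd t) (snd t)"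
      unfolding sum_subtractf sum.distrib sum_distrib_left[symmetric] mult.assoc \<alpha>_def ip_def
      by (simp add: cnj_sum ac_simps)
    also have "\<dots> = complex_of_real (nrm d v - (cmod \<alpha>)\<^sup>2)"
      using t d by (simp add: ip_self complex_norm_square[symmetric] mult.commute[of "cnj \<alpha>"])
    finally have w: "nrm d w = nrm d v - (cmod \<alpha>)\<^sup>2" using of_real_eq_iff by blast
    have "G v \<ge> (1 - \<eta>) * ((cmod \<alpha>)\<^sup>2 * G (snd t)) - nrm d w / \<eta>"
      using gain_perturb[OF G(2) h, of "\<lambda>x. \<alpha> * snd t x" w] v d unfolding gain_scale[OF G(2)] by simp
    moreover have "(1 - \<eta>) * ((cmod \<alpha>)\<^sup>2 * G (snd t)) \<ge> (1 - \<eta>) * ((cmod \<alpha>)\<^sup>2 * p')"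
      using G(1) h by (intro mult_left_mono) auto
    moreover have "(1 - \<eta>) * ((cmod \<alpha>)\<^sup>2 * p') \<ge> (1 - \<eta>) * (q * p')"
      using q p' h by (intro mult_left_mono mult_right_mono) (auto simp: \<alpha>_def)
    moreover have "nrm d w / \<eta> \<le> (nrm d v - q) / \<eta>"
      using w q h by (intro divide_right_mono) (auto simp: \<alpha>_def)
    ultimately have "(1 - \<eta>) * q * p' - (nrm d v - q) / \<eta> \<le> G v" by (simp add: mult.assoc)
    then show ?case by (rule pay_antimono[OF gain_pay[OF G(2), of v, folded d]]) (rule target_antimono)
  next
    case (round j d m L a q p)
    show ?case
    proof (rule pay.round[OF round(1,2)])
      show "\<forall>i<m. pay (target u) (d[j := dim_row (L i)]) (lact d j (L i) a)
         ((1 - \<eta>) * q i * p' - (nrm (d[j := dim_row (L i)]) (lact d j (L i) a) - q i) / \<eta>)"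
        using round by blast
      have "(\<Sum>i<m. (1 - \<eta>) * q i * p' - (nrm (d[j := dim_row (L i)]) (lact d j (L i) a) - q i) / \<eta>)
         = (1 - \<eta>) * sum q {..<m} * p' - (nrm d a - sum q {..<m}) / \<eta>"
        using nrm_lact_sum[OF round(1,2), of a]
        by (simp add: sum_subtractf sum_distrib_left sum_distrib_right sum_divide_distrib[symmetric])
      moreover have "(1 - \<eta>) * p * p' \<le> (1 - \<eta>) * sum q {..<m} * p'"
        using round(3) h p' by (intro mult_right_mono mult_left_mono) auto
      moreover have "(nrm d a - sum q {..<m}) / \<eta> \<le> (nrm d a - p) / \<eta>"
        using round(3) h by (intro divide_right_mono) auto
      ultimately show "(1 - \<eta>) * p * p' - (nrm d a - p) / \<eta> \<le>
        (\<Sum>i<m. (1 - \<eta>) * q i * p' - (nrm (d[j := dim_row (L i)]) (lact d j (L i) a) - q i) / \<eta>)" by linarith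
    qed
  qed
qed

lemma conv_compose:
  assumes "conv s t p" "conv t u p'" "s \<in> St k" "t \<in> St k" "u \<in> St k" "0 \<le> p'" "0 < \<eta>" "\<eta> < 1"
  shows "conv s u ((1 - \<eta>) * p * p' - (1 - p) / \<eta>)"
  using pay_compose[of t "fst s" "snd s" p u p' \<eta>] assms by (auto simp: conv_def St_def)

section \<open>Relabellings and multisets of states\<close>

text \<open>Local isometries that map basis vectors to basis vectors up to phases. They cover
  exchanges of tensor factors, embeddings and phase changes, and they can be performed without
  loss.\<close>

definition isrel :: "nat list \<Rightarrow> nat list \<Rightarrow> (nat \<Rightarrow> nat \<Rightarrow> nat) \<Rightarrow> (nat \<Rightarrow> nat \<Rightarrow> complex) \<Rightarrow> bool" where
  "isrel d e \<pi> c \<longleftrightarrow> length e = length d \<and>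
     (\<forall>j<length d. (\<forall>x<d ! j. \<pi> j x < e ! j \<and> cmod (c j x) = 1) \<and> inj_on (\<pi> j) {..<d ! j})"

lemma mult_add_div [simp]: "y < b \<Longrightarrow> (x * b + y) div b = (x::nat)" by simp

lemma pm_in_box: "isrel d e \<pi> c \<Longrightarrow> xs \<in> ibox d \<Longrightarrow> pm \<pi> xs \<in> ibox e"
  by (auto simp: isrel_def ibox_def)

lemma pm_inj:
  assumes r: "isrel d e \<pi> c" and xs: "xs \<in> ibox d" and ys: "ys \<in> ibox d" and eq: "pm \<pi> xs = pm \<pi> ys"
  shows "xs = ys"
proof (rule nth_equalityI)
  show "length xs = length ys" using xs ys by (simp add: length_box)
  fix j assume j: "j < length xs"
  then have jd: "j < length d" using xs by (simp add: length_box)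
  have "pm \<pi> xs ! j = pm \<pi> ys ! j" using eq by simp
  then have "\<pi> j (xs ! j) = \<pi> j (ys ! j)" using j jd ys by (simp add: length_box)
  then show "xs ! j = ys ! j"
    using r jd nth_box[OF xs jd] nth_box[OF ys jd] by (auto simp: isrel_def inj_on_def)
qed

lemma mact_pm:
  assumes r: "isrel d e \<pi> c" and xs: "xs \<in> ibox d"
  shows "mact d e \<pi> c a (pm \<pi> xs) = (\<Prod>j<length d. c j (xs ! j)) * a xs"
proof -
  have "mact d e \<pi> c a (pm \<pi> xs) = (\<Sum>ys\<in>ibox d. if ys = xs then (\<Prod>j<length d. c j (ys ! j)) * a ys else 0)"
    unfolding mact_def if_P[OF pm_in_box[OF r xs]]
    by (intro sum.cong refl if_cong iffI) (auto intro: pm_inj[OF r _ xs])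
  then show ?thesis using xs by simp
qed

lemma mact_notin: "zs \<notin> pm \<pi> ` ibox d \<Longrightarrow> mact d e \<pi> c a zs = 0"
  by (auto simp: mact_def intro!: sum.neutral)

lemma mact_eqI:
  assumes r: "isrel d e \<pi> c" and b: "supp e b"
    and 1: "\<And>xs. xs \<in> ibox d \<Longrightarrow> b (pm \<pi> xs) = (\<Prod>j<length d. c j (xs ! j)) * a xs"
    and 2: "\<And>zs. zs \<in> ibox e \<Longrightarrow> zs \<notin> pm \<pi> ` ibox d \<Longrightarrow> b zs = 0"
  shows "mact d e \<pi> c a = b"
proof (rule supp_ext[OF supp_mact b])
  fix zs assume zs: "zs \<in> ibox e"
  show "mact d e \<pi> c a zs = b zs"
  proof (cases "zs \<in> pm \<pi> ` ibox d")
    case True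
    then obtain xs where "zs = pm \<pi> xs" "xs \<in> ibox d" by blast
    then show ?thesis using mact_pm[OF r] 1 by simp
  next
    case False then show ?thesis using mact_notin 2[OF zs] by simp
  qed
qed

lemma mact_sum: "mact d e \<pi> c (\<lambda>x. \<Sum>i\<in>I. w i * a i x) = (\<lambda>x. \<Sum>i\<in>I. w i * mact d e \<pi> c (a i) x)"
proof
  fix zs
  have "(\<Sum>xs\<in>ibox d. if pm \<pi> xs = zs then (\<Prod>j<length d. c j (xs ! j)) * (\<Sum>i\<in>I. w i * a i xs) else 0)
    = (\<Sum>xs\<in>ibox d. \<Sum>i\<in>I. w i * (if pm \<pi> xs = zs then (\<Prod>j<length d. c j (xs ! j)) * a i xs else 0))"
    by (intro sum.cong refl) (simp add: sum_distrib_left mult.left_commute)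
  also have "\<dots> = (\<Sum>i\<in>I. w i * (\<Sum>xs\<in>ibox d. if pm \<pi> xs = zs then (\<Prod>j<length d. c j (xs ! j)) * a i xs else 0))"
    by (subst sum.swap) (simp add: sum_distrib_left)
  finally show "mact d e \<pi> c (\<lambda>x. \<Sum>i\<in>I. w i * a i x) zs = (\<Sum>i\<in>I. w i * mact d e \<pi> c (a i) zs)"
    by (simp add: mact_def)
qed

definition rl :: "nat list \<Rightarrow> nat list \<Rightarrow> (amp \<Rightarrow> amp) \<Rightarrow> bool" where
  "rl d e T \<longleftrightarrow> (\<exists>\<pi> c. isrel d e \<pi> c \<and> T = mact d e \<pi> c)"

lemma rl_length: "rl d e T \<Longrightarrow> length e = length d" by (auto simp: rl_def isrel_def)

lemma rl_sum: "rl d e T \<Longrightarrow> T (\<lambda>x. \<Sum>i\<in>I. w i * a i x) = (\<lambda>x. \<Sum>i\<in>I. w i * T (a i) x)"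
  by (auto simp: rl_def mact_sum)

lemma rl_ip:
  assumes "rl d e T"
  shows "ip e (T a) (T b) = ip d a b"
proof -
  obtain \<pi> c where r: "isrel d e \<pi> c" and T: "T = mact d e \<pi> c" using assms by (auto simp: rl_def)
  have inj: "inj_on (pm \<pi>) (ibox d)" using pm_inj[OF r] by (auto simp: inj_on_def)
  have "ip e (T a) (T b) = (\<Sum>zs\<in>pm \<pi> ` ibox d. cnj (T a zs) * T b zs)"
    unfolding ip_def
  proof (rule sum.mono_neutral_right)
    show "pm \<pi> ` ibox d \<subseteq> ibox e" using pm_in_box[OF r] by blast
    show "\<forall>i\<in>ibox e - pm \<pi> ` ibox d. cnj (T a i) * T b i = 0" using mact_notin T by auto
  qed simp
  also have "\<dots> = (\<Sum>xs\<in>ibox d. cnj (T a (pm \<pi> xs)) * T b (pm \<pi> xs))"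
    by (simp add: sum.reindex[OF inj])
  also have "\<dots> = (\<Sum>xs\<in>ibox d. cnj (a xs) * b xs)"
  proof (rule sum.cong[OF refl])
    fix xs assume xs: "xs \<in> ibox d"
    let ?C = "\<Prod>j<length d. c j (xs ! j)"
    have "cmod ?C = 1" unfolding prod_norm[symmetric]
      using r nth_box[OF xs] by (intro prod.neutral) (auto simp: isrel_def)
    then have "cnj ?C * ?C = 1" by (metis complex_norm_square mult.commute of_real_1 one_power2)
    then show "cnj (T a (pm \<pi> xs)) * T b (pm \<pi> xs) = cnj (a xs) * b xs"
      unfolding T mact_pm[OF r xs] complex_cnj_mult by (metis (no_types, lifting) mult.assoc mult.left_commute mult_1)
  qed
  finally show ?thesis by (simp add: ip_def)
qed

lemma rl_pay:
  assumes T: "rl d e T" and a: "supp d a" and e: "\<forall>x\<in>set e. 0 < x" and p: "pay H e (T a) q"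
    and anti: "\<And>d' v q q'. H d' v q \<Longrightarrow> q' \<le> q \<Longrightarrow> H d' v q'"
  shows "pay H d a q"
proof -
  obtain \<pi> c where r: "isrel d e \<pi> c" and T: "T = mact d e \<pi> c" using T by (auto simp: rl_def)
  have box1: "ibox (replicate n (1::nat)) = {replicate n 0}" for n
    by (induction n) (auto simp: box_Cons)
  show ?thesis
  proof (rule pay_monomial[where e = e and m = "replicate (length d) 1" and \<pi> = \<pi> and lam = "\<lambda>j t. c j" and q = "\<lambda>_. q"])
    show "length e = length d" using r by (simp add: isrel_def)
    show "0 < e ! j" if "j < length d" for j using e r that by (simp add: isrel_def)
    show "\<pi> j x < e ! j" if "j < length d" "x < d ! j" for j x using r that by (simp add: isrel_def)
    show "(\<Sum>t<replicate (length d) (1::nat) ! j. cnj (c j x) * c j x') = (if x = x' then 1 else 0)"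
      if "j < length d" "x < d ! j" "x' < d ! j" "\<pi> j x = \<pi> j x'" for j x x'
    proof -
      have "x = x'" using r that by (auto simp: isrel_def inj_on_def)
      moreover have "cmod (c j x) = 1" using r that by (simp add: isrel_def)
      then have "cnj (c j x) * c j x = 1" by (metis complex_norm_square mult.commute of_real_1 one_power2)
      ultimately show ?thesis using that by simp
    qed
    show "pay H e (mact d e \<pi> (\<lambda>j. c j) a) q" using p T by simp
    show "q \<le> (\<Sum>y\<in>ibox (replicate (length d) 1). q)" unfolding box1 by simp
  qed (use a anti in auto)
qed

lemma rl_comp:
  assumes T: "rl d e T" and T': "rl e f T'"
  shows "\<exists>U. rl d f U \<and> (\<forall>a. U a = T' (T a))"
proof -
  obtain \<pi> c where r: "isrel d e \<pi> c" and T: "T = mact d e \<pi> c" using T by (auto simp: rl_def)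
  obtain \<pi>' c' where r': "isrel e f \<pi>' c'" and T': "T' = mact e f \<pi>' c'" using T' by (auto simp: rl_def)
  define \<rho> where "\<rho> = (\<lambda>j x. \<pi>' j (\<pi> j x))"
  define b where "b = (\<lambda>j x. c j x * c' j (\<pi> j x))"
  have rb: "isrel d f \<rho> b"
    using r r' by (auto simp: isrel_def \<rho>_def b_def norm_mult inj_on_def)
  have pm: "pm \<rho> xs = pm \<pi>' (pm \<pi> xs)" for xs by (rule nth_equalityI) (auto simp: \<rho>_def)
  have "mact d f \<rho> b a = T' (T a)" for a
  proof (rule mact_eqI[OF rb])
    show "supp f (T' (T a))" by (simp add: T' supp_mact)
    fix xs assume xs: "xs \<in> ibox d"
    have "T' (T a) (pm \<rho> xs) = (\<Prod>j<length e. c' j (pm \<pi> xs ! j)) * T a (pm \<pi> xs)"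
      unfolding pm T' by (rule mact_pm[OF r' pm_in_box[OF r xs]])
    also have "\<dots> = (\<Prod>j<length e. c' j (pm \<pi> xs ! j)) * ((\<Prod>j<length d. c j (xs ! j)) * a xs)"
      unfolding T mact_pm[OF r xs] ..
    also have "(\<Prod>j<length e. c' j (pm \<pi> xs ! j)) = (\<Prod>j<length d. c' j (\<pi> j (xs ! j)))"
      using r xs by (intro prod.cong) (auto simp: isrel_def length_box)
    finally show "T' (T a) (pm \<rho> xs) = (\<Prod>j<length d. b j (xs ! j)) * a xs"
      by (simp add: b_def prod.distrib)
  next
    fix zs assume zs: "zs \<notin> pm \<rho> ` ibox d"
    show "T' (T a) zs = 0"
    proof (cases "zs \<in> pm \<pi>' ` ibox e")
      case False then show ?thesis unfolding T' by (rule mact_notin)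
    next
      case True
      then obtain ys where ys: "zs = pm \<pi>' ys" "ys \<in> ibox e" by blast
      then have "ys \<notin> pm \<pi> ` ibox d" using zs pm by auto
      then have "T a ys = 0" unfolding T by (rule mact_notin)
      then show ?thesis unfolding ys(1) T' mact_pm[OF r' ys(2)] by simp
    qed
  qed
  then show ?thesis using rb by (auto simp: rl_def)
qed

lemma rl_swap:
  assumes l: "length d = length f"
  shows "\<exists>T. rl (dmul d f) (dmul f d) T \<and> (\<forall>a b. T (tn d a f b) = tn f b d a)"
proof -
  define \<pi> where "\<pi> = (\<lambda>j x. (x mod f ! j) * d ! j + x div f ! j)"
  have r: "isrel (dmul d f) (dmul f d) \<pi> (\<lambda>_ _. 1)"
    unfolding isrel_def
  proof (intro conjI allI impI)
    fix j x assume j: "j < length (dmul d f)" and x: "x < dmul d f ! j"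
    then have x': "x < d ! j * f ! j" and jl: "j < length d" "j < length f" by auto
    then have "f ! j > 0" by (metis mult_0_right not_gr_zero not_less_zero)
    then show "\<pi> j x < dmul f d ! j"
      using x' jl by (simp add: \<pi>_def mult_add_less less_mult_imp_div_less)
  next
    fix j assume j: "j < length (dmul d f)"
    show "inj_on (\<pi> j) {..<dmul d f ! j}"
    proof (rule inj_onI)
      fix x y assume "x \<in> {..<dmul d f ! j}" "y \<in> {..<dmul d f ! j}" and eq: "\<pi> j x = \<pi> j y"
      then have "x < d ! j * f ! j" "y < d ! j * f ! j" using j by auto
      then have lt: "x div f ! j < d ! j" "y div f ! j < d ! j" by (auto simp: less_mult_imp_div_less)
      have "\<pi> j x div d ! j = x mod f ! j" "\<pi> j y div d ! j = y mod f ! j"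
        "\<pi> j x mod d ! j = x div f ! j" "\<pi> j y mod d ! j = y div f ! j" using lt by (auto simp: \<pi>_def)
      then show "x = y" using eq by (metis div_mult_mod_eq)
    qed
  qed (use l in auto)
  have pj: "pm \<pi> (join f xs ys) = join d ys xs" if "xs \<in> ibox d" "ys \<in> ibox f" for xs ys
  proof (rule nth_equalityI)
    fix j assume "j < length (pm \<pi> (join f xs ys))"
    then have j: "j < length f" "j < length d" using l by auto
    have "ys ! j < f ! j" using nth_box[OF that(2)] j by simp
    then show "pm \<pi> (join f xs ys) ! j = join d ys xs ! j" using j by (simp add: \<pi>_def)
  qed (use l in simp)
  have "mact (dmul d f) (dmul f d) \<pi> (\<lambda>_ _. 1) (tn d a f b) = tn f b d a" for a b
  proof (rule mact_eqI[OF r supp_tn])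
    fix zs assume "zs \<in> ibox (dmul d f)"
    then obtain xs ys where z: "xs \<in> ibox d" "ys \<in> ibox f" "zs = join f xs ys" using box_dmul_cases[OF l] by blast
    then show "tn f b d a (pm \<pi> zs) = (\<Prod>j<length (dmul d f). 1) * tn d a f b zs"
      using pj l by (simp add: tn_join)
  next
    fix zs assume "zs \<in> ibox (dmul f d)" and n: "zs \<notin> pm \<pi> ` ibox (dmul d f)"
    then obtain ys xs where z: "ys \<in> ibox f" "xs \<in> ibox d" "zs = join d ys xs" using box_dmul_cases[OF l[symmetric]] by blast
    then have "zs = pm \<pi> (join f xs ys)" using pj by simp
    then show "tn f b d a zs = 0" using n join_in_box[OF l z(2,1)] by blast
  qed
  then show ?thesis using r by (auto simp: rl_def)
qed

lemma rl_tensR: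
  assumes T: "rl d e T" and l: "length d = length f"
  shows "\<exists>U. rl (dmul d f) (dmul e f) U \<and> (\<forall>a b. U (tn d a f b) = tn e (T a) f b)"
proof -
  obtain \<pi> c where r: "isrel d e \<pi> c" and T: "T = mact d e \<pi> c" using T by (auto simp: rl_def)
  have le: "length e = length f" using r l by (simp add: isrel_def)
  define \<rho> where "\<rho> = (\<lambda>j x. \<pi> j (x div f ! j) * f ! j + x mod f ! j)"
  define b where "b = (\<lambda>j x. c j (x div f ! j))"
  have rb: "isrel (dmul d f) (dmul e f) \<rho> b"
    unfolding isrel_def
  proof (intro conjI allI impI)
    fix j x assume j: "j < length (dmul d f)" and x: "x < dmul d f ! j"
    then have x': "x < d ! j * f ! j" and jl: "j < length d" "j < length f" "j < length e" using le by auto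
    then have f: "f ! j > 0" by (metis mult_0_right not_gr_zero not_less_zero)
    have "x div f ! j < d ! j" using x' by (simp add: less_mult_imp_div_less)
    then show "\<rho> j x < dmul e f ! j" "cmod (b j x) = 1"
      using r jl f by (auto simp: \<rho>_def b_def isrel_def mult_add_less)
  next
    fix j assume j: "j < length (dmul d f)"
    show "inj_on (\<rho> j) {..<dmul d f ! j}"
    proof (rule inj_onI)
      fix x y assume "x \<in> {..<dmul d f ! j}" "y \<in> {..<dmul d f ! j}" and eq: "\<rho> j x = \<rho> j y"
      then have lt: "x < d ! j * f ! j" "y < d ! j * f ! j" and jl: "j < length d" "j < length f" using j by auto
      then have f: "f ! j > 0" by (metis mult_0_right not_gr_zero not_less_zero)
      have "\<rho> j x mod f ! j = x mod f ! j" "\<rho> j y mod f ! j = y mod f ! j" by (auto simp: \<rho>_def)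
      then have m: "x mod f ! j = y mod f ! j" using eq by simp
      then have "\<pi> j (x div f ! j) = \<pi> j (y div f ! j)" using eq f by (simp add: \<rho>_def)
      moreover have "x div f ! j < d ! j" "y div f ! j < d ! j" using lt by (auto simp: less_mult_imp_div_less)
      ultimately have "x div f ! j = y div f ! j" using r jl by (auto simp: isrel_def inj_on_def)
      then show "x = y" using m by (metis div_mult_mod_eq)
    qed
  qed (use l le in auto)
  have pj: "pm \<rho> (join f xs ys) = join f (pm \<pi> xs) ys" if "xs \<in> ibox d" "ys \<in> ibox f" for xs ys
  proof (rule nth_equalityI)
    fix j assume "j < length (pm \<rho> (join f xs ys))"
    then have j: "j < length f" "j < length xs" using l that by (auto simp: length_box)
    have "ys ! j < f ! j" using nth_box[OF that(2)] j by simp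
    then show "pm \<rho> (join f xs ys) ! j = join f (pm \<pi> xs) ys ! j" using j by (simp add: \<rho>_def)
  qed (use l in simp)
  have "mact (dmul d f) (dmul e f) \<rho> b (tn d a f b') = tn e (T a) f b'" for a b'
  proof (rule mact_eqI[OF rb supp_tn])
    fix zs assume "zs \<in> ibox (dmul d f)"
    then obtain xs ys where z: "xs \<in> ibox d" "ys \<in> ibox f" "zs = join f xs ys" using box_dmul_cases[OF l] by blast
    have "(\<Prod>j<length (dmul d f). b j (zs ! j)) = (\<Prod>j<length d. c j (xs ! j))"
      using z l nth_box[OF z(2)] by (intro prod.cong) (auto simp: b_def)
    then show "tn e (T a) f b' (pm \<rho> zs) = (\<Prod>j<length (dmul d f). b j (zs ! j)) * tn d a f b' zs"
      using z pj pm_in_box[OF r] l le by (simp add: tn_join T mact_pm[OF r])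
  next
    fix zs assume "zs \<in> ibox (dmul e f)" and n: "zs \<notin> pm \<rho> ` ibox (dmul d f)"
    then obtain us ys where z: "us \<in> ibox e" "ys \<in> ibox f" "zs = join f us ys" using box_dmul_cases[OF le] by blast
    have "us \<notin> pm \<pi> ` ibox d"
    proof
      assume "us \<in> pm \<pi> ` ibox d"
      then obtain xs where xs: "us = pm \<pi> xs" "xs \<in> ibox d" by blast
      then have "zs = pm \<rho> (join f xs ys)" using z pj by simp
      then show False using n join_in_box[OF l xs(2) z(2)] by blast
    qed
    then have "T a us = 0" unfolding T by (rule mact_notin)
    then show "tn e (T a) f b' zs = 0" using z le by (simp add: tn_join)
  qed
  then show ?thesis using rb by (auto simp: rl_def)
qed

lemma rl_tensL:
  assumes T: "rl d e T" and l: "length d = length f"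
  shows "\<exists>U. rl (dmul f d) (dmul f e) U \<and> (\<forall>a b. U (tn f b d a) = tn f b e (T a))"
proof -
  have le: "length e = length f" using rl_length[OF T] l by simp
  obtain U1 where U1: "rl (dmul f d) (dmul d f) U1" "\<forall>a b. U1 (tn f a d b) = tn d b f a" using rl_swap[OF l[symmetric]] by blast
  obtain U2 where U2: "rl (dmul d f) (dmul e f) U2" "\<forall>a b. U2 (tn d a f b) = tn e (T a) f b" using rl_tensR[OF T l] by blast
  obtain U3 where U3: "rl (dmul e f) (dmul f e) U3" "\<forall>a b. U3 (tn e a f b) = tn f b e a" using rl_swap[OF le] by blast
  obtain V where V: "rl (dmul f d) (dmul e f) V" "\<forall>a. V a = U2 (U1 a)" using rl_comp[OF U1(1) U2(1)] by blast
  obtain W where W: "rl (dmul f d) (dmul f e) W" "\<forall>a. W a = U3 (V a)" using rl_comp[OF V(1) U3(1)] by blast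
  show ?thesis using W V(2) U1(2) U2(2) U3(2) by (intro exI[of _ W]) simp
qed

definition relab :: "pv \<Rightarrow> pv \<Rightarrow> bool" where
  "relab s t \<longleftrightarrow> (\<exists>T. rl (fst s) (fst t) T \<and> snd t = T (snd s))"

lemma relab_refl: "s \<in> St k \<Longrightarrow> relab s s"
  unfolding relab_def rl_def
  by (intro exI[of _ "mact (fst s) (fst s) (\<lambda>j x. x) (\<lambda>j x. 1)"] conjI exI[of _ "\<lambda>j x. x"] exI[of _ "\<lambda>j x. 1"])
     (auto simp: isrel_def mact_id St_def)

lemma relab_trans: "relab s t \<Longrightarrow> relab t u \<Longrightarrow> relab s u"
  unfolding relab_def
proof (elim exE conjE)
  fix T T' assume T: "rl (fst s) (fst t) T" "snd t = T (snd s)" "rl (fst t) (fst u) T'" "snd u = T' (snd t)"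
  obtain U where "rl (fst s) (fst u) U" "\<forall>a. U a = T' (T a)" using rl_comp[OF T(1,3)] by blast
  then show "\<exists>T. rl (fst s) (fst u) T \<and> snd u = T (snd s)" using T by auto
qed

lemma relab_swap: "s \<in> St k \<Longrightarrow> t \<in> St k \<Longrightarrow> relab (tens s t) (tens t s)"
  using rl_swap[of "fst s" "fst t"] St_length[of s k] St_length[of t k] by (auto simp: relab_def tens_def)

lemma relab_tensR:
  assumes "relab s t" "s \<in> St k" "u \<in> St k"
  shows "relab (tens s u) (tens t u)"
proof -
  obtain T where T: "rl (fst s) (fst t) T" "snd t = T (snd s)" using assms by (auto simp: relab_def)
  show ?thesis using rl_tensR[OF T(1), of "fst u"] T(2) St_length[OF assms(2)] St_length[OF assms(3)]
    by (auto simp: relab_def tens_def)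
qed

lemma relab_tensL:
  assumes "relab s t" "s \<in> St k" "u \<in> St k"
  shows "relab (tens u s) (tens u t)"
proof -
  obtain T where T: "rl (fst s) (fst t) T" "snd t = T (snd s)" using assms by (auto simp: relab_def)
  show ?thesis using rl_tensL[OF T(1), of "fst u"] T(2) St_length[OF assms(2)] St_length[OF assms(3)]
    by (auto simp: relab_def tens_def)
qed

lemma relab_conv:
  assumes "relab s t" "s \<in> St k" "t \<in> St k" "conv t u p"
  shows "conv s u p"
proof -
  obtain T where T: "rl (fst s) (fst t) T" "snd t = T (snd s)" using assms by (auto simp: relab_def)
  show ?thesis
    unfolding conv_def
  proof (rule rl_pay[OF T(1)])
    show "supp (fst s) (snd s)" using assms by (simp add: St_def)
    show "\<forall>x\<in>set (fst t). 0 < x" using St_pos[OF assms(3)] by blast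
    show "pay (target u) (fst t) (T (snd s)) p" using assms(4) T(2) by (simp add: conv_def)
  qed (rule target_antimono)
qed

lemma pay_supp:
  "pay H d a p \<Longrightarrow> supp d a \<Longrightarrow> pay (\<lambda>d v q. supp d v \<and> H d v q) d a p"
proof (induction rule: pay.induct)
  case (leaf d a p) then show ?case by (intro pay.leaf) auto
next
  case (round j d m L a q p)
  then show ?case by (intro pay.round[OF round(1,2) _ round(3)]) (auto simp: supp_lact)
qed

lemma conv_relab:
  assumes "conv s t p" "relab t u" "s \<in> St k" "u \<in> St k"
  shows "conv s u p"
proof -
  obtain T where T: "rl (fst t) (fst u) T" "snd u = T (snd t)" using assms by (auto simp: relab_def)
  have "pay (\<lambda>d v q. supp d v \<and> target t d v q) (fst s) (snd s) p"
    using assms pay_supp by (auto simp: conv_def St_def)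
  then show ?thesis
    unfolding conv_def
  proof (rule pay_bind)
    fix d v q assume h: "supp d v \<and> target t d v q"
    then have d: "d = fst t" by (simp add: target_def)
    show "pay (target u) d v q"
      unfolding d
    proof (rule rl_pay[OF T(1)])
      show "supp (fst t) v" using h d by simp
      show "\<forall>x\<in>set (fst u). 0 < x" using St_pos[OF assms(4)] by blast
      have "ip (fst u) (snd u) (T v) = ip (fst t) (snd t) v" unfolding T(2) by (rule rl_ip[OF T(1)])
      then show "pay (target u) (fst u) (T v) q" using h by (intro pay.leaf) (auto simp: target_def)
    qed (rule target_antimono)
  qed
qed

lemma dmul_assoc: "dmul (dmul d f) h = dmul d (dmul f h)"
  by (rule nth_equalityI) (auto simp: mult.assoc)

lemma tn_assoc:
  assumes l: "length d = length f" "length f = length h"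
  shows "tn (dmul d f) (tn d a f b) h c = tn d a (dmul f h) (tn f b h c)"
proof (rule tn_eqI)
  show "length d = length (dmul f h)" using l by simp
  show "supp (dmul d (dmul f h)) (tn (dmul d f) (tn d a f b) h c)"
    using supp_tn[of "dmul d f" h] by (simp add: dmul_assoc)
  fix xs ws assume xs: "xs \<in> ibox d" and "ws \<in> ibox (dmul f h)"
  then obtain ys zs where z: "ys \<in> ibox f" "zs \<in> ibox h" "ws = join h ys zs" using box_dmul_cases[OF l(2)] by blast
  have "join (dmul f h) xs ws = join h (join f xs ys) zs"
    using l z by (intro nth_equalityI) (auto simp: algebra_simps)
  then show "tn (dmul d f) (tn d a f b) h c (join (dmul f h) xs ws) = a xs * tn f b h c ws"
    using z xs l join_in_box[OF l(1)] by (simp add: tn_join)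
qed

lemma tens_assoc: "s \<in> St k \<Longrightarrow> t \<in> St k \<Longrightarrow> u \<in> St k \<Longrightarrow> tens (tens s t) u = tens s (tens t u)"
  using tn_assoc[of "fst s" "fst t" "fst u"] St_length[of s k] St_length[of t k] St_length[of u k]
  by (simp add: tens_def dmul_assoc)

section \<open>Products of lists and multisets of states\<close>

definition unit :: "nat \<Rightarrow> pv" where
  "unit k = (replicate k 1, \<lambda>xs. if xs = replicate k 0 then 1 else 0)"

lemma box_ones: "ibox (replicate n (1::nat)) = {replicate n 0}"
  by (induction n) (auto simp: box_Cons)

lemma box_ones_Suc: "ibox (replicate n (Suc 0)) = {replicate n 0}"
  using box_ones by simp

lemma unit_St: "unit k \<in> St k"
  by (auto simp: St_def unit_def valid_dims_def supp_def box_ones_Suc box_ones nrm_def)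

lemma tens_unit_left: "s \<in> St k \<Longrightarrow> tens (unit k) s = s"
proof -
  assume s: "s \<in> St k"
  then have l: "length (fst s) = k" by (rule St_length)
  have d: "dmul (replicate k 1) (fst s) = fst s" using l by (intro nth_equalityI) auto
  have "snd s = tn (replicate k 1) (snd (unit k)) (fst s) (snd s)"
  proof (rule tn_eqI)
    show "supp (dmul (replicate k 1) (fst s)) (snd s)" using s unfolding d by (simp add: St_def)
    fix xs ys assume "xs \<in> ibox (replicate k 1)" "ys \<in> ibox (fst s)"
    then have xs: "xs = replicate k 0" and ly: "length ys = k" using l by (auto simp: box_ones_Suc length_box)
    have "join (fst s) xs ys = ys" unfolding xs using l ly by (intro nth_equalityI) auto
    then show "snd s (join (fst s) xs ys) = snd (unit k) xs * snd s ys" by (simp add: xs unit_def)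
  qed (use l in simp)
  then show ?thesis using d by (simp add: tens_def unit_def prod_eq_iff)
qed

lemma tens_unit_right: "s \<in> St k \<Longrightarrow> tens s (unit k) = s"
proof -
  assume s: "s \<in> St k"
  then have l: "length (fst s) = k" by (rule St_length)
  have d: "dmul (fst s) (replicate k 1) = fst s" using l by (intro nth_equalityI) auto
  have "snd s = tn (fst s) (snd s) (replicate k 1) (snd (unit k))"
  proof (rule tn_eqI)
    show "supp (dmul (fst s) (replicate k 1)) (snd s)" using s unfolding d by (simp add: St_def)
    fix ys xs assume "xs \<in> ibox (replicate k 1)" "ys \<in> ibox (fst s)"
    then have xs: "xs = replicate k 0" and ly: "length ys = k" using l by (auto simp: box_ones_Suc length_box)
    have "join (replicate k 1) ys xs = ys" unfolding xs using l ly by (intro nth_equalityI) auto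
    then show "snd s (join (replicate k 1) ys xs) = snd s ys * snd (unit k) xs" by (simp add: xs unit_def)
  qed (use l in simp)
  then show ?thesis using d by (simp add: tens_def unit_def prod_eq_iff)
qed

definition prodl :: "nat \<Rightarrow> pv list \<Rightarrow> pv" where "prodl k xs = foldr tens xs (unit k)"

lemma prodl_Nil [simp]: "prodl k [] = unit k" by (simp add: prodl_def)

lemma prodl_Cons [simp]: "prodl k (x # xs) = tens x (prodl k xs)" by (simp add: prodl_def)

lemma prodl_St: "set xs \<subseteq> St k \<Longrightarrow> prodl k xs \<in> St k"
  by (induction xs) (auto simp: unit_St tens_St)

lemma prodl_append: "set xs \<subseteq> St k \<Longrightarrow> set ys \<subseteq> St k \<Longrightarrow> prodl k (xs @ ys) = tens (prodl k xs) (prodl k ys)"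
  by (induction xs) (auto simp: tens_unit_left prodl_St tens_assoc[of _ k])

lemma relab_perm:
  "mset xs = mset ys \<Longrightarrow> set xs \<subseteq> St k \<Longrightarrow> relab (prodl k xs) (prodl k ys)"
proof (induction xs arbitrary: ys)
  case Nil then show ?case by (simp add: relab_refl[OF unit_St])
next
  case (Cons x xs)
  have "x \<in> set ys" using Cons.prems by (metis list.set_intros(1) set_mset_mset)
  then obtain ys1 ys2 where ys: "ys = ys1 @ x # ys2" by (meson split_list)
  have m: "mset xs = mset (ys1 @ ys2)" using Cons.prems ys by simp
  have "set xs = set ys1 \<union> set ys2" using arg_cong[OF m, of set_mset] by simp
  then have St: "x \<in> St k" "set xs \<subseteq> St k" "set ys1 \<subseteq> St k" "set ys2 \<subseteq> St k"
    using Cons.prems(2) by auto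
  have 1: "prodl k ys1 \<in> St k" "prodl k ys2 \<in> St k" using St prodl_St by auto
  have "relab (tens x (prodl k xs)) (tens x (prodl k (ys1 @ ys2)))"
    using Cons.IH[OF m St(2)] St prodl_St by (intro relab_tensL) auto
  also have "tens x (prodl k (ys1 @ ys2)) = tens (tens x (prodl k ys1)) (prodl k ys2)"
    using prodl_append[OF St(3,4)] tens_assoc[OF St(1) 1] by simp
  finally have a: "relab (tens x (prodl k xs)) (tens (tens x (prodl k ys1)) (prodl k ys2))" .
  have "relab (tens (tens x (prodl k ys1)) (prodl k ys2)) (tens (tens (prodl k ys1) x) (prodl k ys2))"
    using St 1 by (intro relab_tensR relab_swap) (auto intro: tens_St)
  also have "tens (tens (prodl k ys1) x) (prodl k ys2) = prodl k ys"
    using prodl_append[of ys1 k "x # ys2"] St 1 by (simp add: ys tens_assoc[of _ k])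
  finally show ?case using a relab_trans by simp
qed

text \<open>The order of the factors is an arbitrary choice; by \<open>relab_perm\<close> another
  order gives the same state up to a local relabelling.\<close>

definition Pm :: "nat \<Rightarrow> pv multiset \<Rightarrow> pv" where "Pm k M = prodl k (SOME xs. mset xs = M)"

definition cvm :: "nat \<Rightarrow> pv multiset \<Rightarrow> pv multiset \<Rightarrow> real \<Rightarrow> bool" where
  "cvm k M N p \<longleftrightarrow> conv (Pm k M) (Pm k N) p"

lemma Pm_list: "mset (SOME xs. mset xs = M) = M" by (metis (mono_tags) ex_mset someI)

lemma Pm_set: "set (SOME xs. mset xs = M) = set_mset M" by (metis Pm_list set_mset_mset)

lemma Pm_St: "set_mset M \<subseteq> St k \<Longrightarrow> Pm k M \<in> St k"
  unfolding Pm_def by (rule prodl_St) (simp add: Pm_set)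

lemma relab_Pm:
  assumes "set xs \<subseteq> St k"
  shows "relab (prodl k xs) (Pm k (mset xs))" "relab (Pm k (mset xs)) (prodl k xs)"
  unfolding Pm_def using assms by (auto intro!: relab_perm simp: Pm_list Pm_set)

lemma cvm_list:
  assumes "set xs \<subseteq> St k" "set ys \<subseteq> St k"
  shows "cvm k (mset xs) (mset ys) p \<longleftrightarrow> conv (prodl k xs) (prodl k ys) p"
proof -
  have *: "prodl k xs \<in> St k" "prodl k ys \<in> St k" "Pm k (mset xs) \<in> St k" "Pm k (mset ys) \<in> St k"
    using assms by (auto intro: prodl_St intro!: Pm_St)
  show ?thesis
    unfolding cvm_def
    using relab_conv[OF relab_Pm(1)[OF assms(1)] *(1,3)] relab_conv[OF relab_Pm(2)[OF assms(1)] *(3,1)]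
      conv_relab[OF _ relab_Pm(1)[OF assms(2)] _ *(4)] conv_relab[OF _ relab_Pm(2)[OF assms(2)] _ *(2)] *
    by blast
qed

lemma cvm_add:
  assumes "set_mset M \<subseteq> St k" "set_mset N \<subseteq> St k" "set_mset K \<subseteq> St k" "cvm k M N p"
  shows "cvm k (M + K) (N + K) p"
proof -
  obtain xs ys zs where l: "M = mset xs" "N = mset ys" "K = mset zs" by (metis ex_mset)
  have s: "set xs \<subseteq> St k" "set ys \<subseteq> St k" "set zs \<subseteq> St k" using assms l by auto
  have "conv (prodl k xs) (prodl k ys) p" using assms(4) l cvm_list s by simp
  then have "conv (prodl k (xs @ zs)) (prodl k (ys @ zs)) p"
    unfolding prodl_append[OF s(1,3)] prodl_append[OF s(2,3)] by (intro conv_tens[of _ _ _ k] prodl_St s)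
  then have "cvm k (mset (xs @ zs)) (mset (ys @ zs)) p" by (subst cvm_list) (use s in auto)
  then show ?thesis using l by simp
qed

lemma sum_nrm_leaf: "(\<Sum>y\<in>ibox f. (cmod (b y))\<^sup>2) = nrm f b" by (simp add: nrm_def)

lemma prod_indicator: "(\<Prod>j<(n::nat). if P j then (1::complex) else 0) = (if \<forall>j<n. P j then 1 else 0)"
  by (induction n) (auto simp: less_Suc_eq)

text \<open>All parties measure the second factor in the computational basis. The outcome
  \<open>y\<close> has probability \<open>(cmod (b y))\<^sup>2\<close> and leaves the first factor
  intact up to a scalar.\<close>

lemma conv_discard:
  assumes s: "s \<in> St k" and t: "t \<in> St k"
  shows "conv (tens s t) s 1"
proof -
  define d a f b where "d = fst s" and "a = snd s" and "f = fst t" and "b = snd t"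
  have l: "length d = k" "length f = k" using s t St_length by (auto simp: d_def f_def)
  have pos: "0 < d ! j" "0 < f ! j" if "j < k" for j using St_pos' s t that by (auto simp: d_def f_def)
  have nb: "nrm f b = 1" "nrm d a = 1" "supp d a" using s t by (auto simp: St_def b_def f_def a_def d_def)
  define \<pi> where "\<pi> = (\<lambda>j x. x div f ! j)"
  define lam where "lam = (\<lambda>j t x. if x mod f ! j = t then (1::complex) else 0)"
  have m: "mact (dmul d f) d \<pi> (\<lambda>j. lam j (y ! j)) (tn d a f b) = (\<lambda>xs. b y * a xs)" if y: "y \<in> ibox f" for y
  proof (rule supp_ext[OF supp_mact])
    show "supp d (\<lambda>xs. b y * a xs)" using nb by (simp add: supp_def)
    fix zs assume zs: "zs \<in> ibox d"
    have 1: "pm \<pi> (join f xs ys) = xs" if "xs \<in> ibox d" "ys \<in> ibox f" for xs ys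
      using that l nth_box[OF that(2)] by (intro nth_equalityI) (auto simp: \<pi>_def length_box)
    have 2: "(\<Prod>j<k. lam j (y ! j) (join f xs ys ! j)) = (if ys = y then 1 else 0)" if "ys \<in> ibox f" for xs ys
    proof -
      have "(\<Prod>j<k. lam j (y ! j) (join f xs ys ! j)) = (\<Prod>j<k. if ys ! j = y ! j then 1 else 0)"
        using l nth_box[OF that] by (intro prod.cong) (auto simp: lam_def)
      also have "\<dots> = (if \<forall>j<k. ys ! j = y ! j then 1 else 0)" by (rule prod_indicator)
      also have "(\<forall>j<k. ys ! j = y ! j) \<longleftrightarrow> ys = y"
        using that y l by (auto simp: list_eq_iff_nth_eq length_box)
      finally show ?thesis .
    qed
    have ldf: "length d = length f" and lk: "length (dmul d f) = k" using l by auto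
    have "mact (dmul d f) d \<pi> (\<lambda>j. lam j (y ! j)) (tn d a f b) zs
      = (\<Sum>xs\<in>ibox d. \<Sum>ys\<in>ibox f. if pm \<pi> (join f xs ys) = zs then
           (\<Prod>j<k. lam j (y ! j) (join f xs ys ! j)) * tn d a f b (join f xs ys) else 0)"
      unfolding mact_def lk using zs by (simp add: sum_box_dmul[OF ldf] del: nth_join)
    also have "\<dots> = (\<Sum>xs\<in>ibox d. \<Sum>ys\<in>ibox f. if xs = zs then (if ys = y then a zs * b y else 0) else 0)"
      by (intro sum.cong refl) (simp add: 1 2 tn_join[OF ldf zs y] del: nth_join)
    also have "\<dots> = b y * a zs" using zs y by (simp add: sum.swap[of _ "ibox f"])
    finally show "mact (dmul d f) d \<pi> (\<lambda>j. lam j (y ! j)) (tn d a f b) zs = b y * a zs" .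
  qed
  have "pay (target s) (dmul d f) (tn d a f b) 1"
  proof (rule pay_monomial[where e = d and m = f and \<pi> = \<pi> and lam = lam and q = "\<lambda>y. (cmod (b y))\<^sup>2"])
    show "\<pi> j x < d ! j" if "j < length (dmul d f)" "x < dmul d f ! j" for j x
      using that l by (simp add: \<pi>_def less_mult_imp_div_less)
    show "(\<Sum>t<f ! j. cnj (lam j t x) * lam j t x') = (if x = x' then 1 else 0)"
      if "j < length (dmul d f)" "x < dmul d f ! j" "x' < dmul d f ! j" "\<pi> j x = \<pi> j x'" for j x x'
    proof -
      have "(\<Sum>t<f ! j. cnj (lam j t x) * lam j t x') = (\<Sum>t<f ! j. if t = x mod f ! j then (if x mod f ! j = x' mod f ! j then 1 else 0) else 0)"
        by (intro sum.cong refl) (auto simp: lam_def)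
      also have "\<dots> = (if x mod f ! j = x' mod f ! j then 1 else 0)" using pos(2)[of j] that l by simp
      also have "\<dots> = (if x = x' then 1 else 0)"
        using that(4) unfolding \<pi>_def by (metis div_mult_mod_eq)
      finally show ?thesis .
    qed
    show "pay (target s) d (mact (dmul d f) d \<pi> (\<lambda>j. lam j (y ! j)) (tn d a f b)) ((cmod (b y))\<^sup>2)"
      if "y \<in> ibox f" for y
      unfolding m[OF that]
      by (rule pay.leaf) (use nb in \<open>simp add: target_def ip_scale ip_self norm_mult flip: a_def d_def\<close>)
    show "1 \<le> (\<Sum>y\<in>ibox f. (cmod (b y))\<^sup>2)" using nb by (simp add: sum_nrm_leaf)
  qed (use l pos supp_tn target_antimono in auto)
  then show ?thesis by (simp add: conv_def tens_def d_def f_def a_def b_def)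
qed

text \<open>For payoff 0 only the local dimensions have to match: every party measures its basis and
  prepares the label 0.\<close>

lemma conv_zero:
  assumes s: "s \<in> St k" and t: "t \<in> St k"
  shows "conv s t 0"
  unfolding conv_def
proof (rule pay_monomial[where e = "fst t" and m = "fst s" and \<pi> = "\<lambda>j x. 0" and
      lam = "\<lambda>j t x. if x = t then 1 else 0" and q = "\<lambda>y. 0"])
  have l: "length (fst s) = k" "length (fst t) = k" using s t St_length by auto
  show "length (fst t) = length (fst s)" using l by simp
  show "supp (fst s) (snd s)" using s by (simp add: St_def)
  show "0 < fst t ! j" "0 < fst t ! j" if "j < length (fst s)" for j using St_pos'[OF t] that l by auto
  show "(\<Sum>t<fst s ! j. cnj (if x = t then 1 else 0) * (if x' = t then 1 else (0::complex))) = (if x = x' then 1 else 0)"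
    if "x < fst s ! j" for j x x'
  proof -
    have "(\<Sum>t<fst s ! j. cnj (if x = t then 1 else 0) * (if x' = t then 1 else (0::complex)))
      = (\<Sum>t<fst s ! j. if t = x then (if x = x' then 1 else 0) else 0)" by (intro sum.cong refl) auto
    then show ?thesis using that by simp
  qed
qed (auto simp: target_def intro!: pay.leaf)

lemma cvm_discard:
  assumes "set_mset M \<subseteq> St k" "set_mset N \<subseteq> St k"
  shows "cvm k (M + N) M 1"
proof -
  obtain xs ys where l: "M = mset xs" "N = mset ys" by (metis ex_mset)
  have s: "set xs \<subseteq> St k" "set ys \<subseteq> St k" using assms l by auto
  have "conv (prodl k (xs @ ys)) (prodl k xs) 1"
    unfolding prodl_append[OF s] by (intro conv_discard[of _ k] prodl_St s)
  then have "cvm k (mset (xs @ ys)) (mset xs) 1" by (subst cvm_list) (use s in auto)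
  then show ?thesis using l by simp
qed

section \<open>GHZ states\<close>

definition ghz :: "nat \<Rightarrow> nat \<Rightarrow> pv" where
  "ghz k r = (replicate k r, \<lambda>xs. if \<exists>i<r. xs = replicate k i then complex_of_real (1 / sqrt (real r)) else 0)"

lemma replicate_in_box [simp]: "i < r \<Longrightarrow> replicate k i \<in> ibox (replicate k r)" by (simp add: ibox_def)

lemma replicate_eq: "0 < k \<Longrightarrow> replicate k i = replicate k j \<longleftrightarrow> i = j" by (simp add: replicate_eq_replicate)

lemma sum_diag:
  fixes h :: "nat list \<Rightarrow> 'b::comm_monoid_add"
  assumes k: "0 < k"
  shows "(\<Sum>xs\<in>ibox (replicate k r). if \<exists>i<r. xs = replicate k i then h xs else 0) = (\<Sum>i<r. h (replicate k i))"
proof -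
  have inj: "inj_on (replicate k) {..<r}" using k by (auto simp: inj_on_def replicate_eq)
  have "(\<Sum>xs\<in>ibox (replicate k r). if \<exists>i<r. xs = replicate k i then h xs else 0) = (\<Sum>xs\<in>replicate k ` {..<r}. h xs)"
    by (rule sum.mono_neutral_cong_right) auto
  also have "\<dots> = (\<Sum>i<r. h (replicate k i))" by (simp add: sum.reindex[OF inj])
  finally show ?thesis .
qed

lemma ghz_St: "0 < k \<Longrightarrow> 0 < r \<Longrightarrow> ghz k r \<in> St k"
proof -
  assume k: "0 < k" and r: "0 < r"
  have "nrm (replicate k r) (snd (ghz k r)) = (\<Sum>xs\<in>ibox (replicate k r). if \<exists>i<r. xs = replicate k i then 1 / real r else 0)"
    unfolding nrm_def ghz_def snd_conv by (intro sum.cong refl) (auto simp: norm_divide power_divide)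
  also have "\<dots> = 1" using r by (simp add: sum_diag[OF k])
  finally show ?thesis using k r by (auto simp: St_def ghz_def valid_dims_def supp_def)
qed

lemma ghz_one: "ghz k 1 = unit k" by (auto simp: ghz_def unit_def)

lemma ghz_mult:
  assumes k: "0 < k"
  shows "tens (ghz k r) (ghz k r') = ghz k (r * r')"
proof -
  have d: "dmul (replicate k r) (replicate k r') = replicate k (r * r')" by (rule nth_equalityI) auto
  have "snd (ghz k (r * r')) = tn (replicate k r) (snd (ghz k r)) (replicate k r') (snd (ghz k r'))"
  proof (rule tn_eqI)
    show "supp (dmul (replicate k r) (replicate k r')) (snd (ghz k (r * r')))"
      unfolding d by (auto simp: supp_def ghz_def)
    fix xs ys assume xs: "xs \<in> ibox (replicate k r)" and ys: "ys \<in> ibox (replicate k r')"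
    have l: "length xs = k" "length ys = k" using xs ys by (auto simp: length_box)
    have "(\<exists>i<r * r'. join (replicate k r') xs ys = replicate k i) \<longleftrightarrow> (\<exists>i<r. xs = replicate k i) \<and> (\<exists>i<r'. ys = replicate k i)"
    proof
      assume "\<exists>i<r * r'. join (replicate k r') xs ys = replicate k i"
      then obtain i where i: "i < r * r'" "join (replicate k r') xs ys = replicate k i" by blast
      have "xs ! j * r' + ys ! j = i" if "j < k" for j using arg_cong[OF i(2), of "\<lambda>l. l ! j"] that by simp
      moreover have yj: "ys ! j < r'" if "j < k" for j using nth_box[OF ys, of j] that by simp
      ultimately have e: "xs ! j = i div r'" "ys ! j = i mod r'" if "j < k" for j using that by (metis mult_add_div, metis mod_mult_self3 mod_less)
      have "xs = replicate k (i div r')" "ys = replicate k (i mod r')" using e l by (auto intro!: nth_equalityI)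
      moreover have "i div r' < r" using i(1) by (simp add: less_mult_imp_div_less)
      moreover have "i mod r' < r'" using yj[OF k] by (intro mod_less_divisor) simp
      ultimately show "(\<exists>i<r. xs = replicate k i) \<and> (\<exists>i<r'. ys = replicate k i)" by blast
    next
      assume "(\<exists>i<r. xs = replicate k i) \<and> (\<exists>i<r'. ys = replicate k i)"
      then obtain i i' where i: "i < r" "xs = replicate k i" "i' < r'" "ys = replicate k i'" by blast
      then have "join (replicate k r') xs ys = replicate k (i * r' + i')" by (intro nth_equalityI) auto
      then show "\<exists>i<r * r'. join (replicate k r') xs ys = replicate k i" using mult_add_less[OF i(1,3)] by blast
    qed
    then show "snd (ghz k (r * r')) (join (replicate k r') xs ys) = snd (ghz k r) xs * snd (ghz k r') ys"
      unfolding ghz_def snd_conv by (auto simp: real_sqrt_mult)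
  qed simp
  then show ?thesis using d by (simp add: tens_def ghz_def prod_eq_iff)
qed

lemma prodl_ghz: "0 < k \<Longrightarrow> prodl k (replicate n (ghz k r)) = ghz k (r ^ n)"
  by (induction n) (auto simp: ghz_one[unfolded One_nat_def] ghz_mult)

section \<open>Mixed-radix digits and discrete Fourier sums\<close>

lemma digits_in_box: "i < prod_list d \<Longrightarrow> digits d i \<in> ibox d"
proof (induction d arbitrary: i)
  case (Cons a d)
  then have "prod_list d > 0" by (metis list.simps(8,9) mult_0_right not_gr_zero not_less_zero prod_list.Cons)
  then show ?case using Cons by (simp add: less_mult_imp_div_less)
qed simp

lemma enc_digits: "i < prod_list d \<Longrightarrow> enc d (digits d i) = i"
proof (induction d arbitrary: i)
  case (Cons a d)
  then have "prod_list d > 0" by (metis mult_0_right not_gr_zero not_less_zero prod_list.Cons)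
  then show ?case using Cons.IH[of "i mod prod_list d"] by (simp add: div_mult_mod_eq)
qed simp

lemma enc_less: "xs \<in> ibox d \<Longrightarrow> enc d xs < prod_list d"
proof (induction d arbitrary: xs)
  case (Cons a d)
  then obtain y ys where "xs = y # ys" by (cases xs) (auto simp: ibox_def)
  then show ?case using Cons by (simp add: mult_add_less)
qed simp

lemma digits_enc: "xs \<in> ibox d \<Longrightarrow> digits d (enc d xs) = xs"
proof (induction d arbitrary: xs)
  case (Cons a d)
  then obtain y ys where y: "xs = y # ys" by (cases xs) (auto simp: ibox_def)
  then show ?case using Cons enc_less[of ys d] by simp
qed simp

lemma enc_eq_sum: "length xs = length d \<Longrightarrow> enc d xs = (\<Sum>j<length d. xs ! j * prod_list (drop (Suc j) d))"
proof (induction d arbitrary: xs)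
  case (Cons a d)
  then obtain y ys where y: "xs = y # ys" by (cases xs) auto
  then show ?case using Cons by (simp add: sum.lessThan_Suc_shift del: sum.lessThan_Suc)
qed simp

lemma sum_box_digits: "sum h (ibox d) = (\<Sum>i<prod_list d. h (digits d i))"
  by (rule sum.reindex_bij_witness[of _ "digits d" "enc d"])
     (auto simp: digits_in_box enc_digits enc_less digits_enc)

lemma card_box: "card (ibox d) = prod_list d"
  using sum_box_digits[of "\<lambda>_. 1::nat" d] by simp

lemma inj_shift: "inj_on (\<lambda>i. (i + t) mod r) {..<r::nat}"
proof (rule inj_onI)
  fix i j assume ij: "i \<in> {..<r}" "j \<in> {..<r}" "(i + t) mod r = (j + t) mod r"
  then obtain p q where "(i + t) + r * p = (j + t) + r * q" by (metis nat_mod_eq_iff)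
  then have "i + r * p = j + r * q" by linarith
  then have "i mod r = j mod r" by (metis nat_mod_eq_iff)
  then show "i = j" using ij by simp
qed

lemma sum_shift:
  fixes h :: "nat \<Rightarrow> 'b::comm_monoid_add"
  shows "(\<Sum>i<r. h ((i + t) mod r)) = (\<Sum>i<r. h i)"
proof -
  have "(\<lambda>i. (i + t) mod r) ` {..<r} = {..<r}"
    by (rule endo_inj_surj[OF _ _ inj_shift]) (auto intro: mod_less_divisor)
  then show ?thesis using sum.reindex[OF inj_shift[of t r], of h] by (simp add: comp_def)
qed

lemma sum_cis_orthogonal:
  assumes i: "i < r" "j < r"
  shows "(\<Sum>z<r. cis (2 * pi * real z * (real j - real i) / real r)) = (if i = j then of_nat r else 0)"
proof (cases "i = j")
  case False
  define w where "w = cis (2 * pi * (real j - real i) / real r)"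
  have r: "real r > 0" using i by simp
  have pw: "w ^ z = cis (2 * pi * real z * (real j - real i) / real r)" for z
  proof -
    have "w ^ z = cis (real z * (2 * pi * (real j - real i) / real r))" unfolding w_def by (rule Complex.DeMoivre)
    also have "real z * (2 * pi * (real j - real i) / real r) = 2 * pi * real z * (real j - real i) / real r" by simp
    finally show ?thesis .
  qed
  have "w ^ r = cis (2 * pi * (real j - real i))" unfolding pw
    using r by (intro arg_cong[of _ _ cis]) simp
  also have "\<dots> = 1"
  proof -
    have "real j - real i = of_int (int j - int i)" by simp
    then show ?thesis by (metis cis_multiple_2pi Ints_of_int)
  qed
  finally have wr: "w ^ r = 1" .
  have "w \<noteq> 1"
  proof
    assume "w = 1"
    then have "cos (2 * pi * (real j - real i) / real r) = 1" unfolding w_def by (metis cis.simps(1) one_complex.simps(1))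
    then obtain n :: int where "2 * pi * (real j - real i) / real r = of_int n * 2 * pi" using cos_one_2pi_int by blast
    then have "2 * pi * (real j - real i) = 2 * pi * (of_int n * real r)" using r by (simp add: divide_eq_eq ac_simps)
    then have "real j - real i = of_int n * real r" by (rule iffD1[OF mult_left_cancel, rotated]) simp
    then have "real_of_int (int j - int i) = real_of_int (n * int r)" by simp
    then have "int j - int i = n * int r" by (simp only: of_int_eq_iff)
    moreover have "\<bar>int j - int i\<bar> < int r" using i by linarith
    ultimately have "\<bar>n\<bar> * int r < 1 * int r" by (simp add: abs_mult)
    then have "n = 0" by (simp only: mult_less_cancel_right) linarith
    then show False using \<open>int j - int i = n * int r\<close> False by simp
  qed
  then have "(\<Sum>z<r. w ^ z) = 0" using wr by (simp add: geometric_sum)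
  then show ?thesis using False by (simp add: pw)
qed simp

lemma prod_cis: "finite A \<Longrightarrow> (\<Prod>j\<in>A. cis (f j)) = cis (\<Sum>j\<in>A. f j)"
  by (induction A rule: finite_induct) (auto simp: cis_mult)

lemma mact_diag: "mact d d (\<lambda>j x. x) c a = (\<lambda>zs. if zs \<in> ibox d then (\<Prod>j<length d. c j (zs ! j)) * a zs else 0)"
proof -
  have "pm (\<lambda>j x. x) ys = ys" for ys by (simp add: pm_def map_nth)
  then show ?thesis by (auto simp: mact_def)
qed

text \<open>The target is a sum of \<open>\<psi> i\<close> times the basis vector with the digits of
  \<open>i\<close>. Party 0 imprints these amplitudes on the diagonal of the GHZ state by a
  measurement whose outcomes are cyclic shifts. Every party then keeps only its own digit and erases
  the rest of its label by a Fourier measurement. This leaves a phase linear in \<open>i\<close>,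
  which is a product of local phases. The three rounds appear in reverse order: as \<open>C\<close>,
  as \<open>B\<close> and as the final step.\<close>

lemma conv_from_ghz:
  assumes k: "0 < k" and s: "s \<in> St k" and r: "prod_list (fst s) \<le> r"
  shows "conv (ghz k r) s 1"
proof -
  define d a D where "d = fst s" and "a = snd s" and "D = prod_list d"
  have l: "length d = k" using s St_length by (auto simp: d_def)
  have pos: "0 < d ! j" if "j < k" for j using St_pos' s that by (auto simp: d_def)
  have na: "nrm d a = 1" "supp d a" using s by (auto simp: St_def a_def d_def)
  have D0: "0 < D"
  proof -
    have "ibox d \<noteq> {}" using na(1) by (auto simp: nrm_def)
    then show ?thesis using card_box[of d] by (metis D_def card_gt_0_iff finite_box)
  qed
  have Dr: "D \<le> r" using r by (simp add: D_def d_def)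
  have r0: "0 < r" using D0 Dr by simp
  \<comment> \<open>Padding with zeros up to the rank \<open>r\<close> makes cyclic shifts modulo
    \<open>r\<close> possible.\<close>
  define \<psi> where "\<psi> = (\<lambda>i. if i < D then a (digits d i) else 0)"
  have n\<psi>: "(\<Sum>i<r. (cmod (\<psi> i))\<^sup>2) = 1"
  proof -
    have "(\<Sum>i<r. (cmod (\<psi> i))\<^sup>2) = (\<Sum>i<D. (cmod (a (digits d i)))\<^sup>2)"
      using Dr by (intro sum.mono_neutral_cong_right) (auto simp: \<psi>_def)
    also have "\<dots> = 1" using na(1) by (simp add: nrm_def sum_box_digits D_def)
    finally show ?thesis .
  qed
  \<comment> \<open>There are \<open>k\<close> factors from the Fourier measurements and one from
    the GHZ amplitude.\<close>
  define \<kappa> where "\<kappa> = complex_of_real (1 / sqrt (real r)) ^ k * complex_of_real (1 / sqrt (real r))"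
  have n\<kappa>: "(cmod \<kappa>)\<^sup>2 = (1 / real r) ^ k * (1 / real r)"
  proof -
    have "cmod \<kappa> = (1 / sqrt (real r)) ^ k * (1 / sqrt (real r))" by (simp add: \<kappa>_def norm_mult norm_power norm_divide)
    then have "(cmod \<kappa>)\<^sup>2 = ((1 / sqrt (real r))\<^sup>2) ^ k * (1 / sqrt (real r))\<^sup>2"
      by (simp only: power_mult_distrib power_mult[symmetric] mult.commute)
    then show ?thesis using r0 by (simp add: power_divide)
  qed
  \<comment> \<open>Party \<open>j\<close> undoes its share of the phase, since \<open>enc\<close>
    is a sum of place values.\<close>
  have C: "pay (target s) d (\<lambda>zs. \<kappa> * cis (2 * pi * Z * real (enc d zs) / real r) * a zs) ((cmod \<kappa>)\<^sup>2)" for Z :: real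
  proof (rule pay_monomial[where e = d and m = "replicate k 1" and \<pi> = "\<lambda>j x. x" and
        lam = "\<lambda>j t x. cis (- (2 * pi * Z * real (x * prod_list (drop (Suc j) d)) / real r))" and q = "\<lambda>y. (cmod \<kappa>)\<^sup>2"])
    show "supp d (\<lambda>zs. \<kappa> * cis (2 * pi * Z * real (enc d zs) / real r) * a zs)" using na by (simp add: supp_def)
    have "mact d d (\<lambda>j x. x) (\<lambda>j x. cis (- (2 * pi * Z * real (x * prod_list (drop (Suc j) d)) / real r)))
       (\<lambda>zs. \<kappa> * cis (2 * pi * Z * real (enc d zs) / real r) * a zs) = (\<lambda>x. \<kappa> * a x)" (is "?m = _")
    proof
      fix zs
      show "?m zs = \<kappa> * a zs"
      proof (cases "zs \<in> ibox d")
        case True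
        then have "enc d zs = (\<Sum>j<length d. zs ! j * prod_list (drop (Suc j) d))" by (intro enc_eq_sum length_box)
        then have "(\<Prod>j<length d. cis (- (2 * pi * Z * real (zs ! j * prod_list (drop (Suc j) d)) / real r)))
           = cis (- (2 * pi * Z * real (enc d zs) / real r))"
          by (simp add: prod_cis sum_negf sum_divide_distrib[symmetric] sum_distrib_left[symmetric])
        then show ?thesis using True by (simp add: mact_diag cis_mult[symmetric] mult.assoc[symmetric] cis_mult)
      next
        case False then show ?thesis using na(2) by (simp add: mact_diag supp_def)
      qed
    qed
    then show "pay (target s) d (mact d d (\<lambda>j x. x) (\<lambda>j x. cis (- (2 * pi * Z * real (x * prod_list (drop (Suc j) d)) / real r)))
       (\<lambda>zs. \<kappa> * cis (2 * pi * Z * real (enc d zs) / real r) * a zs)) ((cmod \<kappa>)\<^sup>2)" for y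
      using na by (auto intro!: pay.leaf simp: target_def ip_scale ip_self norm_mult simp flip: d_def a_def)
    show "(\<Sum>t<replicate k (1::nat) ! j. cnj (cis (- (2 * pi * Z * real (x * prod_list (drop (Suc j) d)) / real r))) *
         cis (- (2 * pi * Z * real (x' * prod_list (drop (Suc j) d)) / real r))) = (if x = x' then 1 else 0)"
      if "j < length d" "x = x'" for j x x'
      using that l by (simp add: cis_cnj cis_mult)
    show "(cmod \<kappa>)\<^sup>2 \<le> (\<Sum>y\<in>ibox (replicate k 1). (cmod \<kappa>)\<^sup>2)" unfolding box_ones by simp
  qed (use l pos target_antimono in auto)
  have B: "pay (target s) (replicate k r)
     (\<lambda>xs. if \<exists>i<r. xs = replicate k i then \<psi> ((hd xs + t) mod r) * complex_of_real (1 / sqrt (real r)) else 0) (1 / real r)" for t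
  proof -
    \<comment> \<open>From \<open>D\<close> on the amplitude \<psi> vanishes, so the label 0 merely
      has to be legal.\<close>
    define \<pi> where "\<pi> = (\<lambda>j x. if (x + t) mod r < D then digits d ((x + t) mod r) ! j else 0)"
    define lam where "lam = (\<lambda>(j::nat) z x. complex_of_real (1 / sqrt (real r)) * cis (2 * pi * real z * real ((x + t) mod r) / real r))"
    let ?A = "\<lambda>xs. if \<exists>i<r. xs = replicate k i then \<psi> ((hd xs + t) mod r) * complex_of_real (1 / sqrt (real r)) else 0"
    have lamprod: "(\<Prod>j<k. lam j (y ! j) i) = complex_of_real (1 / sqrt (real r)) ^ k * cis (2 * pi * (\<Sum>j<k. real (y ! j)) * real ((i + t) mod r) / real r)" for y i
      unfolding lam_def prod.distrib prod_cis[OF finite_lessThan]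
      by (simp add: sum_divide_distrib[symmetric] sum_distrib_left[symmetric] sum_distrib_right[symmetric])
    have m: "mact (replicate k r) d \<pi> (\<lambda>j. lam j (y ! j)) ?A
       = (\<lambda>zs. \<kappa> * cis (2 * pi * (\<Sum>j<k. real (y ! j)) * real (enc d zs) / real r) * a zs)" for y
    proof (rule supp_ext[OF supp_mact])
      show "supp d (\<lambda>zs. \<kappa> * cis (2 * pi * (\<Sum>j<k. real (y ! j)) * real (enc d zs) / real r) * a zs)"
        using na by (simp add: supp_def)
      fix zs assume zs: "zs \<in> ibox d"
      let ?G = "\<lambda>i. if i = enc d zs then \<kappa> * cis (2 * pi * (\<Sum>j<k. real (y ! j)) * real (enc d zs) / real r) * a zs else 0"
      have "mact (replicate k r) d \<pi> (\<lambda>j. lam j (y ! j)) ?A zs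
         = (\<Sum>xs\<in>ibox (replicate k r). if \<exists>i<r. xs = replicate k i then
              (if pm \<pi> xs = zs then (\<Prod>j<k. lam j (y ! j) (xs ! j)) * (\<psi> ((hd xs + t) mod r) * complex_of_real (1 / sqrt (real r))) else 0) else 0)"
        unfolding mact_def if_P[OF zs] length_replicate by (intro sum.cong refl) auto
      also have "\<dots> = (\<Sum>i<r. if pm \<pi> (replicate k i) = zs then (\<Prod>j<k. lam j (y ! j) (replicate k i ! j)) *
          (\<psi> ((hd (replicate k i) + t) mod r) * complex_of_real (1 / sqrt (real r))) else 0)"
        by (rule sum_diag[OF k])
      also have "\<dots> = (\<Sum>i<r. ?G ((i + t) mod r))"
      proof (rule sum.cong[OF refl])
        fix i assume "i \<in> {..<r}"
        let ?i = "(i + t) mod r"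
        have hd: "hd (replicate k i) = i" using k by (cases k) auto
        have pr: "(\<Prod>j<k. lam j (y ! j) (replicate k i ! j)) = (\<Prod>j<k. lam j (y ! j) i)" by (intro prod.cong) auto
        show "(if pm \<pi> (replicate k i) = zs then (\<Prod>j<k. lam j (y ! j) (replicate k i ! j)) *
          (\<psi> ((hd (replicate k i) + t) mod r) * complex_of_real (1 / sqrt (real r))) else 0) = ?G ?i"
        proof (cases "?i < D")
          case True
          have "pm \<pi> (replicate k i) = digits d ?i"
            using True digits_in_box[of ?i d] l by (intro nth_equalityI) (auto simp: \<pi>_def D_def length_box)
          then have "pm \<pi> (replicate k i) = zs \<longleftrightarrow> ?i = enc d zs"
            using True zs enc_digits[of ?i d] digits_enc[OF zs] by (auto simp: D_def)
          moreover have "\<psi> (enc d zs) = a zs" using enc_less[OF zs] digits_enc[OF zs] by (simp add: \<psi>_def D_def)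
          ultimately show ?thesis unfolding hd pr lamprod by (auto simp: \<kappa>_def)
        next
          case False
          then have "?i \<noteq> enc d zs" using enc_less[OF zs] by (auto simp: D_def)
          then show ?thesis using False unfolding hd by (simp add: \<psi>_def)
        qed
      qed
      also have "\<dots> = (\<Sum>i<r. ?G i)" by (rule sum_shift)
      also have "\<dots> = \<kappa> * cis (2 * pi * (\<Sum>j<k. real (y ! j)) * real (enc d zs) / real r) * a zs"
      proof -
        have "enc d zs < r" using enc_less[OF zs] Dr by (simp add: D_def)
        then show ?thesis by simp
      qed
      finally show "mact (replicate k r) d \<pi> (\<lambda>j. lam j (y ! j)) ?A zs
         = \<kappa> * cis (2 * pi * (\<Sum>j<k. real (y ! j)) * real (enc d zs) / real r) * a zs" .
    qed
    show ?thesis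
    proof (rule pay_monomial[where e = d and m = "replicate k r" and \<pi> = \<pi> and lam = lam and q = "\<lambda>y. (cmod \<kappa>)\<^sup>2"])
      show "supp (replicate k r) ?A" by (auto simp: supp_def)
      show "\<pi> j x < d ! j" if "j < length (replicate k r)" for j x
        using that pos nth_box[OF digits_in_box, of "(x + t) mod r" d j] l by (auto simp: \<pi>_def D_def)
      show "(\<Sum>z<replicate k r ! j. cnj (lam j z x) * lam j z x') = (if x = x' then 1 else 0)"
        if "j < length (replicate k r)" "x < replicate k r ! j" "x' < replicate k r ! j" for j x x'
      proof -
        have x: "x < r" "x' < r" using that by auto
        have "(\<Sum>z<r. cnj (lam j z x) * lam j z x')
           = (\<Sum>z<r. complex_of_real (1 / real r) * cis (2 * pi * real z * (real ((x' + t) mod r) - real ((x + t) mod r)) / real r))"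
        proof (rule sum.cong[OF refl])
          fix z
          have "cnj (lam j z x) * lam j z x' = complex_of_real (1 / sqrt (real r) * (1 / sqrt (real r))) *
             (cis (- (2 * pi * real z * real ((x + t) mod r) / real r)) * cis (2 * pi * real z * real ((x' + t) mod r) / real r))"
            unfolding lam_def
            by (simp only: complex_cnj_mult cis_cnj complex_cnj_complex_of_real of_real_mult ac_simps)
          also have "\<dots> = complex_of_real (1 / real r) * cis (2 * pi * real z * (real ((x' + t) mod r) - real ((x + t) mod r)) / real r)"
          proof -
            have rr: "1 / sqrt (real r) * (1 / sqrt (real r)) = 1 / real r" using r0 by simp
            show ?thesis unfolding rr cis_mult by (simp add: right_diff_distrib diff_divide_distrib)
          qed
          finally show "cnj (lam j z x) * lam j z x' = complex_of_real (1 / real r) * cis (2 * pi * real z * (real ((x' + t) mod r) - real ((x + t) mod r)) / real r)" .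
        qed
        also have "\<dots> = complex_of_real (1 / real r) * (if (x + t) mod r = (x' + t) mod r then of_nat r else 0)"
          unfolding sum_distrib_left[symmetric] using r0 by (subst sum_cis_orthogonal) auto
        also have "(x + t) mod r = (x' + t) mod r \<longleftrightarrow> x = x'" using inj_on_eq_iff[OF inj_shift[of t r], of x x'] x by simp
        finally show ?thesis using that r0 by simp
      qed
      show "pay (target s) d (mact (replicate k r) d \<pi> (\<lambda>j. lam j (y ! j)) ?A) ((cmod \<kappa>)\<^sup>2)" for y
        unfolding m by (rule C)
      \<comment> \<open>All \<open>r ^ k\<close> outcomes contribute the same weight
        \<open>(cmod \<kappa>)\<^sup>2\<close>.\<close>
      show "1 / real r \<le> (\<Sum>y\<in>ibox (replicate k r). (cmod \<kappa>)\<^sup>2)"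
        using r0 by (simp add: card_box n\<kappa> prod_list_replicate power_divide)
    qed (use l pos target_antimono in auto)
  qed
  \<comment> \<open>Party 0 has one outcome per shift, complete because \<psi> is normalised along
    every cyclic shift; the other parties have a single trivial outcome. Each of the
    \<open>r\<close> outcomes earns \<open>1 / r\<close>.\<close>
  have "pay (target s) (replicate k r) (snd (ghz k r)) 1"
  proof (rule pay_monomial[where e = "replicate k r" and m = "r # replicate (k - 1) 1" and \<pi> = "\<lambda>j x. x" and
        lam = "\<lambda>j t x. if j = 0 then \<psi> ((x + t) mod r) else 1" and q = "\<lambda>y. 1 / real r"])
    show "length (r # replicate (k - 1) 1) = length (replicate k r)" using k by simp
    show "supp (replicate k r) (snd (ghz k r))" by (auto simp: supp_def ghz_def)
    show "(\<Sum>t<(r # replicate (k - 1) 1) ! j. cnj (if j = 0 then \<psi> ((x + t) mod r) else 1) * (if j = 0 then \<psi> ((x' + t) mod r) else 1)) = (if x = x' then 1 else 0)"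
      if "j < length (replicate k r)" "x = x'" for j x x'
    proof (cases "j = 0")
      case True
      have "(\<Sum>t<r. cnj (\<psi> ((x + t) mod r)) * \<psi> ((x + t) mod r)) = complex_of_real (\<Sum>t<r. (cmod (\<psi> ((t + x) mod r)))\<^sup>2)"
        unfolding of_real_sum complex_norm_square by (intro sum.cong refl) (simp add: ac_simps)
      also have "\<dots> = 1" unfolding sum_shift[of "\<lambda>i. (cmod (\<psi> i))\<^sup>2"] n\<psi> by simp
      finally show ?thesis using True that by simp
    next
      case False then show ?thesis using that by (cases j) auto
    qed
    show "pay (target s) (replicate k r) (mact (replicate k r) (replicate k r) (\<lambda>j x. x)
        (\<lambda>j x. if j = 0 then \<psi> ((x + y ! j) mod r) else 1) (snd (ghz k r))) (1 / real r)" for y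
    proof -
      have "mact (replicate k r) (replicate k r) (\<lambda>j x. x) (\<lambda>j x. if j = 0 then \<psi> ((x + y ! j) mod r) else 1) (snd (ghz k r))
        = (\<lambda>xs. if \<exists>i<r. xs = replicate k i then \<psi> ((hd xs + y ! 0) mod r) * complex_of_real (1 / sqrt (real r)) else 0)" (is "?m = ?b")
      proof
        fix xs
        show "?m xs = ?b xs"
        proof (cases "\<exists>i<r. xs = replicate k i")
          case True
          then obtain i where i: "i < r" "xs = replicate k i" by blast
          have hd: "hd xs = i" "xs ! 0 = i" using i k by (cases k; auto)+
          have "(\<Prod>j<k. if j = 0 then \<psi> ((xs ! j + y ! j) mod r) else 1) = \<psi> ((i + y ! 0) mod r)"
            using k hd by (simp add: prod.delta)
          moreover have "xs \<in> ibox (replicate k r)" using i by simp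
          ultimately show ?thesis using True hd by (simp add: mact_diag ghz_def)
        next
          case False then show ?thesis by (auto simp: mact_diag ghz_def)
        qed
      qed
      then show ?thesis using B[of "y ! 0"] by simp
    qed
    show "1 \<le> (\<Sum>y\<in>ibox (r # replicate (k - 1) 1). 1 / real r)"
      using r0 by (simp add: card_box prod_list_replicate)
  qed (use r0 target_antimono in auto)
  then show ?thesis by (simp add: conv_def ghz_def)
qed

text \<open>A vector of Schmidt rank at most \<open>n\<close> between the first party and the others stays of that form along
  the protocol, and its overlap with a GHZ state is at most the product of the squared norms of its two factors.\<close>

lemma rank_bound:
  assumes "pay (target (ghz k r)) d v p" "length d = k" "2 \<le> k" "0 < r" "finite I"
    and "\<And>x xs. x # xs \<in> ibox d \<Longrightarrow> v (x # xs) = (\<Sum>i\<in>I. \<alpha> i [x] * \<beta> i xs)"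
  shows "p * real r \<le> (\<Sum>i\<in>I. nrm [hd d] (\<alpha> i)) * (\<Sum>i\<in>I. nrm (tl d) (\<beta> i))"
  using assms
proof (induction arbitrary: \<alpha> \<beta> rule: pay.induct)
  case (leaf d v p)
  have d: "d = replicate k r" and p: "p \<le> (cmod (ip d (snd (ghz k r)) v))\<^sup>2"
    using leaf(1) by (auto simp: target_def ghz_def)
  obtain k' where k': "k = Suc k'" "0 < k'" using leaf by (cases k) auto
  have "ip d (snd (ghz k r)) v = (\<Sum>xs\<in>ibox (replicate k r). if \<exists>i<r. xs = replicate k i then complex_of_real (1 / sqrt (real r)) * v xs else 0)"
    unfolding ip_def ghz_def snd_conv d by (intro sum.cong refl) auto
  also have "\<dots> = (\<Sum>z<r. complex_of_real (1 / sqrt (real r)) * v (replicate k z))"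
    using k' by (intro sum_diag) simp
  also have "\<dots> = complex_of_real (1 / sqrt (real r)) * (\<Sum>z<r. \<Sum>i\<in>I. \<alpha> i [z] * \<beta> i (replicate k' z))"
    unfolding sum_distrib_left
    by (intro sum.cong refl) (use leaf(6) d k' in \<open>simp add: sum_distrib_left\<close>)
  finally have ipv: "(cmod (ip d (snd (ghz k r)) v))\<^sup>2 = 1 / real r * (cmod (\<Sum>z<r. \<Sum>i\<in>I. \<alpha> i [z] * \<beta> i (replicate k' z)))\<^sup>2"
    using leaf(4) by (simp add: norm_mult norm_divide power_mult_distrib power_divide)
  \<comment> \<open>Cauchy-Schwarz is applied over all pairs of a diagonal position and a Schmidt
    term.\<close>
  have "cmod (\<Sum>z<r. \<Sum>i\<in>I. \<alpha> i [z] * \<beta> i (replicate k' z)) \<le> (\<Sum>k\<in>{..<r} \<times> I. cmod (\<alpha> (snd k) [fst k]) * cmod (\<beta> (snd k) (replicate k' (fst k))))"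
    unfolding sum.cartesian_product by (rule order_trans[OF norm_sum]) (simp add: norm_mult case_prod_unfold)
  then have "(cmod (\<Sum>z<r. \<Sum>i\<in>I. \<alpha> i [z] * \<beta> i (replicate k' z)))\<^sup>2 \<le> (\<Sum>k\<in>{..<r} \<times> I. cmod (\<alpha> (snd k) [fst k]) * cmod (\<beta> (snd k) (replicate k' (fst k))))\<^sup>2"
    by (intro power_mono) auto
  also have "\<dots> \<le> (\<Sum>k\<in>{..<r} \<times> I. (cmod (\<alpha> (snd k) [fst k]))\<^sup>2) * (\<Sum>k\<in>{..<r} \<times> I. (cmod (\<beta> (snd k) (replicate k' (fst k))))\<^sup>2)"
    by (rule Cauchy_Schwarz_ineq_sum)
  also have "(\<Sum>k\<in>{..<r} \<times> I. (cmod (\<alpha> (snd k) [fst k]))\<^sup>2) = (\<Sum>i\<in>I. nrm [hd d] (\<alpha> i))"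
  proof -
    have "nrm [hd d] (\<alpha> i) = (\<Sum>z<r. (cmod (\<alpha> i [z]))\<^sup>2)" for i
      unfolding nrm_def by (simp add: sum_box_Cons d k')
    then have "(\<Sum>i\<in>I. nrm [hd d] (\<alpha> i)) = (\<Sum>z<r. \<Sum>i\<in>I. (cmod (\<alpha> i [z]))\<^sup>2)" by (simp add: sum.swap[of _ I])
    then show ?thesis by (simp add: sum.cartesian_product case_prod_unfold)
  qed
  also have "(\<Sum>k\<in>{..<r} \<times> I. (cmod (\<beta> (snd k) (replicate k' (fst k))))\<^sup>2) \<le> (\<Sum>i\<in>I. nrm (tl d) (\<beta> i))"
  proof -
    have "(\<Sum>k\<in>{..<r} \<times> I. (cmod (\<beta> (snd k) (replicate k' (fst k))))\<^sup>2) = (\<Sum>z<r. \<Sum>i\<in>I. (cmod (\<beta> i (replicate k' z)))\<^sup>2)"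
      by (simp add: sum.cartesian_product case_prod_unfold)
    also have "\<dots> = (\<Sum>i\<in>I. \<Sum>z<r. (cmod (\<beta> i (replicate k' z)))\<^sup>2)" by (rule sum.swap)
    also have "\<dots> = (\<Sum>i\<in>I. \<Sum>xs\<in>ibox (replicate k' r). if \<exists>z<r. xs = replicate k' z then (cmod (\<beta> i xs))\<^sup>2 else 0)"
      using k' by (simp add: sum_diag)
    also have "\<dots> \<le> (\<Sum>i\<in>I. nrm (tl d) (\<beta> i))"
      unfolding nrm_def by (intro sum_mono) (simp add: d k' sum_mono)
    finally show ?thesis .
  qed
  finally have "(cmod (\<Sum>z<r. \<Sum>i\<in>I. \<alpha> i [z] * \<beta> i (replicate k' z)))\<^sup>2 \<le> (\<Sum>i\<in>I. nrm [hd d] (\<alpha> i)) * (\<Sum>i\<in>I. nrm (tl d) (\<beta> i))"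
    by (simp add: mult_left_mono sum_nonneg nrm_nonneg)
  moreover have "p * real r \<le> (cmod (\<Sum>z<r. \<Sum>i\<in>I. \<alpha> i [z] * \<beta> i (replicate k' z)))\<^sup>2"
    using p leaf(4) unfolding ipv by (simp add: field_simps)
  ultimately show ?case by linarith
next
  case (round j d m L v q p)
  obtain D ds where d: "d = D # ds" using round by (cases d) auto
  have IH: "q i * real r \<le> (\<Sum>i'\<in>I. nrm [hd (d[j := dim_row (L i)])] (\<alpha>' i')) * (\<Sum>i'\<in>I. nrm (tl (d[j := dim_row (L i)])) (\<beta>' i'))"
    if "i < m" and "\<And>x xs. x # xs \<in> ibox (d[j := dim_row (L i)]) \<Longrightarrow> lact d j (L i) v (x # xs) = (\<Sum>i\<in>I. \<alpha>' i [x] * \<beta>' i xs)"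
    for i \<alpha>' \<beta>'
    using round(4)[THEN spec, THEN mp, OF that(1), THEN conjunct2, rule_format, of \<alpha>' \<beta>'] that(2) round(5-8) by simp
  have le: "p * real r \<le> (\<Sum>i<m. q i * real r)"
    using round(3) by (simp add: sum_distrib_right[symmetric] mult_right_mono)
  show ?case
  \<comment> \<open>A round of the first party changes only the factors \<alpha>, a round of any
    other party only the factors \<beta>; either way the squared norms, summed over the outcomes,
    are preserved.\<close>
  proof (cases j)
    case 0
    have q: "q i * real r \<le> (\<Sum>i'\<in>I. nrm [dim_row (L i)] (lact [D] 0 (L i) (\<alpha> i'))) * (\<Sum>i'\<in>I. nrm ds (\<beta> i'))"
      if "i < m" for i
    proof -
      have "lact d j (L i) v (x # xs) = (\<Sum>i'\<in>I. lact [D] 0 (L i) (\<alpha> i') [x] * \<beta> i' xs)"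
        if x: "x # xs \<in> ibox (d[j := dim_row (L i)])" for x xs
      proof -
        have x': "x < dim_row (L i)" "xs \<in> ibox ds" using x d 0 by auto
        have "lact d j (L i) v (x # xs) = (\<Sum>y<D. L i $$ (x, y) * v (y # xs))"
          using x d 0 by (simp add: lact_def)
        also have "\<dots> = (\<Sum>y<D. \<Sum>i'\<in>I. L i $$ (x, y) * (\<alpha> i' [y] * \<beta> i' xs))"
          using round(9) x' d by (intro sum.cong refl) (simp add: sum_distrib_left)
        also have "\<dots> = (\<Sum>i'\<in>I. \<Sum>y<D. L i $$ (x, y) * (\<alpha> i' [y] * \<beta> i' xs))" by (rule sum.swap)
        also have "\<dots> = (\<Sum>i'\<in>I. lact [D] 0 (L i) (\<alpha> i') [x] * \<beta> i' xs)"
          using x' by (intro sum.cong refl) (simp add: lact_def sum_distrib_right mult.assoc)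
        finally show ?thesis .
      qed
      from IH[OF that this] show ?thesis using d 0 by simp
    qed
    have "(\<Sum>i<m. q i * real r) \<le> (\<Sum>i<m. (\<Sum>i'\<in>I. nrm [dim_row (L i)] (lact [D] 0 (L i) (\<alpha> i'))) * (\<Sum>i'\<in>I. nrm ds (\<beta> i')))"
      using q by (intro sum_mono) auto
    also have "\<dots> = (\<Sum>i'\<in>I. \<Sum>i<m. nrm [dim_row (L i)] (lact [D] 0 (L i) (\<alpha> i'))) * (\<Sum>i'\<in>I. nrm ds (\<beta> i'))"
      by (simp add: sum_distrib_right[symmetric] sum.swap[of _ I])
    also have "\<dots> = (\<Sum>i'\<in>I. nrm [D] (\<alpha> i')) * (\<Sum>i'\<in>I. nrm ds (\<beta> i'))"
      using nrm_lact_sum[of 0 "[D]" m L] round(2) d 0 by simp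
    finally show ?thesis using le d by simp
  next
    case (Suc j')
    have j': "j' < length ds" using round(1) d Suc by simp
    have q: "q i * real r \<le> (\<Sum>i'\<in>I. nrm [D] (\<alpha> i')) * (\<Sum>i'\<in>I. nrm (ds[j' := dim_row (L i)]) (lact ds j' (L i) (\<beta> i')))"
      if "i < m" for i
    proof -
      have "lact d j (L i) v (x # xs) = (\<Sum>i'\<in>I. \<alpha> i' [x] * lact ds j' (L i) (\<beta> i') xs)"
        if x: "x # xs \<in> ibox (d[j := dim_row (L i)])" for x xs
      proof -
        have x': "x < D" "xs \<in> ibox (ds[j' := dim_row (L i)])" using x d Suc by auto
        have in': "xs[j' := y] \<in> ibox ds" if "y < ds ! j'" for y using box_update[OF x'(2) that] by simp
        have "lact d j (L i) v (x # xs) = (\<Sum>y<ds ! j'. L i $$ (xs ! j', y) * v (x # xs[j' := y]))"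
          using x d Suc by (simp add: lact_def)
        also have "\<dots> = (\<Sum>y<ds ! j'. \<Sum>i'\<in>I. L i $$ (xs ! j', y) * (\<alpha> i' [x] * \<beta> i' (xs[j' := y])))"
          using round(9) x' in' d by (intro sum.cong refl) (simp add: sum_distrib_left)
        also have "\<dots> = (\<Sum>i'\<in>I. \<Sum>y<ds ! j'. L i $$ (xs ! j', y) * (\<alpha> i' [x] * \<beta> i' (xs[j' := y])))" by (rule sum.swap)
        also have "\<dots> = (\<Sum>i'\<in>I. \<alpha> i' [x] * lact ds j' (L i) (\<beta> i') xs)"
          using x' by (intro sum.cong refl) (simp add: lact_def sum_distrib_left mult.left_commute)
        finally show ?thesis .
      qed
      from IH[OF that this] show ?thesis using d Suc by simp
    qed
    have "(\<Sum>i<m. q i * real r) \<le> (\<Sum>i<m. (\<Sum>i'\<in>I. nrm [D] (\<alpha> i')) * (\<Sum>i'\<in>I. nrm (ds[j' := dim_row (L i)]) (lact ds j' (L i) (\<beta> i'))))"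
      using q by (intro sum_mono) auto
    also have "\<dots> = (\<Sum>i'\<in>I. nrm [D] (\<alpha> i')) * (\<Sum>i'\<in>I. \<Sum>i<m. nrm (ds[j' := dim_row (L i)]) (lact ds j' (L i) (\<beta> i')))"
      by (simp add: sum_distrib_left[symmetric] sum.swap[of _ I])
    also have "\<dots> = (\<Sum>i'\<in>I. nrm [D] (\<alpha> i')) * (\<Sum>i'\<in>I. nrm ds (\<beta> i'))"
      using nrm_lact_sum[OF j', of m L] round(2) d Suc by simp
    finally show ?thesis using le d by simp
  qed
qed

lemma ghz_nondeg:
  assumes "conv (ghz k r) (ghz k r') p" "2 \<le> k" "0 < r" "0 < r'"
  shows "p * real r' \<le> real r"
proof -
  obtain k' where k': "k = Suc k'" "0 < k'" using assms by (cases k) auto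
  define \<alpha> where "\<alpha> = (\<lambda>(i::nat) xs. if xs = [i] then (1::complex) else 0)"
  define \<beta> where "\<beta> = (\<lambda>(i::nat) xs. if xs = replicate k' i then complex_of_real (1 / sqrt (real r)) else 0)"
  have "p * real r' \<le> (\<Sum>i<r. nrm [hd (replicate k r)] (\<alpha> i)) * (\<Sum>i<r. nrm (tl (replicate k r)) (\<beta> i))"
  proof (rule rank_bound)
    show "pay (target (ghz k r')) (replicate k r) (snd (ghz k r)) p" using assms(1) by (simp add: conv_def ghz_def)
    fix x xs assume x: "x # xs \<in> ibox (replicate k r)"
    have "(\<Sum>i<r. \<alpha> i [x] * \<beta> i xs) = (\<Sum>i<r. if i = x then \<beta> x xs else 0)"
      by (intro sum.cong refl) (auto simp: \<alpha>_def)
    also have "\<dots> = snd (ghz k r) (x # xs)" using x k' by (auto simp: \<beta>_def ghz_def)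
    finally show "snd (ghz k r) (x # xs) = (\<Sum>i<r. \<alpha> i [x] * \<beta> i xs)" by simp
  qed (use assms in auto)
  also have "(\<Sum>i<r. nrm [hd (replicate k r)] (\<alpha> i)) = real r"
  proof -
    have "nrm [hd (replicate k r)] (\<alpha> i) = 1" if "i < r" for i
      using that k' by (simp add: nrm_def sum_box_Cons \<alpha>_def if_distrib[of cmod] if_distrib[of "\<lambda>x. x ^ 2"] cong: if_cong)
    then show ?thesis by simp
  qed
  also have "(\<Sum>i<r. nrm (tl (replicate k r)) (\<beta> i)) = 1"
  proof -
    have "nrm (tl (replicate k r)) (\<beta> i) = 1 / real r" if "i < r" for i
    proof -
      have "nrm (tl (replicate k r)) (\<beta> i) = (\<Sum>xs\<in>ibox (replicate k' r). if xs = replicate k' i then 1 / real r else 0)"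
        unfolding nrm_def k'(1) replicate_Suc list.sel by (intro sum.cong refl) (auto simp: \<beta>_def norm_divide power_divide)
      then show ?thesis using that by simp
    qed
    then show ?thesis using assms by simp
  qed
  finally show ?thesis by simp
qed

lemma cvm_from_g:
  assumes k: "0 < k" and s: "s \<in> St k" and n: "prod_list (fst s) \<le> 2 ^ n"
  shows "cvm k (replicate_mset n (ghz k 2)) {#s#} 1"
proof -
  have "conv (prodl k (replicate n (ghz k 2))) (prodl k [s]) 1"
    using conv_from_ghz[OF k s n] k s by (simp add: prodl_ghz tens_unit_right)
  then have "cvm k (mset (replicate n (ghz k 2))) (mset [s]) 1"
    by (subst cvm_list) (use ghz_St k s in auto)
  then show ?thesis by simp
qed

lemma entanglement_resource_theory:
  assumes k: "2 \<le> k"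
  shows "resource_theory (St k) (cvm k) (ghz k 2)"
proof
  have k0: "0 < k" using k by simp
  show gS: "ghz k 2 \<in> St k" by (rule ghz_St[OF k0]) simp
  show "cvm k M N q" if "cvm k M N p" "q \<le> p" for M N p q using that by (auto simp: cvm_def intro: conv_antimono)
  show "cvm k M K ((1 - \<eta>) * p * p' - (1 - p) / \<eta>)"
    if "set_mset M \<subseteq> St k" "set_mset N \<subseteq> St k" "set_mset K \<subseteq> St k" "cvm k M N p" "cvm k N K p'" "0 \<le> p'" "0 < \<eta>" "\<eta> < 1"
    for M N K p p' \<eta>
    using that unfolding cvm_def by (intro conv_compose[where t = "Pm k N" and k = k] Pm_St) auto
  show "cvm k (M + K) (N + K) p" if "set_mset M \<subseteq> St k" "set_mset N \<subseteq> St k" "set_mset K \<subseteq> St k" "cvm k M N p" for M N K p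
    using that by (rule cvm_add)
  show "cvm k (M + N) M 1" if "set_mset M \<subseteq> St k" "set_mset N \<subseteq> St k" for M N using that by (rule cvm_discard)
  show "\<exists>n. cvm k (replicate_mset n (ghz k 2)) {#s#} 1" if "s \<in> St k" for s
    using cvm_from_g[OF k0 that, of "prod_list (fst s)"] less_imp_le[OF less_exp] by blast
  show "p * 2 ^ j \<le> 2 ^ i" if "cvm k (replicate_mset i (ghz k 2)) (replicate_mset j (ghz k 2)) p" for i j p
  proof -
    have "cvm k (mset (replicate i (ghz k 2))) (mset (replicate j (ghz k 2))) p" using that by simp
    then have "conv (ghz k (2 ^ i)) (ghz k (2 ^ j)) p"
      by (subst (asm) cvm_list) (use gS in \<open>auto simp: prodl_ghz[OF k0]\<close>)
    then show ?thesis using ghz_nondeg[OF _ k, of "2 ^ i" "2 ^ j" p] by simp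
  qed
qed

section \<open>Monotonicity on average\<close>

lemma conv_refl: "s \<in> St k \<Longrightarrow> conv s s 1"
  unfolding conv_def by (rule pay.leaf) (simp add: target_def ip_self St_def)

lemma tn_scale: "tn d (\<lambda>x. c * a x) f b = (\<lambda>x. c * tn d a f b x)"
  by (auto simp: tn_def)

text \<open>A protocol turns \<open>s\<close> into the ensemble of states \<open>T i\<close> with probabilities \<open>\<bar>c i\<bar>\<^sup>2\<close>.\<close>

definition ensemble :: "pv \<Rightarrow> 'i set \<Rightarrow> ('i \<Rightarrow> complex) \<Rightarrow> ('i \<Rightarrow> pv) \<Rightarrow> bool" where
  "ensemble s I c T \<longleftrightarrow> (\<forall>q. pay (\<lambda>d v p. \<exists>i\<in>I. d = fst (T i) \<and> v = (\<lambda>x. c i * snd (T i) x) \<and> p \<le> q i)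
     (fst s) (snd s) (\<Sum>i\<in>I. q i))"

text \<open>In branch \<open>i\<close> the protocol for \<open>T i\<close> and the spectators
  \<open>M\<close> is run; the scalar \<open>c i\<close> multiplies its payoff by
  \<open>(cmod (c i))\<^sup>2\<close>.\<close>

lemma ensemble_cvm:
  assumes e: "ensemble s I c T" and s: "s \<in> St k" and T: "\<And>i. i \<in> I \<Longrightarrow> T i \<in> St k"
    and M: "set_mset M \<subseteq> St k" and N: "set_mset N \<subseteq> St k"
    and r: "\<And>i. i \<in> I \<Longrightarrow> cvm k (add_mset (T i) M) N (r i)"
  shows "cvm k (add_mset s M) N (\<Sum>i\<in>I. (cmod (c i))\<^sup>2 * r i)"
proof -
  obtain xs ys where l: "M = mset xs" "N = mset ys" by (metis ex_mset)
  have st: "set xs \<subseteq> St k" "set ys \<subseteq> St k" using M N l by auto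
  define u where "u = prodl k xs"
  define t where "t = prodl k ys"
  have u: "u \<in> St k" and t: "t \<in> St k" using prodl_St st by (auto simp: u_def t_def)
  have conv: "conv (tens (T i) u) t (r i)" if "i \<in> I" for i
  proof -
    have "cvm k (mset (T i # xs)) (mset ys) (r i)" using r[OF that] l by simp
    then show ?thesis by (subst (asm) cvm_list) (use st T[OF that] in \<open>auto simp: u_def t_def\<close>)
  qed
  have "pay (\<lambda>d v p. \<exists>i\<in>I. d = fst (T i) \<and> v = (\<lambda>x. c i * snd (T i) x) \<and> p \<le> (cmod (c i))\<^sup>2 * r i)
     (fst s) (snd s) (\<Sum>i\<in>I. (cmod (c i))\<^sup>2 * r i)" using e by (simp add: ensemble_def)
  from pay_tensor[OF this, of "fst u" "snd u"] St_length[OF s] St_length[OF u] St_pos[OF u]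
  have "pay (\<lambda>D w q. \<exists>d' v. length d' = length (fst u) \<and> D = dmul d' (fst u) \<and> w = tn d' v (fst u) (snd u) \<and>
     (\<exists>i\<in>I. d' = fst (T i) \<and> v = (\<lambda>x. c i * snd (T i) x) \<and> q \<le> (cmod (c i))\<^sup>2 * r i))
     (dmul (fst s) (fst u)) (tn (fst s) (snd s) (fst u) (snd u)) (\<Sum>i\<in>I. (cmod (c i))\<^sup>2 * r i)" by simp
  then have "conv (tens s u) t (\<Sum>i\<in>I. (cmod (c i))\<^sup>2 * r i)"
    unfolding conv_def tens_def fst_conv snd_conv
  proof (rule pay_bind)
    fix D w q
    assume "\<exists>d' v. length d' = length (fst u) \<and> D = dmul d' (fst u) \<and> w = tn d' v (fst u) (snd u) \<and>
     (\<exists>i\<in>I. d' = fst (T i) \<and> v = (\<lambda>x. c i * snd (T i) x) \<and> q \<le> (cmod (c i))\<^sup>2 * r i)"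
    then obtain i where i: "i \<in> I" "D = dmul (fst (T i)) (fst u)"
      "w = tn (fst (T i)) (\<lambda>x. c i * snd (T i) x) (fst u) (snd u)" "q \<le> (cmod (c i))\<^sup>2 * r i" by blast
    have "pay (target t) D (tn (fst (T i)) (snd (T i)) (fst u) (snd u)) (r i)"
      using conv[OF i(1)] i(2) by (simp add: conv_def tens_def)
    then have "pay (target t) D w ((cmod (c i))\<^sup>2 * r i)"
      unfolding i(3) tn_scale using t by (intro pay_scale) (auto simp: St_def)
    then show "pay (target t) D w q" using i(4) by (rule pay_antimono) (rule target_antimono)
  qed
  then have "conv (prodl k (s # xs)) (prodl k ys) (\<Sum>i\<in>I. (cmod (c i))\<^sup>2 * r i)" by (simp add: u_def t_def)
  then have "cvm k (mset (s # xs)) (mset ys) (\<Sum>i\<in>I. (cmod (c i))\<^sup>2 * r i)"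
    by (subst cvm_list) (use st s in auto)
  then show ?thesis using l by simp
qed

section \<open>Words over an alphabet and the weak law of large numbers\<close>

definition words :: "'i set \<Rightarrow> nat \<Rightarrow> 'i list set" where "words I n = {w. set w \<subseteq> I \<and> length w = n}"

lemma words_0 [simp]: "words I 0 = {[]}" by (auto simp: words_def)

lemma finite_words [simp]: "finite I \<Longrightarrow> finite (words I n)"
  unfolding words_def by (rule finite_lists_length_eq)

lemma sum_words_Suc: "sum h (words I (Suc n)) = (\<Sum>i\<in>I. \<Sum>w\<in>words I n. h (i # w))"
proof -
  have W: "words I (Suc n) = (\<lambda>(i, w). i # w) ` (I \<times> words I n)"
  proof (intro Set.set_eqI iffI)
    fix v assume v: "v \<in> words I (Suc n)"
    then obtain i w where "v = i # w" by (cases v) (auto simp: words_def)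
    then show "v \<in> (\<lambda>(i, w). i # w) ` (I \<times> words I n)" using v by (auto simp: words_def)
  qed (auto simp: words_def)
  show ?thesis unfolding W
    by (subst sum.reindex) (auto simp: inj_on_def sum.cartesian_product case_prod_unfold)
qed

lemma sum_words_prob:
  assumes "sum P I = (1::real)"
  shows "(\<Sum>w\<in>words I n. prod_list (map P w)) = 1"
  by (induction n) (use assms in \<open>auto simp: sum_words_Suc sum_distrib_left[symmetric]\<close>)

lemma words_mean:
  assumes P: "sum P I = (1::real)" and f: "(\<Sum>i\<in>I. P i * f i) = 0"
  shows "(\<Sum>w\<in>words I n. prod_list (map P w) * sum_list (map f w)) = 0"
proof (induction n)
  case (Suc n)
  have "(\<Sum>w\<in>words I (Suc n). prod_list (map P w) * sum_list (map f w))
    = (\<Sum>i\<in>I. \<Sum>w\<in>words I n. P i * f i * prod_list (map P w) + P i * (prod_list (map P w) * sum_list (map f w)))"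
    unfolding sum_words_Suc by (intro sum.cong refl) (simp add: algebra_simps)
  also have "\<dots> = 0"
    unfolding sum.distrib sum_distrib_left[symmetric] sum_words_prob[OF P] Suc using f by simp
  finally show ?case .
qed simp

lemma words_variance:
  assumes P: "sum P I = (1::real)" and f: "(\<Sum>i\<in>I. P i * f i) = 0"
  shows "(\<Sum>w\<in>words I n. prod_list (map P w) * (sum_list (map f w))\<^sup>2) = real n * (\<Sum>i\<in>I. P i * (f i)\<^sup>2)"
proof (induction n)
  case (Suc n)
  have "(\<Sum>w\<in>words I (Suc n). prod_list (map P w) * (sum_list (map f w))\<^sup>2)
    = (\<Sum>i\<in>I. \<Sum>w\<in>words I n. P i * (f i)\<^sup>2 * prod_list (map P w) +
        2 * (P i * f i) * (prod_list (map P w) * sum_list (map f w)) +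
        P i * (prod_list (map P w) * (sum_list (map f w))\<^sup>2))"
    unfolding sum_words_Suc by (intro sum.cong refl) (simp add: algebra_simps power2_eq_square)
  also have "\<dots> = (\<Sum>i\<in>I. P i * (f i)\<^sup>2) + sum P I * (real n * (\<Sum>i\<in>I. P i * (f i)\<^sup>2))"
    unfolding sum.distrib sum_distrib_left[symmetric] sum_words_prob[OF P] words_mean[OF P f] Suc
    by (simp add: sum_distrib_right)
  finally show ?case using P by (simp add: algebra_simps)
qed simp

text \<open>Chebyshev's inequality for the centred indicator of the letter \<open>b\<close>, whose
  variance is at most 1 per letter. Only a deficit of \<open>b\<close> matters, since surplus states
  can be discarded.\<close>

lemma words_Chebyshev:
  assumes I: "finite I" and P: "sum P I = (1::real)" "\<And>i. i \<in> I \<Longrightarrow> 0 \<le> P i" and b: "b \<in> I" and a: "0 < a"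
  shows "(\<Sum>w | w \<in> words I n \<and> a \<le> real n * P b - real (count_list w b). prod_list (map P w)) \<le> real n / a\<^sup>2"
proof -
  define f where "f = (\<lambda>i. (if i = b then 1 else 0) - P b)"
  have f0: "(\<Sum>i\<in>I. P i * f i) = 0"
  proof -
    have "(\<Sum>i\<in>I. P i * f i) = (\<Sum>i\<in>I. (if i = b then P b else 0) - P b * P i)"
      by (intro sum.cong refl) (auto simp: f_def algebra_simps)
    also have "\<dots> = P b - P b * sum P I" using I b by (simp add: sum_subtractf sum_distrib_left)
    finally show ?thesis using P by simp
  qed
  have Pb: "P b \<le> 1" using member_le_sum[of b I P] I b P by auto
  have f1: "(f i)\<^sup>2 \<le> 1" for i
  proof -
    have "\<bar>f i\<bar> \<le> 1" using Pb P(2)[OF b] by (auto simp: f_def)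
    then show ?thesis by (simp add: abs_square_le_1)
  qed
  have cnt: "sum_list (map f w) = real (count_list w b) - real (length w) * P b" for w
    by (induction w) (auto simp: f_def algebra_simps)
  have Pw: "0 \<le> prod_list (map P w)" if "w \<in> words I n" for w
    using that P(2) by (intro prod_list_nonneg) (auto simp: words_def)
  let ?B = "{w \<in> words I n. a \<le> real n * P b - real (count_list w b)}"
  have "a\<^sup>2 * (\<Sum>w\<in>?B. prod_list (map P w)) \<le> (\<Sum>w\<in>?B. prod_list (map P w) * (sum_list (map f w))\<^sup>2)"
    unfolding sum_distrib_left
  proof (rule sum_mono)
    fix w assume w: "w \<in> ?B"
    then have "a \<le> - sum_list (map f w)" by (auto simp: cnt words_def)
    then have "a\<^sup>2 \<le> (- sum_list (map f w))\<^sup>2" using a by (intro power_mono) auto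
    then show "a\<^sup>2 * prod_list (map P w) \<le> prod_list (map P w) * (sum_list (map f w))\<^sup>2"
      using Pw w by (simp add: mult.commute mult_left_mono)
  qed
  also have "\<dots> \<le> (\<Sum>w\<in>words I n. prod_list (map P w) * (sum_list (map f w))\<^sup>2)"
    using I Pw by (intro sum_mono2) auto
  also have "\<dots> = real n * (\<Sum>i\<in>I. P i * (f i)\<^sup>2)" by (rule words_variance[OF P(1) f0])
  also have "\<dots> \<le> real n * (\<Sum>i\<in>I. P i * 1)"
    using P f1 by (intro mult_left_mono sum_mono) auto
  finally have "a\<^sup>2 * (\<Sum>w\<in>?B. prod_list (map P w)) \<le> real n" using P(1) by simp
  then show ?thesis using a by (simp add: pos_le_divide_eq mult.commute)
qed

lemma mset_map_words:
  "finite I \<Longrightarrow> set w \<subseteq> I \<Longrightarrow> mset (map T w) = (\<Sum>i\<in>I. replicate_mset (count_list w i) (T i))"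
proof (induction w)
  case (Cons j w)
  have "(\<Sum>i\<in>I. replicate_mset (count_list (j # w) i) (T i))
     = (\<Sum>i\<in>I. (if i = j then {#T j#} else {#}) + replicate_mset (count_list w i) (T i))"
    by (intro sum.cong refl) auto
  also have "\<dots> = {#T j#} + (\<Sum>i\<in>I. replicate_mset (count_list w i) (T i))"
    using Cons.prems by (simp add: sum.distrib)
  finally show ?case using Cons by simp
qed simp

text \<open>The copies are processed one after another; \<open>X\<close> collects the ensemble
  members obtained so far.\<close>

lemma ensemble_words:
  assumes e: "ensemble s I c T" and I: "finite I" and s: "s \<in> St k" and T: "\<And>i. i \<in> I \<Longrightarrow> T i \<in> St k"
    and N: "set_mset N \<subseteq> St k" and X: "set_mset X \<subseteq> St k"
    and v: "\<And>w. w \<in> words I n \<Longrightarrow> cvm k (X + mset (map T w)) N (v w)"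
  shows "cvm k (X + replicate_mset n s) N (\<Sum>w\<in>words I n. prod_list (map (\<lambda>i. (cmod (c i))\<^sup>2) w) * v w)"
  using X v
proof (induction n arbitrary: X v)
  case 0 then show ?case by simp
next
  case (Suc n)
  have "cvm k (add_mset s (X + replicate_mset n s)) N (\<Sum>i\<in>I. (cmod (c i))\<^sup>2 * (\<Sum>w\<in>words I n. prod_list (map (\<lambda>i. (cmod (c i))\<^sup>2) w) * v (i # w)))"
  proof (rule ensemble_cvm[OF e s T _ N])
    show "set_mset (X + replicate_mset n s) \<subseteq> St k" using Suc s by auto
    fix i assume i: "i \<in> I"
    have "cvm k (add_mset (T i) X + replicate_mset n s) N (\<Sum>w\<in>words I n. prod_list (map (\<lambda>i. (cmod (c i))\<^sup>2) w) * v (i # w))"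
    proof (rule Suc.IH)
      show "set_mset (add_mset (T i) X) \<subseteq> St k" using Suc T[OF i] by auto
      fix w assume "w \<in> words I n"
      then have "i # w \<in> words I (Suc n)" using i by (auto simp: words_def)
      from Suc.prems(2)[OF this] show "cvm k (add_mset (T i) X + mset (map T w)) N (v (i # w))" by simp
    qed
    then show "cvm k (add_mset (T i) (X + replicate_mset n s)) N (\<Sum>w\<in>words I n. prod_list (map (\<lambda>i. (cmod (c i))\<^sup>2) w) * v (i # w))"
      by simp
  qed
  moreover have "(\<Sum>w\<in>words I (Suc n). prod_list (map (\<lambda>i. (cmod (c i))\<^sup>2) w) * v w)
     = (\<Sum>i\<in>I. (cmod (c i))\<^sup>2 * (\<Sum>w\<in>words I n. prod_list (map (\<lambda>i. (cmod (c i))\<^sup>2) w) * v (i # w)))"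
    unfolding sum_words_Suc by (simp add: sum_distrib_left mult.assoc)
  ultimately show ?case by simp
qed

lemma cvm_zero: "set_mset M \<subseteq> St k \<Longrightarrow> set_mset N \<subseteq> St k \<Longrightarrow> cvm k M N 0"
  unfolding cvm_def by (intro conv_zero[of _ k] Pm_St)

lemma cvm_subset: "set_mset M \<subseteq> St k \<Longrightarrow> N \<subseteq># M \<Longrightarrow> cvm k M N 1"
  using cvm_discard[of N k "M - N"] by (metis in_diffD set_mset_mono subset_iff subset_mset.add_diff_inverse)

section \<open>Additive monotones and averages over ensembles\<close>

locale entanglement_functional =
  fixes k :: nat and E :: "pv multiset \<Rightarrow> real"
  assumes k: "2 \<le> k"
    and E_add: "\<lbrakk>set_mset M \<subseteq> St k; set_mset N \<subseteq> St k\<rbrakk> \<Longrightarrow> E (M + N) = E M + E N"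
    and E_g: "E {#ghz k 2#} = 1"
    and E_mono: "resource_theory.ge (St k) (cvm k) (ghz k 2) M N \<Longrightarrow> E N \<le> E M"
begin

sublocale resource_theory "St k" "cvm k" "ghz k 2"
  by (rule entanglement_resource_theory[OF k])

definition Es :: "pv \<Rightarrow> real" where "Es s = E {#s#}"

lemma E_empty [simp]: "E {#} = 0" using E_add[of "{#}" "{#}"] by simp

lemma E_repeat: "M \<in> Cr \<Longrightarrow> E (repeat_mset n M) = real n * E M"
proof (induction n)
  case (Suc n)
  then have "set_mset M \<subseteq> St k" "set_mset (repeat_mset n M) \<subseteq> St k" using Cr_repeat[of M n] by (auto simp: Cr_iff)
  then show ?case using E_add Suc by (simp add: algebra_simps)
qed simp

lemma E_replicate: "s \<in> St k \<Longrightarrow> E (replicate_mset n s) = real n * Es s"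
  using E_repeat[of "{#s#}" n] by (simp add: Es_def)

lemma E_nonneg: "M \<in> Cr \<Longrightarrow> 0 \<le> E M"
  using E_mono[OF ge_subset[of M "{#}"]] by simp

lemma Es_nonneg: "s \<in> St k \<Longrightarrow> 0 \<le> Es s" unfolding Es_def by (rule E_nonneg) simp

lemma E_sum:
  "finite I \<Longrightarrow> (\<And>i. i \<in> I \<Longrightarrow> X i \<in> Cr) \<Longrightarrow> (\<Sum>i\<in>I. X i) \<in> Cr \<and> E (\<Sum>i\<in>I. X i) = (\<Sum>i\<in>I. E (X i))"
proof (induction I rule: finite_induct)
  case (insert i I)
  then have "X i \<in> Cr" "sum X I \<in> Cr" by auto
  then show ?case using E_add[of "X i" "sum X I"] insert by (simp add: Cr_iff)
qed simp

lemma Es_mono_conv: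
  assumes "s \<in> St k" "t \<in> St k" "\<And>q. q < 1 \<Longrightarrow> conv s t q"
  shows "Es t \<le> Es s"
  unfolding Es_def
proof (rule E_mono, rule ge_of_cv)
  fix q :: real assume "q < 1"
  then have "conv (prodl k [s]) (prodl k [t]) q" using assms by (simp add: tens_unit_right)
  then have "cvm k (mset [s]) (mset [t]) q" by (subst cvm_list) (use assms in auto)
  then show "cvm k {#s#} {#t#} q" by simp
qed (use assms in auto)

text \<open>The two-element multiset of \<open>s\<close> and \<open>t\<close> and the single state
  \<open>tens s t\<close> have the same product, so they convert into each other, and additivity on
  multisets becomes additivity on tensor products.\<close>

lemma Es_tens:
  assumes "s \<in> St k" "t \<in> St k"
  shows "Es (tens s t) = Es s + Es t"
proof -
  have eq: "prodl k [tens s t] = prodl k [s, t]" using assms by (simp add: tens_unit_right tens_St)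
  have c: "conv (prodl k [s, t]) (prodl k [s, t]) q" if "q < 1" for q
    using that assms by (intro conv_antimono[OF conv_refl[OF prodl_St]]) auto
  have "cvm k (mset [tens s t]) (mset [s, t]) q" "cvm k (mset [s, t]) (mset [tens s t]) q" if "q < 1" for q
    using c[OF that] assms by (subst cvm_list; auto simp: eq[simplified] tens_St)+
  then have "E {#s, t#} \<le> E {#tens s t#}" "E {#tens s t#} \<le> E {#s, t#}"
    using assms by (auto intro!: E_mono ge_of_cv simp: tens_St)
  moreover have "E {#s, t#} = Es s + Es t" using E_add[of "{#s#}" "{#t#}"] assms by (simp add: Es_def add_mset_commute)
  ultimately show ?thesis by (simp add: Es_def)
qed

lemma Es_le_log:
  assumes "s \<in> St k" "prod_list (fst s) \<le> 2 ^ n"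
  shows "Es s \<le> real n"
proof -
  have "cvm k (replicate_mset n (ghz k 2)) {#s#} q" if "q < 1" for q
    using cvm_from_g[OF _ assms] k that cv_antimono less_imp_le by (metis less_le_trans zero_less_numeral)
  then have "E {#s#} \<le> E (replicate_mset n (ghz k 2))" using assms by (intro E_mono ge_of_cv) auto
  then show ?thesis using E_replicate[OF g_in] E_g by (simp add: Es_def)
qed

text \<open>By the law of large numbers, \<open>l\<close> copies of \<open>s\<close> are
  asymptotically worth a multiset \<open>Y\<close> with almost \<open>l * P i\<close> copies of each
  \<open>T i\<close>. Monotonicity and additivity give the inequality up to an error that vanishes
  as \<open>l\<close> grows.\<close>

lemma Es_average:
  assumes e: "ensemble s I c T" and I: "finite I" and s: "s \<in> St k" and T: "\<And>i. i \<in> I \<Longrightarrow> T i \<in> St k"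
    and P1: "(\<Sum>i\<in>I. (cmod (c i))\<^sup>2) = 1"
  shows "(\<Sum>i\<in>I. (cmod (c i))\<^sup>2 * Es (T i)) \<le> Es s"
proof -
  define P where "P = (\<lambda>i. (cmod (c i))\<^sup>2)"
  have Psum: "sum P I = 1" using P1 by (simp add: P_def)
  have P0: "0 \<le> P i" for i by (simp add: P_def)
  define K where "K = (\<Sum>i\<in>I. Es (T i))"
  have K0: "0 \<le> K" unfolding K_def using Es_nonneg T by (intro sum_nonneg) auto
  have main: "(\<Sum>i\<in>I. P i * Es (T i)) \<le> Es s + 2 / real l * K" if l: "l > 0" for l :: nat
  proof -
    \<comment> \<open>In a block of \<open>l\<close> copies the demand for each \<open>T i\<close>
      stays \<open>l * \<delta> = 1\<close> below its expectation; over \<open>n\<close> blocks this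
      becomes a margin linear in \<open>n\<close>. In \<open>m\<close>, \<open>nat\<close> turns a
      negative demand into 0.\<close>
    define \<delta> where "\<delta> = 1 / real l"
    have d: "\<delta> > 0" using l by (simp add: \<delta>_def)
    define m where "m = (\<lambda>i. nat \<lfloor>real l * (P i - \<delta>)\<rfloor>)"
    define Y where "Y = (\<Sum>i\<in>I. replicate_mset (m i) (T i))"
    have rep: "replicate_mset j (T i) \<in> Cr" if "i \<in> I" for i j using T[OF that] by (auto simp: Cr_iff)
    have Y: "Y \<in> Cr" "E Y = (\<Sum>i\<in>I. real (m i) * Es (T i))"
      unfolding Y_def using E_sum[OF I rep] E_replicate[OF T] by simp_all
    have sC: "replicate_mset j s \<in> Cr" for j using s by (auto simp: Cr_iff)
    have mle: "real (m i) \<le> real l * (P i - \<delta>)" if "m i > 0" for i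
      using that unfolding m_def by linarith
    \<comment> \<open>Union bound over the letters: a word fails only if some letter falls short of
      its expectation by \<delta> times the length of the word.\<close>
    have prob: "cvm k (replicate_mset (n * l) s) (repeat_mset n Y) (1 - real (card I) * (real (n * l) / (\<delta> * real (n * l))\<^sup>2))"
      if n: "n > 0" for n
    proof -
      let ?n = "n * l" and ?N = "repeat_mset n Y"
      have N0: "real ?n > 0" using n l by simp
      let ?good = "\<lambda>w. \<forall>i\<in>I. n * m i \<le> count_list w i"
      have NC: "?N \<in> Cr" using Y by simp
      have "cvm k ({#} + mset (map T w)) ?N (if ?good w then 1 else 0)" if w: "w \<in> words I ?n" for w
      proof -
        have wI: "set w \<subseteq> I" using w by (simp add: words_def)
        have wS: "set_mset (mset (map T w)) \<subseteq> St k" using wI T by auto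
        show ?thesis
        proof (cases "?good w")
          case True
          have "?N = (\<Sum>i\<in>I. replicate_mset (n * m i) (T i))"
            unfolding Y_def using I by (induction I rule: finite_induct) auto
          also have "\<dots> \<subseteq># (\<Sum>i\<in>I. replicate_mset (count_list w i) (T i))"
            using I True by (induction I rule: finite_induct) (auto intro: replicate_mset_subset subset_mset.add_mono)
          also have "\<dots> = mset (map T w)" by (rule mset_map_words[OF I wI, symmetric])
          finally show ?thesis using True cvm_subset[OF wS] by simp
        next
          case False
          show ?thesis unfolding if_not_P[OF False] using cvm_zero[OF wS, of ?N] NC by (simp add: Cr_iff)
        qed
      qed
      then have "cvm k ({#} + replicate_mset ?n s) ?N (\<Sum>w\<in>words I ?n. prod_list (map (\<lambda>i. (cmod (c i))\<^sup>2) w) * (if ?good w then 1 else 0))"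
        using NC by (intro ensemble_words[OF e I s T]) (auto simp: Cr_iff)
      then have cv: "cvm k (replicate_mset ?n s) ?N (\<Sum>w\<in>words I ?n. prod_list (map P w) * (if ?good w then 1 else 0))"
        by (simp add: P_def)
      have Pw: "0 \<le> prod_list (map P w)" for w using P0 by (auto intro!: prod_list_nonneg)
      let ?bad = "\<lambda>i. {w \<in> words I ?n. \<delta> * real ?n \<le> real ?n * P i - real (count_list w i)}"
      have "1 = (\<Sum>w\<in>words I ?n. prod_list (map P w))" using sum_words_prob[OF Psum] by simp
      also have "\<dots> \<le> (\<Sum>w\<in>words I ?n. prod_list (map P w) * (if ?good w then 1 else 0) + (\<Sum>i\<in>I. if w \<in> ?bad i then prod_list (map P w) else 0))"
      proof (rule sum_mono)
        fix w assume w: "w \<in> words I ?n"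
        show "prod_list (map P w) \<le> prod_list (map P w) * (if ?good w then 1 else 0) + (\<Sum>i\<in>I. if w \<in> ?bad i then prod_list (map P w) else 0)"
        proof (cases "?good w")
          case True then show ?thesis using Pw by (auto intro!: sum_nonneg)
        next
          case False
          then obtain i where i: "i \<in> I" "count_list w i < n * m i" by (auto simp: not_le)
          then have "m i > 0" by (cases "m i") auto
          from mle[OF this] have "real n * real (m i) \<le> real n * (real l * (P i - \<delta>))" by (intro mult_left_mono) auto
          moreover have "real (count_list w i) \<le> real n * real (m i)" using i(2) by (metis less_imp_le of_nat_le_iff of_nat_mult)
          ultimately have "w \<in> ?bad i" using w by (simp add: algebra_simps)
          then have "prod_list (map P w) \<le> (\<Sum>i\<in>I. if w \<in> ?bad i then prod_list (map P w) else 0)"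
            using member_le_sum[OF i(1), of "\<lambda>i. if w \<in> ?bad i then prod_list (map P w) else 0"] I Pw by simp
          then show ?thesis unfolding if_not_P[OF False] by simp
        qed
      qed
      also have "\<dots> = (\<Sum>w\<in>words I ?n. prod_list (map P w) * (if ?good w then 1 else 0)) + (\<Sum>i\<in>I. \<Sum>w\<in>?bad i. prod_list (map P w))"
      proof -
        have "(\<Sum>w\<in>words I ?n. \<Sum>i\<in>I. if w \<in> ?bad i then prod_list (map P w) else 0)
           = (\<Sum>i\<in>I. \<Sum>w\<in>words I ?n. if w \<in> ?bad i then prod_list (map P w) else 0)" by (rule sum.swap)
        also have "\<dots> = (\<Sum>i\<in>I. \<Sum>w\<in>?bad i. prod_list (map P w))"
        proof (rule sum.cong[OF refl])
          fix i
          show "(\<Sum>w\<in>words I ?n. if w \<in> ?bad i then prod_list (map P w) else 0) = (\<Sum>w\<in>?bad i. prod_list (map P w))"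
            by (rule sum.mono_neutral_cong_right) (use I in auto)
        qed
        finally show ?thesis by (simp add: sum.distrib)
      qed
      also have "(\<Sum>i\<in>I. \<Sum>w\<in>?bad i. prod_list (map P w)) \<le> (\<Sum>i\<in>I. real ?n / (\<delta> * real ?n)\<^sup>2)"
        using d N0 by (intro sum_mono words_Chebyshev[OF I Psum P0]) (auto simp del: of_nat_mult)
      also have "\<dots> = real (card I) * (real ?n / (\<delta> * real ?n)\<^sup>2)" by simp
      finally have "1 - real (card I) * (real ?n / (\<delta> * real ?n)\<^sup>2) \<le> (\<Sum>w\<in>words I ?n. prod_list (map P w) * (if ?good w then 1 else 0))"
        by simp
      then show ?thesis using cv cv_antimono by blast
    qed
    have "ge (replicate_mset l s) Y"
    proof (rule geI[OF sC Y(1)])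
      show "tends (\<lambda>n. repeat_mset n (replicate_mset l s)) (\<lambda>n. repeat_mset n Y)"
        unfolding tends_def
      proof (intro conjI allI impI)
        fix \<epsilon> :: real assume eps: "\<epsilon> > 0"
        obtain n0 :: nat where n0: "real n0 \<ge> real (card I) / (\<epsilon> * \<delta>\<^sup>2)" using real_arch_simple by blast
        have "cvm k (repeat_mset n (replicate_mset l s)) (repeat_mset n Y) (1 - \<epsilon>)" if n: "n \<ge> n0 + 1" for n
        proof -
          have np: "n > 0" and nn: "real n \<ge> real (card I) / (\<epsilon> * \<delta>\<^sup>2)" using n n0 by auto
          have "real n * 1 \<le> real n * real l" using l by (intro mult_left_mono) auto
          then have "real (card I) / (\<epsilon> * \<delta>\<^sup>2) \<le> real (n * l)" using nn by simp
          then have "real (card I) \<le> real (n * l) * (\<epsilon> * \<delta>\<^sup>2)" using eps d by (simp add: pos_divide_le_eq)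
          moreover have "real (n * l) > 0" using np l by simp
          ultimately have "real (card I) / (\<delta>\<^sup>2 * real (n * l)) \<le> \<epsilon>" using d
            by (subst pos_divide_le_eq) (auto simp: ac_simps simp del: of_nat_mult)
          moreover have "real (card I) * (real (n * l) / (\<delta> * real (n * l))\<^sup>2) = real (card I) / (\<delta>\<^sup>2 * real (n * l))"
            using \<open>real (n * l) > 0\<close> by (simp add: power2_eq_square)
          ultimately show ?thesis using prob[OF np] cv_antimono by simp
        qed
        then show "\<forall>\<^sub>F n in sequentially. cvm k (repeat_mset n (replicate_mset l s)) (repeat_mset n Y) (1 - \<epsilon>)"
          by (rule eventually_sequentiallyI)
      qed (use Y sC in auto)
    qed
    then have "E Y \<le> real l * Es s" using E_mono E_replicate[OF s] by metis
    moreover have "(\<Sum>i\<in>I. (real l * P i - 2) * Es (T i)) \<le> E Y"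
      unfolding Y(2)
    proof (rule sum_mono)
      fix i assume i: "i \<in> I"
      \<comment> \<open>One copy is lost to the margin \<delta> and at most one to rounding.\<close>
      have "real l * (P i - \<delta>) - 1 \<le> real (m i)" unfolding m_def by linarith
      moreover have "real l * \<delta> = 1" using l by (simp add: \<delta>_def)
      ultimately have "real l * P i - 2 \<le> real (m i)" by (simp add: right_diff_distrib)
      then show "(real l * P i - 2) * Es (T i) \<le> real (m i) * Es (T i)"
        using Es_nonneg[OF T[OF i]] by (rule mult_right_mono)
    qed
    ultimately have "real l * (\<Sum>i\<in>I. P i * Es (T i)) - 2 * K \<le> real l * Es s"
      by (simp add: left_diff_distrib sum_subtractf sum_distrib_left K_def mult.assoc)
    then show ?thesis using l by (simp add: field_simps)
  qed
  show ?thesis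
  proof (rule field_le_epsilon)
    fix e :: real assume e: "e > 0"
    obtain l :: nat where l: "real l \<ge> 2 * K / e + 1" using real_arch_simple by blast
    have "2 * K / e \<ge> 0" using K0 e by simp
    then have l0: "real l > 0" using l by linarith
    have "2 * K / e \<le> real l" using l by linarith
    then have "2 / real l * K \<le> e" using e l0 by (simp add: field_simps)
    then show "(\<Sum>i\<in>I. (cmod (c i))\<^sup>2 * Es (T i)) \<le> Es s + e"
      using main[of l] l0 by (simp add: P_def)
  qed
qed

end

section \<open>Flagged superpositions\<close>

definition ket :: "nat \<Rightarrow> nat \<Rightarrow> amp" where
  "ket k s = (\<lambda>xs. if xs = replicate k s then 1 else 0)"

definition fs :: "nat \<Rightarrow> nat \<Rightarrow> nat list \<Rightarrow> (nat \<Rightarrow> complex) \<Rightarrow> (nat \<Rightarrow> amp) \<Rightarrow> amp" where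
  "fs k r f c v = (\<lambda>xs. \<Sum>s<r. c s * tn (replicate k r) (ket k s) f (v s) xs)"

text \<open>The locally flagged superposition \<open>\<Sum>\<^sub>s c\<^sub>s |s\<dots>s\<rangle> \<otimes> v\<^sub>s\<close>.\<close>

definition FS :: "nat \<Rightarrow> nat \<Rightarrow> nat list \<Rightarrow> (nat \<Rightarrow> complex) \<Rightarrow> (nat \<Rightarrow> amp) \<Rightarrow> pv" where
  "FS k r f c v = (dmul (replicate k r) f, fs k r f c v)"

lemma fst_FS [simp]: "fst (FS k r f c v) = dmul (replicate k r) f" by (simp add: FS_def)

lemma snd_FS [simp]: "snd (FS k r f c v) = fs k r f c v" by (simp add: FS_def)

lemma ip_ket:
  assumes k: "0 < k" and s: "s < r" "s' < r"
  shows "ip (replicate k r) (ket k s) (ket k s') = (if s = s' then 1 else 0)"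
proof -
  have "ip (replicate k r) (ket k s) (ket k s') = (\<Sum>xs\<in>ibox (replicate k r). if xs = replicate k s then (if s = s' then 1 else 0) else 0)"
    unfolding ip_def ket_def using k by (intro sum.cong refl) (auto simp: replicate_eq)
  then show ?thesis using s by simp
qed

lemma ip_fs:
  assumes k: "0 < k" and f: "length f = k"
  shows "ip (dmul (replicate k r) f) (fs k r f c v) (fs k r f c' v') = (\<Sum>s<r. cnj (c s) * c' s * ip f (v s) (v' s))"
proof -
  have "ip (dmul (replicate k r) f) (fs k r f c v) (fs k r f c' v')
    = (\<Sum>x\<in>ibox (dmul (replicate k r) f). \<Sum>s<r. \<Sum>s'<r. cnj (c s) * c' s' *
         (cnj (tn (replicate k r) (ket k s) f (v s) x) * tn (replicate k r) (ket k s') f (v' s') x))"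
    unfolding ip_def fs_def cnj_sum sum_product by (intro sum.cong refl) (simp add: ac_simps)
  also have "\<dots> = (\<Sum>s<r. \<Sum>s'<r. cnj (c s) * c' s' * ip (dmul (replicate k r) f)
         (tn (replicate k r) (ket k s) f (v s)) (tn (replicate k r) (ket k s') f (v' s')))"
    unfolding ip_def sum_distrib_left
    by (rule trans[OF sum.swap]) (intro sum.cong refl sum.swap)
  also have "\<dots> = (\<Sum>s<r. \<Sum>s'<r. if s' = s then cnj (c s) * c' s * ip f (v s) (v' s) else 0)"
    using k f by (intro sum.cong refl) (auto simp: ip_tn ip_ket)
  finally show ?thesis by simp
qed

lemma supp_sum: "(\<And>i. i \<in> I \<Longrightarrow> supp d (a i)) \<Longrightarrow> supp d (\<lambda>x. \<Sum>i\<in>I. w i * a i x)"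
  by (auto simp: supp_def intro!: sum.neutral)

lemma supp_fs: "supp (dmul (replicate k r) f) (fs k r f c v)"
  unfolding fs_def by (intro supp_sum supp_tn)

lemma FS_St:
  assumes k: "0 < k" and r: "0 < r" and f: "valid_dims k f" and c: "(\<Sum>s<r. (cmod (c s))\<^sup>2) = 1"
    and v: "\<And>s. s < r \<Longrightarrow> nrm f (v s) = 1"
  shows "FS k r f c v \<in> St k"
proof -
  have l: "length f = k" using f by (simp add: valid_dims_def)
  have "complex_of_real (nrm (dmul (replicate k r) f) (fs k r f c v)) = (\<Sum>s<r. cnj (c s) * c s * ip f (v s) (v s))"
    unfolding ip_self[symmetric] ip_fs[OF k l] ..
  also have "\<dots> = complex_of_real (\<Sum>s<r. (cmod (c s))\<^sup>2)"
    unfolding of_real_sum complex_norm_square by (intro sum.cong refl) (simp add: ip_self v ac_simps)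
  finally have "nrm (dmul (replicate k r) f) (fs k r f c v) = 1" using c of_real_eq_iff by metis
  moreover have "valid_dims k (replicate k r)" using r by (simp add: valid_dims_def)
  ultimately show ?thesis using f by (simp add: St_def supp_fs dmul_valid)
qed

lemma tn_sum_left: "tn d (\<lambda>x. \<Sum>i\<in>I. w i * a i x) f b = (\<lambda>x. \<Sum>i\<in>I. w i * tn d (a i) f b x)"
  by (auto simp: tn_def sum_distrib_right mult.assoc)

lemma tn_sum_right: "tn d a f (\<lambda>x. \<Sum>i\<in>I. w i * b i x) = (\<lambda>x. \<Sum>i\<in>I. w i * tn d a f (b i) x)"
  by (auto simp: tn_def sum_distrib_left mult.left_commute)

lemma tens_FS:
  assumes "length f = k" "length h = k"
  shows "tens (FS k r f c v) (h, b) = FS k r (dmul f h) c (\<lambda>s. tn f (v s) h b)"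
  unfolding tens_def FS_def fst_conv snd_conv fs_def tn_sum_left dmul_assoc
  using assms by (simp add: tn_assoc)

text \<open>Every party holds a copy of the flag, so a relabelling that depends on the flag is still
  local: party \<open>j\<close> reads the flag as \<open>x div f ! j\<close> and transforms
  \<open>x mod f ! j\<close>. Index lists on which the parties disagree about the flag carry
  amplitude 0.\<close>

lemma ctrl_relabel:
  assumes k: "0 < k" and f: "length f = k" "length f' = k"
    and \<iota>: "inj_on \<iota> {..<r}" "\<And>s. s < r \<Longrightarrow> \<iota> s < r'"
    and T: "\<And>s. s < r \<Longrightarrow> rl f f' (T s)"
  shows "\<exists>U. rl (dmul (replicate k r) f) (dmul (replicate k r') f') U \<and>
     (\<forall>s<r. \<forall>a. U (tn (replicate k r) (ket k s) f a) = tn (replicate k r') (ket k (\<iota> s)) f' (T s a))"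
proof -
  have "\<forall>s. \<exists>p. s < r \<longrightarrow> isrel f f' (fst p) (snd p) \<and> T s = mact f f' (fst p) (snd p)"
    using T unfolding rl_def by (metis fst_conv snd_conv)
  then obtain p where p: "\<And>s. s < r \<Longrightarrow> isrel f f' (fst (p s)) (snd (p s))"
      "\<And>s. s < r \<Longrightarrow> T s = mact f f' (fst (p s)) (snd (p s))" by metis
  define \<rho> where "\<rho> = (\<lambda>j x. \<iota> (x div f ! j) * f' ! j + fst (p (x div f ! j)) j (x mod f ! j))"
  define b where "b = (\<lambda>j x. snd (p (x div f ! j)) j (x mod f ! j))"
  let ?R = "replicate k r" and ?R' = "replicate k r'"
  have lR: "length ?R = length f" "length ?R' = length f'" using f by auto
  have r: "isrel (dmul ?R f) (dmul ?R' f') \<rho> b"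
    unfolding isrel_def
  proof (intro conjI allI impI)
    fix j x assume "j < length (dmul ?R f)" "x < dmul ?R f ! j"
    then have j: "j < k" "j < length f" and x: "x < r * f ! j" using f by auto
    have fj: "f ! j > 0" using x by (metis mult_0_right not_gr_zero not_less_zero)
    have xd: "x div f ! j < r" "x mod f ! j < f ! j" using x fj by (auto simp: less_mult_imp_div_less)
    then have "fst (p (x div f ! j)) j (x mod f ! j) < f' ! j" "cmod (b j x) = 1"
      using p(1)[OF xd(1)] j by (auto simp: isrel_def b_def)
    then show "\<rho> j x < dmul ?R' f' ! j" "cmod (b j x) = 1"
      using j f \<iota>(2)[OF xd(1)] by (auto simp: \<rho>_def mult_add_less)
  next
    fix j assume "j < length (dmul ?R f)"
    then have j: "j < k" "j < length f" using f by auto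
    show "inj_on (\<rho> j) {..<dmul ?R f ! j}"
    proof (rule inj_onI)
      fix x y assume "x \<in> {..<dmul ?R f ! j}" "y \<in> {..<dmul ?R f ! j}" and eq: "\<rho> j x = \<rho> j y"
      then have xy: "x < r * f ! j" "y < r * f ! j" using j f by auto
      have fj: "f ! j > 0" using xy by (metis mult_0_right not_gr_zero not_less_zero)
      have xd: "x div f ! j < r" "x mod f ! j < f ! j" "y div f ! j < r" "y mod f ! j < f ! j"
        using xy fj by (auto simp: less_mult_imp_div_less)
      have lt: "fst (p (x div f ! j)) j (x mod f ! j) < f' ! j" "fst (p (y div f ! j)) j (y mod f ! j) < f' ! j"
        using p(1)[OF xd(1)] p(1)[OF xd(3)] xd j by (auto simp: isrel_def)
      have e1: "\<iota> (x div f ! j) = \<iota> (y div f ! j)"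
        using arg_cong[OF eq, of "\<lambda>z. z div f' ! j"] lt unfolding \<rho>_def by (simp only: mult_add_div)
      then have "x div f ! j = y div f ! j" using \<iota>(1) xd by (auto simp: inj_on_def)
      moreover from this have "fst (p (x div f ! j)) j (x mod f ! j) = fst (p (x div f ! j)) j (y mod f ! j)"
        using eq e1 unfolding \<rho>_def by simp
      then have "x mod f ! j = y mod f ! j" using p(1)[OF xd(1)] xd j by (auto simp: isrel_def inj_on_def)
      ultimately show "x = y" by (metis div_mult_mod_eq)
    qed
  qed (use f in auto)
  have pj: "pm \<rho> (join f us ys) = join f' (map \<iota> us) (map (\<lambda>j. fst (p (us ! j)) j (ys ! j)) [0..<k])"
    if "us \<in> ibox ?R" "ys \<in> ibox f" for us ys
    using that f nth_box[OF that(2)] by (intro nth_equalityI) (auto simp: \<rho>_def length_box)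
  have "mact (dmul ?R f) (dmul ?R' f') \<rho> b (tn ?R (ket k s) f a) = tn ?R' (ket k (\<iota> s)) f' (T s a)" if s: "s < r" for s a
  proof (rule mact_eqI[OF r supp_tn])
    fix zs assume "zs \<in> ibox (dmul ?R f)"
    then obtain us ys where z: "us \<in> ibox ?R" "ys \<in> ibox f" "zs = join f us ys" using box_dmul_cases[OF lR(1)] by blast
    have lu: "length us = k" and ly: "length ys = k" using z f by (auto simp: length_box)
    have uj: "us ! j < r" if "j < k" for j using nth_box[OF z(1), of j] that by simp
    let ?w = "map (\<lambda>j. fst (p (us ! j)) j (ys ! j)) [0..<k]"
    have w: "?w \<in> ibox f'"
      using p(1)[OF uj] nth_box[OF z(2)] f by (auto simp: ibox_def isrel_def)
    have mu: "map \<iota> us \<in> ibox ?R'" using uj lu \<iota>(2) by (auto simp: ibox_def)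
    have L: "tn ?R' (ket k (\<iota> s)) f' (T s a) (pm \<rho> zs) = ket k (\<iota> s) (map \<iota> us) * T s a ?w"
      unfolding z(3) pj[OF z(1,2)] by (rule tn_join[OF lR(2) mu w])
    have R: "tn ?R (ket k s) f a zs = ket k s us * a ys" unfolding z(3) by (rule tn_join[OF lR(1) z(1,2)])
    show "tn ?R' (ket k (\<iota> s)) f' (T s a) (pm \<rho> zs) = (\<Prod>j<length (dmul ?R f). b j (zs ! j)) * tn ?R (ket k s) f a zs"
    proof (cases "us = replicate k s")
      case True
      have w': "?w = pm (fst (p s)) ys" using True ly by (intro nth_equalityI) auto
      have "T s a ?w = (\<Prod>j<length f. snd (p s) j (ys ! j)) * a ys"
        unfolding w' p(2)[OF s] by (rule mact_pm[OF p(1)[OF s] z(2)])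
      moreover have "(\<Prod>j<length (dmul ?R f). b j (zs ! j)) = (\<Prod>j<length f. snd (p s) j (ys ! j))"
        using True f nth_box[OF z(2)] by (intro prod.cong) (auto simp: b_def z(3))
      ultimately show ?thesis unfolding L R using True by (simp add: ket_def)
    next
      case False
      have "map \<iota> us \<noteq> replicate k (\<iota> s)"
      proof
        assume eq: "map \<iota> us = replicate k (\<iota> s)"
        have "us ! j = s" if "j < k" for j
          using arg_cong[OF eq, of "\<lambda>l. l ! j"] that lu uj[OF that] s \<iota>(1) by (auto simp: inj_on_def)
        then show False using False lu by (auto simp: list_eq_iff_nth_eq)
      qed
      then show ?thesis unfolding L R using False by (simp add: ket_def)
    qed
  next
    fix zs assume "zs \<in> ibox (dmul ?R' f')" and n: "zs \<notin> pm \<rho> ` ibox (dmul ?R f)"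
    then obtain us ys where z: "us \<in> ibox ?R'" "ys \<in> ibox f'" "zs = join f' us ys" using box_dmul_cases[OF lR(2)] by blast
    have L: "tn ?R' (ket k (\<iota> s)) f' (T s a) zs = ket k (\<iota> s) us * T s a ys"
      unfolding z(3) by (rule tn_join[OF lR(2) z(1,2)])
    show "tn ?R' (ket k (\<iota> s)) f' (T s a) zs = 0"
    proof (cases "us = replicate k (\<iota> s)")
      case True
      have "ys \<notin> pm (fst (p s)) ` ibox f"
      proof
        assume "ys \<in> pm (fst (p s)) ` ibox f"
        then obtain xs where xs: "xs \<in> ibox f" "ys = pm (fst (p s)) xs" by blast
        have sR: "replicate k s \<in> ibox ?R" using s by simp
        have "pm \<rho> (join f (replicate k s) xs) = zs"
          unfolding pj[OF sR xs(1)] z(3) True xs(2) using xs(1) f by (intro nth_equalityI) (auto simp: length_box)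
        then show False using n join_in_box[OF lR(1) sR xs(1)] by blast
      qed
      then have "T s a ys = 0" unfolding p(2)[OF s] by (rule mact_notin)
      then show ?thesis unfolding L by simp
    next
      case False then show ?thesis unfolding L by (simp add: ket_def)
    qed
  qed
  then show ?thesis using r by (intro exI[of _ "mact (dmul ?R f) (dmul ?R' f') \<rho> b"]) (auto simp: rl_def)
qed

lemma FS_relab:
  assumes k: "0 < k" and f: "length f = k" "length f' = k"
    and \<iota>: "inj_on \<iota> {..<r}" "\<And>s. s < r \<Longrightarrow> \<iota> s < r'"
    and c: "\<And>s. s < r \<Longrightarrow> c' (\<iota> s) = c s" "\<And>s'. s' < r' \<Longrightarrow> s' \<notin> \<iota> ` {..<r} \<Longrightarrow> c' s' = 0"
    and v: "\<And>s. s < r \<Longrightarrow> relab (f, v s) (f', v' (\<iota> s))"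
  shows "relab (FS k r f c v) (FS k r' f' c' v')"
proof -
  have "\<forall>s. \<exists>T. s < r \<longrightarrow> rl f f' T \<and> v' (\<iota> s) = T (v s)" using v by (auto simp: relab_def)
  then obtain T where T: "\<And>s. s < r \<Longrightarrow> rl f f' (T s)" "\<And>s. s < r \<Longrightarrow> v' (\<iota> s) = T s (v s)" by metis
  obtain U where U: "rl (dmul (replicate k r) f) (dmul (replicate k r') f') U"
     "\<And>s a. s < r \<Longrightarrow> U (tn (replicate k r) (ket k s) f a) = tn (replicate k r') (ket k (\<iota> s)) f' (T s a)"
  proof -
    have "\<exists>U. rl (dmul (replicate k r) f) (dmul (replicate k r') f') U \<and>
     (\<forall>s<r. \<forall>a. U (tn (replicate k r) (ket k s) f a) = tn (replicate k r') (ket k (\<iota> s)) f' (T s a))"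
      by (rule ctrl_relabel[OF k f \<iota>(1)]) (use \<iota>(2) T(1) in auto)
    then show ?thesis using that by blast
  qed
  have "U (fs k r f c v) = (\<lambda>x. \<Sum>s<r. c s * U (tn (replicate k r) (ket k s) f (v s)) x)"
    unfolding fs_def by (rule rl_sum[OF U(1)])
  also have "\<dots> = (\<lambda>x. \<Sum>s<r. c' (\<iota> s) * tn (replicate k r') (ket k (\<iota> s)) f' (v' (\<iota> s)) x)"
    using U(2) c(1) T(2) by (intro ext sum.cong) auto
  also have "\<dots> = (\<lambda>x. \<Sum>s'\<in>\<iota> ` {..<r}. c' s' * tn (replicate k r') (ket k s') f' (v' s') x)"
    by (simp add: sum.reindex[OF \<iota>(1)])
  also have "\<dots> = fs k r' f' c' v'"
    unfolding fs_def
  proof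
    fix x
    show "(\<Sum>s'\<in>\<iota> ` {..<r}. c' s' * tn (replicate k r') (ket k s') f' (v' s') x) = (\<Sum>s<r'. c' s * tn (replicate k r') (ket k s) f' (v' s) x)"
      using \<iota>(2) c(2) by (intro sum.mono_neutral_left) auto
  qed
  finally show ?thesis using U(1) by (auto simp: relab_def)
qed

lemma middle_swap:
  assumes l: "length R = n" "length R' = n" "length f = n" "length f' = n"
  shows "\<exists>U. rl (dmul (dmul R R') (dmul f f')) (dmul (dmul R f) (dmul R' f')) U \<and>
    (\<forall>A B C D. U (tn (dmul R R') (tn R A R' B) (dmul f f') (tn f C f' D)) = tn (dmul R f) (tn R A f C) (dmul R' f') (tn R' B f' D))"
proof -
  obtain U1 where U1: "rl (dmul R' f) (dmul f R') U1" "\<forall>B C. U1 (tn R' B f C) = tn f C R' B"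
    using rl_swap[of R' f] l by auto
  obtain U2 where U2: "rl (dmul (dmul R' f) f') (dmul (dmul f R') f') U2"
     "\<forall>a b. U2 (tn (dmul R' f) a f' b) = tn (dmul f R') (U1 a) f' b"
    using rl_tensR[OF U1(1), of f'] l by auto
  obtain U3 where U3: "rl (dmul R (dmul (dmul R' f) f')) (dmul R (dmul (dmul f R') f')) U3"
     "\<forall>a b. U3 (tn R b (dmul (dmul R' f) f') a) = tn R b (dmul (dmul f R') f') (U2 a)"
    using rl_tensL[OF U2(1), of R] l by auto
  have "U3 (tn (dmul R R') (tn R A R' B) (dmul f f') (tn f C f' D)) = tn (dmul R f) (tn R A f C) (dmul R' f') (tn R' B f' D)" for A B C D
  proof -
    have "tn (dmul R R') (tn R A R' B) (dmul f f') (tn f C f' D) = tn R A (dmul R' (dmul f f')) (tn R' B (dmul f f') (tn f C f' D))"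
      using l by (intro tn_assoc) auto
    also have "tn R' B (dmul f f') (tn f C f' D) = tn (dmul R' f) (tn R' B f C) f' D"
      using l by (intro tn_assoc[symmetric]) auto
    finally have 1: "tn (dmul R R') (tn R A R' B) (dmul f f') (tn f C f' D) = tn R A (dmul (dmul R' f) f') (tn (dmul R' f) (tn R' B f C) f' D)"
      by (simp add: dmul_assoc)
    have "tn (dmul R f) (tn R A f C) (dmul R' f') (tn R' B f' D) = tn R A (dmul f (dmul R' f')) (tn f C (dmul R' f') (tn R' B f' D))"
      using l by (intro tn_assoc) auto
    also have "tn f C (dmul R' f') (tn R' B f' D) = tn (dmul f R') (tn f C R' B) f' D"
      using l by (intro tn_assoc[symmetric]) auto
    finally have 2: "tn (dmul R f) (tn R A f C) (dmul R' f') (tn R' B f' D) = tn R A (dmul (dmul f R') f') (tn (dmul f R') (tn f C R' B) f' D)"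
      by (simp add: dmul_assoc)
    show ?thesis unfolding 1 2 using U1(2) U2(2) U3(2) by simp
  qed
  then show ?thesis using U3(1) by (intro exI[of _ U3]) (simp add: dmul_assoc)
qed

lemma ket_tn:
  assumes k: "0 < k" and s: "s < r" "s' < r'"
  shows "tn (replicate k r) (ket k s) (replicate k r') (ket k s') = ket k (s * r' + s')"
proof -
  have d: "dmul (replicate k r) (replicate k r') = replicate k (r * r')" by (rule nth_equalityI) auto
  have "ket k (s * r' + s') = tn (replicate k r) (ket k s) (replicate k r') (ket k s')"
  proof (rule tn_eqI)
    show "supp (dmul (replicate k r) (replicate k r')) (ket k (s * r' + s'))"
      unfolding d using mult_add_less[OF s] by (auto simp: supp_def ket_def)
    fix xs ys assume xs: "xs \<in> ibox (replicate k r)" and ys: "ys \<in> ibox (replicate k r')"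
    have l: "length xs = k" "length ys = k" using xs ys by (auto simp: length_box)
    have "join (replicate k r') xs ys = replicate k (s * r' + s') \<longleftrightarrow> xs = replicate k s \<and> ys = replicate k s'"
    proof
      assume eq: "join (replicate k r') xs ys = replicate k (s * r' + s')"
      have j: "xs ! j * r' + ys ! j = s * r' + s'" if "j < k" for j using arg_cong[OF eq, of "\<lambda>l. l ! j"] that by simp
      have y: "ys ! j < r'" if "j < k" for j using nth_box[OF ys, of j] that by simp
      have "xs ! j = s \<and> ys ! j = s'" if "j < k" for j
        using j[OF that] y[OF that] s(2) by (metis add_left_cancel mult_add_div)
      then show "xs = replicate k s \<and> ys = replicate k s'" using l by (auto simp: list_eq_iff_nth_eq)
    next
      assume "xs = replicate k s \<and> ys = replicate k s'"
      then show "join (replicate k r') xs ys = replicate k (s * r' + s')" by (intro nth_equalityI) auto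
    qed
    then show "ket k (s * r' + s') (join (replicate k r') xs ys) = ket k s xs * ket k s' ys" by (simp add: ket_def)
  qed simp
  then show ?thesis by simp
qed

text \<open>Once the middle factors are exchanged, the two flags \<open>s\<close> and
  \<open>s'\<close> merge into the single flag \<open>s * r' + s'\<close>.\<close>

lemma FS_mult:
  assumes k: "0 < k" and f: "length f = k" "length f' = k"
  shows "relab (FS k (r * r') (dmul f f') (\<lambda>s. c (s div r') * c' (s mod r')) (\<lambda>s. tn f (v (s div r')) f' (v' (s mod r'))))
    (tens (FS k r f c v) (FS k r' f' c' v'))"
proof -
  let ?R = "replicate k r" and ?R' = "replicate k r'"
  have d: "dmul ?R ?R' = replicate k (r * r')" by (rule nth_equalityI) auto
  obtain U where U: "rl (dmul (dmul ?R ?R') (dmul f f')) (dmul (dmul ?R f) (dmul ?R' f')) U"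
    "\<And>A B C D. U (tn (dmul ?R ?R') (tn ?R A ?R' B) (dmul f f') (tn f C f' D)) = tn (dmul ?R f) (tn ?R A f C) (dmul ?R' f') (tn ?R' B f' D)"
    using middle_swap[of ?R k ?R' f f'] f by auto
  let ?I = "{..<r} \<times> {..<r'}"
  let ?w = "\<lambda>p. c (fst p) * c' (snd p)"
  have "fs k (r * r') (dmul f f') (\<lambda>s. c (s div r') * c' (s mod r')) (\<lambda>s. tn f (v (s div r')) f' (v' (s mod r')))
    = (\<lambda>x. \<Sum>p\<in>?I. ?w p * tn (dmul ?R ?R') (tn ?R (ket k (fst p)) ?R' (ket k (snd p))) (dmul f f') (tn f (v (fst p)) f' (v' (snd p))) x)"
    unfolding fs_def sum_nat_dmul d
  proof (rule ext, goal_cases)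
    case (1 x)
    show ?case unfolding sum.cartesian_product
      by (intro sum.cong refl) (auto simp: ket_tn[OF k])
  qed
  then have "U (fs k (r * r') (dmul f f') (\<lambda>s. c (s div r') * c' (s mod r')) (\<lambda>s. tn f (v (s div r')) f' (v' (s mod r'))))
    = (\<lambda>x. \<Sum>p\<in>?I. ?w p * tn (dmul ?R f) (tn ?R (ket k (fst p)) f (v (fst p))) (dmul ?R' f') (tn ?R' (ket k (snd p)) f' (v' (snd p))) x)"
    by (simp only: rl_sum[OF U(1)] U(2))
  also have "\<dots> = tn (dmul ?R f) (fs k r f c v) (dmul ?R' f') (fs k r' f' c' v')"
    unfolding fs_def tn_sum_left tn_sum_right
    by (intro ext) (simp add: sum.cartesian_product[symmetric] sum_distrib_left mult.assoc case_prod_unfold sum.cartesian_product')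
  finally show ?thesis using U(1) by (auto simp: relab_def tens_def d)
qed

section \<open>Powers of a flagged superposition and typical flags\<close>

lemma sum_bits: "(\<Sum>s<2 ^ n. h (digits (replicate n 2) s)) = (\<Sum>w\<in>words {..<2} n. h w)"
proof -
  have "ibox (replicate n 2) = words {..<2} n"
    by (auto simp: ibox_def words_def in_set_conv_nth) (metis lessThan_iff nth_mem subsetD)
  then show ?thesis using sum_box_digits[of h "replicate n 2"] by (simp add: prod_list_replicate)
qed

lemma words_generating: "(\<Sum>w\<in>words {..<2::nat} n. x ^ sum_list w) = (1 + x) ^ n" for x :: real
proof (induction n)
  case (Suc n)
  have "(\<Sum>w\<in>words {..<2::nat} (Suc n). x ^ sum_list w) = (\<Sum>i<2. x ^ i * (\<Sum>w\<in>words {..<2::nat} n. x ^ sum_list w))"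
    unfolding sum_words_Suc by (simp add: power_add sum_distrib_left)
  then show ?case using Suc by (simp add: numeral_2_eq_2 distrib_right)
qed simp

lemma count_bits: "set w \<subseteq> {..<2::nat} \<Longrightarrow> count_list w 0 + sum_list w = length w"
proof (induction w)
  case (Cons i w)
  then have "i = 0 \<or> i = 1" by auto
  then show ?case using Cons by auto
qed simp

lemma mset_bits: "set w \<subseteq> {..<2::nat} \<Longrightarrow> mset w = replicate_mset (sum_list w) 1 + replicate_mset (length w - sum_list w) 0"
proof (induction w)
  case (Cons i w)
  have "sum_list w \<le> length w" using count_bits[of w] Cons.prems by auto
  moreover have "i = 0 \<or> i = 1" using Cons.prems by auto
  ultimately show ?case using Cons by (auto simp: Suc_diff_le)
qed simp

definition dpow :: "nat \<Rightarrow> nat list \<Rightarrow> nat \<Rightarrow> nat list" where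
  "dpow k d n = foldr dmul (replicate n d) (replicate k 1)"

lemma dpow_0 [simp]: "dpow k d 0 = replicate k 1" by (simp add: dpow_def)

lemma dpow_Suc [simp]: "dpow k d (Suc n) = dmul d (dpow k d n)" by (simp add: dpow_def)

lemma valid_dpow: "valid_dims k d \<Longrightarrow> valid_dims k (dpow k d n)"
  by (induction n) (auto simp: dmul_valid, simp add: valid_dims_def)

lemma prod_list_dmul: "length d = length f \<Longrightarrow> prod_list (dmul d f) = prod_list d * prod_list f"
  by (induction d f rule: list_induct2) (auto simp: dmul_def)

lemma prod_list_dpow: "valid_dims k d \<Longrightarrow> prod_list (dpow k d n) = prod_list d ^ n"
proof (induction n)
  case (Suc n)
  then have "length d = length (dpow k d n)" using valid_dpow[of k d n] by (simp add: valid_dims_def)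
  then show ?case using Suc by (simp add: prod_list_dmul)
qed (simp add: prod_list_replicate)

lemma fst_prodl_const: "fst (prodl k (map (\<lambda>\<beta>. (d, v \<beta>)) w)) = dpow k d (length w)"
  by (induction w) (auto simp: unit_def tens_def)

lemma digits_replicate_Suc: "digits (replicate (Suc n) b) s = (s div b ^ n) # digits (replicate n b) (s mod b ^ n)"
  by (simp add: prod_list_replicate)

lemma length_digits [simp]: "length (digits d s) = length d"
  by (induction d arbitrary: s) auto

text \<open>The condition on \<open>c1 0\<close> gives the string of zeros positive weight, so that
  a projection onto strings with few ones can be normalised.\<close>

locale flagged =
  fixes k :: nat and d :: "nat list" and c1 :: "nat \<Rightarrow> complex" and v1 :: "nat \<Rightarrow> amp"
  assumes k0: "0 < k"
    and v1_St: "\<And>\<beta>. (d, v1 \<beta>) \<in> St k"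
    and c1_sum: "(cmod (c1 0))\<^sup>2 + (cmod (c1 1))\<^sup>2 = 1"
    and c1_0: "c1 0 \<noteq> 0"
begin

definition \<Phi> :: pv where "\<Phi> = FS k 2 d c1 v1"

text \<open>A power of \<Phi> is again a flagged superposition. Its flags are bit strings, numbered
  by their binary value; \<open>cN\<close> and \<open>VN\<close> are the amplitude and the state
  that belong to the string \<open>s\<close>.\<close>

definition cN :: "nat \<Rightarrow> nat \<Rightarrow> complex" where "cN n s = prod_list (map c1 (digits (replicate n 2) s))"

definition VN :: "nat \<Rightarrow> nat \<Rightarrow> pv" where "VN n s = prodl k (map (\<lambda>\<beta>. (d, v1 \<beta>)) (digits (replicate n 2) s))"

definition ones :: "nat \<Rightarrow> nat \<Rightarrow> nat" where "ones n s = sum_list (digits (replicate n 2) s)"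

lemma d_valid: "valid_dims k d" using v1_St[of 0] by (simp add: St_def)

lemma d_len: "length d = k" using d_valid by (simp add: valid_dims_def)

lemma dpow_len: "length (dpow k d n) = k" using valid_dpow[OF d_valid] by (simp add: valid_dims_def)

lemma VN_St: "VN n s \<in> St k" unfolding VN_def using v1_St by (intro prodl_St) auto

lemma fst_VN: "fst (VN n s) = dpow k d n" unfolding VN_def by (simp add: fst_prodl_const)

lemma VN_pair: "(dpow k d n, snd (VN n s)) = VN n s" using fst_VN by (metis prod.collapse)

lemma nrm_VN: "nrm (dpow k d n) (snd (VN n s)) = 1" using VN_St[of n s] fst_VN[of n s] by (simp add: St_def)

lemma \<Phi>_St: "\<Phi> \<in> St k"
  unfolding \<Phi>_def using v1_St c1_sum
  by (intro FS_St[OF k0 _ d_valid]) (auto simp: St_def numeral_2_eq_2)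

lemma cmod_cN: "(cmod (cN n s))\<^sup>2 = prod_list (map (\<lambda>\<beta>. (cmod (c1 \<beta>))\<^sup>2) (digits (replicate n 2) s))"
proof -
  have "(cmod (prod_list (map c1 w)))\<^sup>2 = prod_list (map (\<lambda>\<beta>. (cmod (c1 \<beta>))\<^sup>2) w)" for w
    by (induction w) (auto simp: norm_mult power_mult_distrib)
  then show ?thesis by (simp add: cN_def)
qed

lemma P_sum: "(\<Sum>\<beta><2. (cmod (c1 \<beta>))\<^sup>2) = 1" using c1_sum by (simp add: numeral_2_eq_2)

lemma cN_sum: "(\<Sum>s<2 ^ n. (cmod (cN n s))\<^sup>2) = 1"
  unfolding cmod_cN sum_bits[of "\<lambda>w. prod_list (map (\<lambda>\<beta>. (cmod (c1 \<beta>))\<^sup>2) w)" n] by (rule sum_words_prob[OF P_sum])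

lemma cN_Suc: "cN (Suc n) s = c1 (s div 2 ^ n) * cN n (s mod 2 ^ n)"
  unfolding cN_def digits_replicate_Suc by simp

lemma VN_Suc: "snd (VN (Suc n) s) = tn d (v1 (s div 2 ^ n)) (dpow k d n) (snd (VN n (s mod 2 ^ n)))"
  using fst_VN[of n "s mod 2 ^ n"] unfolding VN_def digits_replicate_Suc by (simp add: tens_def)

lemma flag_St: "FS k (2 ^ n) (dpow k d n) (cN n) (\<lambda>s. snd (VN n s)) \<in> St k"
  by (rule FS_St[OF k0 _ valid_dpow[OF d_valid] cN_sum nrm_VN]) simp

lemma flag_power: "relab (FS k (2 ^ n) (dpow k d n) (cN n) (\<lambda>s. snd (VN n s))) (prodl k (replicate n \<Phi>))"
proof (induction n)
  case 0
  have "tens (unit k) (unit k) = unit k" by (rule tens_unit_left[OF unit_St])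
  then have "tn (replicate k 1) (ket k 0) (replicate k 1) (snd (unit k)) = snd (unit k)" and
      "dmul (replicate k 1) (replicate k 1) = replicate k 1"
    by (simp_all add: tens_def unit_def ket_def)
  then have "FS k (2 ^ 0) (dpow k d 0) (cN 0) (\<lambda>s. snd (VN 0 s)) = unit k"
    by (simp add: FS_def fs_def cN_def VN_def) (simp add: unit_def)
  then show ?case using relab_refl[OF unit_St] by simp
next
  case (Suc n)
  let ?F = "\<lambda>n. FS k (2 ^ n) (dpow k d n) (cN n) (\<lambda>s. snd (VN n s))"
  have "?F (Suc n) = FS k (2 * 2 ^ n) (dmul d (dpow k d n)) (\<lambda>s. c1 (s div 2 ^ n) * cN n (s mod 2 ^ n))
      (\<lambda>s. tn d (v1 (s div 2 ^ n)) (dpow k d n) (snd (VN n (s mod 2 ^ n))))"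
    by (simp add: VN_Suc) (simp add: cN_Suc[abs_def])
  moreover have "relab \<dots> (tens \<Phi> (?F n))"
    unfolding \<Phi>_def by (rule FS_mult[OF k0 d_len dpow_len])
  moreover have "relab (tens \<Phi> (?F n)) (tens \<Phi> (prodl k (replicate n \<Phi>)))"
    by (rule relab_tensL[OF Suc flag_St \<Phi>_St])
  ultimately show ?case using relab_trans by simp
qed

text \<open>Restricted to strings with at most \<open>m\<close> ones, every term contains at least
  \<open>n - m\<close> factors \<open>v1 0\<close>. A permutation controlled by the flag moves these
  to a common place, where they factor out of the superposition. The remainder \<open>W\<close> has
  one flag value per kept string and only \<open>m\<close> factors, hence a small dimension. The
  squared overlap of the restricted state with the full power is the weight of the kept
  strings.\<close>

lemma typical_conv:
  assumes mn: "m \<le> n"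
  defines "G \<equiv> {s. s < 2 ^ n \<and> ones n s \<le> m}"
  shows "\<exists>W\<in>St k. prod_list (fst W) = card G ^ k * prod_list d ^ m \<and>
     cvm k (add_mset W (replicate_mset (n - m) (d, v1 0))) (replicate_mset n \<Phi>) (\<Sum>s\<in>G. (cmod (cN n s))\<^sup>2)"
proof -
  have finG: "finite G" by (simp add: G_def)
  define PG where "PG = (\<Sum>s\<in>G. (cmod (cN n s))\<^sup>2)"
  have d0: "digits (replicate n 2) 0 = replicate n 0" for n by (induction n) (auto simp: prod_list_replicate)
  \<comment> \<open>The string of zeros is always kept, so the weight \<open>PG\<close> is
    positive.\<close>
  have G0: "0 \<in> G" by (simp add: G_def ones_def d0 sum_list_replicate)
  have "(cmod (cN n 0))\<^sup>2 \<le> PG" unfolding PG_def by (rule member_le_sum[OF G0]) (use finG in auto)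
  moreover have "cN n 0 \<noteq> 0" using c1_0 by (simp add: cN_def d0 prod_list_replicate)
  ultimately have PG0: "PG > 0" by (smt (verit) norm_eq_zero zero_less_power2)
  define r where "r = card G"
  have r0: "0 < r" using G0 finG by (auto simp: r_def card_gt_0_iff)
  obtain h where h: "bij_betw h {0..<r} G" using ex_bij_betw_nat_finite[OF finG] by (auto simp: r_def)
  have h': "bij_betw h {..<r} G" using h by (simp add: atLeast0LessThan)
  have hinj: "inj_on h {..<r}" and him: "h ` {..<r} = G" using h' by (auto simp: bij_betw_def)
  have hG: "h i \<in> G" if "i < r" for i using him that by blast
  \<comment> \<open>The canonical order of the \<open>m\<close> factors inside \<open>W\<close>: one
    \<open>v1 1\<close> for each one of \<open>s\<close>, then padding with
    \<open>v1 0\<close>.\<close>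
  define L where "L = (\<lambda>s. map (\<lambda>\<beta>. (d, v1 \<beta>)) (replicate (ones n s) 1 @ replicate (m - ones n s) 0))"
  have LSt: "set (L s) \<subseteq> St k" for s using v1_St by (auto simp: L_def)
  have fstL: "fst (prodl k (L s)) = dpow k d m" if "s \<in> G" for s
    using that unfolding L_def fst_prodl_const by (simp add: G_def)
  define cW where "cW = (\<lambda>i. cN n (h i) / complex_of_real (sqrt PG))"
  define vW where "vW = (\<lambda>i. snd (prodl k (L (h i))))"
  define W where "W = FS k r (dpow k d m) cW vW"
  have cWsum: "(\<Sum>i<r. (cmod (cW i))\<^sup>2) = 1"
  proof -
    have "(\<Sum>i<r. (cmod (cW i))\<^sup>2) = (\<Sum>i<r. (cmod (cN n (h i)))\<^sup>2 / PG)"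
      using PG0 by (intro sum.cong refl) (simp add: cW_def norm_divide power_divide)
    also have "\<dots> = (\<Sum>s\<in>G. (cmod (cN n s))\<^sup>2 / PG)" by (rule sum.reindex_bij_betw[OF h'])
    also have "\<dots> = 1" using PG0 by (simp add: PG_def sum_divide_distrib[symmetric])
    finally show ?thesis .
  qed
  have WSt: "W \<in> St k"
    unfolding W_def
  proof (rule FS_St[OF k0 r0 valid_dpow[OF d_valid] cWsum])
    fix i assume "i < r"
    then show "nrm (dpow k d m) (vW i) = 1"
      using prodl_St[OF LSt, of "h i"] fstL[OF hG] by (simp add: St_def vW_def)
  qed
  have dimW: "prod_list (fst W) = card G ^ k * prod_list d ^ m"
    unfolding W_def using dpow_len prod_list_dpow[OF d_valid]
    by (simp add: prod_list_dmul prod_list_replicate r_def)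
  let ?\<phi> = "(d, v1 0)"
  define Rst where "Rst = prodl k (replicate (n - m) ?\<phi>)"
  have RstS: "Rst \<in> St k" unfolding Rst_def using v1_St by (intro prodl_St) auto
  have fstR: "fst Rst = dpow k d (n - m)"
    unfolding Rst_def using fst_prodl_const[of k d v1 "replicate (n - m) 0"] by simp
  define c' where "c' = (\<lambda>s. if s \<in> G then cN n s / complex_of_real (sqrt PG) else 0)"
  define Psi where "Psi = FS k (2 ^ n) (dpow k d n) c' (\<lambda>s. snd (VN n s))"
  have PsiSt: "Psi \<in> St k"
    unfolding Psi_def
  proof (rule FS_St[OF k0 _ valid_dpow[OF d_valid] _ nrm_VN])
    have "(\<Sum>s<2 ^ n. (cmod (c' s))\<^sup>2) = (\<Sum>s\<in>G. (cmod (cN n s))\<^sup>2 / PG)"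
      using PG0 by (intro sum.mono_neutral_cong_right) (auto simp: G_def c'_def norm_divide power_divide)
    also have "\<dots> = 1" using PG0 by (simp add: PG_def sum_divide_distrib[symmetric])
    finally show "(\<Sum>s<2 ^ n. (cmod (c' s))\<^sup>2) = 1" .
  qed simp
  have "tens W Rst = FS k r (dmul (dpow k d m) (dpow k d (n - m))) cW (\<lambda>i. tn (dpow k d m) (vW i) (dpow k d (n - m)) (snd Rst))"
    using tens_FS[OF dpow_len dpow_len, of r m cW vW "n - m" "snd Rst"] fstR unfolding W_def by (metis prod.collapse)
  moreover have "relab (FS k r (dmul (dpow k d m) (dpow k d (n - m))) cW (\<lambda>i. tn (dpow k d m) (vW i) (dpow k d (n - m)) (snd Rst))) Psi"
    unfolding Psi_def
  proof (rule FS_relab[OF k0 _ dpow_len hinj])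
    show "length (dmul (dpow k d m) (dpow k d (n - m))) = k" by (simp add: dpow_len)
    fix i assume i: "i < r"
    show "h i < 2 ^ n" using hG[OF i] by (simp add: G_def)
    show "c' (h i) = cW i" using hG[OF i] by (simp add: c'_def cW_def)
    have o: "ones n (h i) \<le> m" using hG[OF i] by (simp add: G_def)
    have bs: "set (digits (replicate n 2) (h i)) \<subseteq> {..<2}"
    proof -
      have "digits (replicate n 2) (h i) \<in> ibox (replicate n 2)"
        using hG[OF i] by (intro digits_in_box) (simp add: G_def prod_list_replicate)
      then show ?thesis by (auto simp: ibox_def in_set_conv_nth)
    qed
    have "(dmul (dpow k d m) (dpow k d (n - m)), tn (dpow k d m) (vW i) (dpow k d (n - m)) (snd Rst)) = tens (prodl k (L (h i))) Rst"
      using fstL[OF hG[OF i]] fstR by (simp add: tens_def vW_def)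
    also have "\<dots> = prodl k (L (h i) @ replicate (n - m) ?\<phi>)"
      unfolding Rst_def using LSt v1_St by (subst prodl_append) auto
    finally have eq: "(dmul (dpow k d m) (dpow k d (n - m)), tn (dpow k d m) (vW i) (dpow k d (n - m)) (snd Rst)) = \<dots>" .
    have "mset (L (h i) @ replicate (n - m) ?\<phi>) = mset (map (\<lambda>\<beta>. (d, v1 \<beta>)) (digits (replicate n 2) (h i)))"
    proof -
      have "n - ones n (h i) = (m - ones n (h i)) + (n - m)" using o mn by simp
      then show ?thesis
        using arg_cong[OF mset_bits[OF bs], of "image_mset (\<lambda>\<beta>. (d, v1 \<beta>))"]
        by (simp add: L_def ones_def replicate_mset_plus)
    qed
    then have "relab (prodl k (L (h i) @ replicate (n - m) ?\<phi>)) (VN n (h i))"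
      unfolding VN_def by (rule relab_perm) (use LSt v1_St in auto)
    then show "relab (dmul (dpow k d m) (dpow k d (n - m)), tn (dpow k d m) (vW i) (dpow k d (n - m)) (snd Rst)) (dpow k d n, snd (VN n (h i)))"
      unfolding eq VN_pair .
  next
    fix s' assume "s' \<notin> h ` {..<r}"
    then show "c' s' = 0" using him by (simp add: c'_def)
  qed
  ultimately have 1: "relab (tens W Rst) Psi" by simp
  let ?Full = "FS k (2 ^ n) (dpow k d n) (cN n) (\<lambda>s. snd (VN n s))"
  have "conv Psi ?Full PG"
    unfolding conv_def
  proof (rule pay.leaf)
    have "ip (dmul (replicate k (2 ^ n)) (dpow k d n)) (fs k (2 ^ n) (dpow k d n) (cN n) (\<lambda>s. snd (VN n s))) (fs k (2 ^ n) (dpow k d n) c' (\<lambda>s. snd (VN n s)))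
       = (\<Sum>s<2 ^ n. cnj (cN n s) * c' s * ip (dpow k d n) (snd (VN n s)) (snd (VN n s)))" by (rule ip_fs[OF k0 dpow_len])
    also have "\<dots> = (\<Sum>s\<in>G. complex_of_real ((cmod (cN n s))\<^sup>2 / sqrt PG))"
    proof (rule sum.mono_neutral_cong_right)
      fix s assume "s \<in> G"
      have "cnj (cN n s) * (cN n s / complex_of_real (sqrt PG)) = complex_of_real ((cmod (cN n s))\<^sup>2 / sqrt PG)"
        unfolding of_real_divide complex_norm_square by (simp add: mult.commute)
      then show "cnj (cN n s) * c' s * ip (dpow k d n) (snd (VN n s)) (snd (VN n s)) = complex_of_real ((cmod (cN n s))\<^sup>2 / sqrt PG)"
        using \<open>s \<in> G\<close> by (simp add: c'_def ip_self nrm_VN)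
    qed (auto simp: G_def c'_def)
    also have "\<dots> = complex_of_real (PG / sqrt PG)"
      unfolding of_real_sum[symmetric] by (simp add: PG_def sum_divide_distrib)
    also have "PG / sqrt PG = sqrt PG" using PG0 by (simp add: real_div_sqrt)
    finally show "target ?Full (fst Psi) (snd Psi) PG" using PG0 by (simp add: target_def Psi_def)
  qed
  then have "conv Psi (prodl k (replicate n \<Phi>)) PG"
    using \<Phi>_St by (intro conv_relab[OF _ flag_power PsiSt] prodl_St) auto
  then have "conv (tens W Rst) (prodl k (replicate n \<Phi>)) PG"
    by (rule relab_conv[OF 1 tens_St[OF WSt RstS] PsiSt])
  then have "conv (prodl k (W # replicate (n - m) ?\<phi>)) (prodl k (replicate n \<Phi>)) PG" by (simp add: Rst_def)
  then have "cvm k (mset (W # replicate (n - m) ?\<phi>)) (mset (replicate n \<Phi>)) PG"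
    by (subst cvm_list) (use WSt v1_St \<Phi>_St in auto)
  then show ?thesis using WSt dimW unfolding PG_def by (intro bexI[of _ W]) auto
qed

text \<open>The expected number of ones is \<open>q * n\<close>. A string with more than
  \<open>2 * q * n\<close> ones deviates by at least \<open>q * n\<close>, which is improbable by
  Chebyshev's inequality.\<close>

lemma typical_prob:
  assumes q: "q = (cmod (c1 1))\<^sup>2" "0 < q" and m: "2 * q * real n \<le> real m" and n: "0 < n"
  shows "1 - 1 / (real n * q\<^sup>2) \<le> (\<Sum>s | s < 2 ^ n \<and> ones n s \<le> m. (cmod (cN n s))\<^sup>2)"
proof -
  define P where "P = (\<lambda>\<beta>. (cmod (c1 \<beta>))\<^sup>2)"
  define B where "B = {w \<in> words {..<2::nat} n. q * real n \<le> real n * P 0 - real (count_list w 0)}"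
  have Psum: "sum P {..<2} = 1" using P_sum by (simp add: P_def)
  have P0: "P 0 = 1 - q" using c1_sum q by (simp add: P_def)
  have Pw: "0 \<le> prod_list (map P w)" for w by (rule prod_list_nonneg) (auto simp: P_def)
  have "(\<Sum>w\<in>B. prod_list (map P w)) \<le> real n / (q * real n)\<^sup>2"
    unfolding B_def by (rule words_Chebyshev) (use Psum q n in \<open>auto simp: P_def\<close>)
  also have "\<dots> = 1 / (real n * q\<^sup>2)" using n by (simp add: power2_eq_square)
  finally have Bb: "(\<Sum>w\<in>B. prod_list (map P w)) \<le> 1 / (real n * q\<^sup>2)" .
  have "(\<Sum>s | s < 2 ^ n \<and> ones n s \<le> m. (cmod (cN n s))\<^sup>2) = (\<Sum>s<2 ^ n. if ones n s \<le> m then (cmod (cN n s))\<^sup>2 else 0)"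
    by (subst sum.inter_filter[symmetric]) auto
  also have "\<dots> = (\<Sum>w\<in>words {..<2} n. if sum_list w \<le> m then prod_list (map P w) else 0)"
    unfolding cmod_cN ones_def P_def[symmetric]
    by (rule sum_bits[of "\<lambda>w. if sum_list w \<le> m then prod_list (map P w) else 0" n])
  also have "\<dots> \<ge> (\<Sum>w\<in>words {..<2} n. prod_list (map P w) - (if w \<in> B then prod_list (map P w) else 0))"
  proof (rule sum_mono)
    fix w assume w: "w \<in> words {..<2::nat} n"
    show "prod_list (map P w) - (if w \<in> B then prod_list (map P w) else 0) \<le> (if sum_list w \<le> m then prod_list (map P w) else 0)"
    proof (cases "sum_list w \<le> m")
      case True then show ?thesis using Pw by auto
    next
      case False
      have "count_list w 0 + sum_list w = n" using count_bits[of w] w by (simp add: words_def)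
      then have "real (count_list w 0) = real n - real (sum_list w)" by linarith
      then have "real (count_list w 0) \<le> real n - real m" using False by linarith
      then have "w \<in> B" using w m by (simp add: B_def P0 algebra_simps)
      then show ?thesis using False by simp
    qed
  qed
  moreover have "(\<Sum>w\<in>words {..<2} n. prod_list (map P w) - (if w \<in> B then prod_list (map P w) else 0))
     = 1 - (\<Sum>w\<in>B. prod_list (map P w))"
  proof -
    have "(\<Sum>w\<in>words {..<2} n. if w \<in> B then prod_list (map P w) else 0) = (\<Sum>w\<in>B. prod_list (map P w))"
      by (rule sum.mono_neutral_cong_right) (auto simp: B_def)
    then show ?thesis by (simp add: sum_subtractf sum_words_prob[OF Psum])
  qed
  ultimately show ?thesis using Bb by linarith
qed

text \<open>Chernoff's argument: a string with at most \<open>m\<close> ones has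
  \<open>x ^ ones \<ge> x ^ m\<close>, and the sum of \<open>x ^ ones\<close> over all strings is
  \<open>(1 + x) ^ n\<close>.\<close>

lemma typical_card:
  fixes x :: real
  assumes x: "0 < x" "x \<le> 1"
  shows "real (card {s. s < 2 ^ n \<and> ones n s \<le> m}) \<le> (1 + x) ^ n * (1 / x) ^ m"
proof -
  let ?G = "{s. s < 2 ^ n \<and> ones n s \<le> m}"
  have "real (card ?G) * x ^ m = (\<Sum>s\<in>?G. x ^ m)" by simp
  also have "\<dots> \<le> (\<Sum>s\<in>?G. x ^ ones n s)" using x by (intro sum_mono power_decreasing) auto
  also have "\<dots> \<le> (\<Sum>s<2 ^ n. x ^ ones n s)" using x by (intro sum_mono2) auto
  also have "\<dots> = (1 + x) ^ n"
    unfolding ones_def using sum_bits[of "\<lambda>w. x ^ sum_list w" n] words_generating[of x n] by simp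
  finally show ?thesis using x by (simp add: field_simps power_divide)
qed

end

lemma prod_list_ge_1: "valid_dims k d \<Longrightarrow> 1 \<le> prod_list d"
proof -
  assume "valid_dims k d"
  then have "\<forall>x\<in>set d. 0 < x" by (simp add: valid_dims_def)
  then have "0 < prod_list d" by (induction d) auto
  then show ?thesis by simp
qed

lemma ip_commute: "ip d b a = cnj (ip d a b)"
  by (simp add: ip_def cnj_sum mult.commute)

lemma nrm_combination:
  assumes "nrm d a = 1" "nrm d b = 1" "ip d a b = 0" "x\<^sup>2 + y\<^sup>2 = 1"
  shows "nrm d (\<lambda>z. complex_of_real x * a z + complex_of_real y * b z) = 1"
proof -
  have ba: "ip d b a = 0" using ip_commute[of d b a] assms(3) by simp
  let ?X = "complex_of_real x" and ?Y = "complex_of_real y"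
  have "complex_of_real (nrm d (\<lambda>z. ?X * a z + ?Y * b z)) = ip d (\<lambda>z. ?X * a z + ?Y * b z) (\<lambda>z. ?X * a z + ?Y * b z)"
    by (simp add: ip_self)
  also have "\<dots> = (\<Sum>z\<in>ibox d. ?X * ?X * (cnj (a z) * a z) + ?X * ?Y * (cnj (a z) * b z) + ?Y * ?X * (cnj (b z) * a z) + ?Y * ?Y * (cnj (b z) * b z))"
    unfolding ip_def by (intro sum.cong refl) (simp add: algebra_simps)
  also have "\<dots> = ?X * ?X * ip d a a + ?X * ?Y * ip d a b + ?Y * ?X * ip d b a + ?Y * ?Y * ip d b b"
    unfolding ip_def sum.distrib sum_distrib_left by simp
  also have "\<dots> = ?X * ?X + ?Y * ?Y" using assms(1-3) ba by (simp add: ip_self)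
  also have "\<dots> = complex_of_real (x\<^sup>2 + y\<^sup>2)" by (simp add: power2_eq_square)
  finally show ?thesis using assms(4) of_real_eq_iff by metis
qed

lemma supp_combination: "supp d a \<Longrightarrow> supp d b \<Longrightarrow> supp d (\<lambda>z. x * a z + y * b z)"
  by (simp add: supp_def)

text \<open>Each party measures its flag qubit in the Hadamard basis. This erases the flag and
  leaves only the relative sign \<open>(-1) ^ sum_list y\<close>, with the same prefactor for all
  outcomes.\<close>

lemma flag_measurement:
  assumes k: "0 < k" and phi: "(d, \<phi>) \<in> St k" and chi: "(d, \<xi>) \<in> St k"
  shows "ensemble (FS k 2 d (\<lambda>\<beta>. if \<beta> = 0 then complex_of_real a else complex_of_real b) (\<lambda>\<beta>. if \<beta> = 0 then \<phi> else \<xi>))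
    (ibox (replicate k 2)) (\<lambda>y. complex_of_real (1 / sqrt 2) ^ k)
    (\<lambda>y. (d, \<lambda>x. complex_of_real a * \<phi> x + complex_of_real ((-1) ^ sum_list y * b) * \<xi> x))"
  unfolding ensemble_def
proof
  fix q :: "nat list \<Rightarrow> real"
  let ?c1 = "\<lambda>\<beta>::nat. if \<beta> = 0 then complex_of_real a else complex_of_real b"
  let ?v1 = "\<lambda>\<beta>::nat. if \<beta> = 0 then \<phi> else \<xi>"
  let ?R = "replicate k 2" and ?\<kappa> = "complex_of_real (1 / sqrt 2) ^ k"
  let ?T = "\<lambda>y. (d, \<lambda>x. complex_of_real a * \<phi> x + complex_of_real ((-1) ^ sum_list y * b) * \<xi> x)"
  let ?H = "\<lambda>d v p. \<exists>i\<in>ibox ?R. d = fst (?T i) \<and> v = (\<lambda>x. ?\<kappa> * snd (?T i) x) \<and> p \<le> q i"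
  have l: "length d = k" using St_length[OF phi] by simp
  have lR: "length ?R = length d" using l by simp
  have sp: "supp d \<phi>" "supp d \<xi>" using phi chi by (auto simp: St_def)
  define \<pi> where "\<pi> = (\<lambda>j x. x mod d ! j)"
  define lam where "lam = (\<lambda>j y x. complex_of_real (1 / sqrt 2) * (-1) ^ (y * (x div d ! j)))"
  have pj: "pm \<pi> (join d us ys) = ys" if "us \<in> ibox ?R" "ys \<in> ibox d" for us ys
    using that l nth_box[OF that(2)] by (intro nth_equalityI) (auto simp: \<pi>_def length_box)
  have one: "mact (dmul ?R d) d \<pi> (\<lambda>j. lam j (y ! j)) (tn ?R (ket k s) d v) = (\<lambda>zs. ?\<kappa> * (-1) ^ (s * sum_list y) * v zs)"
    if s: "s < 2" and v: "supp d v" and y: "y \<in> ibox ?R" for s v y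
  proof (rule supp_ext[OF supp_mact])
    show "supp d (\<lambda>zs. ?\<kappa> * (-1) ^ (s * sum_list y) * v zs)" using v by (simp add: supp_def)
    fix zs assume zs: "zs \<in> ibox d"
    have ldm: "length (dmul ?R d) = k" using l by simp
    have "mact (dmul ?R d) d \<pi> (\<lambda>j. lam j (y ! j)) (tn ?R (ket k s) d v) zs
      = (\<Sum>us\<in>ibox ?R. \<Sum>ys\<in>ibox d. if pm \<pi> (join d us ys) = zs then
          (\<Prod>j<k. lam j (y ! j) (join d us ys ! j)) * tn ?R (ket k s) d v (join d us ys) else 0)"
      unfolding mact_def ldm if_P[OF zs] by (rule sum_box_dmul[OF lR])
    also have "\<dots> = (\<Sum>us\<in>ibox ?R. \<Sum>ys\<in>ibox d. if ys = zs then
          (if us = replicate k s then (\<Prod>j<k. lam j (y ! j) (join d us zs ! j)) * v zs else 0) else 0)"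
      by (intro sum.cong refl) (auto simp: pj tn_join[OF lR] ket_def)
    also have "\<dots> = (\<Prod>j<k. lam j (y ! j) (join d (replicate k s) zs ! j)) * v zs"
      using zs s by simp
    also have "(\<Prod>j<k. lam j (y ! j) (join d (replicate k s) zs ! j)) = (\<Prod>j<k. complex_of_real (1 / sqrt 2) * (-1) ^ (s * y ! j))"
      using l nth_box[OF zs] by (intro prod.cong) (auto simp: lam_def mult.commute)
    also have "\<dots> = ?\<kappa> * (-1) ^ (\<Sum>j<k. s * y ! j)" unfolding prod.distrib power_sum by simp
    also have "(\<Sum>j<k. s * y ! j) = s * sum_list y"
      using y by (simp add: sum_list_sum_nth length_box sum_distrib_left atLeast0LessThan)
    finally show "mact (dmul ?R d) d \<pi> (\<lambda>j. lam j (y ! j)) (tn ?R (ket k s) d v) zs = ?\<kappa> * (-1) ^ (s * sum_list y) * v zs" .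
  qed
  have "pay ?H (dmul ?R d) (fs k 2 d ?c1 ?v1) (\<Sum>i\<in>ibox ?R. q i)"
  proof (rule pay_monomial[where e = d and m = ?R and \<pi> = \<pi> and lam = lam and q = q])
    show "supp (dmul ?R d) (fs k 2 d ?c1 ?v1)" by (rule supp_fs)
    show "0 < d ! j" if "j < length (dmul ?R d)" for j using St_pos'[OF phi] that l by simp
    then show "\<pi> j x < d ! j" if "j < length (dmul ?R d)" for j x using that by (simp add: \<pi>_def)
    show "(\<Sum>t<?R ! j. cnj (lam j t x) * lam j t x') = (if x = x' then 1 else 0)"
      if jx: "j < length (dmul ?R d)" "x < dmul ?R d ! j" "x' < dmul ?R d ! j" "\<pi> j x = \<pi> j x'" for j x x'
    proof -
      have j: "j < k" using jx(1) by simp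
      have x: "x div d ! j < 2" "x' div d ! j < 2" using jx(2,3) j l by (auto simp: less_mult_imp_div_less)
      have half: "complex_of_real (1 / sqrt 2) * complex_of_real (1 / sqrt 2) = 1 / 2"
        unfolding of_real_mult[symmetric] by simp
      have summand: "cnj (lam j t x) * lam j t x' = (1 / 2) * (-1) ^ (t * (x div d ! j) + t * (x' div d ! j))" for t
      proof -
        have "cnj (lam j t x) * lam j t x' = (complex_of_real (1 / sqrt 2) * complex_of_real (1 / sqrt 2)) * ((-1) ^ (t * (x div d ! j)) * (-1) ^ (t * (x' div d ! j)))"
          unfolding lam_def by simp
        then show ?thesis unfolding half by (simp add: power_add)
      qed
      have "(\<Sum>t<?R ! j. cnj (lam j t x) * lam j t x') = 1 / 2 + (1 / 2) * (-1) ^ (x div d ! j + x' div d ! j)"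
        unfolding summand using j by (simp add: numeral_2_eq_2)
      also have "\<dots> = (if x div d ! j = x' div d ! j then 1 else 0)"
      proof -
        have "x div d ! j = 0 \<or> x div d ! j = 1" "x' div d ! j = 0 \<or> x' div d ! j = 1" using x by auto
        then show ?thesis by auto
      qed
      also have "\<dots> = (if x = x' then 1 else 0)" using jx(4) unfolding \<pi>_def by (metis div_mult_mod_eq)
      finally show ?thesis .
    qed
    fix y assume y: "y \<in> ibox ?R"
    have "mact (dmul ?R d) d \<pi> (\<lambda>j. lam j (y ! j)) (fs k 2 d ?c1 ?v1)
      = (\<lambda>x. \<Sum>s<2. ?c1 s * mact (dmul ?R d) d \<pi> (\<lambda>j. lam j (y ! j)) (tn ?R (ket k s) d (?v1 s)) x)"
      unfolding fs_def by (rule mact_sum)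
    also have "\<dots> = (\<lambda>x. \<Sum>s<2. ?c1 s * (?\<kappa> * (-1) ^ (s * sum_list y) * ?v1 s x))"
      using one[OF _ _ y] sp by (intro ext sum.cong) auto
    also have "\<dots> = (\<lambda>x. ?\<kappa> * snd (?T y) x)"
      by (rule ext) (simp add: numeral_2_eq_2 algebra_simps)
    finally show "pay ?H d (mact (dmul ?R d) d \<pi> (\<lambda>j. lam j (y ! j)) (fs k 2 d ?c1 ?v1)) (q y)"
      using y by (intro pay.leaf) (auto intro!: bexI[of _ y])
  next
    fix d' v p p' assume "?H d' v p" "p' \<le> p"
    then show "?H d' v p'" by (meson order_trans)
  qed (use l in auto)
  then show "pay ?H (fst (FS k 2 d ?c1 ?v1)) (snd (FS k 2 d ?c1 ?v1)) (\<Sum>i\<in>ibox ?R. q i)" by simp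
qed

text \<open>By the midpoint condition each increment over a step of length \<open>t\<close> exceeds
  the next one to its left by at most \<open>2 * S\<close>. A large increment from 0 to
  \<open>t\<close> therefore persists over \<open>n\<close> steps to the left, while these
  increments telescope to at most \<open>B\<close>.\<close>

lemma approx_concave_increment:
  fixes g :: "real \<Rightarrow> real"
  assumes b: "\<And>x. 0 \<le> g x" "\<And>x. g x \<le> B" and mid: "\<And>x. g (x + t) + g (x - t) \<le> 2 * g x + 2 * S" and n: "0 < n"
  shows "g t - g 0 \<le> B / real n + real n * S"
proof -
  define D where "D = (\<lambda>j::nat. g ((1 - real j) * t) - g (- real j * t))"
  have step: "D (Suc j) \<ge> D j - 2 * S" for j
  proof -
    have "- real j * t + t = (1 - real j) * t" "- real j * t - t = - real (Suc j) * t" "(1 - real (Suc j)) * t = - real j * t"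
      by (simp_all add: algebra_simps)
    then show ?thesis using mid[of "- real j * t"] unfolding D_def by simp
  qed
  have Dj: "D j \<ge> D 0 - 2 * real j * S" for j
  proof (induction j)
    case (Suc j) then show ?case using step[of j] by (simp add: algebra_simps)
  qed simp
  have S0: "0 \<le> S \<or> B \<ge> 0" using b order_trans by blast
  have tel: "(\<Sum>j<n. D j) = g t - g ((1 - real n) * t)" for n
  proof (induction n)
    case (Suc n)
    have "(1 - real (Suc n)) * t = - real n * t" by simp
    then show ?case using Suc by (simp add: D_def)
  qed simp
  have sumj: "(\<Sum>j<n. 2 * real j) = real n * (real n - 1)" for n
    by (induction n) (auto simp: algebra_simps)
  have "real n * D 0 - real n * (real n - 1) * S = (\<Sum>j<n. D 0 - 2 * real j * S)"
    by (simp add: sum_subtractf sum_distrib_right[symmetric] sumj)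
  also have "\<dots> \<le> (\<Sum>j<n. D j)" using Dj by (intro sum_mono) auto
  also have "\<dots> \<le> B" unfolding tel using b(1)[of "(1 - real n) * t"] b(2)[of t] by linarith
  finally have "real n * D 0 \<le> B + real n * (real n - 1) * S" by simp
  then have "D 0 \<le> (B + real n * (real n - 1) * S) / real n" using n by (simp add: field_simps)
  also have "\<dots> = B / real n + (real n - 1) * S" using n by (simp add: field_simps)
  also have "\<dots> \<le> B / real n + real n * S"
  proof -
    \<comment> \<open>A negative error would make the increments \<open>D j\<close> grow without
      bound, against \<open>B\<close>.\<close>
    have "S \<ge> 0"
    proof (rule ccontr)
      assume "\<not> S \<ge> 0"
      then have S: "S < 0" by simp
      obtain n :: nat where n: "real n > (\<bar>B\<bar> + \<bar>D 0\<bar>) / (- 2 * S)" using reals_Archimedean2 by blast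
      then have "- 2 * S * real n > \<bar>B\<bar> + \<bar>D 0\<bar>" using S by (simp add: field_simps)
      moreover have "D n \<le> B" unfolding D_def using b(1)[of "- real n * t"] b(2)[of "(1 - real n) * t"] by linarith
      ultimately show False using Dj[of n] by (simp add: algebra_simps)
    qed
    then show ?thesis by (simp add: mult_right_mono)
  qed
  finally show ?thesis by (simp add: D_def)
qed

lemma flag_error_tendsto: "((\<lambda>q. real k * (log 2 (1 + q) + 2 * q * log 2 (1 / q)) + 2 * q) \<longlongrightarrow> 0) (at_right 0)"
  by real_asymp

section \<open>Continuity of additive monotones\<close>

context entanglement_functional
begin

lemma k0: "0 < k" using k by simp

lemma Es_bound:
  assumes "s \<in> St k"
  shows "Es s \<le> 1 + log 2 (real (prod_list (fst s)))"
proof -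
  define D where "D = prod_list (fst s)"
  have D: "1 \<le> D" using assms prod_list_ge_1 by (auto simp: D_def St_def)
  define n where "n = nat \<lceil>log 2 (real D)\<rceil>"
  have l0: "0 \<le> log 2 (real D)" using D by simp
  have "log 2 (real D) \<le> real n" unfolding n_def by linarith
  then have "real D \<le> 2 powr real n" using D by (simp add: log_le_iff)
  then have "real D \<le> real (2 ^ n)" by (simp add: powr_realpow)
  then have "D \<le> 2 ^ n" by (simp only: of_nat_le_iff)
  then have "Es s \<le> real n" using Es_le_log[OF assms] by (simp add: D_def)
  also have "\<dots> \<le> 1 + log 2 (real D)" unfolding n_def using l0 by linarith
  finally show ?thesis by (simp add: D_def)
qed

text \<open>Asymptotically, \<open>l\<close> copies of the superposition come from
  \<open>l - m\<close> copies of \<open>v1 0\<close> and the states \<open>W\<close> of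
  \<open>typical_conv\<close>, with \<open>m\<close> about \<open>2 * q * l\<close>.
  \<open>W\<close> is bought from as many GHZ states as the logarithm of its dimension, and this
  cost per copy is the error term.\<close>

lemma flag_upper:
  assumes fl: "flagged k d c1 v1" and q: "q = (cmod (c1 1))\<^sup>2" "0 < q" "q \<le> 1 / 4"
  shows "Es (flagged.\<Phi> k d c1 v1) \<le> Es (d, v1 0) + (real k * (log 2 (1 + q) + 2 * q * log 2 (1 / q)) + 2 * q * log 2 (real (prod_list d)))"
proof -
  interpret flagged k d c1 v1 by (rule fl)
  let ?\<phi> = "(d, v1 0)" and ?D = "real (prod_list d)"
  have \<phi>S: "?\<phi> \<in> St k" by (rule v1_St)
  have D1: "1 \<le> ?D" using prod_list_ge_1[OF d_valid] by simp
  define L where "L = log 2 ?D"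
  have L0: "0 \<le> L" using D1 by (simp add: L_def)
  have lq: "0 \<le> log 2 (1 / q)" using q by simp
  have main: "real l * Es \<Phi> \<le> real l * Es ?\<phi> + (1 + real k * (real l * log 2 (1 + q) + (2 * q * real l + 1) * log 2 (1 / q)) + (2 * q * real l + 1) * L)"
    if l: "l \<ge> 2" for l :: nat
  proof -
    define m where "m = nat \<lceil>2 * q * real l\<rceil>"
    have m1: "2 * q * real l \<le> real m" unfolding m_def by linarith
    have "0 \<le> 2 * q * real l" using q by simp
    then have m2: "real m \<le> 2 * q * real l + 1" unfolding m_def by linarith
    have "2 * q * real l \<le> 2 * (1 / 4) * real l" using q by (intro mult_right_mono) auto
    then have ml: "m \<le> l" using m2 l by linarith
    \<comment> \<open>For \<open>n\<close> blocks of length \<open>l\<close> the dimension of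
      \<open>W\<close> is at most \<open>base ^ n\<close>; \<open>c\<close> below is the resulting
      number of GHZ states per block.\<close>
    define base where "base = ((1 + q) ^ l * (1 / q) ^ m) ^ k * ?D ^ m"
    have base1: "1 \<le> base"
    proof -
      have "1 \<le> (1 + q) ^ l" "1 \<le> (1 / q) ^ m" "1 \<le> ?D ^ m" using q D1 by (auto intro!: one_le_power)
      then have "1 \<le> (1 + q) ^ l * (1 / q) ^ m" by (metis mult_mono' mult_1 zero_le_one)
      then have "1 \<le> ((1 + q) ^ l * (1 / q) ^ m) ^ k" by (rule one_le_power)
      then show ?thesis unfolding base_def using \<open>1 \<le> ?D ^ m\<close> by (metis mult_mono' mult_1 zero_le_one)
    qed
    have lbase: "log 2 base = real k * (real l * log 2 (1 + q) + real m * log 2 (1 / q)) + real m * L"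
    proof -
      have pos: "0 < 1 + q" "0 < 1 / q" "0 < ?D" using q(2) D1 by (simp_all add: add_pos_pos)
      then have "0 < (1 + q) ^ l" "0 < (1 / q) ^ m" "0 < ((1 + q) ^ l * (1 / q) ^ m) ^ k" "0 < ?D ^ m"
        by (simp_all only: zero_less_power mult_pos_pos)
      then show ?thesis unfolding base_def L_def
        by (simp only: log_mult_pos log_nat_power pos mult_pos_pos less_imp_le)
    qed
    define c where "c = nat \<lceil>log 2 base\<rceil>"
    have c1': "base \<le> 2 ^ c"
    proof -
      have "log 2 base \<le> real c" unfolding c_def by linarith
      then have "base \<le> 2 powr real c" using base1 by (simp add: log_le_iff)
      then show ?thesis by (simp add: powr_realpow)
    qed
    have "0 \<le> log 2 base" using base1 by simp
    then have c2: "real c \<le> 1 + log 2 base" unfolding c_def by linarith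
    define M where "M = replicate_mset (l - m) ?\<phi> + replicate_mset c (ghz k 2)"
    have repC: "replicate_mset j ?\<phi> \<in> Cr" "replicate_mset j \<Phi> \<in> Cr" for j using \<phi>S \<Phi>_St by (auto simp: Cr_iff)
    have MC: "M \<in> Cr" unfolding M_def using repC by simp
    let ?G = "\<lambda>n. {s. s < 2 ^ (n * l) \<and> ones (n * l) s \<le> n * m}"
    have "\<forall>n. \<exists>W. W \<in> St k \<and> prod_list (fst W) = card (?G n) ^ k * prod_list d ^ (n * m) \<and>
       cvm k (add_mset W (replicate_mset (n * l - n * m) ?\<phi>)) (replicate_mset (n * l) \<Phi>) (\<Sum>s\<in>?G n. (cmod (cN (n * l) s))\<^sup>2)"
      using typical_conv[of "n * m" "n * l" for n] ml by (auto simp: Bex_def)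
    from choice[OF this] obtain W where W: "\<And>n. W n \<in> St k" "\<And>n. prod_list (fst (W n)) = card (?G n) ^ k * prod_list d ^ (n * m)"
       "\<And>n. cvm k (add_mset (W n) (replicate_mset (n * l - n * m) ?\<phi>)) (replicate_mset (n * l) \<Phi>) (\<Sum>s\<in>?G n. (cmod (cN (n * l) s))\<^sup>2)"
      by blast
    have t1: "tends (\<lambda>n. repeat_mset n M) (\<lambda>n. add_mset (W n) (replicate_mset (n * l - n * m) ?\<phi>))"
      unfolding tends_def
    proof (intro conjI allI impI always_eventually)
      fix n and \<epsilon> :: real assume e: "0 < \<epsilon>"
      have "real (card (?G n)) \<le> (1 + q) ^ (n * l) * (1 / q) ^ (n * m)"
        using typical_card[of q "n * l" "n * m"] q by simp
      then have "real (card (?G n)) ^ k * ?D ^ (n * m) \<le> ((1 + q) ^ (n * l) * (1 / q) ^ (n * m)) ^ k * ?D ^ (n * m)"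
        by (intro mult_right_mono power_mono) auto
      also have "\<dots> = base ^ n" unfolding base_def by (simp add: power_mult_distrib power_mult[symmetric] ac_simps del: power_divide)
      also have "\<dots> \<le> (2 ^ c) ^ n" using c1' base1 by (intro power_mono) auto
      finally have "real (card (?G n) ^ k * prod_list d ^ (n * m)) \<le> real (2 ^ (n * c))"
        by (simp add: power_mult[symmetric] mult.commute)
      then have "prod_list (fst (W n)) \<le> 2 ^ (n * c)" unfolding W(2) by (simp only: of_nat_le_iff)
      then have "cvm k (replicate_mset (n * c) (ghz k 2)) {#W n#} 1" using cvm_from_g[OF k0 W(1)] by blast
      then have "cvm k (replicate_mset (n * c) (ghz k 2) + replicate_mset (n * l - n * m) ?\<phi>) ({#W n#} + replicate_mset (n * l - n * m) ?\<phi>) 1"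
        using W(1) \<phi>S g_in by (intro cvm_add) auto
      moreover have "repeat_mset n M = replicate_mset (n * c) (ghz k 2) + replicate_mset (n * l - n * m) ?\<phi>"
        unfolding M_def by (simp add: diff_mult_distrib2 add.commute)
      ultimately show "cvm k (repeat_mset n M) (add_mset (W n) (replicate_mset (n * l - n * m) ?\<phi>)) (1 - \<epsilon>)"
        using e by (auto intro: cv_antimono)
    qed (use MC W(1) repC in auto)
    have t2: "tends (\<lambda>n. add_mset (W n) (replicate_mset (n * l - n * m) ?\<phi>)) (\<lambda>n. repeat_mset n (replicate_mset l \<Phi>))"
      unfolding tends_def
    proof (intro conjI allI impI)
      fix \<epsilon> :: real assume e: "0 < \<epsilon>"
      obtain n0 :: nat where n0: "real n0 \<ge> 1 / (\<epsilon> * q\<^sup>2)" using real_arch_simple by blast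
      have "cvm k (add_mset (W n) (replicate_mset (n * l - n * m) ?\<phi>)) (repeat_mset n (replicate_mset l \<Phi>)) (1 - \<epsilon>)"
        if n: "n \<ge> n0 + 1" for n
      proof -
        have nl: "n * l > 0" using n l by simp
        have "2 * q * real (n * l) \<le> real (n * m)"
          using mult_left_mono[OF m1, of "real n"] by (simp add: ac_simps)
        then have pr: "1 - 1 / (real (n * l) * q\<^sup>2) \<le> (\<Sum>s\<in>?G n. (cmod (cN (n * l) s))\<^sup>2)"
          by (rule typical_prob[OF q(1,2) _ nl])
        have "real n * 1 \<le> real n * real l" using l by (intro mult_left_mono) auto
        moreover have "real n0 \<le> real n" using n by simp
        ultimately have "1 / (\<epsilon> * q\<^sup>2) \<le> real (n * l)" using n0 unfolding of_nat_mult by linarith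
        then have "1 \<le> real (n * l) * (\<epsilon> * q\<^sup>2)" using e q by (simp add: pos_divide_le_eq)
        then have "1 / (real (n * l) * q\<^sup>2) \<le> \<epsilon>" using nl q by (subst pos_divide_le_eq) (auto simp: ac_simps simp del: of_nat_mult)
        then have "1 - \<epsilon> \<le> (\<Sum>s\<in>?G n. (cmod (cN (n * l) s))\<^sup>2)" using pr by linarith
        then show ?thesis using cv_antimono[OF W(3)[of n]] by simp
      qed
      then show "\<forall>\<^sub>F n in sequentially. cvm k (add_mset (W n) (replicate_mset (n * l - n * m) ?\<phi>)) (repeat_mset n (replicate_mset l \<Phi>)) (1 - \<epsilon>)"
        by (rule eventually_sequentiallyI)
    qed (use W(1) repC in auto)
    have "ge M (replicate_mset l \<Phi>)" by (rule geI[OF MC repC(2) tends_trans[OF t1 t2]])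
    then have "E (replicate_mset l \<Phi>) \<le> E M" by (rule E_mono)
    moreover have "E M = real (l - m) * Es ?\<phi> + real c"
    proof -
      have "E M = E (replicate_mset (l - m) ?\<phi>) + E (replicate_mset c (ghz k 2))"
        unfolding M_def using \<phi>S g_in by (intro E_add) auto
      then show ?thesis using E_replicate[OF \<phi>S] E_replicate[OF g_in] E_g by (simp add: Es_def)
    qed
    ultimately have "real l * Es \<Phi> \<le> real (l - m) * Es ?\<phi> + real c" using E_replicate[OF \<Phi>_St] by simp
    moreover have "real (l - m) * Es ?\<phi> \<le> real l * Es ?\<phi>" using Es_nonneg[OF \<phi>S] by (intro mult_right_mono) auto
    moreover have "real c \<le> 1 + real k * (real l * log 2 (1 + q) + (2 * q * real l + 1) * log 2 (1 / q)) + (2 * q * real l + 1) * L"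
    proof -
      have "real m * log 2 (1 / q) \<le> (2 * q * real l + 1) * log 2 (1 / q)" using m2 lq by (rule mult_right_mono)
      then have "real k * (real l * log 2 (1 + q) + real m * log 2 (1 / q)) \<le> real k * (real l * log 2 (1 + q) + (2 * q * real l + 1) * log 2 (1 / q))"
        by (intro mult_left_mono) auto
      moreover have "real m * L \<le> (2 * q * real l + 1) * L" using m2 L0 by (rule mult_right_mono)
      ultimately show ?thesis using c2 lbase by linarith
    qed
    ultimately show ?thesis by linarith
  qed
  \<comment> \<open>These rounding terms do not grow with \<open>l\<close>, so they vanish per
    copy.\<close>
  define K where "K = 1 + real k * log 2 (1 / q) + L"
  have K0: "K \<ge> 0" unfolding K_def using lq L0 by simp
  show ?thesis
  proof (rule field_le_epsilon)
    fix e :: real assume e: "e > 0"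
    obtain l0 :: nat where l0: "real l0 \<ge> K / e" using real_arch_simple by blast
    define l where "l = max 2 l0"
    have l: "l \<ge> 2" "real l \<ge> K / e" using l0 by (auto simp: l_def)
    have "real l * Es \<Phi> \<le> real l * (Es ?\<phi> + (real k * (log 2 (1 + q) + 2 * q * log 2 (1 / q)) + 2 * q * L)) + K"
      using main[OF l(1)] by (simp add: K_def algebra_simps)
    moreover have "K \<le> real l * e" using l(2) e by (simp add: pos_divide_le_eq)
    ultimately have "real l * Es \<Phi> \<le> real l * (Es ?\<phi> + (real k * (log 2 (1 + q) + 2 * q * log 2 (1 / q)) + 2 * q * L) + e)"
      by (simp add: distrib_left)
    then show "Es \<Phi> \<le> Es ?\<phi> + (real k * (log 2 (1 + q) + 2 * q * log 2 (1 / q)) + 2 * q * log 2 ?D) + e"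
      using l(1) unfolding L_def by (simp only: mult_le_cancel_left_pos of_nat_0_less_iff)
  qed
qed

lemma Es_midpoint:
  assumes phi: "(d, \<phi>) \<in> St k" and chi: "(d, \<xi>) \<in> St k" and orth: "ip d \<phi> \<xi> = 0"
    and ab: "a\<^sup>2 + b\<^sup>2 = 1" and q: "q = b\<^sup>2" "0 < q" "q \<le> 1 / 4"
  shows "Es (d, \<lambda>x. complex_of_real a * \<phi> x + complex_of_real b * \<xi> x) + Es (d, \<lambda>x. complex_of_real a * \<phi> x + complex_of_real (- b) * \<xi> x)
    \<le> 2 * Es (d, \<phi>) + 2 * ((real k * (log 2 (1 + q) + 2 * q * log 2 (1 / q)) + 2 * q) * (1 + log 2 (real (prod_list d))))"
proof -
  let ?c1 = "\<lambda>\<beta>::nat. if \<beta> = 0 then complex_of_real a else complex_of_real b"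
  let ?v1 = "\<lambda>\<beta>::nat. if \<beta> = 0 then \<phi> else \<xi>"
  let ?T = "\<lambda>y. (d, \<lambda>x. complex_of_real a * \<phi> x + complex_of_real ((-1) ^ sum_list y * b) * \<xi> x)"
  let ?\<kappa> = "complex_of_real (1 / sqrt 2) ^ k"
  let ?p = "(d, \<lambda>x. complex_of_real a * \<phi> x + complex_of_real b * \<xi> x)"
  let ?m = "(d, \<lambda>x. complex_of_real a * \<phi> x + complex_of_real (- b) * \<xi> x)"
  have a0: "a \<noteq> 0" using ab q by auto
  have fl: "flagged k d ?c1 ?v1"
    by unfold_locales (use k0 phi chi ab a0 in auto)
  let ?\<Phi> = "FS k 2 d ?c1 ?v1"
  have \<Phi>: "flagged.\<Phi> k d ?c1 ?v1 = ?\<Phi>" by (rule flagged.\<Phi>_def[OF fl])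
  have \<Phi>S: "?\<Phi> \<in> St k" using flagged.\<Phi>_St[OF fl] by (simp add: \<Phi>)
  have n1: "nrm d \<phi> = 1" "nrm d \<xi> = 1" "supp d \<phi>" "supp d \<xi>" "valid_dims k d" using phi chi by (auto simp: St_def)
  have comb: "(d, \<lambda>x. complex_of_real a * \<phi> x + complex_of_real b' * \<xi> x) \<in> St k" if "b'\<^sup>2 = b\<^sup>2" for b'
    using nrm_combination[OF n1(1,2) orth, of a b'] supp_combination[OF n1(3,4)] n1(5) ab that by (simp add: St_def)
  have TS: "?T y \<in> St k" for y by (rule comb) (simp add: power_mult_distrib power_mult[symmetric])
  have \<kappa>2: "(cmod ?\<kappa>)\<^sup>2 = (1 / 2) ^ k"
  proof -
    have "cmod ?\<kappa> = (1 / sqrt 2) ^ k" by (simp add: norm_power norm_divide)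
    then have "(cmod ?\<kappa>)\<^sup>2 = ((1 / sqrt 2)\<^sup>2) ^ k" by (simp only: power_mult[symmetric] mult.commute)
    then show ?thesis by (simp add: power_divide)
  qed
  have card: "card (ibox (replicate k (2::nat))) = 2 ^ k" by (simp add: card_box prod_list_replicate)
  have "(\<Sum>y\<in>ibox (replicate k 2). (cmod ?\<kappa>)\<^sup>2 * Es (?T y)) \<le> Es ?\<Phi>"
  proof (rule Es_average[OF flag_measurement[OF k0 phi chi, of a b] _ \<Phi>S])
    show "(\<Sum>y\<in>ibox (replicate k 2). (cmod ?\<kappa>)\<^sup>2) = 1" unfolding \<kappa>2 by (simp add: card power_divide)
  qed (use TS in auto)
  moreover have "(\<Sum>y\<in>ibox (replicate k 2). (cmod ?\<kappa>)\<^sup>2 * Es (?T y)) = (Es ?p + Es ?m) / 2"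
  proof -
    obtain k' where k': "k = Suc k'" using k0 by (cases k) auto
    \<comment> \<open>Flipping the first outcome flips the sign, so both signs occur equally
      often.\<close>
    have pair: "(\<Sum>z<2. Es (?T (z # xs))) = Es ?p + Es ?m" for xs
    proof (cases "even (sum_list xs)")
      case True then show ?thesis by (simp add: numeral_2_eq_2)
    next
      case False then show ?thesis by (simp add: numeral_2_eq_2)
    qed
    have "(\<Sum>y\<in>ibox (replicate k 2). Es (?T y)) = (\<Sum>xs\<in>ibox (replicate k' 2). \<Sum>z<2. Es (?T (z # xs)))"
      unfolding k' replicate_Suc sum_box_Cons by (rule sum.swap)
    also have "\<dots> = 2 ^ k' * (Es ?p + Es ?m)"
      unfolding pair by (simp add: card_box prod_list_replicate)
    finally have "(\<Sum>y\<in>ibox (replicate k 2). (cmod ?\<kappa>)\<^sup>2 * Es (?T y)) = (1 / 2) ^ k * (2 ^ k' * (Es ?p + Es ?m))"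
      by (simp only: sum_distrib_left[symmetric] \<kappa>2)
    also have "\<dots> = (1 / 2) ^ k * 2 ^ k' * (Es ?p + Es ?m)" by (simp only: mult.assoc)
    also have "(1 / 2 :: real) ^ k * 2 ^ k' = 1 / 2" by (simp add: k' power_divide)
    finally show ?thesis by simp
  qed
  ultimately have 1: "Es ?p + Es ?m \<le> 2 * Es ?\<Phi>" by simp
  let ?A = "real k * (log 2 (1 + q) + 2 * q * log 2 (1 / q))" and ?L = "log 2 (real (prod_list d))"
  have "Es ?\<Phi> \<le> Es (d, \<phi>) + (?A + 2 * q * ?L)"
    using flag_upper[OF fl, of q] q by (simp add: \<Phi>)
  moreover have "?A + 2 * q * ?L \<le> (?A + 2 * q) * (1 + ?L)"
  proof -
    have "0 \<le> log 2 (1 + q)" "0 \<le> log 2 (1 / q)" using q(2,3) by (auto simp: zero_le_log_cancel_iff)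
    then have "0 \<le> ?A" using q(2) by (intro mult_nonneg_nonneg add_nonneg_nonneg) auto
    moreover have "0 \<le> ?L" using prod_list_ge_1[OF n1(5)] by simp
    ultimately have "0 \<le> ?A * ?L" by simp
    then show ?thesis using q by (simp add: algebra_simps)
  qed
  ultimately show ?thesis using 1 by linarith
qed

lemma Es_phase:
  assumes s: "(d, \<phi>) \<in> St k" and u: "cmod u = 1"
  shows "(d, \<lambda>x. u * \<phi> x) \<in> St k" "Es (d, \<lambda>x. u * \<phi> x) = Es (d, \<phi>)"
proof -
  have n: "nrm d \<phi> = 1" using s by (simp add: St_def)
  show uS: "(d, \<lambda>x. u * \<phi> x) \<in> St k" using s u by (auto simp: St_def nrm_scale supp_def)
  have "conv (d, \<lambda>x. u * \<phi> x) (d, \<phi>) 1"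
    unfolding conv_def by (rule pay.leaf) (use n u in \<open>simp add: target_def ip_scale ip_self\<close>)
  moreover have "conv (d, \<phi>) (d, \<lambda>x. u * \<phi> x) 1"
    unfolding conv_def
  proof (rule pay.leaf)
    have "ip d (\<lambda>x. u * \<phi> x) \<phi> = cnj u * ip d \<phi> \<phi>" by (simp add: ip_def sum_distrib_left mult.assoc)
    then show "target (d, \<lambda>x. u * \<phi> x) (fst (d, \<phi>)) (snd (d, \<phi>)) 1" using n u by (simp add: target_def ip_self)
  qed
  ultimately show "Es (d, \<lambda>x. u * \<phi> x) = Es (d, \<phi>)"
    using s uS by (intro antisym Es_mono_conv) (auto intro: conv_antimono less_imp_le)
qed

text \<open>After a phase change the two states lie on a great circle at angle
  \<open>arccos c\<close>. A point of that circle and its tangent direction are again orthonormal,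
  so the midpoint inequality holds along the whole circle and
  \<open>approx_concave_increment\<close> applies with steps of this angle.\<close>

lemma Es_continuity:
  assumes e: "\<epsilon> > 0"
  shows "\<exists>\<delta>>0. \<forall>d \<phi> \<psi>. (d, \<phi>) \<in> St k \<and> (d, \<psi>) \<in> St k \<and> 1 - (cmod (ip d \<phi> \<psi>))\<^sup>2 < \<delta>
    \<longrightarrow> \<bar>Es (d, \<phi>) - Es (d, \<psi>)\<bar> < \<epsilon> * (1 + log 2 (real (prod_list d)))"
proof -
  let ?\<sigma> = "\<lambda>q. real k * (log 2 (1 + q) + 2 * q * log 2 (1 / q)) + 2 * q"
  \<comment> \<open>The bound \<open>B / n + n * S\<close> has competing terms: \<open>n\<close> is
    fixed first to make \<open>1 / n\<close> smaller than \<open>\<epsilon> / 4\<close>, then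
    \<delta> is chosen to make \<open>n\<close> times the flag error smaller than
    \<open>\<epsilon> / 4\<close>.\<close>
  obtain n :: nat where n: "real n > 4 / \<epsilon>" using reals_Archimedean2 by blast
  have "4 / \<epsilon> > 0" using e by simp
  then have n0: "0 < n" using n by linarith
  have "\<forall>\<^sub>F q in at_right 0. ?\<sigma> q < \<epsilon> / (4 * real n)"
    using order_tendstoD(2)[OF flag_error_tendsto[of k], of "\<epsilon> / (4 * real n)"] e n0 by simp
  then obtain b where b: "b > 0" "\<And>q. 0 < q \<Longrightarrow> q < b \<Longrightarrow> ?\<sigma> q < \<epsilon> / (4 * real n)"
    unfolding eventually_at_right_field by auto
  define \<delta> where "\<delta> = min b (1 / 4)"
  have "\<bar>Es (d, \<phi>) - Es (d, \<psi>)\<bar> < \<epsilon> * (1 + log 2 (real (prod_list d)))"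
    if phi: "(d, \<phi>) \<in> St k" and psi0: "(d, \<psi>) \<in> St k" and close: "1 - (cmod (ip d \<phi> \<psi>))\<^sup>2 < \<delta>" for d \<phi> \<psi>
  proof -
    let ?L = "log 2 (real (prod_list d))"
    have vd: "valid_dims k d" using phi by (simp add: St_def)
    have L0: "0 \<le> ?L" using prod_list_ge_1[OF vd] by simp
    define c where "c = cmod (ip d \<phi> \<psi>)"
    have c2: "c\<^sup>2 > 3 / 4" using close by (simp add: c_def \<delta>_def)
    have c0: "0 < c" using c2 by (cases "c = 0") (auto simp: c_def)
    \<comment> \<open>The phase that makes the overlap with \<phi> equal to the positive number
      \<open>c\<close>.\<close>
    define u where "u = cnj (ip d \<phi> \<psi>) / complex_of_real c"
    have u1: "cmod u = 1" using c0 by (simp add: u_def norm_divide c_def)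
    define \<psi>' where "\<psi>' = (\<lambda>x. u * \<psi> x)"
    have psi: "(d, \<psi>') \<in> St k" and Epsi: "Es (d, \<psi>') = Es (d, \<psi>)" unfolding \<psi>'_def using Es_phase[OF psi0 u1] by auto
    have nn: "nrm d \<phi> = 1" "nrm d \<psi>' = 1" "supp d \<phi>" "supp d \<psi>'" using phi psi by (auto simp: St_def)
    have ipc: "ip d \<phi> \<psi>' = complex_of_real c"
    proof -
      have "ip d \<phi> \<psi>' = u * ip d \<phi> \<psi>" unfolding \<psi>'_def by (rule ip_scale)
      also have "\<dots> = complex_of_real (c\<^sup>2) / complex_of_real c"
        unfolding u_def c_def complex_norm_square by (simp add: mult.commute)
      also have "\<dots> = complex_of_real c" using c0 by (simp add: power2_eq_square)
      finally show ?thesis .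
    qed
    have cle: "c\<^sup>2 \<le> 1"
      using Cauchy_Schwarz_ip[of d \<phi> \<psi>] phi psi0 by (simp add: c_def St_def)
    define q where "q = 1 - c\<^sup>2"
    show ?thesis
    \<comment> \<open>For \<open>q = 0\<close> the two vectors differ only by a phase and determine
      no orthogonal direction \<xi>.\<close>
    proof (cases "q = 0")
      case True
      have "conv (d, \<phi>) (d, \<psi>) 1" "conv (d, \<psi>) (d, \<phi>) 1"
        unfolding conv_def using True by (auto intro!: pay.leaf simp: target_def q_def c_def ip_commute[of d \<psi> \<phi>])
      then have "Es (d, \<phi>) = Es (d, \<psi>)"
        using phi psi0 by (intro antisym Es_mono_conv) (auto intro: conv_antimono less_imp_le)
      then show ?thesis using e L0 by simp
    next
      case False
      then have q0: "0 < q" using cle by (simp add: q_def)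
      have qb: "q < b" "q \<le> 1 / 4" using close by (auto simp: q_def \<delta>_def c_def)
      define s where "s = sqrt q"
      have s0: "0 < s" "s\<^sup>2 = q" using q0 by (auto simp: s_def)
      define \<xi> where "\<xi> = (\<lambda>x. (\<psi>' x - complex_of_real c * \<phi> x) / complex_of_real s)"
      have orth: "ip d \<phi> \<xi> = 0"
      proof -
        have "ip d \<phi> \<xi> = (ip d \<phi> \<psi>' - complex_of_real c * ip d \<phi> \<phi>) / complex_of_real s"
          unfolding ip_def \<xi>_def sum_distrib_left sum_subtractf[symmetric] sum_divide_distrib
          by (intro sum.cong refl) (simp add: algebra_simps diff_divide_distrib)
        then show ?thesis using ipc nn by (simp add: ip_self)
      qed
      have psi_eq: "\<psi>' = (\<lambda>x. complex_of_real c * \<phi> x + complex_of_real s * \<xi> x)"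
        using s0 by (simp add: \<xi>_def)
      have nchi: "nrm d \<xi> = 1"
      proof -
        have "complex_of_real 1 = ip d \<psi>' \<psi>'" using nn by (simp add: ip_self)
        also have "\<dots> = (\<Sum>z\<in>ibox d. complex_of_real (c * c) * (cnj (\<phi> z) * \<phi> z) + complex_of_real (c * s) * (cnj (\<phi> z) * \<xi> z)
            + complex_of_real (c * s) * (cnj (\<xi> z) * \<phi> z) + complex_of_real (s * s) * (cnj (\<xi> z) * \<xi> z))"
          unfolding ip_def by (subst (1 2) psi_eq) (intro sum.cong refl, simp add: algebra_simps)
        also have "\<dots> = complex_of_real (c * c) * ip d \<phi> \<phi> + complex_of_real (c * s) * ip d \<phi> \<xi> + complex_of_real (c * s) * ip d \<xi> \<phi> + complex_of_real (s * s) * ip d \<xi> \<xi>"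
          unfolding ip_def sum.distrib sum_distrib_left by simp
        also have "\<dots> = complex_of_real (c\<^sup>2 + s\<^sup>2 * nrm d \<xi>)"
          using orth ip_commute[of d \<xi> \<phi>] nn by (simp add: ip_self power2_eq_square)
        finally have "1 = c\<^sup>2 + s\<^sup>2 * nrm d \<xi>" using of_real_eq_iff by blast
        then have "s\<^sup>2 * nrm d \<xi> = 1 - c\<^sup>2" by linarith
        then have "q * nrm d \<xi> = q" unfolding s0(2) by (simp only: q_def)
        then show ?thesis using q0 by simp
      qed
      have chi: "(d, \<xi>) \<in> St k" using nchi nn vd by (simp add: St_def supp_def \<xi>_def)
      define \<gamma> where "\<gamma> = (\<lambda>t x. complex_of_real (cos t) * \<phi> x + complex_of_real (sin t) * \<xi> x)"
      \<comment> \<open>The tangent direction of the circle, which is the orthogonal partner that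
        \<open>Es_midpoint\<close> requires.\<close>
      define \<gamma>' where "\<gamma>' = (\<lambda>t x. complex_of_real (- sin t) * \<phi> x + complex_of_real (cos t) * \<xi> x)"
      have gS: "(d, \<gamma> t) \<in> St k" "(d, \<gamma>' t) \<in> St k" for t
        using nrm_combination[OF nn(1) nchi orth, of "cos t" "sin t"] nrm_combination[OF nn(1) nchi orth, of "- sin t" "cos t"]
          supp_combination[of d \<phi> \<xi> "complex_of_real (cos t)" "complex_of_real (sin t)"]
          supp_combination[of d \<phi> \<xi> "complex_of_real (- sin t)" "complex_of_real (cos t)"] chi nn(3) vd
        unfolding \<gamma>_def \<gamma>'_def St_def by (auto simp: sin_squared_eq)
      have go: "ip d (\<gamma> t) (\<gamma>' t) = 0" for t
      proof -
        have "ip d (\<gamma> t) (\<gamma>' t) = (\<Sum>z\<in>ibox d. complex_of_real (- (cos t * sin t)) * (cnj (\<phi> z) * \<phi> z) + complex_of_real (cos t * cos t) * (cnj (\<phi> z) * \<xi> z)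
            + complex_of_real (- (sin t * sin t)) * (cnj (\<xi> z) * \<phi> z) + complex_of_real (sin t * cos t) * (cnj (\<xi> z) * \<xi> z))"
          unfolding ip_def \<gamma>_def \<gamma>'_def by (intro sum.cong refl) (simp add: algebra_simps)
        also have "\<dots> = complex_of_real (- (cos t * sin t)) * ip d \<phi> \<phi> + complex_of_real (cos t * cos t) * ip d \<phi> \<xi> + complex_of_real (- (sin t * sin t)) * ip d \<xi> \<phi> + complex_of_real (sin t * cos t) * ip d \<xi> \<xi>"
          unfolding ip_def sum.distrib sum_distrib_left by simp
        finally show ?thesis using orth ip_commute[of d \<xi> \<phi>] nn(1) nchi by (simp add: ip_self mult.commute)
      qed
      define \<theta> where "\<theta> = arccos c"
      have "c \<le> 1" using cle c0 by (simp add: power2_le_iff_abs_le abs_square_le_1)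
      then have ct: "cos \<theta> = c" using c0 by (simp add: \<theta>_def cos_arccos)
      have st: "sin \<theta> = s"
        using c0 \<open>c \<le> 1\<close> by (simp add: \<theta>_def sin_arccos s_def q_def)
      define g where "g = (\<lambda>t. Es (d, \<gamma> t))"
      let ?S = "?\<sigma> q * (1 + ?L)"
      have mid: "g (x + \<theta>) + g (x - \<theta>) \<le> 2 * g x + 2 * ?S" for x
      proof -
        have e1: "\<gamma> (x + \<theta>) = (\<lambda>z. complex_of_real c * \<gamma> x z + complex_of_real s * \<gamma>' x z)"
          unfolding \<gamma>_def \<gamma>'_def cos_add sin_add ct st by (rule ext) (simp add: algebra_simps)
        have e2: "\<gamma> (x - \<theta>) = (\<lambda>z. complex_of_real c * \<gamma> x z + complex_of_real (- s) * \<gamma>' x z)"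
          unfolding \<gamma>_def \<gamma>'_def cos_diff sin_diff ct st by (rule ext) (simp add: algebra_simps)
        have cs: "c\<^sup>2 + s\<^sup>2 = 1" using s0 by (simp add: q_def)
        show ?thesis
          unfolding g_def e1 e2
          by (rule Es_midpoint[OF gS(1)[of x] gS(2)[of x] go[of x] cs s0(2)[symmetric] q0 qb(2)])
      qed
      have bd: "0 \<le> g x" "g x \<le> 1 + ?L" for x
        unfolding g_def using Es_nonneg[OF gS(1)] Es_bound[OF gS(1)] by auto
      have 1: "g \<theta> - g 0 \<le> (1 + ?L) / real n + real n * ?S"
        by (rule approx_concave_increment[OF bd mid n0])
      \<comment> \<open>The reflected function satisfies the same midpoint inequality and gives the
        opposite bound.\<close>
      have "(\<lambda>t. g (\<theta> - t)) \<theta> - (\<lambda>t. g (\<theta> - t)) 0 \<le> (1 + ?L) / real n + real n * ?S"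
      proof (rule approx_concave_increment[OF _ _ _ n0])
        fix x
        have "\<theta> - (x + \<theta>) = (\<theta> - x) - \<theta>" "\<theta> - (x - \<theta>) = (\<theta> - x) + \<theta>" by auto
        then show "g (\<theta> - (x + \<theta>)) + g (\<theta> - (x - \<theta>)) \<le> 2 * g (\<theta> - x) + 2 * ?S" using mid[of "\<theta> - x"] by simp
      qed (use bd in auto)
      then have 2: "g 0 - g \<theta> \<le> (1 + ?L) / real n + real n * ?S" by simp
      have g0: "g 0 = Es (d, \<phi>)" by (simp add: g_def \<gamma>_def)
      have g1: "g \<theta> = Es (d, \<psi>)" unfolding g_def \<gamma>_def ct st using Epsi psi_eq by simp
      have "\<bar>Es (d, \<phi>) - Es (d, \<psi>)\<bar> \<le> (1 + ?L) / real n + real n * ?S" using 1 2 g0 g1 by linarith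
      also have "\<dots> = (1 / real n + real n * ?\<sigma> q) * (1 + ?L)" by (simp add: algebra_simps add_divide_distrib)
      also have "\<dots> < \<epsilon> * (1 + ?L)"
      proof (rule mult_strict_right_mono)
        have "1 / real n < \<epsilon> / 4" using n n0 e by (simp add: field_simps)
        moreover have "real n * ?\<sigma> q < real n * (\<epsilon> / (4 * real n))"
          using b(2)[OF q0 qb(1)] n0 by (intro mult_strict_left_mono) auto
        then have "real n * ?\<sigma> q < \<epsilon> / 4" using n0 by simp
        ultimately show "1 / real n + real n * ?\<sigma> q < \<epsilon>" using e by linarith
        show "0 < 1 + ?L" using L0 by simp
      qed
      finally show ?thesis .
    qed
  qed
  moreover have "\<delta> > 0" using b by (simp add: \<delta>_def)
  ultimately show ?thesis by blast
qed

end

section \<open>LOCC channels as matrices\<close>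

definition vec_of :: "nat list \<Rightarrow> amp \<Rightarrow> complex vec" where
  "vec_of d a = vec (prod_list d) (\<lambda>i. a (digits d i))"

definition amp_of :: "nat list \<Rightarrow> complex vec \<Rightarrow> amp" where
  "amp_of d v = (\<lambda>xs. if xs \<in> ibox d then v $ enc d xs else 0)"

lemma dim_vec_of [simp]: "dim_vec (vec_of d a) = prod_list d" by (simp add: vec_of_def)

lemma vec_of_amp: "dim_vec v = prod_list d \<Longrightarrow> vec_of d (amp_of d v) = v"
  by (rule eq_vecI) (auto simp: vec_of_def amp_of_def digits_in_box enc_digits)

lemma supp_amp_of: "supp d (amp_of d v)" by (simp add: supp_def amp_of_def)

lemma amp_of_vec: "supp d a \<Longrightarrow> amp_of d (vec_of d a) = a"
  by (rule supp_ext[OF supp_amp_of]) (auto simp: vec_of_def amp_of_def digits_enc enc_less)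

lemma ip_vec_of: "ip d a b = (\<Sum>i<prod_list d. cnj (vec_of d a $ i) * vec_of d b $ i)"
  unfolding ip_def sum_box_digits by (simp add: vec_of_def)

lemma nrm_vec_of: "nrm d a = (\<Sum>i<prod_list d. (cmod (vec_of d a $ i))\<^sup>2)"
  unfolding nrm_def sum_box_digits by (simp add: vec_of_def)

lemma local_op_carrier: "local_op d j e L \<in> carrier_mat (prod_list (d[j := e])) (prod_list d)"
  by (simp add: local_op_def Let_def)

lemma local_op_mult:
  assumes j: "j < length d" and L: "dim_row L = e"
  shows "local_op d j e L *\<^sub>v vec_of d a = vec_of (d[j := e]) (lact d j L a)"
proof (rule eq_vecI)
  show "dim_vec (local_op d j e L *\<^sub>v vec_of d a) = dim_vec (vec_of (d[j := e]) (lact d j L a))"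
    using local_op_carrier[of d j e L] by simp
  fix r assume "r < dim_vec (vec_of (d[j := e]) (lact d j L a))"
  then have r: "r < prod_list (d[j := e])" by simp
  define zs where "zs = digits (d[j := e]) r"
  have zs: "zs \<in> ibox (d[j := e])" unfolding zs_def using r by (rule digits_in_box)
  have lz: "length zs = length d" using length_box[OF zs] by simp
  have "(local_op d j e L *\<^sub>v vec_of d a) $ r
     = (\<Sum>c<prod_list d. (if \<forall>i<length d. i \<noteq> j \<longrightarrow> zs ! i = digits d c ! i then L $$ (zs ! j, digits d c ! j) else 0) * a (digits d c))"
    unfolding zs_def using r by (simp add: local_op_def Let_def mult_mat_vec_def scalar_prod_def vec_of_def atLeast0LessThan)
  also have "\<dots> = (\<Sum>xs\<in>ibox d. (if \<forall>i<length d. i \<noteq> j \<longrightarrow> zs ! i = xs ! i then L $$ (zs ! j, xs ! j) else 0) * a xs)"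
    by (rule sum_box_digits[symmetric])
  also have "\<dots> = (\<Sum>xs\<in>ibox (d[j := 1]). \<Sum>y<d ! j. if xs = zs[j := 0] then L $$ (zs ! j, y) * a (zs[j := y]) else 0)"
  proof (subst sum_box_split[OF j], intro sum.cong refl)
    fix xs y assume xs: "xs \<in> ibox (d[j := 1])" and y: "y \<in> {..<d ! j}"
    have lx: "length xs = length d" using length_box[OF xs] by simp
    have x0: "xs ! j = 0" using nth_box[OF xs, of j] j by simp
    have "(\<forall>i<length d. i \<noteq> j \<longrightarrow> zs ! i = xs[j := y] ! i) \<longleftrightarrow> xs = zs[j := 0]"
    proof
      assume h: "\<forall>i<length d. i \<noteq> j \<longrightarrow> zs ! i = xs[j := y] ! i"
      show "xs = zs[j := 0]"
      proof (rule nth_equalityI)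
        fix i assume "i < length xs"
        then show "xs ! i = zs[j := 0] ! i" using h x0 lx lz by (cases "i = j") auto
      qed (use lx lz in simp)
    qed auto
    then show "(if \<forall>i<length d. i \<noteq> j \<longrightarrow> zs ! i = xs[j := y] ! i then L $$ (zs ! j, xs[j := y] ! j) else 0) * a (xs[j := y])
      = (if xs = zs[j := 0] then L $$ (zs ! j, y) * a (zs[j := y]) else 0)"
      using j lx lz by simp
  qed
  also have "\<dots> = (\<Sum>xs\<in>ibox (d[j := 1]). if xs = zs[j := 0] then (\<Sum>y<d ! j. L $$ (zs ! j, y) * a (zs[j := y])) else 0)"
    by (intro sum.cong refl) simp
  also have "\<dots> = (\<Sum>y<d ! j. L $$ (zs ! j, y) * a (zs[j := y]))"
    using box_update[OF zs, of 0 1] by simp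
  also have "\<dots> = lact d j L a zs" using zs L by (simp add: lact_def)
  finally show "(local_op d j e L *\<^sub>v vec_of d a) $ r = vec_of (d[j := e]) (lact d j L a) $ r"
    using r by (simp add: vec_of_def zs_def)
qed

lemma msum_entry:
  assumes "\<forall>A\<in>set As. A \<in> carrier_mat n m"
  shows "msum n m As \<in> carrier_mat n m \<and> (\<forall>i<n. \<forall>j<m. msum n m As $$ (i, j) = (\<Sum>A\<leftarrow>As. A $$ (i, j)))"
  using assms
proof (induction As)
  case Nil show ?case by (simp add: msum_def)
next
  case (Cons A As)
  then have "msum n m As \<in> carrier_mat n m" by simp
  moreover have "msum n m (A # As) = A + msum n m As" by (simp add: msum_def)
  ultimately show ?case using Cons by auto
qed

lemma instrument_iff:
  assumes L: "\<And>i. i < m \<Longrightarrow> 0 < dim_row (L i) \<and> dim_col (L i) = D"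
  shows "instrument D m L \<longleftrightarrow> msum D D (map (\<lambda>i. adj (L i) * L i) [0..<m]) = 1\<^sub>m D"
proof -
  have c: "\<forall>A\<in>set (map (\<lambda>i. adj (L i) * L i) [0..<m]). A \<in> carrier_mat D D"
    using L by (auto simp: adj_def)
  have ent: "msum D D (map (\<lambda>i. adj (L i) * L i) [0..<m]) $$ (y, y') = (\<Sum>i<m. \<Sum>z<dim_row (L i). cnj (L i $$ (z, y)) * L i $$ (z, y'))"
    if "y < D" "y' < D" for y y'
  proof -
    have "msum D D (map (\<lambda>i. adj (L i) * L i) [0..<m]) $$ (y, y') = (\<Sum>i\<leftarrow>[0..<m]. (adj (L i) * L i) $$ (y, y'))"
      using msum_entry[OF c] that by (simp add: comp_def)
    also have "\<dots> = (\<Sum>i<m. (adj (L i) * L i) $$ (y, y'))"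
      by (simp add: interv_sum_list_conv_sum_set_nat atLeast0LessThan)
    also have "\<dots> = (\<Sum>i<m. \<Sum>z<dim_row (L i). cnj (L i $$ (z, y)) * L i $$ (z, y'))"
      using L that by (intro sum.cong refl) (simp add: adj_def scalar_prod_def times_mat_def atLeast0LessThan)
    finally show ?thesis .
  qed
  show ?thesis
  proof
    assume i: "instrument D m L"
    show "msum D D (map (\<lambda>i. adj (L i) * L i) [0..<m]) = 1\<^sub>m D"
      by (rule eq_matI) (use msum_entry[OF c] ent i in \<open>auto simp: instrument_def\<close>)
  next
    assume e: "msum D D (map (\<lambda>i. adj (L i) * L i) [0..<m]) = 1\<^sub>m D"
    show "instrument D m L"
      unfolding instrument_def using L ent e by auto
  qed
qed

lemma concat_map2_index:
  assumes "length Ps = length Ls"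
  shows "concat (map2 (\<lambda>(e, L) P. map (\<lambda>K. K * local_op d j e L) P) Ls Ps)
    = concat (map (\<lambda>i. map (\<lambda>K. K * local_op d j (fst (Ls ! i)) (snd (Ls ! i))) (Ps ! i)) [0..<length Ls])"
  using assms by (intro arg_cong[of _ _ concat] nth_equalityI) (auto simp: case_prod_unfold)

lemma locc_structure:
  assumes "locc d e Ks"
  shows "(\<forall>K\<in>set Ks. K \<in> carrier_mat (prod_list e) (prod_list d)) \<and> length e = length d \<and> (\<forall>x\<in>set d. 0 < x)"
  using assms
proof (induction rule: locc.induct)
  case (stop d) then show ?case by simp
next
  case (round j d Ls Ps d')
  have "\<forall>K\<in>set (map (\<lambda>K. K * local_op d j (fst (Ls ! i)) (snd (Ls ! i))) (Ps ! i)). K \<in> carrier_mat (prod_list d') (prod_list d)"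
    if "i < length Ls" for i
    using round.IH that by (auto intro!: mult_carrier_mat[OF _ local_op_carrier])
  \<comment> \<open>A round without outcomes is impossible in positive dimension; the equality of
    lengths is drawn from some branch.\<close>
  moreover have "Ls \<noteq> []"
  proof
    assume "Ls = []"
    then have "0\<^sub>m (d ! j) (d ! j) = (1\<^sub>m (d ! j) :: complex mat)" using round by (simp add: msum_def)
    then have "(0\<^sub>m (d ! j) (d ! j) :: complex mat) $$ (0, 0) = 1\<^sub>m (d ! j) $$ (0, 0)" by simp
    moreover have "0 < d ! j" using round by simp
    ultimately show False by simp
  qed
  then have "0 < length Ls" by simp
  then have "length d' = length d" using round.IH by auto
  ultimately show ?case using round unfolding concat_map2_index[OF round(5)] by auto
qed

lemma locc_round_data:
  assumes "\<forall>(e, L)\<in>set Ls. 0 < e \<and> L \<in> carrier_mat e D" "msum D D (map (\<lambda>(e, L). adj L * L) Ls) = 1\<^sub>m D"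
  shows "instrument D (length Ls) (\<lambda>i. snd (Ls ! i))" "\<And>i. i < length Ls \<Longrightarrow> dim_row (snd (Ls ! i)) = fst (Ls ! i)"
proof -
  have a: "0 < fst (Ls ! i) \<and> snd (Ls ! i) \<in> carrier_mat (fst (Ls ! i)) D" if "i < length Ls" for i
    using assms(1) nth_mem[OF that] by (auto simp: case_prod_unfold)
  then show d: "\<And>i. i < length Ls \<Longrightarrow> dim_row (snd (Ls ! i)) = fst (Ls ! i)" by auto
  have "map (\<lambda>(e, L). adj L * L) Ls = map (\<lambda>i. adj (snd (Ls ! i)) * snd (Ls ! i)) [0..<length Ls]"
    by (intro nth_equalityI) (auto simp: case_prod_unfold)
  then show "instrument D (length Ls) (\<lambda>i. snd (Ls ! i))"
  proof -
    have "0 < dim_row (snd (Ls ! i)) \<and> dim_col (snd (Ls ! i)) = D" if "i < length Ls" for i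
      using a[OF that] by auto
    from instrument_iff[OF this, of "length Ls"] show "instrument D (length Ls) (\<lambda>i. snd (Ls ! i))"
      using assms(2) \<open>map (\<lambda>(e, L). adj L * L) Ls = _\<close> by simp
  qed
qed

lemma locc_branch:
  assumes "locc (d[j := e]) d' P" "K \<in> set P" "j < length d" "dim_row L = e"
  shows "(K * local_op d j e L) *\<^sub>v vec_of d a = K *\<^sub>v vec_of (d[j := e]) (lact d j L a)"
proof -
  have K: "K \<in> carrier_mat (prod_list d') (prod_list (d[j := e]))" using locc_structure[OF assms(1)] assms(2) by blast
  have v: "vec_of d a \<in> carrier_vec (prod_list d)" by (rule carrier_vecI) simp
  show ?thesis using assoc_mult_mat_vec[OF K local_op_carrier v] local_op_mult[OF assms(3,4)] by simp
qed

lemma list_all2_concat_split: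
  "list_all2 P (concat xss) qs \<Longrightarrow> \<exists>qss. qs = concat qss \<and> list_all2 (list_all2 P) xss qss"
proof (induction xss arbitrary: qs)
  case (Cons xs xss)
  then obtain us vs where "qs = us @ vs" "list_all2 P xs us" "list_all2 P (concat xss) vs"
    by (auto simp: list_all2_append1)
  moreover from Cons.IH[OF this(3)] obtain vss where "vs = concat vss" "list_all2 (list_all2 P) xss vss" by blast
  ultimately show ?case by (intro exI[of _ "us # vss"]) auto
qed simp

lemma sum_list_index: "sum_list (map f [0..<n]) = (\<Sum>i<n. f i)" for f :: "nat \<Rightarrow> 'b::comm_monoid_add"
  by (simp add: interv_sum_list_conv_sum_set_nat atLeast0LessThan)

text \<open>The Kraus operators are the leaves of a protocol tree, so payoffs attached to them sum
  up along the tree.\<close>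

lemma locc_pay:
  assumes "locc d e Ks" "supp d a" "list_all2 (\<lambda>K q. pay H e (amp_of e (K *\<^sub>v vec_of d a)) q) Ks qs"
  shows "pay H d a (sum_list qs)"
  using assms
proof (induction arbitrary: a qs rule: locc.induct)
  case (stop d)
  then obtain q where q: "qs = [q]" "pay H d (amp_of d (1\<^sub>m (prod_list d) *\<^sub>v vec_of d a)) q"
    by (auto simp: list_all2_Cons1)
  have "1\<^sub>m (prod_list d) *\<^sub>v vec_of d a = vec_of d a" by (rule one_mult_mat_vec) (rule carrier_vecI, simp)
  then show ?case using q amp_of_vec[OF stop(2)] by simp
next
  case (round j d Ls Ps d')
  let ?e = "\<lambda>i. fst (Ls ! i)" and ?L = "\<lambda>i. snd (Ls ! i)" and ?n = "length Ls"
  have data: "instrument (d ! j) ?n ?L" "\<And>i. i < ?n \<Longrightarrow> dim_row (?L i) = ?e i"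
    using locc_round_data[OF round(3,4)] by auto
  let ?P = "\<lambda>K q. pay H d' (amp_of d' (K *\<^sub>v vec_of d a)) q"
  have IH: "pay H (d[j := ?e i]) b (sum_list rs)"
    if "i < ?n" "supp (d[j := ?e i]) b" "list_all2 (\<lambda>K q. pay H d' (amp_of d' (K *\<^sub>v vec_of (d[j := ?e i]) b)) q) (Ps ! i) rs" for i b rs
    using round.IH that by blast
  have lc: "locc (d[j := ?e i]) d' (Ps ! i)" if "i < ?n" for i using round.IH that by blast
  obtain qss where qss: "qs = concat qss"
    "list_all2 (list_all2 ?P) (map (\<lambda>i. map (\<lambda>K. K * local_op d j (?e i) (?L i)) (Ps ! i)) [0..<?n]) qss"
    using list_all2_concat_split round.prems(2) unfolding concat_map2_index[OF round(5)] by blast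
  have len: "length qss = ?n" using list_all2_lengthD[OF qss(2)] by simp
  have br: "list_all2 ?P (map (\<lambda>K. K * local_op d j (?e i) (?L i)) (Ps ! i)) (qss ! i)" if "i < ?n" for i
    using list_all2_nthD[OF qss(2), of i] that by simp
  have "pay H d a (\<Sum>i<?n. sum_list (qss ! i))"
  proof (rule pay.round[OF round(1) data(1)])
    show "\<forall>i<?n. pay H (d[j := dim_row (?L i)]) (lact d j (?L i) a) (sum_list (qss ! i))"
    proof (intro allI impI)
      fix i assume i: "i < ?n"
      have "list_all2 (\<lambda>K q. pay H d' (amp_of d' (K *\<^sub>v vec_of (d[j := ?e i]) (lact d j (?L i) a))) q) (Ps ! i) (qss ! i)"
        using br[OF i] locc_branch[OF lc[OF i] nth_mem round(1) data(2)[OF i]]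
        by (simp add: list_all2_conv_all_nth)
      moreover have "supp (d[j := ?e i]) (lact d j (?L i) a)" using supp_lact[of d j "?L i" a] data(2)[OF i] by simp
      ultimately show "pay H (d[j := dim_row (?L i)]) (lact d j (?L i) a) (sum_list (qss ! i))"
        using IH[OF i] data(2)[OF i] by simp
    qed
  qed simp
  moreover have "sum_list qs = (\<Sum>i<?n. sum_list (qss ! i))"
  proof -
    have "sum_list (concat qss) = sum_list (map sum_list qss)" by (induction qss) auto
    also have "\<dots> = (\<Sum>i<?n. sum_list (qss ! i))" using len by (simp add: sum_list_sum_nth atLeast0LessThan)
    finally show ?thesis using qss(1) by simp
  qed
  ultimately show ?case by simp
qed

lemma sum_list_concat_map:
  "sum_list (map f (concat (map g [0..<n]))) = (\<Sum>i<n. sum_list (map f (g i)))" for f :: "'c \<Rightarrow> 'b::comm_monoid_add"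
  by (induction n) auto

lemma locc_nrm:
  assumes "locc d e Ks" "supp d a"
  shows "(\<Sum>K\<leftarrow>Ks. nrm e (amp_of e (K *\<^sub>v vec_of d a))) = nrm d a"
  using assms
proof (induction arbitrary: a rule: locc.induct)
  case (stop d)
  have "1\<^sub>m (prod_list d) *\<^sub>v vec_of d a = vec_of d a" by (rule one_mult_mat_vec) (rule carrier_vecI, simp)
  then show ?case using amp_of_vec[OF stop(2)] by simp
next
  case (round j d Ls Ps d')
  let ?e = "\<lambda>i. fst (Ls ! i)" and ?L = "\<lambda>i. snd (Ls ! i)" and ?n = "length Ls"
  have data: "instrument (d ! j) ?n ?L" "\<And>i. i < ?n \<Longrightarrow> dim_row (?L i) = ?e i"
    using locc_round_data[OF round(3,4)] by auto
  have lc: "locc (d[j := ?e i]) d' (Ps ! i)" if "i < ?n" for i using round.IH that by blast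
  have IH: "(\<Sum>K\<leftarrow>Ps ! i. nrm d' (amp_of d' (K *\<^sub>v vec_of (d[j := ?e i]) b))) = nrm (d[j := ?e i]) b"
    if "i < ?n" "supp (d[j := ?e i]) b" for i b
    using round.IH that by blast
  have "(\<Sum>K\<leftarrow>map (\<lambda>K. K * local_op d j (?e i) (?L i)) (Ps ! i). nrm d' (amp_of d' (K *\<^sub>v vec_of d a)))
     = nrm (d[j := dim_row (?L i)]) (lact d j (?L i) a)" if i: "i < ?n" for i
  proof -
    have "(\<Sum>K\<leftarrow>map (\<lambda>K. K * local_op d j (?e i) (?L i)) (Ps ! i). nrm d' (amp_of d' (K *\<^sub>v vec_of d a)))
       = (\<Sum>K\<leftarrow>Ps ! i. nrm d' (amp_of d' (K *\<^sub>v vec_of (d[j := ?e i]) (lact d j (?L i) a))))"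
      unfolding map_map comp_def
      using locc_branch[OF lc[OF i] _ round(1) data(2)[OF i]] by (intro arg_cong[of _ _ sum_list] map_cong) auto
    also have "\<dots> = nrm (d[j := ?e i]) (lact d j (?L i) a)"
      using supp_lact[of d j "?L i" a] data(2)[OF i] by (intro IH[OF i]) simp
    finally show ?thesis using data(2)[OF i] by simp
  qed
  then have "(\<Sum>K\<leftarrow>concat (map2 (\<lambda>(e, L) P. map (\<lambda>K. K * local_op d j e L) P) Ls Ps). nrm d' (amp_of d' (K *\<^sub>v vec_of d a)))
     = (\<Sum>i<?n. nrm (d[j := dim_row (?L i)]) (lact d j (?L i) a))"
    unfolding concat_map2_index[OF round(5)] sum_list_concat_map by (intro sum.cong) auto
  also have "\<dots> = nrm d a" by (rule nrm_lact_sum[OF round(1) data(1)])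
  finally show ?case .
qed

text \<open>Conversely, multiplying the local operators along each branch of the protocol tree
  produces a Kraus list, and the payoffs become squared overlaps with the target.\<close>

lemma pay_locc:
  assumes "pay (target t) d a p" "supp d a" "\<forall>x\<in>set d. 0 < x"
  shows "\<exists>Ks. locc d (fst t) Ks \<and> p \<le> (\<Sum>K\<leftarrow>Ks. (cmod (ip (fst t) (snd t) (amp_of (fst t) (K *\<^sub>v vec_of d a))))\<^sup>2)"
  using assms
proof (induction rule: pay.induct)
  case (leaf d a p)
  have d: "d = fst t" using leaf(1) by (simp add: target_def)
  have "1\<^sub>m (prod_list d) *\<^sub>v vec_of d a = vec_of d a" by (rule one_mult_mat_vec) (rule carrier_vecI, simp)
  then show ?case using leaf amp_of_vec[OF leaf(2)] locc.stop[OF leaf(3)]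
    by (intro exI[of _ "[1\<^sub>m (prod_list d)]"]) (auto simp: target_def)
next
  case (round j d m L a q p)
  let ?e = "fst t" and ?D = "\<lambda>i. d[j := dim_row (L i)]"
  let ?F = "\<lambda>d a K. (cmod (ip (fst t) (snd t) (amp_of (fst t) (K *\<^sub>v vec_of d a))))\<^sup>2"
  have Lp: "0 < dim_row (L i)" "dim_col (L i) = d ! j" if "i < m" for i using round(2) that by (auto simp: instrument_def)
  have "\<exists>Ks. locc (?D i) ?e Ks \<and> q i \<le> (\<Sum>K\<leftarrow>Ks. ?F (?D i) (lact d j (L i) a) K)" if i: "i < m" for i
  proof -
    have "\<forall>x\<in>set (?D i). 0 < x" using round.prems(2) Lp[OF i] set_update_subset_insert[of d j "dim_row (L i)"] by auto
    then show ?thesis using round.IH i supp_lact[of d j "L i" a] by blast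
  qed
  then have "\<forall>i. \<exists>Ks. i < m \<longrightarrow> locc (?D i) ?e Ks \<and> q i \<le> (\<Sum>K\<leftarrow>Ks. ?F (?D i) (lact d j (L i) a) K)" by blast
  from choice[OF this] obtain Ks where Ks: "\<And>i. i < m \<Longrightarrow> locc (?D i) ?e (Ks i)"
     "\<And>i. i < m \<Longrightarrow> q i \<le> (\<Sum>K\<leftarrow>Ks i. ?F (?D i) (lact d j (L i) a) K)" by blast
  define Ls where "Ls = map (\<lambda>i. (dim_row (L i), L i)) [0..<m]"
  define Ps where "Ps = map Ks [0..<m]"
  let ?C = "concat (map2 (\<lambda>(e, L) P. map (\<lambda>K. K * local_op d j e L) P) Ls Ps)"
  have "locc d ?e ?C"
  proof (rule locc.round[OF round(1) round.prems(2)])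
    show "\<forall>(e, L)\<in>set Ls. 0 < e \<and> L \<in> carrier_mat e (d ! j)" using Lp by (auto simp: Ls_def)
    have "map (\<lambda>(e, L). adj L * L) Ls = map (\<lambda>i. adj (L i) * L i) [0..<m]" by (simp add: Ls_def comp_def)
    then show "msum (d ! j) (d ! j) (map (\<lambda>(e, L). adj L * L) Ls) = 1\<^sub>m (d ! j)"
      using instrument_iff[of m L "d ! j"] round(2) Lp by simp
    show "length Ps = length Ls" by (simp add: Ls_def Ps_def)
    show "\<forall>i<length Ls. locc (d[j := fst (Ls ! i)]) ?e (Ps ! i)" using Ks(1) by (simp add: Ls_def Ps_def)
  qed
  moreover have "p \<le> (\<Sum>K\<leftarrow>?C. ?F d a K)"
  proof -
    have lenPs: "length Ps = length Ls" by (simp add: Ls_def Ps_def)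
    have "(\<Sum>K\<leftarrow>?C. ?F d a K) = (\<Sum>i<m. \<Sum>K\<leftarrow>map (\<lambda>K. K * local_op d j (dim_row (L i)) (L i)) (Ks i). ?F d a K)"
      unfolding concat_map2_index[OF lenPs] sum_list_concat_map by (auto simp: Ls_def Ps_def intro!: sum.cong)
    also have "\<dots> = (\<Sum>i<m. \<Sum>K\<leftarrow>Ks i. ?F (?D i) (lact d j (L i) a) K)"
    proof (rule sum.cong[OF refl])
      fix i assume "i \<in> {..<m}"
      then have i: "i < m" by simp
      show "(\<Sum>K\<leftarrow>map (\<lambda>K. K * local_op d j (dim_row (L i)) (L i)) (Ks i). ?F d a K) = (\<Sum>K\<leftarrow>Ks i. ?F (?D i) (lact d j (L i) a) K)"
        unfolding map_map comp_def
        using locc_branch[OF Ks(1)[OF i] _ round(1) refl] by (intro arg_cong[of _ _ sum_list] map_cong) auto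
    qed
    also have "\<dots> \<ge> (\<Sum>i<m. q i)" using Ks(2) by (intro sum_mono) auto
    finally show ?thesis using round(3) by linarith
  qed
  ultimately show ?case by blast
qed

section \<open>Fidelity with pure states\<close>

text \<open>Polarisation: test vectors supported on \<open>a\<close> and \<open>b\<close> with
  coefficients (1, 0), (0, 1), (1, 1) and (1, i) force the symmetry.\<close>

lemma hermitian_of_real_form:
  fixes s :: "nat \<Rightarrow> nat \<Rightarrow> complex"
  assumes re: "\<And>w. Im (\<Sum>i<n. cnj (w i) * (\<Sum>j<n. s i j * w j)) = 0" and ab: "a < n" "b < n"
  shows "s b a = cnj (s a b)"
proof -
  have Q: "(\<Sum>i<n. cnj ((if i = a then x else 0) + (if i = b then z else 0)) * (\<Sum>j<n. s i j * ((if j = a then x else 0) + (if j = b then z else 0))))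
     = cnj x * (s a a * x + s a b * z) + cnj z * (s b a * x + s b b * z)" for x z
  proof -
    have 1: "(\<Sum>j<n. s i j * ((if j = a then x else 0) + (if j = b then z else 0))) = s i a * x + s i b * z" for i
    proof -
      have "(\<Sum>j<n. s i j * ((if j = a then x else 0) + (if j = b then z else 0)))
         = (\<Sum>j<n. (if j = a then s i a * x else 0) + (if j = b then s i b * z else 0))"
        by (intro sum.cong refl) (auto simp: distrib_left)
      then show ?thesis using ab by (simp add: sum.distrib distrib_left)
    qed
    have "(\<Sum>i<n. cnj ((if i = a then x else 0) + (if i = b then z else 0)) * (s i a * x + s i b * z))
       = (\<Sum>i<n. (if i = a then cnj x * (s a a * x + s a b * z) else 0) + (if i = b then cnj z * (s b a * x + s b b * z) else 0))"
      by (intro sum.cong refl) (auto simp: algebra_simps)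
    then show ?thesis unfolding 1 using ab by (simp add: sum.distrib)
  qed
  have R: "Im (cnj x * (s a a * x + s a b * z) + cnj z * (s b a * x + s b b * z)) = 0" for x z
    using re[of "\<lambda>i. (if i = a then x else 0) + (if i = b then z else 0)"] unfolding Q .
  have "Im (s a a) = 0" "Im (s b b) = 0" using R[of 1 0] R[of 0 1] by auto
  then show ?thesis using R[of 1 1] R[of 1 \<i>] by (simp add: complex_eq_iff)
qed

text \<open>\<open>s\<close> is Hermitian and its square annihilates the complement of
  \<open>v\<close>, hence so does \<open>s\<close>. Therefore \<open>s\<close> is a multiple \<mu>
  of the projector onto \<open>v\<close>, and \<mu> is the nonnegative root of
  \<open>c\<close>.\<close>

lemma rank_one_sqrt_unique:
  fixes s :: "nat \<Rightarrow> nat \<Rightarrow> complex" and v :: "nat \<Rightarrow> complex"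
  assumes re: "\<And>w. Im (\<Sum>i<n. cnj (w i) * (\<Sum>j<n. s i j * w j)) = 0"
    and nn: "\<And>w. 0 \<le> Re (\<Sum>i<n. cnj (w i) * (\<Sum>j<n. s i j * w j))"
    and sq: "\<And>i j. i < n \<Longrightarrow> j < n \<Longrightarrow> (\<Sum>l<n. s i l * s l j) = complex_of_real c * (v i * cnj (v j))"
    and v: "(\<Sum>i<n. (cmod (v i))\<^sup>2) = 1" and c: "0 \<le> c" and ij: "i < n" "j < n"
  shows "s i j = complex_of_real (sqrt c) * (v i * cnj (v j))"
proof -
  have herm: "s b a = cnj (s a b)" if "a < n" "b < n" for a b using hermitian_of_real_form[OF re that] .
  have v1: "(\<Sum>i<n. cnj (v i) * v i) = 1"
  proof -
    have "(\<Sum>i<n. cnj (v i) * v i) = complex_of_real (\<Sum>i<n. (cmod (v i))\<^sup>2)"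
      unfolding of_real_sum complex_norm_square by (simp add: mult.commute)
    then show ?thesis using v by simp
  qed
  define S where "S = (\<lambda>w i. \<Sum>j<n. s i j * w j)"
  have nS: "(\<Sum>i<n. cnj (S w i) * S w i) = complex_of_real c * (cnj (\<Sum>i<n. cnj (v i) * w i) * (\<Sum>i<n. cnj (v i) * w i))" for w
  proof -
    have "(\<Sum>i<n. cnj (S w i) * S w i) = (\<Sum>i<n. \<Sum>j<n. \<Sum>l<n. cnj (w j) * w l * (s j i * s i l))"
      unfolding S_def cnj_sum sum_product
      by (intro sum.cong refl) (auto simp: herm[symmetric])
    also have "\<dots> = (\<Sum>j<n. \<Sum>i<n. \<Sum>l<n. cnj (w j) * w l * (s j i * s i l))" by (rule sum.swap)
    also have "\<dots> = (\<Sum>j<n. \<Sum>l<n. \<Sum>i<n. cnj (w j) * w l * (s j i * s i l))" by (intro sum.cong refl sum.swap)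
    also have "\<dots> = (\<Sum>j<n. \<Sum>l<n. cnj (w j) * w l * (complex_of_real c * (v j * cnj (v l))))"
      by (intro sum.cong refl) (simp add: sum_distrib_left[symmetric] sq)
    also have "\<dots> = (\<Sum>j<n. \<Sum>l<n. complex_of_real c * (cnj (cnj (v j) * w j) * (cnj (v l) * w l)))"
      by (intro sum.cong refl) (simp add: ac_simps)
    also have "\<dots> = complex_of_real c * ((\<Sum>j<n. cnj (cnj (v j) * w j)) * (\<Sum>l<n. cnj (v l) * w l))"
      unfolding sum_product by (simp only: sum_distrib_left)
    finally show ?thesis by (simp add: cnj_sum)
  qed
  define x where "x = S v"
  have sx: "s a b = x a * cnj (v b)" if a: "a < n" and b: "b < n" for a b
  proof -
    define w where "w = (\<lambda>i. (if i = b then 1 else 0) - cnj (v b) * v i)"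
    have "(\<Sum>i<n. cnj (v i) * w i) = (\<Sum>i<n. (if i = b then cnj (v b) else 0) - cnj (v b) * (cnj (v i) * v i))"
      unfolding w_def by (intro sum.cong refl) (auto simp: algebra_simps)
    also have "\<dots> = 0" using b v1 by (simp add: sum_subtractf sum_distrib_left[symmetric])
    finally have d0: "(\<Sum>i<n. cnj (v i) * w i) = 0" .
    have "complex_of_real (\<Sum>i<n. (cmod (S w i))\<^sup>2) = (\<Sum>i<n. cnj (S w i) * S w i)"
      unfolding of_real_sum complex_norm_square by (simp add: mult.commute)
    also have "\<dots> = 0" unfolding nS d0 by simp
    finally have "(\<Sum>i<n. (cmod (S w i))\<^sup>2) = 0" by (simp only: of_real_eq_0_iff)
    then have "S w a = 0" using a by (simp add: sum_nonneg_eq_0_iff)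
    moreover have "S w a = s a b - cnj (v b) * x a"
    proof -
      have "S w a = (\<Sum>j<n. (if j = b then s a b else 0) - cnj (v b) * (s a j * v j))"
        unfolding S_def w_def by (intro sum.cong refl) (auto simp: algebra_simps)
      then show ?thesis using b by (simp add: sum_subtractf sum_distrib_left[symmetric] x_def S_def)
    qed
    ultimately show ?thesis by (simp add: mult.commute)
  qed
  define \<mu> where "\<mu> = (\<Sum>i<n. cnj (x i) * v i)"
  have xm: "x b = \<mu> * v b" if b: "b < n" for b
  proof -
    have "x b = (\<Sum>i<n. x b * (cnj (v i) * v i))" using v1 by (simp add: sum_distrib_left[symmetric])
    also have "\<dots> = (\<Sum>i<n. s b i * v i)" using sx b by (intro sum.cong refl) (simp add: mult.assoc)
    also have "\<dots> = (\<Sum>i<n. (cnj (x i) * v i) * v b)"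
    proof (rule sum.cong[OF refl])
      fix i assume "i \<in> {..<n}"
      then have i: "i < n" by simp
      have "s b i = cnj (x i) * v b" by (subst herm[OF i b], subst sx[OF i b]) simp
      then show "s b i * v i = cnj (x i) * v i * v b" by simp
    qed
    finally show ?thesis by (simp add: \<mu>_def sum_distrib_right)
  qed
  have sm: "s a b = \<mu> * (v a * cnj (v b))" if "a < n" "b < n" for a b using sx[OF that] xm that by simp
  have "(\<Sum>i<n. cnj (v i) * (\<Sum>j<n. s i j * v j)) = (\<Sum>i<n. \<mu> * (cnj (v i) * v i))"
    using xm by (intro sum.cong refl) (simp add: x_def S_def)
  also have "\<dots> = \<mu>" using v1 by (simp add: sum_distrib_left[symmetric])
  finally have mu: "Im \<mu> = 0" "0 \<le> Re \<mu>" using re[of v] nn[of v] by auto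
  obtain a where a: "a < n" "v a \<noteq> 0"
  proof -
    have "\<exists>a<n. v a \<noteq> 0"
    proof (rule ccontr)
      assume "\<not> ?thesis"
      then have "(\<Sum>i<n. (cmod (v i))\<^sup>2) = 0" by simp
      then show False using v by simp
    qed
    then show ?thesis using that by blast
  qed
  have "(\<Sum>l<n. s a l * s l a) = (\<Sum>l<n. \<mu>\<^sup>2 * (v a * cnj (v a)) * (cnj (v l) * v l))"
    using sm a by (intro sum.cong refl) (simp add: power2_eq_square ac_simps)
  also have "\<dots> = \<mu>\<^sup>2 * (v a * cnj (v a))" using v1 by (simp add: sum_distrib_left[symmetric])
  finally have "\<mu>\<^sup>2 * (v a * cnj (v a)) = complex_of_real c * (v a * cnj (v a))"
    unfolding sq[OF a(1) a(1)] by (rule sym)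
  then have mc: "\<mu>\<^sup>2 = complex_of_real c" using a(2) by simp
  have mr: "\<mu> = complex_of_real (Re \<mu>)" using mu by (simp add: complex_eq_iff)
  then have "complex_of_real ((Re \<mu>)\<^sup>2) = complex_of_real c" using mc by (metis of_real_power)
  then have "(Re \<mu>)\<^sup>2 = c" using of_real_eq_iff by blast
  then have "Re \<mu> = sqrt c" using mu by (metis real_sqrt_unique)
  then show ?thesis using sm[OF ij] mr by simp
qed

lemma proj_entry: "i < dim_vec v \<Longrightarrow> j < dim_vec v \<Longrightarrow> proj v $$ (i, j) = v $ i * cnj (v $ j)"
  by (simp add: proj_def)

lemma proj_carrier: "proj v \<in> carrier_mat (dim_vec v) (dim_vec v)" by (simp add: proj_def)

lemma qform_vec:
  assumes "A \<in> carrier_mat n n"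
  shows "qform A (vec n w) = (\<Sum>i<n. cnj (w i) * (\<Sum>j<n. A $$ (i, j) * w j))"
  using assms by (auto simp: qform_def mult_mat_vec_def scalar_prod_def atLeast0LessThan intro!: sum.cong)

lemma unit_norm_sum: "unit_norm v \<Longrightarrow> (\<Sum>l<dim_vec v. cnj (v $ l) * v $ l) = 1"
proof -
  assume "unit_norm v"
  then have "complex_of_real (\<Sum>l<dim_vec v. (cmod (v $ l))\<^sup>2) = 1" by (simp add: unit_norm_def)
  then show ?thesis unfolding of_real_sum complex_norm_square by (simp add: mult.commute)
qed

text \<open>\<open>msqrt\<close> is a definite description, so uniqueness has to be proved.
  Multiples of rank-one projectors suffice, because the second argument of every fidelity considered
  here is pure.\<close>

lemma msqrt_proj:
  assumes u: "unit_norm v" and c: "0 \<le> c"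
  shows "msqrt (complex_of_real c \<cdot>\<^sub>m proj v) = complex_of_real (sqrt c) \<cdot>\<^sub>m proj v"
  unfolding msqrt_def
proof (rule the_equality)
  let ?n = "dim_vec v" and ?S = "complex_of_real (sqrt c) \<cdot>\<^sub>m proj v" and ?A = "complex_of_real c \<cdot>\<^sub>m proj v"
  have dr: "dim_row ?A = ?n" by (simp add: proj_def)
  have SC: "?S \<in> carrier_mat ?n ?n" using proj_carrier by simp
  have Sent: "?S $$ (i, j) = complex_of_real (sqrt c) * (v $ i * cnj (v $ j))" if "i < ?n" "j < ?n" for i j
    using that by (simp add: proj_def)
  have "psd ?S"
    unfolding psd_def
  proof (intro conjI allI impI)
    show "dim_row ?S = dim_col ?S" by (simp add: proj_def)
    fix w :: "complex vec" assume "dim_vec w = dim_row ?S"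
    then have w: "w = vec ?n (\<lambda>i. w $ i)" by (auto simp: proj_def)
    let ?t = "\<Sum>i<?n. cnj (w $ i) * v $ i"
    have "qform ?S w = (\<Sum>i<?n. cnj (w $ i) * (\<Sum>j<?n. ?S $$ (i, j) * w $ j))"
      by (subst w) (rule qform_vec[OF SC])
    also have "\<dots> = (\<Sum>i<?n. \<Sum>j<?n. complex_of_real (sqrt c) * (cnj (w $ i) * v $ i * cnj (cnj (w $ j) * v $ j)))"
      unfolding sum_distrib_left by (intro sum.cong refl) (simp add: Sent ac_simps del: index_smult_mat)
    also have "\<dots> = complex_of_real (sqrt c) * (?t * cnj ?t)"
      unfolding cnj_sum sum_product by (simp only: sum_distrib_left)
    also have "\<dots> = complex_of_real (sqrt c * (cmod ?t)\<^sup>2)" unfolding of_real_mult complex_norm_square ..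
    finally have q: "qform ?S w = complex_of_real (sqrt c * (cmod ?t)\<^sup>2)" .
    show "Im (qform ?S w) = 0" "0 \<le> Re (qform ?S w)" unfolding q using c by auto
  qed
  moreover have "?S * ?S = ?A"
  proof (rule eq_matI)
    fix i j assume "i < dim_row ?A" "j < dim_col ?A"
    then have ij: "i < ?n" "j < ?n" by (auto simp: proj_def)
    have "(?S * ?S) $$ (i, j) = (\<Sum>l<?n. ?S $$ (i, l) * ?S $$ (l, j))"
      using ij SC by (simp add: times_mat_def scalar_prod_def atLeast0LessThan del: index_smult_mat) 
    also have "\<dots> = (\<Sum>l<?n. complex_of_real (sqrt c * sqrt c) * (v $ i * cnj (v $ j)) * (cnj (v $ l) * v $ l))"
      by (intro sum.cong refl) (use ij in \<open>simp add: Sent ac_simps del: index_smult_mat real_sqrt_mult_self\<close>)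
    also have "\<dots> = complex_of_real c * (v $ i * cnj (v $ j))"
      unfolding sum_distrib_left[symmetric] unit_norm_sum[OF u] using c by simp
    finally show "(?S * ?S) $$ (i, j) = ?A $$ (i, j)" using ij by (simp add: proj_def)
  qed (auto simp: proj_def)
  ultimately show "?S \<in> carrier_mat (dim_row ?A) (dim_row ?A) \<and> psd ?S \<and> ?S * ?S = ?A" using SC dr by simp
next
  fix S let ?n = "dim_vec v" and ?A = "complex_of_real c \<cdot>\<^sub>m proj v"
  assume "S \<in> carrier_mat (dim_row ?A) (dim_row ?A) \<and> psd S \<and> S * S = ?A"
  then have SC: "S \<in> carrier_mat ?n ?n" and psd: "psd S" and sq: "S * S = ?A" by (auto simp: proj_def)
  show "S = complex_of_real (sqrt c) \<cdot>\<^sub>m proj v"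
  proof (rule eq_matI)
    fix i j assume "i < dim_row (complex_of_real (sqrt c) \<cdot>\<^sub>m proj v)" "j < dim_col (complex_of_real (sqrt c) \<cdot>\<^sub>m proj v)"
    then have ij: "i < ?n" "j < ?n" by (auto simp: proj_def)
    have qf: "Im (\<Sum>i<?n. cnj (w i) * (\<Sum>j<?n. S $$ (i, j) * w j)) = 0 \<and> 0 \<le> Re (\<Sum>i<?n. cnj (w i) * (\<Sum>j<?n. S $$ (i, j) * w j))" for w
      using psd SC qform_vec[OF SC, of w] unfolding psd_def by (metis carrier_matD(1) dim_vec)
    have "S $$ (i, j) = complex_of_real (sqrt c) * (v $ i * cnj (v $ j))"
    proof (rule rank_one_sqrt_unique[where s = "\<lambda>i j. S $$ (i, j)" and v = "\<lambda>i. v $ i" and n = ?n])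
      fix a b assume ab: "a < ?n" "b < ?n"
      have "(S * S) $$ (a, b) = (\<Sum>l<?n. S $$ (a, l) * S $$ (l, b))"
        using ab SC by (simp add: times_mat_def scalar_prod_def atLeast0LessThan)
      then show "(\<Sum>l<?n. S $$ (a, l) * S $$ (l, b)) = complex_of_real c * (v $ a * cnj (v $ b))"
        using ab unfolding sq by (simp add: proj_def)
    qed (use qf u c ij in \<open>auto simp: unit_norm_def\<close>)
    then show "S $$ (i, j) = (complex_of_real (sqrt c) \<cdot>\<^sub>m proj v) $$ (i, j)" using ij by (simp add: proj_def)
  qed (use SC in \<open>auto simp: proj_def\<close>)
qed

text \<open>Between two copies of the projector \<open>R\<close> collapses to a multiple of that
  projector. The factor is the expectation of \<open>R\<close> in the state \<open>v\<close>, and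
  this is the squared fidelity.\<close>

lemma fidelity_pure:
  assumes u: "unit_norm v" and R: "R \<in> carrier_mat (dim_vec v) (dim_vec v)"
    and ent: "\<And>a b. a < dim_vec v \<Longrightarrow> b < dim_vec v \<Longrightarrow> R $$ (a, b) = (\<Sum>l<(m::nat). x l a * cnj (x l b))"
  shows "fidelity R (proj v) = sqrt (\<Sum>l<m. (cmod (\<Sum>a<dim_vec v. cnj (v $ a) * x l a))\<^sup>2)"
proof -
  let ?n = "dim_vec v"
  define t where "t = (\<lambda>l. \<Sum>a<?n. cnj (v $ a) * x l a)"
  define C where "C = (\<Sum>l<m. (cmod (t l))\<^sup>2)"
  have C0: "0 \<le> C" by (simp add: C_def sum_nonneg)
  have s1: "msqrt (proj v) = proj v"
  proof -
    have "1 \<cdot>\<^sub>m proj v = proj v" by (rule eq_matI) auto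
    then show ?thesis using msqrt_proj[OF u, of 1] by simp
  qed
  have "proj v * R * proj v = complex_of_real C \<cdot>\<^sub>m proj v"
  proof (rule eq_matI)
    fix i j assume "i < dim_row (complex_of_real C \<cdot>\<^sub>m proj v)" "j < dim_col (complex_of_real C \<cdot>\<^sub>m proj v)"
    then have ij: "i < ?n" "j < ?n" by (auto simp: proj_def)
    have "(proj v * R * proj v) $$ (i, j) = (\<Sum>b<?n. (\<Sum>a<?n. v $ i * cnj (v $ a) * R $$ (a, b)) * (v $ b * cnj (v $ j)))"
      using ij R by (simp add: times_mat_def scalar_prod_def proj_def atLeast0LessThan)
    also have "\<dots> = (\<Sum>b<?n. \<Sum>a<?n. \<Sum>l<m. v $ i * cnj (v $ j) * (cnj (v $ a) * x l a * cnj (cnj (v $ b) * x l b)))"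
      unfolding sum_distrib_right
      by (intro sum.cong refl) (simp add: ent sum_distrib_left sum_distrib_right ac_simps)
    also have "\<dots> = (\<Sum>b<?n. \<Sum>l<m. \<Sum>a<?n. v $ i * cnj (v $ j) * (cnj (v $ a) * x l a * cnj (cnj (v $ b) * x l b)))"
      by (intro sum.cong refl sum.swap)
    also have "\<dots> = (\<Sum>l<m. \<Sum>b<?n. \<Sum>a<?n. v $ i * cnj (v $ j) * (cnj (v $ a) * x l a * cnj (cnj (v $ b) * x l b)))"
      by (rule sum.swap)
    also have "\<dots> = (\<Sum>l<m. v $ i * cnj (v $ j) * (t l * cnj (t l)))"
    proof (rule sum.cong[OF refl])
      fix l
      have "(\<Sum>b<?n. \<Sum>a<?n. v $ i * cnj (v $ j) * (cnj (v $ a) * x l a * cnj (cnj (v $ b) * x l b)))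
         = (\<Sum>a<?n. \<Sum>b<?n. v $ i * cnj (v $ j) * (cnj (v $ a) * x l a * cnj (cnj (v $ b) * x l b)))" by (rule sum.swap)
      then show "(\<Sum>b<?n. \<Sum>a<?n. v $ i * cnj (v $ j) * (cnj (v $ a) * x l a * cnj (cnj (v $ b) * x l b)))
         = v $ i * cnj (v $ j) * (t l * cnj (t l))"
        unfolding t_def cnj_sum sum_product by (simp only: sum_distrib_left)
    qed
    also have "\<dots> = complex_of_real C * (v $ i * cnj (v $ j))"
      unfolding C_def of_real_sum complex_norm_square sum_distrib_right by (simp add: mult.commute)
    finally show "(proj v * R * proj v) $$ (i, j) = (complex_of_real C \<cdot>\<^sub>m proj v) $$ (i, j)"
      using ij by (simp add: proj_def)
  qed (use R in \<open>auto simp: proj_def\<close>)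
  then have "fidelity R (proj v) = Re (mtrace (complex_of_real (sqrt C) \<cdot>\<^sub>m proj v))"
    unfolding fidelity_def s1 using msqrt_proj[OF u C0] by simp
  also have "mtrace (complex_of_real (sqrt C) \<cdot>\<^sub>m proj v) = complex_of_real (sqrt C) * (\<Sum>i<?n. cnj (v $ i) * v $ i)"
    unfolding mtrace_def sum_distrib_left by (simp add: proj_def ac_simps)
  finally show ?thesis by (simp add: unit_norm_sum[OF u] C_def t_def)
qed

lemma kraus_entry:
  assumes K: "K \<in> carrier_mat n m" and p: "dim_vec p = m" and ab: "a < n" "b < n"
  shows "(K * proj p * adj K) $$ (a, b) = (K *\<^sub>v p) $ a * cnj ((K *\<^sub>v p) $ b)"
proof -
  have "(K * proj p * adj K) $$ (a, b) = (\<Sum>j<m. (\<Sum>i<m. K $$ (a, i) * (p $ i * cnj (p $ j))) * cnj (K $$ (b, j)))"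
    using K p ab by (simp add: times_mat_def scalar_prod_def proj_def adj_def atLeast0LessThan)
  also have "\<dots> = (\<Sum>j<m. \<Sum>i<m. K $$ (a, i) * p $ i * cnj (K $$ (b, j) * p $ j))"
    unfolding sum_distrib_right by (intro sum.cong refl) simp
  also have "\<dots> = (\<Sum>i<m. \<Sum>j<m. K $$ (a, i) * p $ i * cnj (K $$ (b, j) * p $ j))" by (rule sum.swap)
  also have "\<dots> = (\<Sum>i<m. K $$ (a, i) * p $ i) * (\<Sum>j<m. cnj (K $$ (b, j) * p $ j))"
    by (rule sum_product[symmetric])
  also have "\<dots> = (K *\<^sub>v p) $ a * cnj ((K *\<^sub>v p) $ b)"
    using K p ab by (simp add: mult_mat_vec_def scalar_prod_def atLeast0LessThan cnj_sum)
  finally show ?thesis .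
qed

lemma kraus_sum_entry:
  assumes K: "\<And>K. K \<in> set Ks \<Longrightarrow> K \<in> carrier_mat n m" and p: "dim_vec p = m"
  shows "msum n n (map (\<lambda>K. K * proj p * adj K) Ks) \<in> carrier_mat n n"
    "\<And>a b. a < n \<Longrightarrow> b < n \<Longrightarrow> msum n n (map (\<lambda>K. K * proj p * adj K) Ks) $$ (a, b)
       = (\<Sum>l<length Ks. (Ks ! l *\<^sub>v p) $ a * cnj ((Ks ! l *\<^sub>v p) $ b))"
proof -
  have c: "\<forall>A\<in>set (map (\<lambda>K. K * proj p * adj K) Ks). A \<in> carrier_mat n n"
  proof
    fix A assume "A \<in> set (map (\<lambda>K. K * proj p * adj K) Ks)"
    then obtain K' where K': "K' \<in> set Ks" "A = K' * proj p * adj K'" by auto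
    have KC: "K' \<in> carrier_mat n m" by (rule K[OF K'(1)])
    then have "adj K' \<in> carrier_mat m n" by (simp add: adj_def)
    moreover have "proj p \<in> carrier_mat m m" using proj_carrier[of p] p by simp
    ultimately show "A \<in> carrier_mat n n" unfolding K'(2) using KC by (meson mult_carrier_mat)
  qed
  show "msum n n (map (\<lambda>K. K * proj p * adj K) Ks) \<in> carrier_mat n n" using msum_entry[OF c] by simp
  fix a b assume ab: "a < n" "b < n"
  have "msum n n (map (\<lambda>K. K * proj p * adj K) Ks) $$ (a, b) = (\<Sum>K\<leftarrow>Ks. (K * proj p * adj K) $$ (a, b))"
    using msum_entry[OF c] ab by (simp add: comp_def)
  also have "\<dots> = (\<Sum>K\<leftarrow>Ks. (K *\<^sub>v p) $ a * cnj ((K *\<^sub>v p) $ b))"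
    using kraus_entry[OF K p ab] by (intro arg_cong[of _ _ sum_list] map_cong) auto
  also have "\<dots> = (\<Sum>l<length Ks. (Ks ! l *\<^sub>v p) $ a * cnj ((Ks ! l *\<^sub>v p) $ b))"
    by (simp add: sum_list_sum_nth atLeast0LessThan)
  finally show "msum n n (map (\<lambda>K. K * proj p * adj K) Ks) $$ (a, b) = (\<Sum>l<length Ks. (Ks ! l *\<^sub>v p) $ a * cnj ((Ks ! l *\<^sub>v p) $ b))" .
qed

lemma fidelity_kraus:
  assumes K: "\<And>K. K \<in> set Ks \<Longrightarrow> K \<in> carrier_mat (dim_vec v) (dim_vec p)" and u: "unit_norm v"
  shows "fidelity (apply_kraus (dim_vec v) Ks (proj p)) (proj v)
    = sqrt (\<Sum>l<length Ks. (cmod (\<Sum>a<dim_vec v. cnj (v $ a) * (Ks ! l *\<^sub>v p) $ a))\<^sup>2)"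
  unfolding apply_kraus_def using kraus_sum_entry[OF K refl] by (intro fidelity_pure[OF u]) auto

lemma fidelity_proj:
  assumes "dim_vec p = dim_vec v" "unit_norm v"
  shows "fidelity (proj p) (proj v) = cmod (\<Sum>a<dim_vec v. cnj (v $ a) * p $ a)"
  using fidelity_pure[OF assms(2), where R = "proj p" and m = 1 and x = "\<lambda>l a. p $ a"] assms by (simp add: proj_def)

section \<open>Pure states as operators\<close>

context resource_theory
begin

text \<open>Conversion in \<open>n div q\<close> blocks leaves at most \<open>p\<close> copies of
  \<open>t\<close> missing, on account of the incomplete block and the ceiling; these are bought
  from a constant number of GHZ states.\<close>

lemma ge_rate:
  assumes st: "s \<in> S" "t \<in> S" and q: "0 < q" and ge: "ge (replicate_mset q s) (replicate_mset p t)" and d: "0 < \<delta>"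
  shows "tends (\<lambda>n. replicate_mset n s + replicate_mset (nat \<lfloor>\<delta> * real n\<rfloor>) g)
     (\<lambda>n. replicate_mset (nat \<lceil>real p / real q * real n\<rceil>) t)"
proof -
  have C: "replicate_mset n s \<in> Cr" "replicate_mset n t \<in> Cr" for n using st by (auto simp: Cr_iff)
  obtain b where b: "tends (\<lambda>_. replicate_mset b g) (\<lambda>_. replicate_mset p t)" using multiset_from_g[OF C(2)] by blast
  let ?l = "\<lambda>n. n div q"
  have lim: "filterlim ?l at_top sequentially"
    unfolding filterlim_at_top
  proof
    fix Z
    show "\<forall>\<^sub>F x in sequentially. Z \<le> ?l x"
      using q by (intro eventually_sequentiallyI[of "Z * q"]) (simp add: less_eq_div_iff_mult_less_eq)
  qed
  have d2: "\<delta> / 2 > 0" using d by simp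
  have t: "tends (\<lambda>n. replicate_mset (?l n * q) s + replicate_mset (nat \<lfloor>\<delta> / 2 * real (?l n)\<rfloor>) g) (\<lambda>n. replicate_mset (?l n * p) t)"
    using tends_subseq[OF geD[OF ge d2] lim] by simp
  have "\<forall>\<^sub>F n in sequentially. nat \<lfloor>\<delta> / 2 * real (?l n)\<rfloor> + b \<le> nat \<lfloor>\<delta> * real n\<rfloor>"
  proof -
    obtain n0 :: nat where n0: "real n0 \<ge> 2 * real b / \<delta>" using real_arch_simple by blast
    have "nat \<lfloor>\<delta> / 2 * real (?l n)\<rfloor> + b \<le> nat \<lfloor>\<delta> * real n\<rfloor>" if "n \<ge> n0" for n
    proof -
      have "real (nat \<lfloor>\<delta> / 2 * real (?l n)\<rfloor>) \<le> \<delta> / 2 * real (?l n)" using d by (intro of_nat_floor) simp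
      also have "\<dots> \<le> \<delta> / 2 * real n" using d by (intro mult_left_mono) auto
      finally have 1: "real (nat \<lfloor>\<delta> / 2 * real (?l n)\<rfloor>) \<le> \<delta> / 2 * real n" .
      have "real n \<ge> 2 * real b / \<delta>" using n0 that by linarith
      then have "real b \<le> \<delta> / 2 * real n" using d by (simp add: field_simps)
      with 1 have "real (nat \<lfloor>\<delta> / 2 * real (?l n)\<rfloor> + b) \<le> \<delta> * real n" by simp
      then show ?thesis using d by (subst nat_floor_le_iff) auto
    qed
    then show ?thesis by (rule eventually_sequentiallyI)
  qed
  then have "tends (\<lambda>n. replicate_mset n s + replicate_mset (nat \<lfloor>\<delta> * real n\<rfloor>) g)
     (\<lambda>n. (replicate_mset (?l n * q) s + replicate_mset (nat \<lfloor>\<delta> / 2 * real (?l n)\<rfloor>) g) + replicate_mset b g)"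
  proof (intro tends_subset, goal_cases)
    case 3
    then show ?case
      by eventually_elim (auto simp: add.assoc simp flip: replicate_mset_plus intro!: subset_mset.add_mono replicate_mset_subset)
  qed (use C in auto)
  also have "tends \<dots> (\<lambda>n. replicate_mset (?l n * p) t + replicate_mset p t)" by (rule tends_add[OF t b])
  also have "tends \<dots> (\<lambda>n. replicate_mset (nat \<lceil>real p / real q * real n\<rceil>) t)"
  proof (intro tends_subset always_eventually allI)
    fix n
    have "n < (?l n + 1) * q" using q by (metis Suc_eq_plus1 add.commute div_less_iff_less_mult lessI)
    then have "real n \<le> (real (?l n) + 1) * real q" by (metis less_imp_le of_nat_1 of_nat_add of_nat_le_iff of_nat_mult)
    then have "real p * real n \<le> real p * ((real (?l n) + 1) * real q)" by (intro mult_left_mono) auto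
    then have "real p / real q * real n \<le> real (?l n * p + p)" using q by (simp add: field_simps)
    then have "nat \<lceil>real p / real q * real n\<rceil> \<le> ?l n * p + p" by (metis ceiling_le_iff nat_le_iff of_int_of_nat_eq)
    then show "replicate_mset (nat \<lceil>real p / real q * real n\<rceil>) t \<subseteq># replicate_mset (?l n * p) t + replicate_mset p t"
      unfolding replicate_mset_plus[symmetric] by (rule replicate_mset_subset)
  qed (use C in auto)
  finally show ?thesis .
qed

end

definition op :: "pv \<Rightarrow> kop" where "op s = (fst s, proj (vec_of (fst s) (snd s)))"

lemma fst_op [simp]: "fst (op s) = fst s" by (simp add: op_def)

lemma unit_norm_vec_of: "s \<in> St k \<Longrightarrow> unit_norm (vec_of (fst s) (snd s))"
  by (simp add: unit_norm_def nrm_vec_of[symmetric] St_def)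

lemma op_pure: "s \<in> St k \<Longrightarrow> kpure k (op s)"
  unfolding kpure_def using unit_norm_vec_of[of s k]
  by (auto simp: op_def St_def intro!: exI[of _ "vec_of (fst s) (snd s)"])

lemma vec_state:
  assumes "valid_dims k d" "dim_vec v = prod_list d" "unit_norm v"
  shows "(d, amp_of d v) \<in> St k" "op (d, amp_of d v) = (d, proj v)"
proof -
  have "nrm d (amp_of d v) = 1" using assms unfolding nrm_vec_of vec_of_amp[OF assms(2)] by (simp add: unit_norm_def)
  then show "(d, amp_of d v) \<in> St k" using assms by (simp add: St_def supp_amp_of)
  show "op (d, amp_of d v) = (d, proj v)" by (simp add: op_def vec_of_amp[OF assms(2)])
qed

lemma kpure_op: "kpure k x \<Longrightarrow> \<exists>s\<in>St k. op s = x"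
proof -
  assume "kpure k x"
  then obtain v where v: "valid_dims k (fst x)" "dim_vec v = prod_list (fst x)" "unit_norm v" "snd x = proj v"
    by (auto simp: kpure_def)
  then show ?thesis using vec_state[OF v(1-3)] by (intro bexI[of _ "(fst x, amp_of (fst x) v)"]) (auto simp: prod_eq_iff)
qed

lemma op_entry: "x \<in> ibox (fst s) \<Longrightarrow> y \<in> ibox (fst s) \<Longrightarrow> snd (op s) $$ (enc (fst s) x, enc (fst s) y) = snd s x * cnj (snd s y)"
  by (simp add: op_def proj_def vec_of_def enc_less digits_enc)

lemma ktensor_op:
  assumes "s \<in> St k" "t \<in> St k"
  shows "ktensor (op s) (op t) = op (tens s t)"
proof -
  have l: "length (fst s) = length (fst t)" using St_length assms by metis
  let ?de = "dmul (fst s) (fst t)"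
  have "snd (ktensor (op s) (op t)) = snd (op (tens s t))"
  proof (rule eq_matI)
    show "dim_row (snd (ktensor (op s) (op t))) = dim_row (snd (op (tens s t)))"
      "dim_col (snd (ktensor (op s) (op t))) = dim_col (snd (op (tens s t)))"
      by (simp_all add: ktensor_def Let_def op_def tens_def proj_def dmul_def)
    fix r c assume "r < dim_row (snd (op (tens s t)))" "c < dim_col (snd (op (tens s t)))"
    then have rc: "r < prod_list ?de" "c < prod_list ?de" by (auto simp: op_def tens_def proj_def)
    have bx: "digits ?de r \<in> ibox ?de" "digits ?de c \<in> ibox ?de" using rc digits_in_box by auto
    have "snd (ktensor (op s) (op t)) $$ (r, c) =
        snd (op s) $$ (enc (fst s) (map2 (div) (digits ?de r) (fst t)), enc (fst s) (map2 (div) (digits ?de c) (fst t))) *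
        snd (op t) $$ (enc (fst t) (map2 (mod) (digits ?de r) (fst t)), enc (fst t) (map2 (mod) (digits ?de c) (fst t)))"
      using rc by (simp add: ktensor_def Let_def dmul_def)
    also have "\<dots> = tn (fst s) (snd s) (fst t) (snd t) (digits ?de r) * cnj (tn (fst s) (snd s) (fst t) (snd t) (digits ?de c))"
      using bx div_in_box[OF l] mod_in_box[OF l] by (simp add: op_entry tn_def)
    also have "\<dots> = snd (op (tens s t)) $$ (r, c)" using rc by (simp add: op_def tens_def proj_def vec_of_def)
    finally show "snd (ktensor (op s) (op t)) $$ (r, c) = snd (op (tens s t)) $$ (r, c)" .
  qed
  moreover have "fst (ktensor (op s) (op t)) = fst (op (tens s t))" by (simp add: ktensor_def Let_def tens_def dmul_def)
  ultimately show ?thesis by (simp add: prod_eq_iff)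
qed

lemma op_trivial:
  assumes "s \<in> St k" "fst s = replicate k 1"
  shows "op s = trivial_kop k"
proof -
  have "nrm (replicate k 1) (snd s) = 1" using assms by (simp add: St_def)
  then have "(cmod (snd s (replicate k 0)))\<^sup>2 = 1\<^sup>2" unfolding nrm_def box_ones by simp
  then have n: "cmod (snd s (replicate k 0)) = 1" by (rule power2_eq_imp_eq) auto
  have "digits (replicate k 1) 0 = replicate k 0" by (induction k) auto
  then have "vec_of (replicate k 1) (snd s) $ 0 = snd s (replicate k 0)" by (simp add: vec_of_def prod_list_replicate)
  moreover have "snd s (replicate k 0) * cnj (snd s (replicate k 0)) = 1"
    using n by (metis complex_norm_square of_real_1 one_power2)
  ultimately have "proj (vec_of (replicate k 1) (snd s)) = 1\<^sub>m 1"
    by (intro eq_matI) (auto simp: proj_def prod_list_replicate)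
  then show ?thesis using assms by (simp add: op_def trivial_kop_def)
qed

lemma kpow_op: "s \<in> St k \<Longrightarrow> kpow k (op s) n = op (prodl k (replicate n s))"
proof (induction n)
  case 0 then show ?case using op_trivial[OF unit_St] by (simp add: unit_def)
next
  case (Suc n)
  have r: "replicate (Suc n) s = replicate n s @ [s]" by (simp add: replicate_append_same)
  have sub: "set (replicate n s) \<subseteq> St k" "set [s] \<subseteq> St k" using Suc by auto
  have "prodl k (replicate (Suc n) s) = tens (prodl k (replicate n s)) s"
    unfolding r prodl_append[OF sub] using Suc by (simp add: tens_unit_right)
  then show ?case using Suc ktensor_op[OF prodl_St[OF sub(1)] Suc(2)] by simp
qed

lemma GHZ_op: "0 < k \<Longrightarrow> op (ghz k r) = GHZ k r"
proof -
  assume k: "0 < k"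
  have "vec_of (replicate k r) (snd (ghz k r)) = ghz_vec k r"
  proof (rule eq_vecI)
    show "dim_vec (vec_of (replicate k r) (snd (ghz k r))) = dim_vec (ghz_vec k r)" by (simp add: ghz_vec_def prod_list_replicate)
    fix i assume "i < dim_vec (ghz_vec k r)"
    then have i: "i < prod_list (replicate k r)" by (simp add: ghz_vec_def prod_list_replicate)
    let ?xs = "digits (replicate k r) i"
    have xs: "?xs \<in> ibox (replicate k r)" using i by (rule digits_in_box)
    have "(\<exists>i<r. ?xs = replicate k i) \<longleftrightarrow> (\<forall>x\<in>set ?xs. x = hd ?xs)"
    proof
      assume "\<exists>i<r. ?xs = replicate k i"
      then show "\<forall>x\<in>set ?xs. x = hd ?xs" using k by (cases k) auto
    next
      assume "\<forall>x\<in>set ?xs. x = hd ?xs"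
      then have "?xs = replicate k (hd ?xs)" by (metis length_digits length_replicate replicate_length_same)
      moreover have "hd ?xs < r"
        using nth_box[OF xs, of 0] k length_box[OF xs] by (cases ?xs) auto
      ultimately show "\<exists>i<r. ?xs = replicate k i" by blast
    qed
    then show "vec_of (replicate k r) (snd (ghz k r)) $ i = ghz_vec k r $ i"
      using i by (simp add: vec_of_def ghz_vec_def ghz_def prod_list_replicate)
  qed
  then show ?thesis by (simp add: op_def GHZ_def ghz_def)
qed

definition overlap :: "pv \<Rightarrow> pv \<Rightarrow> complex mat list \<Rightarrow> real" where
  "overlap s t Ks = (\<Sum>K\<leftarrow>Ks. (cmod (ip (fst t) (snd t) (amp_of (fst t) (K *\<^sub>v vec_of (fst s) (snd s)))))\<^sup>2)"

lemma purified_dist_kraus: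
  assumes t: "t \<in> St k" and Ks: "locc (fst s) (fst t) Ks"
  shows "purified_dist (apply_kraus (prod_list (fst t)) Ks (snd (op s))) (snd (op t)) = sqrt (1 - overlap s t Ks)"
proof -
  let ?v = "vec_of (fst t) (snd t)" and ?p = "vec_of (fst s) (snd s)"
  have K: "K \<in> carrier_mat (prod_list (fst t)) (prod_list (fst s))" if "K \<in> set Ks" for K using locc_structure[OF Ks] that by blast
  have "fidelity (apply_kraus (dim_vec ?v) Ks (proj ?p)) (proj ?v)
    = sqrt (\<Sum>l<length Ks. (cmod (\<Sum>a<dim_vec ?v. cnj (?v $ a) * (Ks ! l *\<^sub>v ?p) $ a))\<^sup>2)"
    using K by (intro fidelity_kraus unit_norm_vec_of[OF t]) auto
  also have "(\<Sum>l<length Ks. (cmod (\<Sum>a<dim_vec ?v. cnj (?v $ a) * (Ks ! l *\<^sub>v ?p) $ a))\<^sup>2) = overlap s t Ks"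
  proof -
    have "overlap s t Ks = (\<Sum>l<length Ks. (cmod (ip (fst t) (snd t) (amp_of (fst t) (Ks ! l *\<^sub>v ?p))))\<^sup>2)"
      unfolding overlap_def by (simp add: sum_list_sum_nth atLeast0LessThan)
    also have "\<dots> = (\<Sum>l<length Ks. (cmod (\<Sum>a<dim_vec ?v. cnj (?v $ a) * (Ks ! l *\<^sub>v ?p) $ a))\<^sup>2)"
    proof (rule sum.cong[OF refl])
      fix l assume "l \<in> {..<length Ks}"
      then have "Ks ! l \<in> carrier_mat (prod_list (fst t)) (prod_list (fst s))" using K by simp
      then have "dim_vec (Ks ! l *\<^sub>v ?p) = prod_list (fst t)" by simp
      then show "(cmod (ip (fst t) (snd t) (amp_of (fst t) (Ks ! l *\<^sub>v ?p))))\<^sup>2 = (cmod (\<Sum>a<dim_vec ?v. cnj (?v $ a) * (Ks ! l *\<^sub>v ?p) $ a))\<^sup>2"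
        unfolding ip_vec_of by (simp add: vec_of_amp)
    qed
    finally show ?thesis by simp
  qed
  finally have "fidelity (apply_kraus (prod_list (fst t)) Ks (snd (op s))) (snd (op t)) = sqrt (overlap s t Ks)" by (simp add: op_def)
  moreover have "0 \<le> overlap s t Ks" unfolding overlap_def by (auto intro!: sum_list_nonneg)
  ultimately show ?thesis by (simp add: purified_dist_def)
qed

lemma purified_dist_op:
  assumes s: "s \<in> St k" and t: "t \<in> St k" and e: "fst s = fst t"
  shows "purified_dist (snd (op s)) (snd (op t)) = sqrt (1 - (cmod (ip (fst t) (snd t) (snd s)))\<^sup>2)"
  unfolding purified_dist_def op_def snd_conv using e
  by (subst fidelity_proj) (use unit_norm_vec_of[OF t] in \<open>auto simp: ip_vec_of\<close>)

lemma conv_locc_trans: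
  assumes c: "conv s t p" and s: "s \<in> St k" and t: "t \<in> St k" and e: "0 \<le> \<epsilon>" "1 - \<epsilon>\<^sup>2 \<le> p"
  shows "locc_trans (op s) \<epsilon> (op t)"
proof -
  obtain Ks where Ks: "locc (fst s) (fst t) Ks" "p \<le> overlap s t Ks"
    using pay_locc[of t "fst s" "snd s" p] c s by (auto simp: conv_def St_def valid_dims_def overlap_def)
  have "sqrt (1 - overlap s t Ks) \<le> sqrt (\<epsilon>\<^sup>2)" using Ks(2) e by (intro real_sqrt_le_mono) simp
  then have "sqrt (1 - overlap s t Ks) \<le> \<epsilon>" using e by simp
  then show ?thesis unfolding locc_trans_def using Ks(1) purified_dist_kraus[OF t Ks(1)] by auto
qed

lemma locc_trans_overlap:
  assumes "locc_trans (op s) \<epsilon> (op t)" and t: "t \<in> St k" and e: "0 \<le> \<epsilon>"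
  shows "\<exists>Ks. locc (fst s) (fst t) Ks \<and> 1 - \<epsilon>\<^sup>2 \<le> overlap s t Ks"
proof -
  obtain Ks where Ks: "locc (fst s) (fst t) Ks" "sqrt (1 - overlap s t Ks) \<le> \<epsilon>"
    using assms(1) purified_dist_kraus[OF t, of s] unfolding locc_trans_def by auto
  have "1 - overlap s t Ks \<le> \<epsilon>\<^sup>2"
  \<comment> \<open>An overlap above 1, not excluded at this point, makes the claim trivial.\<close>
  proof (cases "0 \<le> 1 - overlap s t Ks")
    case True then show ?thesis using Ks(2) e by (metis real_sqrt_le_iff real_sqrt_abs abs_of_nonneg)
  next
    case False then show ?thesis using zero_le_power2[of \<epsilon>] by linarith
  qed
  then show ?thesis using Ks(1) by (intro exI[of _ Ks]) simp
qed

section \<open>Admissible functionals bound the rate\<close>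

text \<open>Every Kraus operator is taken as a flag value of its own; each branch is then pure, and
  monotonicity on average applies.\<close>

lemma branch_average:
  assumes E: "monotone_on_average k E" and s: "s \<in> St k" and t: "t \<in> St k" and Ks: "locc (fst s) (fst t) Ks"
  shows "\<exists>p u. (\<forall>l<length Ks. 0 \<le> p l \<and> (u l \<in> St k \<and> fst (u l) = fst t) \<and>
       p l * (cmod (ip (fst t) (snd t) (snd (u l))))\<^sup>2 = (cmod (ip (fst t) (snd t) (amp_of (fst t) (Ks ! l *\<^sub>v vec_of (fst s) (snd s)))))\<^sup>2) \<and>
     (\<Sum>l<length Ks. p l) = (1::real) \<and> (\<Sum>l<length Ks. p l * E (op (u l))) \<le> E (op s)"
proof -
  let ?d = "fst s" and ?e = "fst t" and ?ph = "vec_of (fst s) (snd s)" and ?m = "length Ks"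
  define v where "v = (\<lambda>l. amp_of ?e (Ks ! l *\<^sub>v ?ph))"
  define p where "p = (\<lambda>l. nrm ?e (v l))"
  \<comment> \<open>A branch of probability 0 has no normalised vector; \<open>t\<close> is a pure
    default that contributes nothing to the average.\<close>
  define u where "u = (\<lambda>l. if p l = 0 then t else (?e, \<lambda>x. complex_of_real (1 / sqrt (p l)) * v l x))"
  have p0: "0 \<le> p l" for l by (simp add: p_def nrm_nonneg)
  have KC: "Ks ! l \<in> carrier_mat (prod_list ?e) (prod_list ?d)" if "l < ?m" for l using locc_structure[OF Ks] that by simp
  have psum: "(\<Sum>l<?m. p l) = 1"
  proof -
    have "(\<Sum>K\<leftarrow>Ks. nrm ?e (amp_of ?e (K *\<^sub>v ?ph))) = 1" using locc_nrm[OF Ks] s by (simp add: St_def)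
    then show ?thesis by (simp add: p_def v_def sum_list_sum_nth atLeast0LessThan)
  qed
  have uS: "u l \<in> St k" "fst (u l) = ?e" for l
  proof -
    show "fst (u l) = ?e" by (simp add: u_def)
    show "u l \<in> St k"
    proof (cases "p l = 0")
      case False
      then have "p l > 0" using p0[of l] by simp
      then have "nrm ?e (\<lambda>x. complex_of_real (1 / sqrt (p l)) * v l x) = 1"
        unfolding nrm_scale by (simp add: norm_divide power_divide p_def)
      moreover have "supp ?e (\<lambda>x. complex_of_real (1 / sqrt (p l)) * v l x)" using supp_amp_of[of ?e] by (simp add: supp_def v_def)
      ultimately show ?thesis using t False by (simp add: u_def St_def)
    qed (use t in \<open>simp add: u_def\<close>)
  qed
  have vu: "v l x = complex_of_real (sqrt (p l)) * snd (u l) x" if "x \<in> ibox ?e" for l x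
  proof (cases "p l = 0")
    case True
    then have "(cmod (v l x))\<^sup>2 = 0" using that unfolding p_def nrm_def by (simp add: sum_nonneg_eq_0_iff)
    then show ?thesis using True by simp
  next
    case False
    then have "p l > 0" using p0[of l] by simp
    then show ?thesis using False by (simp add: u_def)
  qed
  have "(\<Sum>l<?m. p l * E (?e, proj (vec_of ?e (snd (u l))))) \<le> E (?d, proj ?ph)"
  proof (rule E[unfolded monotone_on_average_def, rule_format, where f = "\<lambda>b. b" and Ks = Ks], intro conjI allI impI)
    show "kpure k (?d, proj ?ph)" using op_pure[OF s] by (simp add: op_def)
    show "dim_vec ?ph = prod_list ?d" by simp
    show "locc ?d ?e Ks" by (rule Ks)
    show "\<And>b. b < ?m \<Longrightarrow> b < ?m" by simp
    show "\<And>x. 0 \<le> p x" by (rule p0)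
    show "sum p {..<?m} = 1" by (rule psum)
    fix l assume l: "l < ?m"
    show "kpure k (?e, proj (vec_of ?e (snd (u l))))" using op_pure[OF uS(1)[of l]] uS(2)[of l] by (simp add: op_def)
    show "dim_vec (vec_of ?e (snd (u l))) = prod_list ?e" by simp
    have f: "filter (\<lambda>b. b = l) [0..<?m] = [l]"
    proof -
      have "[0..<?m] = [0..<l] @ l # [Suc l..<?m]" using l by (metis le0 less_imp_le_nat upt_add_eq_append upt_conv_Cons le_add_diff_inverse)
      then show ?thesis by auto
    qed
    let ?K = "Ks ! l"
    have "msum (prod_list ?e) (prod_list ?e) (map (\<lambda>K. K * proj ?ph * adj K) [?K]) = complex_of_real (p l) \<cdot>\<^sub>m proj (vec_of ?e (snd (u l)))"
    proof (rule eq_matI)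
      have C: "msum (prod_list ?e) (prod_list ?e) (map (\<lambda>K. K * proj ?ph * adj K) [?K]) \<in> carrier_mat (prod_list ?e) (prod_list ?e)"
        by (rule kraus_sum_entry(1)[where m = "prod_list ?d"]) (use KC[OF l] in auto)
      then show "dim_row (msum (prod_list ?e) (prod_list ?e) (map (\<lambda>K. K * proj ?ph * adj K) [?K])) = dim_row (complex_of_real (p l) \<cdot>\<^sub>m proj (vec_of ?e (snd (u l))))"
        "dim_col (msum (prod_list ?e) (prod_list ?e) (map (\<lambda>K. K * proj ?ph * adj K) [?K])) = dim_col (complex_of_real (p l) \<cdot>\<^sub>m proj (vec_of ?e (snd (u l))))"
        by (simp_all add: proj_def)
      fix a b assume "a < dim_row (complex_of_real (p l) \<cdot>\<^sub>m proj (vec_of ?e (snd (u l))))" "b < dim_col (complex_of_real (p l) \<cdot>\<^sub>m proj (vec_of ?e (snd (u l))))"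
      then have ab: "a < prod_list ?e" "b < prod_list ?e" by (auto simp: proj_def)
      have Kv: "(?K *\<^sub>v ?ph) $ i = complex_of_real (sqrt (p l)) * vec_of ?e (snd (u l)) $ i" if i: "i < prod_list ?e" for i
      proof -
        have "vec_of ?e (v l) = ?K *\<^sub>v ?ph" unfolding v_def by (rule vec_of_amp) (use KC[OF l] in simp)
        then have "(?K *\<^sub>v ?ph) $ i = v l (digits ?e i)" using i by (metis index_vec vec_of_def)
        then show ?thesis using vu[OF digits_in_box[OF i]] i by (simp add: vec_of_def)
      qed
      have "msum (prod_list ?e) (prod_list ?e) (map (\<lambda>K. K * proj ?ph * adj K) [?K]) $$ (a, b) = (\<Sum>i<length [?K]. ([?K] ! i *\<^sub>v ?ph) $ a * cnj (([?K] ! i *\<^sub>v ?ph) $ b))"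
        by (rule kraus_sum_entry(2)[where m = "prod_list ?d"]) (use KC[OF l] ab in auto)
      also have "\<dots> = (?K *\<^sub>v ?ph) $ a * cnj ((?K *\<^sub>v ?ph) $ b)" by simp
      also have "\<dots> = complex_of_real (sqrt (p l) * sqrt (p l)) * (vec_of ?e (snd (u l)) $ a * cnj (vec_of ?e (snd (u l)) $ b))"
        unfolding Kv[OF ab(1)] Kv[OF ab(2)] by (simp del: real_sqrt_mult_self)
      also have "\<dots> = (complex_of_real (p l) \<cdot>\<^sub>m proj (vec_of ?e (snd (u l)))) $$ (a, b)"
        using ab p0[of l] by (simp add: proj_def)
      finally show "msum (prod_list ?e) (prod_list ?e) (map (\<lambda>K. K * proj ?ph * adj K) [?K]) $$ (a, b) = (complex_of_real (p l) \<cdot>\<^sub>m proj (vec_of ?e (snd (u l)))) $$ (a, b)" .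
    qed
    then show "msum (prod_list ?e) (prod_list ?e) (map (\<lambda>b. Ks ! b * proj ?ph * adj (Ks ! b)) (filter (\<lambda>b. b = l) [0..<?m])) = complex_of_real (p l) \<cdot>\<^sub>m proj (vec_of ?e (snd (u l)))"
      unfolding f by simp
  qed
  then have "(\<Sum>l<?m. p l * E (op (u l))) \<le> E (op s)" by (simp add: op_def uS(2))
  moreover have "p l * (cmod (ip ?e (snd t) (snd (u l))))\<^sup>2 = (cmod (ip ?e (snd t) (v l)))\<^sup>2" for l
  proof -
    have "ip ?e (snd t) (v l) = complex_of_real (sqrt (p l)) * ip ?e (snd t) (snd (u l))"
      unfolding ip_def sum_distrib_left by (intro sum.cong refl) (simp add: vu)
    then show ?thesis using p0[of l] by (simp add: norm_mult power_mult_distrib)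
  qed
  ultimately show ?thesis using p0 uS psum unfolding v_def by blast
qed

lemma fully_additiveD:
  assumes "fully_additive k E" "s \<in> St k" "t \<in> St k"
  shows "E (op (tens s t)) = E (op s) + E (op t)"
  unfolding ktensor_op[OF assms(2,3), symmetric]
  using assms(1) op_pure[OF assms(2)] op_pure[OF assms(3)] unfolding fully_additive_def by blast

lemma admissible_trivial:
  assumes "fully_additive k E"
  shows "E (trivial_kop k) = 0"
proof -
  have t: "op (unit k) = trivial_kop k" by (rule op_trivial[OF unit_St]) (simp add: unit_def)
  show ?thesis using fully_additiveD[OF assms unit_St unit_St] unfolding tens_unit_left[OF unit_St] t by simp
qed

text \<open>Every state can be converted into the one-dimensional state, on which additivity forces
  the value 0.\<close>

lemma admissible_nonneg:
  assumes a: "fully_additive k E" "monotone_on_average k E" and s: "s \<in> St k"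
  shows "0 \<le> E (op s)"
proof -
  obtain Ks where Ks: "locc (fst s) (fst (unit k)) Ks"
    using pay_locc[of "unit k" "fst s" "snd s" 0] conv_zero[OF s unit_St] s by (auto simp: conv_def St_def valid_dims_def)
  obtain p u where pu: "\<And>l. l < length Ks \<Longrightarrow> u l \<in> St k \<and> fst (u l) = fst (unit k)"
      "(\<Sum>l<length Ks. p l * E (op (u l))) \<le> E (op s)"
    using branch_average[OF a(2) s unit_St Ks] by blast
  have "E (op (u l)) = 0" if "l < length Ks" for l
  proof -
    have "op (u l) = trivial_kop k" using pu(1)[OF that] by (intro op_trivial) (auto simp: unit_def)
    then show ?thesis using admissible_trivial[OF a(1)] by simp
  qed
  then have "(\<Sum>l<length Ks. p l * E (op (u l))) = 0" by simp
  then show ?thesis using pu(2) by simp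
qed

lemma admissible_kpow:
  assumes a: "fully_additive k E" and s: "s \<in> St k"
  shows "E (op (prodl k (replicate n s))) = real n * E (op s)"
proof (induction n)
  case 0 then show ?case using admissible_trivial[OF a] op_trivial[OF unit_St] by (simp add: unit_def)
next
  case (Suc n)
  have P: "prodl k (replicate n s) \<in> St k" using s by (intro prodl_St) auto
  have "E (op (tens s (prodl k (replicate n s)))) = E (op s) + E (op (prodl k (replicate n s)))"
    by (rule fully_additiveD[OF a s P])
  then show ?case using Suc by (simp add: algebra_simps)
qed

text \<open>Branches close to the target have nearly its value by continuity, and the remaining ones
  have a nonnegative value. The average deficit of squared fidelity is at most
  \<open>\<epsilon>\<^sup>2\<close>, so by Markov's inequality the remaining branches have
  probability at most \<open>\<epsilon>\<^sup>2 / \<delta>\<^sup>2\<close>.\<close>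

lemma approximate_monotone:
  assumes a: "fully_additive k E" "monotone_on_average k E" "asymptotically_continuous k E" and \<eta>: "0 < \<eta>"
  shows "\<exists>\<delta>>0. \<forall>s t \<epsilon>. s \<in> St k \<and> t \<in> St k \<and> 0 \<le> \<epsilon> \<and> locc_trans (op s) \<epsilon> (op t) \<longrightarrow>
     E (op t) * (1 - \<epsilon>\<^sup>2 / \<delta>\<^sup>2) - \<eta> * (1 + log 2 (real (prod_list (fst t)))) \<le> E (op s)"
proof -
  obtain \<delta> where \<delta>: "\<delta> > 0" "\<And>s t. kpure k s \<Longrightarrow> kpure k t \<Longrightarrow> kdist s t < \<delta> \<Longrightarrow>
        \<bar>E s / (1 + log 2 (real (prod_list (fst s)))) - E t / (1 + log 2 (real (prod_list (fst t))))\<bar> < \<eta>"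
    using a(3) \<eta> unfolding asymptotically_continuous_def by meson
  have "E (op t) * (1 - \<epsilon>\<^sup>2 / \<delta>\<^sup>2) - \<eta> * (1 + log 2 (real (prod_list (fst t)))) \<le> E (op s)"
    if s: "s \<in> St k" and t: "t \<in> St k" and e: "0 \<le> \<epsilon>" and tr: "locc_trans (op s) \<epsilon> (op t)" for s t \<epsilon>
  proof -
    let ?N = "1 + log 2 (real (prod_list (fst t)))"
    have "valid_dims k (fst t)" using t by (simp add: St_def)
    then have "0 \<le> log 2 (real (prod_list (fst t)))" using prod_list_ge_1[of k "fst t"] by simp
    then have N0: "0 < ?N" by linarith
    have Et: "0 \<le> E (op t)" by (rule admissible_nonneg[OF a(1,2) t])
    obtain Ks where Ks: "locc (fst s) (fst t) Ks" "1 - \<epsilon>\<^sup>2 \<le> overlap s t Ks" using locc_trans_overlap[OF tr t e] by blast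
    define F where "F = (\<lambda>u::pv. (cmod (ip (fst t) (snd t) (snd u)))\<^sup>2)"
    obtain p u where p0: "\<And>l. l < length Ks \<Longrightarrow> 0 \<le> p l" and u: "\<And>l. l < length Ks \<Longrightarrow> u l \<in> St k" "\<And>l. l < length Ks \<Longrightarrow> fst (u l) = fst t"
       and pF: "\<And>l. l < length Ks \<Longrightarrow> p l * F (u l) = (cmod (ip (fst t) (snd t) (amp_of (fst t) (Ks ! l *\<^sub>v vec_of (fst s) (snd s)))))\<^sup>2"
       and psum: "(\<Sum>l<length Ks. p l) = 1" and avg: "(\<Sum>l<length Ks. p l * E (op (u l))) \<le> E (op s)"
      using branch_average[OF a(2) s t Ks(1)] unfolding F_def by blast
    have ov: "overlap s t Ks = (\<Sum>l<length Ks. p l * F (u l))"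
      unfolding overlap_def by (simp add: sum_list_sum_nth atLeast0LessThan pF)
    \<comment> \<open>Markov's inequality in linear form: once the deficit
      \<open>1 - F (u l)\<close> reaches \<open>\<delta>\<^sup>2\<close>, the left side is at most
      0.\<close>
    have each: "E (op t) - \<eta> * ?N - E (op t) * ((1 - F (u l)) / \<delta>\<^sup>2) \<le> E (op (u l))" if l: "l < length Ks" for l
    proof -
      have F1: "F (u l) \<le> 1"
        using Cauchy_Schwarz_ip[of "fst t" "snd t" "snd (u l)"] t u[OF l] by (simp add: F_def St_def)
      have d2: "0 < \<delta>\<^sup>2" using \<delta>(1) by simp
      show ?thesis
      proof (cases "1 - F (u l) < \<delta>\<^sup>2")
        case True
        have "kdist (op (u l)) (op t) = sqrt (1 - F (u l))"
          unfolding kdist_def using purified_dist_op[OF u(1)[OF l] t u(2)[OF l]] u(2)[OF l] by (simp add: F_def)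
        also have "\<dots> < sqrt (\<delta>\<^sup>2)" by (rule real_sqrt_less_mono) (rule True)
        finally have "kdist (op (u l)) (op t) < \<delta>" using \<delta>(1) by simp
        from \<delta>(2)[OF op_pure[OF u(1)[OF l]] op_pure[OF t] this]
        have "\<bar>E (op (u l)) / ?N - E (op t) / ?N\<bar> < \<eta>" using u(2)[OF l] by simp
        then have "E (op t) / ?N - \<eta> < E (op (u l)) / ?N" by linarith
        then have "(E (op t) / ?N - \<eta>) * ?N < E (op (u l)) / ?N * ?N" using N0 by (rule mult_strict_right_mono)
        then have "E (op t) - \<eta> * ?N < E (op (u l))" using N0 by (simp add: left_diff_distrib)
        moreover have "0 \<le> E (op t) * ((1 - F (u l)) / \<delta>\<^sup>2)" using Et F1 d2 by simp
        ultimately show ?thesis by linarith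
      next
        case False
        then have "1 \<le> (1 - F (u l)) / \<delta>\<^sup>2" using d2 by (simp add: pos_le_divide_eq)
        then have "E (op t) * 1 \<le> E (op t) * ((1 - F (u l)) / \<delta>\<^sup>2)" using Et by (rule mult_left_mono)
        moreover have "0 \<le> \<eta> * ?N" using \<eta> N0 by simp
        moreover have "0 \<le> E (op (u l))" by (rule admissible_nonneg[OF a(1,2) u(1)[OF l]])
        ultimately show ?thesis by linarith
      qed
    qed
    have "E (op t) * (1 - \<epsilon>\<^sup>2 / \<delta>\<^sup>2) - \<eta> * ?N \<le> (E (op t) - \<eta> * ?N) - E (op t) * ((1 - overlap s t Ks) / \<delta>\<^sup>2)"
    proof -
      have "(1 - overlap s t Ks) / \<delta>\<^sup>2 \<le> \<epsilon>\<^sup>2 / \<delta>\<^sup>2" using Ks(2) by (intro divide_right_mono) auto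
      then have "E (op t) * ((1 - overlap s t Ks) / \<delta>\<^sup>2) \<le> E (op t) * (\<epsilon>\<^sup>2 / \<delta>\<^sup>2)" using Et by (rule mult_left_mono)
      then show ?thesis by (simp add: right_diff_distrib)
    qed
    also have "\<dots> = (\<Sum>l<length Ks. p l * (E (op t) - \<eta> * ?N - E (op t) * ((1 - F (u l)) / \<delta>\<^sup>2)))"
    proof -
      have "(\<Sum>l<length Ks. p l * (E (op t) - \<eta> * ?N - E (op t) * ((1 - F (u l)) / \<delta>\<^sup>2)))
        = (\<Sum>l<length Ks. p l * (E (op t) - \<eta> * ?N) - E (op t) / \<delta>\<^sup>2 * (p l - p l * F (u l)))"
        by (intro sum.cong refl) (simp add: algebra_simps diff_divide_distrib)
      also have "\<dots> = (\<Sum>l<length Ks. p l) * (E (op t) - \<eta> * ?N) - E (op t) / \<delta>\<^sup>2 * ((\<Sum>l<length Ks. p l) - overlap s t Ks)"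
        unfolding ov by (simp only: sum_subtractf sum_distrib_left[symmetric] sum_distrib_right[symmetric])
      finally show ?thesis unfolding psum by simp
    qed
    also have "\<dots> \<le> (\<Sum>l<length Ks. p l * E (op (u l)))"
      using each p0 by (intro sum_mono mult_left_mono) auto
    finally show ?thesis using avg by linarith
  qed
  then show ?thesis using \<delta>(1) by blast
qed

lemma direct_part:
  assumes k: "0 < k" and adm: "admissible k E" and s: "s \<in> St k" and t: "t \<in> St k" and r: "achievable k (op s) (op t) r"
  shows "r * E (op t) \<le> E (op s)"
proof -
  have a: "fully_additive k E" "monotone_on_average k E" "asymptotically_continuous k E" "E (GHZ k 2) = 1"
    using adm by (auto simp: admissible_def)
  have r0: "0 \<le> r" using r by (simp add: achievable_def)
  have gS: "ghz k 2 \<in> St k" by (rule ghz_St[OF k]) simp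
  have Eg: "E (op (ghz k 2)) = 1" using a(4) GHZ_op[OF k] by simp
  have Et: "0 \<le> E (op t)" by (rule admissible_nonneg[OF a(1,2) t])
  let ?L = "log 2 (real (prod_list (fst t)))"
  have vt: "valid_dims k (fst t)" using t by (simp add: St_def)
  have D1: "1 \<le> prod_list (fst t)" by (rule prod_list_ge_1[OF vt])
  have L0: "0 \<le> ?L" using D1 by simp
  \<comment> \<open>The coefficients of \<eta> per copy: the GHZ supply, the loss from bad branches
    and the continuity error.\<close>
  define B where "B = 1 + (r * E (op t) + E (op t)) + (1 + (r + 1) * ?L)"
  have B0: "0 < B" unfolding B_def using r0 Et L0 by (smt (verit) mult_nonneg_nonneg)
  have main: "r * E (op t) \<le> E (op s) + \<eta> * B" if h: "0 < \<eta>" "\<eta> < 1" for \<eta>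
  proof -
    obtain \<delta> where \<delta>: "\<delta> > 0" "\<And>s t \<epsilon>. s \<in> St k \<Longrightarrow> t \<in> St k \<Longrightarrow> 0 \<le> \<epsilon> \<Longrightarrow> locc_trans (op s) \<epsilon> (op t) \<Longrightarrow>
       E (op t) * (1 - \<epsilon>\<^sup>2 / \<delta>\<^sup>2) - \<eta> * (1 + log 2 (real (prod_list (fst t)))) \<le> E (op s)"
      using approximate_monotone[OF a(1-3) h(1)] by blast
    \<comment> \<open>This makes \<open>\<epsilon>\<^sup>2 / \<delta>\<^sup>2\<close> at most
      \<open>\<eta>\<^sup>2\<close>, hence at most \<eta>.\<close>
    define \<epsilon>0 where "\<epsilon>0 = \<delta> * \<eta>"
    have e0: "0 < \<epsilon>0" using \<delta>(1) h by (simp add: \<epsilon>0_def)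
    let ?A = "\<lambda>n. {\<epsilon>. \<epsilon> \<ge> 0 \<and> locc_trans (ktensor (kpow k (op s) n) (kpow k (GHZ k 2) (nat \<lfloor>\<eta> * real n\<rfloor>))) \<epsilon> (kpow k (op t) (nat \<lceil>r * real n\<rceil>))}"
    have "limsup (\<lambda>n. Inf (ereal ` ?A n)) = 0" using r h(1) by (simp add: achievable_def)
    then have "limsup (\<lambda>n. Inf (ereal ` ?A n)) < ereal \<epsilon>0" using e0 by simp
    then have "\<forall>\<^sub>F n in sequentially. Inf (ereal ` ?A n) < ereal \<epsilon>0" by (rule Limsup_lessD)
    then obtain n0 where n0: "\<And>n. n \<ge> n0 \<Longrightarrow> Inf (ereal ` ?A n) < ereal \<epsilon>0" unfolding eventually_sequentially by blast
    \<comment> \<open>From \<open>n = 1\<close> on, the rounding in \<open>m\<close> is absorbed by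
      \<open>m \<le> (r + 1) * n\<close>.\<close>
    define n where "n = max 1 n0"
    have n1: "1 \<le> n" "n0 \<le> n" by (auto simp: n_def)
    define m where "m = nat \<lceil>r * real n\<rceil>"
    define g where "g = nat \<lfloor>\<eta> * real n\<rfloor>"
    obtain \<epsilon> where \<epsilon>: "\<epsilon> \<in> ?A n" "\<epsilon> < \<epsilon>0" using n0[OF n1(2)] unfolding Inf_less_iff by auto
    let ?S = "tens (prodl k (replicate n s)) (prodl k (replicate g (ghz k 2)))" and ?T = "prodl k (replicate m t)"
    have P: "prodl k (replicate n s) \<in> St k" "prodl k (replicate g (ghz k 2)) \<in> St k" "?T \<in> St k"
      using s t gS by (auto intro!: prodl_St)
    have SS: "?S \<in> St k" using P tens_St by blast
    have tr: "locc_trans (op ?S) \<epsilon> (op ?T)" and eps0: "0 \<le> \<epsilon>"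
      using \<epsilon>(1) unfolding GHZ_op[OF k, symmetric] kpow_op[OF s] kpow_op[OF t] kpow_op[OF gS] m_def[symmetric] g_def[symmetric] ktensor_op[OF P(1,2)] by auto
    have ES: "E (op ?S) = real n * E (op s) + real g"
    proof -
      have "E (op ?S) = E (op (prodl k (replicate n s))) + E (op (prodl k (replicate g (ghz k 2))))"
        by (rule fully_additiveD[OF a(1) P(1,2)])
      then show ?thesis unfolding admissible_kpow[OF a(1) s] admissible_kpow[OF a(1) gS] Eg by simp
    qed
    have ET: "E (op ?T) = real m * E (op t)" by (rule admissible_kpow[OF a(1) t])
    have "fst ?T = dpow k (fst t) m"
      using fst_prodl_const[of k "fst t" "\<lambda>_. snd t" "replicate m 0"] by (simp add: map_replicate)
    then have LT: "log 2 (real (prod_list (fst ?T))) = real m * ?L"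
      using D1 by (simp add: prod_list_dpow[OF vt] log_nat_power)
    have "\<epsilon>\<^sup>2 \<le> \<epsilon>0\<^sup>2" using \<epsilon>(2) eps0 by (intro power_mono) auto
    then have "\<epsilon>\<^sup>2 / \<delta>\<^sup>2 \<le> \<epsilon>0\<^sup>2 / \<delta>\<^sup>2" by (intro divide_right_mono) auto
    also have "\<dots> = \<eta>\<^sup>2" using \<delta>(1) by (simp add: \<epsilon>0_def power_mult_distrib)
    also have "\<dots> \<le> \<eta>" using h by (simp add: power2_eq_square mult_left_le)
    finally have ed: "\<epsilon>\<^sup>2 / \<delta>\<^sup>2 \<le> \<eta>" .
    have "real m * E (op t) * (1 - \<epsilon>\<^sup>2 / \<delta>\<^sup>2) - \<eta> * (1 + real m * ?L) \<le> real n * E (op s) + real g"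
      using \<delta>(2)[OF SS P(3) eps0 tr] unfolding ES ET LT .
    moreover have "real m * E (op t) * (1 - \<eta>) \<le> real m * E (op t) * (1 - \<epsilon>\<^sup>2 / \<delta>\<^sup>2)"
      using ed Et by (intro mult_left_mono) auto
    moreover have "real g \<le> \<eta> * real n" unfolding g_def using h by (intro of_nat_floor) simp
    ultimately have ineq: "real m * E (op t) * (1 - \<eta>) - \<eta> * (1 + real m * ?L) \<le> real n * E (op s) + \<eta> * real n" by linarith
    have m1: "r * real n \<le> real m" unfolding m_def by linarith
    have "0 \<le> r * real n" using r0 by simp
    then have "real m \<le> r * real n + 1" unfolding m_def by linarith
    then have m2: "real m \<le> (r + 1) * real n" using n1(1) by (simp add: distrib_right)
    have nr: "1 \<le> real n" using n1(1) by simp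
    have "r * real n * E (op t) \<le> real m * E (op t)" using m1 Et by (rule mult_right_mono)
    moreover have "\<eta> * (real m * E (op t)) \<le> \<eta> * ((r + 1) * real n * E (op t))" using m2 Et h by (intro mult_left_mono mult_right_mono) auto
    moreover have "\<eta> * (1 + real m * ?L) \<le> \<eta> * (real n + (r + 1) * real n * ?L)" using m2 L0 h nr by (intro mult_left_mono add_mono mult_right_mono) auto
    ultimately have "real n * (r * E (op t)) \<le> real n * (E (op s) + \<eta> * B)"
      using ineq unfolding B_def by (simp add: algebra_simps)
    then show ?thesis using nr by simp
  qed
  show ?thesis
  proof (rule field_le_epsilon)
    fix e :: real assume e: "0 < e"
    define \<eta> where "\<eta> = min (1 / 2) (e / B)"
    have h: "0 < \<eta>" "\<eta> < 1" using e B0 by (auto simp: \<eta>_def)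
    have "\<eta> * B \<le> e / B * B" using B0 by (intro mult_right_mono) (auto simp: \<eta>_def)
    then show "r * E (op t) \<le> E (op s) + e" using main[OF h] B0 by simp
  qed
qed

section \<open>Functionals on pure states from functionals on multisets\<close>

lemma ge_achievable:
  assumes k: "2 \<le> k" and s: "s \<in> St k" and t: "t \<in> St k" and q: "0 < q"
    and ge: "resource_theory.ge (St k) (cvm k) (ghz k 2) (replicate_mset q s) (replicate_mset p t)"
  shows "achievable k (op s) (op t) (real p / real q)"
  unfolding achievable_def
proof (intro conjI allI impI)
  interpret resource_theory "St k" "cvm k" "ghz k 2" by (rule entanglement_resource_theory[OF k])
  show "0 \<le> real p / real q" by simp
  fix \<delta> :: real assume d: "\<delta> > 0"
  have k0: "0 < k" using k by simp
  have gS: "ghz k 2 \<in> St k" by (rule ghz_St[OF k0]) simp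
  let ?r = "real p / real q"
  let ?A = "\<lambda>n. {\<epsilon>. \<epsilon> \<ge> 0 \<and> locc_trans (ktensor (kpow k (op s) n) (kpow k (GHZ k 2) (nat \<lfloor>\<delta> * real n\<rfloor>))) \<epsilon> (kpow k (op t) (nat \<lceil>?r * real n\<rceil>))}"
  have ev: "\<forall>\<^sub>F n in sequentially. Inf (ereal ` ?A n) \<le> ereal \<epsilon>" if e: "0 < \<epsilon>" for \<epsilon>
  proof -
    have "\<epsilon>\<^sup>2 > 0" using e by simp
    then have "\<forall>\<^sub>F n in sequentially. cvm k (replicate_mset n s + replicate_mset (nat \<lfloor>\<delta> * real n\<rfloor>) (ghz k 2))
        (replicate_mset (nat \<lceil>?r * real n\<rceil>) t) (1 - \<epsilon>\<^sup>2)"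
      using ge_rate[OF s t q ge d] unfolding tends_def by blast
    then show ?thesis
    proof eventually_elim
      case (elim n)
      define m where "m = nat \<lceil>?r * real n\<rceil>"
      define h where "h = nat \<lfloor>\<delta> * real n\<rfloor>"
      have sub: "set (replicate n s) \<subseteq> St k" "set (replicate h (ghz k 2)) \<subseteq> St k" "set (replicate m t) \<subseteq> St k"
        "set (replicate n s @ replicate h (ghz k 2)) \<subseteq> St k"
        using s t gS by auto
      have "cvm k (mset (replicate n s @ replicate h (ghz k 2))) (mset (replicate m t)) (1 - \<epsilon>\<^sup>2)"
        using elim unfolding m_def[symmetric] h_def[symmetric] by simp
      then have "conv (prodl k (replicate n s @ replicate h (ghz k 2))) (prodl k (replicate m t)) (1 - \<epsilon>\<^sup>2)"
        unfolding cvm_list[OF sub(4,3)] .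
      then have "locc_trans (op (prodl k (replicate n s @ replicate h (ghz k 2)))) \<epsilon> (op (prodl k (replicate m t)))"
        using e by (intro conv_locc_trans[OF _ prodl_St[OF sub(4)] prodl_St[OF sub(3)]]) auto
      then have "\<epsilon> \<in> ?A n"
        using e unfolding m_def[symmetric] h_def[symmetric] GHZ_op[OF k0, symmetric] kpow_op[OF s] kpow_op[OF t] kpow_op[OF gS]
          ktensor_op[OF prodl_St[OF sub(1)] prodl_St[OF sub(2)]] prodl_append[OF sub(1,2)] by simp
      then show ?case by (intro Inf_lower imageI)
    qed
  qed
  have "limsup (\<lambda>n. Inf (ereal ` ?A n)) \<le> 0"
  proof (rule ereal_le_epsilon2)
    fix \<epsilon> :: real assume "0 < \<epsilon>"
    then show "limsup (\<lambda>n. Inf (ereal ` ?A n)) \<le> 0 + ereal \<epsilon>" using Limsup_bounded[OF ev] by simp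
  qed
  moreover have "0 \<le> limsup (\<lambda>n. Inf (ereal ` ?A n))"
    by (intro le_Limsup always_eventually allI Inf_greatest) auto
  ultimately show "limsup (\<lambda>n. Inf (ereal ` ?A n)) = 0" by (rule antisym)
qed

text \<open>The vector that witnesses \<open>kpure\<close> need not be \<open>v\<close>, but the
  diagonal of the projector fixes the moduli of its entries.\<close>

lemma kpure_proj:
  assumes p: "kpure k (d, proj v)" and d: "dim_vec v = prod_list d"
  shows "valid_dims k d" "unit_norm v"
proof -
  obtain w where w: "valid_dims k d" "dim_vec w = prod_list d" "unit_norm w" "proj v = proj w"
    using p by (auto simp: kpure_def)
  show "valid_dims k d" by (rule w(1))
  have "(cmod (v $ i))\<^sup>2 = (cmod (w $ i))\<^sup>2" if "i < prod_list d" for i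
  proof -
    have "complex_of_real ((cmod (v $ i))\<^sup>2) = complex_of_real ((cmod (w $ i))\<^sup>2)"
      unfolding complex_norm_square using proj_entry[of i v i] proj_entry[of i w i] that d w(2,4) by simp
    then show ?thesis unfolding of_real_eq_iff .
  qed
  then show "unit_norm v" using w(2,3) d by (simp add: unit_norm_def)
qed

text \<open>The quadratic form of the mixture vanishes on vectors orthogonal to \<open>u\<close>, so
  no \<open>W b\<close> has a component there. This makes all branches that share a flag value
  proportional to one state.\<close>

lemma rank_one_mixture:
  fixes W :: "'i \<Rightarrow> nat \<Rightarrow> complex"
  assumes fin: "finite B" and u: "(\<Sum>a<D. cnj (u a) * u a) = 1"
    and eq: "\<And>a c. a < D \<Longrightarrow> c < D \<Longrightarrow> (\<Sum>b\<in>B. W b a * cnj (W b c)) = complex_of_real P * (u a * cnj (u c))"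
  shows "(\<Sum>b\<in>B. (cmod (\<Sum>a<D. cnj (u a) * W b a))\<^sup>2) = P"
    and "\<And>b a. b \<in> B \<Longrightarrow> a < D \<Longrightarrow> W b a = (\<Sum>a<D. cnj (u a) * W b a) * u a"
proof -
  have form: "(\<Sum>b\<in>B. (cmod (\<Sum>a<D. cnj (z a) * W b a))\<^sup>2) = P * (cmod (\<Sum>a<D. cnj (z a) * u a))\<^sup>2" for z
  proof -
    have sq: "complex_of_real ((cmod (\<Sum>a<D. cnj (z a) * v a))\<^sup>2) = (\<Sum>a<D. \<Sum>c<D. cnj (z a) * z c * (v a * cnj (v c)))" for v
      unfolding complex_norm_square cnj_sum sum_product by (intro sum.cong refl) simp
    have "complex_of_real (\<Sum>b\<in>B. (cmod (\<Sum>a<D. cnj (z a) * W b a))\<^sup>2)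
        = (\<Sum>b\<in>B. \<Sum>a<D. \<Sum>c<D. cnj (z a) * z c * (W b a * cnj (W b c)))" unfolding of_real_sum sq ..
    also have "\<dots> = (\<Sum>a<D. \<Sum>b\<in>B. \<Sum>c<D. cnj (z a) * z c * (W b a * cnj (W b c)))" by (rule sum.swap)
    also have "\<dots> = (\<Sum>a<D. \<Sum>c<D. \<Sum>b\<in>B. cnj (z a) * z c * (W b a * cnj (W b c)))" by (intro sum.cong refl sum.swap)
    also have "\<dots> = (\<Sum>a<D. \<Sum>c<D. cnj (z a) * z c * (complex_of_real P * (u a * cnj (u c))))"
      by (intro sum.cong refl) (simp add: sum_distrib_left[symmetric] eq)
    also have "\<dots> = complex_of_real P * (\<Sum>a<D. \<Sum>c<D. cnj (z a) * z c * (u a * cnj (u c)))"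
      unfolding sum_distrib_left by (intro sum.cong refl) (simp add: mult_ac)
    also have "\<dots> = complex_of_real (P * (cmod (\<Sum>a<D. cnj (z a) * u a))\<^sup>2)" unfolding of_real_mult sq ..
    finally show ?thesis unfolding of_real_eq_iff .
  qed
  show "(\<Sum>b\<in>B. (cmod (\<Sum>a<D. cnj (u a) * W b a))\<^sup>2) = P" using form[of u] u by simp
  fix b a assume b: "b \<in> B" and a: "a < D"
  define \<alpha> where "\<alpha> = (\<Sum>a<D. cnj (u a) * W b a)"
  define z where "z = (\<lambda>a. W b a - \<alpha> * u a)"
  have "(\<Sum>a<D. cnj (u a) * z a) = \<alpha> - \<alpha> * (\<Sum>a<D. cnj (u a) * u a)"
    unfolding z_def \<alpha>_def[symmetric] right_diff_distrib sum_subtractf sum_distrib_left by (simp add: \<alpha>_def mult_ac)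
  then have "(\<Sum>a<D. cnj (u a) * z a) = 0" using u by simp
  then have "cnj (\<Sum>a<D. cnj (u a) * z a) = 0" by simp
  then have zu: "(\<Sum>a<D. cnj (z a) * u a) = 0" unfolding cnj_sum by (simp add: mult.commute)
  then have "(\<Sum>b\<in>B. (cmod (\<Sum>a<D. cnj (z a) * W b a))\<^sup>2) = 0" using form[of z] by simp
  then have zW: "(\<Sum>a<D. cnj (z a) * W b a) = 0" using b fin by (simp add: sum_nonneg_eq_0_iff)
  have "complex_of_real (\<Sum>a<D. (cmod (z a))\<^sup>2) = (\<Sum>a<D. cnj (z a) * (W b a - \<alpha> * u a))"
    unfolding of_real_sum complex_norm_square by (intro sum.cong refl) (simp add: z_def)
  also have "\<dots> = (\<Sum>a<D. cnj (z a) * W b a) - \<alpha> * (\<Sum>a<D. cnj (z a) * u a)"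
    unfolding right_diff_distrib sum_subtractf sum_distrib_left by (simp add: mult_ac)
  also have "\<dots> = complex_of_real 0" unfolding zu zW by simp
  finally have "(\<Sum>a<D. (cmod (z a))\<^sup>2) = 0" unfolding of_real_eq_iff .
  then have "z a = 0" using a by (simp add: sum_nonneg_eq_0_iff)
  then show "W b a = (\<Sum>a<D. cnj (u a) * W b a) * u a" by (simp add: z_def \<alpha>_def)
qed

context entanglement_functional
begin

lemma Es_op_eq:
  assumes s: "s \<in> St k" and t: "t \<in> St k" and e: "op s = op t"
  shows "Es s = Es t"
proof -
  have le: "Es t \<le> Es s" if s: "s \<in> St k" and t: "t \<in> St k" and e: "op s = op t" for s t
  proof (rule Es_mono_conv[OF s t])
    fix q :: real assume q: "q < 1"
    have d: "fst s = fst t" using e by (metis fst_op)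
    have "sqrt (1 - (cmod (ip (fst t) (snd t) (snd s)))\<^sup>2) = sqrt (1 - (cmod (ip (fst t) (snd t) (snd t)))\<^sup>2)"
      using purified_dist_op[OF s t d] purified_dist_op[OF t t refl] e by simp
    also have "\<dots> = 0" using t by (simp add: ip_self St_def)
    finally have "(cmod (ip (fst t) (snd t) (snd s)))\<^sup>2 = 1" by simp
    then show "conv s t q" unfolding conv_def using d q by (intro pay.leaf) (simp add: target_def)
  qed
  show ?thesis using le[OF s t e] le[OF t s e[symmetric]] by simp
qed

text \<open>The choice is immaterial, since states with the same operator have the same value by
  \<open>Es_op_eq\<close>.\<close>

definition Epure :: "kop \<Rightarrow> real" where "Epure x = Es (SOME s. s \<in> St k \<and> op s = x)"

lemma Epure_op: "s \<in> St k \<Longrightarrow> Epure (op s) = Es s"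
proof -
  assume s: "s \<in> St k"
  then have "\<exists>t. t \<in> St k \<and> op t = op s" by blast
  from someI_ex[OF this] show ?thesis unfolding Epure_def using Es_op_eq s by metis
qed

lemma Epure_continuous: "asymptotically_continuous k Epure"
  unfolding asymptotically_continuous_def
proof (intro allI impI)
  fix \<epsilon> :: real assume e: "\<epsilon> > 0"
  obtain \<delta> where \<delta>: "\<delta> > 0" "\<And>d \<phi> \<psi>. (d, \<phi>) \<in> St k \<Longrightarrow> (d, \<psi>) \<in> St k \<Longrightarrow> 1 - (cmod (ip d \<phi> \<psi>))\<^sup>2 < \<delta>
    \<Longrightarrow> \<bar>Es (d, \<phi>) - Es (d, \<psi>)\<bar> < \<epsilon> * (1 + log 2 (real (prod_list d)))"
    using Es_continuity[OF e] by blast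
  \<comment> \<open>The bound 1 excludes states on different spaces, whose distance is 1.\<close>
  have "\<bar>Epure x / (1 + log 2 (real (prod_list (fst x)))) - Epure y / (1 + log 2 (real (prod_list (fst y))))\<bar> < \<epsilon>"
    if xy: "kpure k x" "kpure k y" and kd: "kdist x y < min 1 (sqrt \<delta>)" for x y
  proof -
    obtain s t where st: "s \<in> St k" "op s = x" "t \<in> St k" "op t = y" using kpure_op xy by metis
    have fxy: "fst x = fst y" using kd by (auto simp: kdist_def split: if_splits)
    then have d: "fst s = fst t" using st by (metis fst_op)
    have "sqrt (1 - (cmod (ip (fst t) (snd t) (snd s)))\<^sup>2) < sqrt \<delta>"
      using kd fxy purified_dist_op[OF st(1,3) d] st by (simp add: kdist_def)
    then have "1 - (cmod (ip (fst t) (snd t) (snd s)))\<^sup>2 < \<delta>" by simp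
    moreover have "(fst t, snd t) \<in> St k" "(fst t, snd s) \<in> St k" using st(1,3) d by (simp, metis prod.collapse)
    ultimately have "\<bar>Es (fst t, snd t) - Es (fst t, snd s)\<bar> < \<epsilon> * (1 + log 2 (real (prod_list (fst t))))" by (intro \<delta>(2))
    moreover have "(fst t, snd s) = s" using d by (simp add: prod_eq_iff)
    ultimately have b: "\<bar>Es s - Es t\<bar> < \<epsilon> * (1 + log 2 (real (prod_list (fst t))))" by (simp add: abs_minus_commute)
    have "valid_dims k (fst t)" using st(3) by (simp add: St_def)
    then have "0 \<le> log 2 (real (prod_list (fst t)))" using prod_list_ge_1[of k "fst t"] by simp
    then have N0: "0 < 1 + log 2 (real (prod_list (fst t)))" by linarith
    have "\<bar>Es s / (1 + log 2 (real (prod_list (fst t)))) - Es t / (1 + log 2 (real (prod_list (fst t))))\<bar>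
      = \<bar>Es s - Es t\<bar> / (1 + log 2 (real (prod_list (fst t))))"
      unfolding diff_divide_distrib[symmetric] abs_divide using N0 by simp
    also have "\<dots> < \<epsilon>" using b N0 by (simp add: pos_divide_less_eq)
    finally show ?thesis using Epure_op[OF st(1)] Epure_op[OF st(3)] d st(2,4) fst_op[of s] fst_op[of t] by simp
  qed
  then show "\<exists>\<delta>>0. \<forall>s t. kpure k s \<and> kpure k t \<and> kdist s t < \<delta> \<longrightarrow>
      \<bar>Epure s / (1 + log 2 (real (prod_list (fst s)))) - Epure t / (1 + log 2 (real (prod_list (fst t))))\<bar> < \<epsilon>"
    using \<delta>(1) by (intro exI[of _ "min 1 (sqrt \<delta>)"]) auto
qed

lemma Epure_additive: "fully_additive k Epure"
  unfolding fully_additive_def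
proof (intro allI impI)
  fix x y assume xy: "kpure k x \<and> kpure k y"
  obtain s t where st: "s \<in> St k" "op s = x" "t \<in> St k" "op t = y" using kpure_op xy by metis
  have "Epure (ktensor (op s) (op t)) = Epure (op s) + Epure (op t)"
    unfolding ktensor_op[OF st(1,3)] Epure_op[OF tens_St[OF st(1,3)]] Epure_op[OF st(1)] Epure_op[OF st(3)] by (rule Es_tens[OF st(1,3)])
  then show "Epure (ktensor x y) = Epure x + Epure y" using st by simp
qed

text \<open>Branches with the same flag value mix to a pure state, so each of them is a multiple of
  that state. The protocol is thus an ensemble over single branches, to which
  \<open>Es_average\<close> applies; grouping by flag value recovers the given
  probabilities.\<close>

lemma Epure_monotone: "monotone_on_average k Epure"
  unfolding monotone_on_average_def
proof (intro allI impI, elim conjE)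
  fix d :: "nat list" and \<phi> :: "complex vec" and d' Ks and m :: nat and f :: "nat \<Rightarrow> nat" and P :: "nat \<Rightarrow> real" and \<phi>s :: "nat \<Rightarrow> complex vec"
  assume pure: "kpure k (d, proj \<phi>)" and dim: "dim_vec \<phi> = prod_list d" and locc: "locc d d' Ks"
    and f: "\<forall>b<length Ks. f b < m" and Psum: "(\<Sum>x<m. P x) = 1"
    and out: "\<forall>x<m. kpure k (d', proj (\<phi>s x)) \<and> dim_vec (\<phi>s x) = prod_list d' \<and>
          msum (prod_list d') (prod_list d')
             (map (\<lambda>b. Ks ! b * proj \<phi> * adj (Ks ! b)) (filter (\<lambda>b. f b = x) [0..<length Ks]))
          = complex_of_real (P x) \<cdot>\<^sub>m proj (\<phi>s x)"
  let ?N = "length Ks" and ?D = "prod_list d'"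
  define s where "s = (d, amp_of d \<phi>)"
  define u where "u = (\<lambda>x. (d', amp_of d' (\<phi>s x)))"
  define W where "W = (\<lambda>b. Ks ! b *\<^sub>v \<phi>)"
  define \<alpha> where "\<alpha> = (\<lambda>b. \<Sum>a<?D. cnj (\<phi>s (f b) $ a) * W b $ a)"
  have s: "s \<in> St k" "op s = (d, proj \<phi>)" unfolding s_def using vec_state[OF kpure_proj(1)[OF pure dim] dim kpure_proj(2)[OF pure dim]] by auto
  have px: "kpure k (d', proj (\<phi>s x))" "dim_vec (\<phi>s x) = ?D" if "x < m" for x using out that by auto
  have u: "u x \<in> St k" "op (u x) = (d', proj (\<phi>s x))" "unit_norm (\<phi>s x)" if "x < m" for x
    unfolding u_def using vec_state[OF kpure_proj(1)[OF px[OF that]] px(2)[OF that] kpure_proj(2)[OF px[OF that]]] kpure_proj(2)[OF px[OF that]] by auto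
  have K: "Ks ! b \<in> carrier_mat ?D (prod_list d)" if "b < ?N" for b using locc_structure[OF locc] that by auto
  have dimW: "dim_vec (W b) = ?D" if "b < ?N" for b using K[OF that] by (simp add: W_def)
  have mix: "(\<Sum>b\<in>{b\<in>{..<?N}. f b = x}. W b $ a * cnj (W b $ c)) = complex_of_real (P x) * (\<phi>s x $ a * cnj (\<phi>s x $ c))"
    if x: "x < m" and a: "a < ?D" and c: "c < ?D" for x a c
  proof -
    let ?bs = "filter (\<lambda>b. f b = x) [0..<?N]"
    let ?As = "map (\<lambda>b. Ks ! b * proj \<phi> * adj (Ks ! b)) ?bs"
    have "\<forall>A\<in>set ?As. A \<in> carrier_mat ?D ?D"
    proof
      fix A assume "A \<in> set ?As"
      then obtain b where b: "b < ?N" "A = Ks ! b * proj \<phi> * adj (Ks ! b)" by auto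
      then show "A \<in> carrier_mat ?D ?D" using K[OF b(1)] by (auto simp: adj_def)
    qed
    from msum_entry[OF this] have "msum ?D ?D ?As $$ (a, c) = (\<Sum>A\<leftarrow>?As. A $$ (a, c))" using a c by blast
    also have "\<dots> = (\<Sum>b\<leftarrow>?bs. (Ks ! b * proj \<phi> * adj (Ks ! b)) $$ (a, c))" by (simp add: comp_def)
    also have "\<dots> = (\<Sum>b\<in>set ?bs. (Ks ! b * proj \<phi> * adj (Ks ! b)) $$ (a, c))" by (rule sum_list_distinct_conv_sum_set) simp
    also have "\<dots> = (\<Sum>b\<in>{b\<in>{..<?N}. f b = x}. W b $ a * cnj (W b $ c))"
    proof (rule sum.cong)
      fix b assume "b \<in> {b\<in>{..<?N}. f b = x}"
      then show "(Ks ! b * proj \<phi> * adj (Ks ! b)) $$ (a, c) = W b $ a * cnj (W b $ c)"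
        unfolding W_def using K by (intro kraus_entry[OF _ dim a c]) auto
    qed auto
    finally have "(\<Sum>b\<in>{b\<in>{..<?N}. f b = x}. W b $ a * cnj (W b $ c)) = (complex_of_real (P x) \<cdot>\<^sub>m proj (\<phi>s x)) $$ (a, c)"
      using out x by simp
    also have "\<dots> = complex_of_real (P x) * (\<phi>s x $ a * cnj (\<phi>s x $ c))"
      using px(2)[OF x] a c by (simp add: proj_def)
    finally show ?thesis .
  qed
  have un: "(\<Sum>a<?D. cnj (\<phi>s x $ a) * \<phi>s x $ a) = 1" if "x < m" for x using unit_norm_sum[OF u(3)[OF that]] px(2)[OF that] by simp
  have fB: "finite {b\<in>{..<?N}. f b = x}" for x by simp
  have prob: "(\<Sum>b\<in>{b\<in>{..<?N}. f b = x}. (cmod (\<alpha> b))\<^sup>2) = P x" if x: "x < m" for x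
  proof -
    have "(\<Sum>b\<in>{b\<in>{..<?N}. f b = x}. (cmod (\<alpha> b))\<^sup>2) = (\<Sum>b\<in>{b\<in>{..<?N}. f b = x}. (cmod (\<Sum>a<?D. cnj (\<phi>s x $ a) * W b $ a))\<^sup>2)"
      by (rule sum.cong) (auto simp: \<alpha>_def)
    also have "\<dots> = P x" using rank_one_mixture(1)[OF fB un[OF x] mix[OF x]] .
    finally show ?thesis .
  qed
  have Weq: "amp_of d' (W b) = (\<lambda>y. \<alpha> b * snd (u (f b)) y)" if b: "b < ?N" for b
  proof -
    have x: "f b < m" using f b by blast
    have "W b $ a = \<alpha> b * \<phi>s (f b) $ a" if "a < ?D" for a
      unfolding \<alpha>_def using b that by (intro rank_one_mixture(2)[OF fB un[OF x] mix[OF x]]) auto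
    then show ?thesis by (intro ext) (auto simp: amp_of_def u_def enc_less)
  qed
  have "ensemble s {..<?N} \<alpha> (\<lambda>b. u (f b))"
    unfolding ensemble_def
  proof
    fix q :: "nat \<Rightarrow> real"
    let ?H = "\<lambda>d v p. \<exists>i\<in>{..<?N}. d = fst (u (f i)) \<and> v = (\<lambda>x. \<alpha> i * snd (u (f i)) x) \<and> p \<le> q i"
    have "list_all2 (\<lambda>K q. pay ?H d' (amp_of d' (K *\<^sub>v vec_of d (snd s))) q) Ks (map q [0..<?N])"
      unfolding list_all2_conv_all_nth
    proof (intro conjI allI impI)
      fix b assume b: "b < ?N"
      have "?H d' (amp_of d' (W b)) (q b)" unfolding Weq[OF b] using b by (intro bexI[of _ b]) (auto simp: u_def)
      then show "pay ?H d' (amp_of d' (Ks ! b *\<^sub>v vec_of d (snd s))) (map q [0..<?N] ! b)"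
        using b dim by (intro pay.leaf) (simp add: s_def vec_of_amp W_def)
    qed simp
    moreover have "supp d (snd s)" by (simp add: s_def supp_amp_of)
    ultimately have "pay ?H d (snd s) (sum_list (map q [0..<?N]))" using locc_pay[OF locc] by blast
    then show "pay ?H (fst s) (snd s) (\<Sum>i<?N. q i)" unfolding sum_list_index by (simp add: s_def)
  qed
  moreover have sumP: "(\<Sum>b<?N. (cmod (\<alpha> b))\<^sup>2 * g (f b)) = (\<Sum>x<m. P x * g x)" for g
  proof -
    have "(\<Sum>b<?N. (cmod (\<alpha> b))\<^sup>2 * g (f b)) = (\<Sum>x<m. \<Sum>b\<in>{b\<in>{..<?N}. f b = x}. (cmod (\<alpha> b))\<^sup>2 * g (f b))"
      using f by (intro sum.group[symmetric]) auto
    also have "\<dots> = (\<Sum>x<m. (\<Sum>b\<in>{b\<in>{..<?N}. f b = x}. (cmod (\<alpha> b))\<^sup>2) * g x)"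
      unfolding sum_distrib_right by (intro sum.cong refl) auto
    also have "\<dots> = (\<Sum>x<m. P x * g x)"
    proof (rule sum.cong[OF refl])
      fix x assume "x \<in> {..<m}"
      then have x: "x < m" by simp
      show "(\<Sum>b\<in>{b\<in>{..<?N}. f b = x}. (cmod (\<alpha> b))\<^sup>2) * g x = P x * g x" unfolding prob[OF x] ..
    qed
    finally show ?thesis .
  qed
  moreover have "(\<Sum>b<?N. (cmod (\<alpha> b))\<^sup>2) = 1" using sumP[of "\<lambda>_. 1"] Psum by simp
  ultimately have "(\<Sum>b<?N. (cmod (\<alpha> b))\<^sup>2 * Es (u (f b))) \<le> Es s"
    using f s u by (intro Es_average) auto
  then have "(\<Sum>x<m. P x * Es (u x)) \<le> Epure (d, proj \<phi>)" unfolding sumP[of "\<lambda>x. Es (u x)"] using Epure_op[OF s(1)] s(2) by simp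
  moreover have "(\<Sum>x<m. P x * Es (u x)) = (\<Sum>x<m. P x * Epure (d', proj (\<phi>s x)))"
    by (intro sum.cong refl) (use Epure_op[OF u(1)] u(2) in auto)
  ultimately show "(\<Sum>x<m. P x * Epure (d', proj (\<phi>s x))) \<le> Epure (d, proj \<phi>)" by simp
qed

lemma Epure_admissible: "admissible k Epure"
proof -
  have k0: "0 < k" using k by simp
  have "Epure (op (ghz k 2)) = 1" using Epure_op[OF ghz_St[OF k0]] E_g by (simp add: Es_def)
  then show ?thesis
    unfolding admissible_def GHZ_op[OF k0] using Epure_additive Epure_monotone Epure_continuous by blast
qed

end

theorem theorem1:
  fixes k :: nat and d e :: "nat list" and \<phi> \<psi> :: "complex vec"
  assumes "k \<ge> 2"
    and "valid_dims k d" and "dim_vec \<phi> = prod_list d" and "unit_norm \<phi>"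
    and "valid_dims k e" and "dim_vec \<psi> = prod_list e" and "unit_norm \<psi>"
  shows "R_LOCCq k (d, proj \<phi>) (e, proj \<psi>) =
    Inf {ereal (E (d, proj \<phi>) / E (e, proj \<psi>)) | E. admissible k E \<and> E (e, proj \<psi>) \<noteq> 0}"
proof -
  define s where "s = (d, amp_of d \<phi>)"
  define t where "t = (e, amp_of e \<psi>)"
  have s: "s \<in> St k" "op s = (d, proj \<phi>)" unfolding s_def using vec_state[OF assms(2-4)] by auto
  have t: "t \<in> St k" "op t = (e, proj \<psi>)" unfolding t_def using vec_state[OF assms(5-7)] by auto
  have k: "2 \<le> k" "0 < k" using assms(1) by auto
  interpret resource_theory "St k" "cvm k" "ghz k 2" by (rule entanglement_resource_theory[OF k(1)])
  let ?R = "R_LOCCq k (op s) (op t)"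
  let ?X = "{ereal (E (op s) / E (op t)) | E. admissible k E \<and> E (op t) \<noteq> 0}"
  have C: "replicate_mset n s \<in> Cr" "replicate_mset n t \<in> Cr" for n using s(1) t(1) by (auto simp: Cr_iff)
  have "?R \<le> Inf ?X"
  proof (rule Inf_greatest)
    fix y assume "y \<in> ?X"
    then obtain E where E: "y = ereal (E (op s) / E (op t))" "admissible k E" "E (op t) \<noteq> 0" by blast
    have "0 \<le> E (op t)" using E(2) by (intro admissible_nonneg[OF _ _ t(1)]) (auto simp: admissible_def)
    then have Et: "0 < E (op t)" using E(3) by simp
    show "?R \<le> y" unfolding R_LOCCq_def
    proof (rule Sup_least)
      fix x assume "x \<in> ereal ` {r. achievable k (op s) (op t) r}"
      then obtain r where r: "x = ereal r" "achievable k (op s) (op t) r" by blast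
      have "r * E (op t) \<le> E (op s)" by (rule direct_part[OF k(2) E(2) s(1) t(1) r(2)])
      then show "x \<le> y" unfolding r(1) E(1) using Et by (simp add: pos_le_divide_eq)
    qed
  qed
  moreover have "Inf ?X \<le> ?R"
  proof (rule ccontr)
    assume "\<not> Inf ?X \<le> ?R"
    then have "?R < Inf ?X" by simp
    \<comment> \<open>A rational rate can be tested on finitely many copies. An infimum over the
      empty set is covered as well: being infinite it also exceeds \<open>a\<close>, and the
      functional constructed below contradicts this.\<close>
    then obtain a :: rat where a: "?R < ereal (real_of_rat a)" "ereal (real_of_rat a) < Inf ?X" using ereal_dense3 by blast
    have up: "ereal r \<le> ?R" if "achievable k (op s) (op t) r" for r
      unfolding R_LOCCq_def using that by (intro Sup_upper) blast
    \<comment> \<open>Rate 0 is always achievable, which makes \<open>a\<close> positive.\<close>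
    have "achievable k (op s) (op t) (real 0 / real 1)"
      by (rule ge_achievable[OF k(1) s(1) t(1)]) (simp, rule ge_subset[OF C(1)], simp)
    from up[OF this] have "ereal 0 \<le> ?R" by simp
    then have "ereal 0 < ereal (real_of_rat a)" using a(1) by (rule le_less_trans)
    then have a0: "0 < real_of_rat a" by simp
    obtain p q :: nat where pq: "q \<noteq> 0" "\<bar>real_of_rat a\<bar> = real p / real q"
      by (rule Rats_abs_nat_div_natE[of "real_of_rat a"]) auto
    then have apq: "real_of_rat a = real p / real q" and q: "0 < q" using a0 by auto
    \<comment> \<open>Otherwise \<open>p / q\<close> would be an achievable rate above the
      supremum.\<close>
    have "\<not> ge (replicate_mset q s) (replicate_mset p t)"
    proof
      assume "ge (replicate_mset q s) (replicate_mset p t)"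
      from up[OF ge_achievable[OF k(1) s(1) t(1) q this]] show False using a(1) apq by simp
    qed
    from separating_functional[OF C this] obtain E :: "pv multiset \<Rightarrow> real" where
      E: "\<And>M N. M \<in> Cr \<Longrightarrow> N \<in> Cr \<Longrightarrow> E (M + N) = E M + E N" "E {#ghz k 2#} = 1"
        "\<And>M N. ge M N \<Longrightarrow> E N \<le> E M" "E (replicate_mset q s) < E (replicate_mset p t)" by blast
    interpret F: entanglement_functional k E
    proof
      show "2 \<le> k" by (rule k(1))
      show "E (M + N) = E M + E N" if "set_mset M \<subseteq> St k" "set_mset N \<subseteq> St k" for M N
        using that unfolding Cr_iff[symmetric] by (rule E(1))
      show "E {#ghz k 2#} = 1" by (rule E(2))
      show "E N \<le> E M" if "ge M N" for M N using that by (rule E(3))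
    qed
    have lt: "real q * F.Es s < real p * F.Es t"
      using E(4) unfolding F.E_replicate[OF s(1)] F.E_replicate[OF t(1)] .
    moreover have "0 \<le> real q * F.Es s" using F.Es_nonneg[OF s(1)] by simp
    ultimately have "0 < real p * F.Es t" by linarith
    \<comment> \<open>Strict separation forces a positive value on \<open>t\<close>, so the
      functional takes part in the infimum.\<close>
    then have t0: "0 < F.Es t" by (simp add: zero_less_mult_iff)
    have "F.Es s / F.Es t < real p / real q" using lt t0 q by (simp add: field_simps)
    then have "ereal (F.Epure (op s) / F.Epure (op t)) < ereal (real_of_rat a)"
      unfolding F.Epure_op[OF s(1)] F.Epure_op[OF t(1)] apq by simp
    moreover have "Inf ?X \<le> ereal (F.Epure (op s) / F.Epure (op t))"
      using F.Epure_admissible F.Epure_op[OF t(1)] t0 by (intro Inf_lower CollectI exI[of _ F.Epure]) auto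
    ultimately have "Inf ?X < ereal (real_of_rat a)" by (rule le_less_trans[rotated])
    then show False using a(2) by (rule less_asym)
  qed
  ultimately show ?thesis unfolding s(2) t(2) by (rule antisym)
qed

end
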